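(* Let $(X_t)_{t\in\mathbb{Z}}$ satisfy the process assumptions (A1), let $\varphi$ satisfy (A2), let the block length $b=b(n)$ satisfy (B1) and (B2), and let the spectral density estimator $\widehat f_n$ satisfy (C) (all listed in the context). Assume also that the central limit theorem $$L_n=\sqrt{n}\,\big(M(\varphi,I_n)-M(\varphi,f)\big)\stackrel{d}{\longrightarrow}\mathcal N(0,\tau^2),\qquad \tau^2=\tau_1^2+\tau_2,$$ holds. Then, as $n\to\infty$: (i) $\mathrm{Var}^*(L_n^* )\stackrel{P}{\longrightarrow}\tau^2$; (ii) $\sup_{x\in\mathbb{R}}\big|P^*(L_n^*\le x)-P(L_n\le x)\big|=o_P(1)$; (iii) $\sup_{x\in\mathbb{R}}\big|P^*(L_{n,R}^*\le x)-P(L_{n,R}\le x)\big|=o_P(1)$.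
   Context: **Process and statistics.** $(X_t)_{t\in\mathbb Z}$ is a real-valued process with autocovariance function $\gamma$ and spectral density $f(\lambda)=\frac1{2\pi}\sum_{h\in\mathbb Z}\gamma(h)e^{-ih\lambda}$. The periodogram of $X_1,\dots,X_n$ is $I_n(\lambda)=\frac{1}{2\pi n}\big|\sum_{t=1}^nX_te^{-i\lambda t}\big|^2$. For integrable functions put $M(\varphi,g)=\int_{-\pi}^{\pi}\varphi(\lambda)g(\lambda)\,d\lambda$ and $R(\varphi,g)=M(\varphi,g)/M(1,g)$. Further $L_n=\sqrt n(M(\varphi,I_n)-M(\varphi,f))$ and $L_{n,R}=\sqrt n(R(\varphi,I_n)-R(\varphi,f))$. **Assumptions.** (A1) $(X_t)$ is strictly stationary, real-valued, with finite eighth moments, mean zero, $\sum_{h\in\mathbb Z}(1+|h|)|\gamma(h)|<\infty$, $\inf_{\lambda\in[0,\pi]}f(\lambda)>0$, $\sum_{h_1,h_2,h_3\in\mathbb Z}(1+|h_1|+|h_2|+|h_3|)\,|\mathrm{cum}(X_0,X_{h_1},X_{h_2},X_{h_3})|<\infty$ and $\sum_{h_1,\dots,h_7\in\mathbb Z}|\mathrm{cum}(X_0,X_{h_1},\dots,X_{h_7})|<\infty$. (A2) $\varphi:[-\pi,\pi]\to\mathbb R$ is square-integrable and of bounded variation. (B1) $n=bk$ with $b=b(n),k=k(n)\in\mathbb N$, $b\to\infty$ and $k\to\infty$ as $n\to\infty$. (B2) $b^3/n\to0$ and $\ln(N)/b\to0$ as $n\to\infty$, where $N=n-b+1$. (C)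 $\widehat f_n$ is an estimator of $f$ based on $X_1,\dots,X_n$ with $\sup_{\lambda\in[-\pi,\pi]}|\widehat f_n(\lambda)-f(\lambda)|=o_P(1)$. **Limiting variances.** With $f_4(\lambda,\mu,\eta)=\frac{1}{(2\pi)^3}\sum_{h_1,h_2,h_3\in\mathbb Z}\mathrm{cum}(X_0,X_{h_1},X_{h_2},X_{h_3})e^{-i(h_1\lambda+h_2\mu+h_3\eta)}$, $\tau^2=\tau_1^2+\tau_2$ where $$\tau_1^2=2\pi\int_{-\pi}^{\pi}\varphi(\lambda)\big(\varphi(\lambda)+\varphi(-\lambda)\big)f(\lambda)^2\,d\lambda,\qquad \tau_2=2\pi\int_{-\pi}^{\pi}\int_{-\pi}^{\pi}\varphi(\lambda_1)\varphi(\lambda_2)f_4(\lambda_1,\lambda_2,-\lambda_2)\,d\lambda_1d\lambda_2.$$ The limiting variance of $L_{n,R}$, which is asymptotically normal with mean zero, is $\tau_R^2=\tau_{1,R}^2+\tau_{2,R}$ where, with $w(\lambda)=\varphi(\lambda)\int_{-\pi}^{\pi}f(\alpha)d\alpha-\int_{-\pi}^{\pi}\varphi(\alpha)f(\alpha)d\alpha$, $$\tau_{1,R}^2=\frac{2\pi}{M(1,f)^4}\int_{-\pi}^{\pi}w(\lambda)\big(w(\lambda)+w(-\lambda)\big)f(\lambda)^2\,d\lambda,\qquad \tau_{2,R}=\frac{2\pi}{M(1,f)^4}\int_{-\pi}^{\pi}\int_{-\pi}^{\pi}w(\lambda_1)w(\lambda_2)f_4(\lambda_1,\lambda_2,-\lambda_2)\,d\lambda_1d\lambda_2.$$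 **Bootstrap (convolved bootstrapped periodograms of subsamples).** $\mathcal G(m)=\{j\in\mathbb Z:1\le|j|\le[m/2]\}$, $\lambda_{j,m}=2\pi j/m$. For $t=1,\dots,N$ let $I_{t,b}(\lambda)=\frac1{2\pi b}\big|\sum_{s=1}^bX_{t+s-1}e^{-i\lambda s}\big|^2$, $\widetilde f_b(\lambda)=\frac1N\sum_{t=1}^NI_{t,b}(\lambda)$ and $U_{t,b}(\lambda_{j,b})=I_{t,b}(\lambda_{j,b})/\widetilde f_b(\lambda_{j,b})$, $j\in\mathcal G(b)$. Let $i_1^*,\dots,i_k^*$ be, conditionally on the data, i.i.d. uniform on $\{1,\dots,N\}$, and set $$I_b^{(l)}(\lambda_{j,b})=\widehat f_n(\lambda_{j,b})\,U_{i_l^*,b}(\lambda_{j,b}),\qquad I_{j,b}^*=\frac1k\sum_{l=1}^kI_b^{(l)}(\lambda_{j,b}),$$ $$L_n^*=\sqrt n\,\frac{2\pi}{b}\sum_{j\in\mathcal G(b)}\varphi(\lambda_{j,b})\big(I_{j,b}^*-\widehat f_n(\lambda_{j,b})\big),\qquad L_{n,R}^*=\sqrt n\left(\frac{\sum_{j\in\mathcal G(b)}\varphi(\lambda_{j,b})I_{j,b}^*}{\sum_{j\in\mathcal G(b)}I_{j,b}^*}-\frac{\sum_{j\in\mathcal G(b)}\varphi(\lambda_{j,b})\widehat f_n(\lambda_{j,b})}{\sum_{j\in\mathcal G(b)}\widehat f_n(\lambda_{j,b})}\right).$$ $P^*,\mathrm{Var}^*$ denote probability and variance conditional on $X_1,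\dots,X_n$.
   Formalization: (ii) is stated for τ²>0; (iii) for τ_R²>0, with the asymptotic normality L_{n,R}→N(0,τ_R²) from the context as a premise. For zero limiting variance (ii), (iii) can fail (iid normal X, odd φ, asymmetric f̂_n). n runs through sample sizes with n=bk, since this cannot hold for every n. *)

theory Defs
  imports "HOL-Probability.Probability"
begin

section \<open>Convergence in probability\<close>

text \<open>
  \<open>Y\<^sub>m = o\<^sub>P(1)\<close>. The values are extended reals because suprema over uncountable sets may be
  infinite. The outer measure is the probability whenever the event is measurable; it avoids
  the convention that \<^const>\<open>emeasure\<close> is 0 on non-measurable sets, under which the condition
  would say nothing about a supremum that is not measurable.
\<close>

definition oP1 :: "'a measure \<Rightarrow> (nat \<Rightarrow> 'a \<Rightarrow> ereal) \<Rightarrow> bool" where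
  "oP1 M Y \<longleftrightarrow>
     (\<forall>\<epsilon>>0. (\<lambda>m. outer_measure_of M {\<omega> \<in> space M. ereal \<epsilon> < \<bar>Y m \<omega>\<bar>}) \<longlonglongrightarrow> 0)"

definition conv_in_prob :: "'a measure \<Rightarrow> (nat \<Rightarrow> 'a \<Rightarrow> real) \<Rightarrow> real \<Rightarrow> bool" where
  "conv_in_prob M Y c \<longleftrightarrow> oP1 M (\<lambda>m \<omega>. ereal (Y m \<omega> - c))"

text \<open>The normal law with mean 0 and variance \<open>v \<ge> 0\<close>, the point mass at 0 if \<open>v = 0\<close>.\<close>

definition centred_normal :: "real \<Rightarrow> real measure" where
  "centred_normal v =
     (if v = 0 then return borel 0 else density lborel (normal_density 0 (sqrt v)))"

section \<open>Functions of bounded variation\<close>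

definition bounded_variation_on :: "real \<Rightarrow> real \<Rightarrow> (real \<Rightarrow> real) \<Rightarrow> bool" where
  "bounded_variation_on a c g \<longleftrightarrow>
     (\<exists>B. \<forall>(p :: nat \<Rightarrow> real) m. mono_on {..m} p \<and> p ` {..m} \<subseteq> {a..c} \<longrightarrow>
        (\<Sum>i<m. \<bar>g (p (Suc i)) - g (p i)\<bar>) \<le> B)"

section \<open>Stationary processes, cumulants and spectral densities\<close>

definition strictly_stationary :: "'a measure \<Rightarrow> (int \<Rightarrow> 'a \<Rightarrow> real) \<Rightarrow> bool" where
  "strictly_stationary M X \<longleftrightarrow>
     (\<forall>h J. finite J \<longrightarrow>
        distr M (Pi\<^sub>M J (\<lambda>_. borel)) (\<lambda>\<omega>. \<lambda>t\<in>J. X (t + h) \<omega>) =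
        distr M (Pi\<^sub>M J (\<lambda>_. borel)) (\<lambda>\<omega>. \<lambda>t\<in>J. X t \<omega>))"

definition autocov :: "'a measure \<Rightarrow> (int \<Rightarrow> 'a \<Rightarrow> real) \<Rightarrow> int \<Rightarrow> real" where
  "autocov M X h =
     (\<integral>\<omega>. (X 0 \<omega> - (\<integral>\<omega>. X 0 \<omega> \<partial>M)) * (X h \<omega> - (\<integral>\<omega>. X h \<omega> \<partial>M)) \<partial>M)"

text \<open>
  The joint cumulant \<open>cum(Y\<^sub>0, \<dots>, Y\<^sub>r\<^sub>-\<^sub>1)\<close> of the random variables in a list: the sum over the
  partitions \<open>P\<close> of the positions of
  \<open>(-1)\<^bsup>|P|-1\<^esup> (|P|-1)! \<Prod>\<^bsub>B\<in>P\<^esub> E (\<Prod>\<^bsub>i\<in>B\<^esub> Y\<^sub>i)\<close>.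
\<close>

definition cum :: "'a measure \<Rightarrow> ('a \<Rightarrow> real) list \<Rightarrow> real" where
  "cum M Ys =
     (\<Sum>P | partition_on {..<length Ys} P.
        (- 1) ^ (card P - 1) * fact (card P - 1) *
        (\<Prod>B\<in>P. \<integral>\<omega>. (\<Prod>i\<in>B. (Ys ! i) \<omega>) \<partial>M))"

text \<open>The series is real because the autocovariance function is even.\<close>

definition spectral_density :: "'a measure \<Rightarrow> (int \<Rightarrow> 'a \<Rightarrow> real) \<Rightarrow> real \<Rightarrow> real" where
  "spectral_density M X l =
     Re (1 / (2 * pi) * (\<Sum>\<^sub>\<infinity>h. autocov M X h * exp (- \<i> * of_int h * of_real l)))"

definition fourth_order_density ::
    "'a measure \<Rightarrow> (int \<Rightarrow> 'a \<Rightarrow> real) \<Rightarrow> real \<Rightarrow> real \<Rightarrow> real \<Rightarrow> complex" where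
  "fourth_order_density M X l1 l2 l3 =
     1 / (2 * pi) ^ 3 *
     (\<Sum>\<^sub>\<infinity>(h1, h2, h3). cum M [X 0, X h1, X h2, X h3] *
        exp (- \<i> * (of_int h1 * of_real l1 + of_int h2 * of_real l2 + of_int h3 * of_real l3)))"

section \<open>Integrated periodograms and ratio statistics\<close>

definition spec_mean :: "(real \<Rightarrow> real) \<Rightarrow> (real \<Rightarrow> real) \<Rightarrow> real" where
  "spec_mean \<phi> g = (LBINT l:{-pi..pi}. \<phi> l * g l)"

definition spec_ratio :: "(real \<Rightarrow> real) \<Rightarrow> (real \<Rightarrow> real) \<Rightarrow> real" where
  "spec_ratio \<phi> g = spec_mean \<phi> g / spec_mean (\<lambda>_. 1) g"

text \<open>The periodogram of the finite stretch \<open>x 1, \<dots>, x n\<close>.\<close>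

definition periodogram :: "(nat \<Rightarrow> real) \<Rightarrow> nat \<Rightarrow> real \<Rightarrow> real" where
  "periodogram x n l =
     1 / (2 * pi * n) * (cmod (\<Sum>t=1..n. x t * exp (- \<i> * of_real l * of_nat t)))\<^sup>2"

definition sample :: "(int \<Rightarrow> 'a \<Rightarrow> real) \<Rightarrow> nat \<Rightarrow> 'a \<Rightarrow> nat \<Rightarrow> real" where
  "sample X n \<omega> = (\<lambda>t\<in>{1..n}. X (int t) \<omega>)"

definition L_stat ::
    "'a measure \<Rightarrow> (int \<Rightarrow> 'a \<Rightarrow> real) \<Rightarrow> (real \<Rightarrow> real) \<Rightarrow> nat \<Rightarrow> 'a \<Rightarrow> real" where
  "L_stat M X \<phi> n \<omega> =
     sqrt n * (spec_mean \<phi> (periodogram (sample X n \<omega>) n) - spec_mean \<phi> (spectral_density M X))"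

definition LR_stat ::
    "'a measure \<Rightarrow> (int \<Rightarrow> 'a \<Rightarrow> real) \<Rightarrow> (real \<Rightarrow> real) \<Rightarrow> nat \<Rightarrow> 'a \<Rightarrow> real" where
  "LR_stat M X \<phi> n \<omega> =
     sqrt n * (spec_ratio \<phi> (periodogram (sample X n \<omega>) n) - spec_ratio \<phi> (spectral_density M X))"

section \<open>Limiting variances\<close>

definition tau1_sq :: "'a measure \<Rightarrow> (int \<Rightarrow> 'a \<Rightarrow> real) \<Rightarrow> (real \<Rightarrow> real) \<Rightarrow> real" where
  "tau1_sq M X \<phi> =
     2 * pi * (LBINT l:{-pi..pi}. \<phi> l * (\<phi> l + \<phi> (- l)) * (spectral_density M X l)\<^sup>2)"

text \<open>
  The double integral is real: stationarity and the symmetry of cumulants make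
  \<open>f\<^sub>4(\<lambda>\<^sub>1, \<lambda>\<^sub>2, -\<lambda>\<^sub>2)\<close> even in each of its two arguments.
\<close>

definition tau2 :: "'a measure \<Rightarrow> (int \<Rightarrow> 'a \<Rightarrow> real) \<Rightarrow> (real \<Rightarrow> real) \<Rightarrow> real" where
  "tau2 M X \<phi> =
     Re (2 * pi * (LBINT l1:{-pi..pi}. (LBINT l2:{-pi..pi}.
        \<phi> l1 * \<phi> l2 * fourth_order_density M X l1 l2 (- l2))))"

definition tau_sq :: "'a measure \<Rightarrow> (int \<Rightarrow> 'a \<Rightarrow> real) \<Rightarrow> (real \<Rightarrow> real) \<Rightarrow> real" where
  "tau_sq M X \<phi> = tau1_sq M X \<phi> + tau2 M X \<phi>"

definition ratio_weight ::
    "'a measure \<Rightarrow> (int \<Rightarrow> 'a \<Rightarrow> real) \<Rightarrow> (real \<Rightarrow> real) \<Rightarrow> real \<Rightarrow> real" where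
  "ratio_weight M X \<phi> l =
     \<phi> l * (LBINT a:{-pi..pi}. spectral_density M X a)
     - (LBINT a:{-pi..pi}. \<phi> a * spectral_density M X a)"

definition tauR_sq :: "'a measure \<Rightarrow> (int \<Rightarrow> 'a \<Rightarrow> real) \<Rightarrow> (real \<Rightarrow> real) \<Rightarrow> real" where
  "tauR_sq M X \<phi> =
     tau1_sq M X (ratio_weight M X \<phi>) / spec_mean (\<lambda>_. 1) (spectral_density M X) ^ 4
     + tau2 M X (ratio_weight M X \<phi>) / spec_mean (\<lambda>_. 1) (spectral_density M X) ^ 4"

section \<open>Convolved bootstrapped periodograms of subsamples\<close>

definition fourier_indices :: "nat \<Rightarrow> int set" where
  "fourier_indices m = {j. 1 \<le> \<bar>j\<bar> \<and> \<bar>j\<bar> \<le> int (m div 2)}"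

definition fourier_freq :: "int \<Rightarrow> nat \<Rightarrow> real" where
  "fourier_freq j m = 2 * pi * of_int j / of_nat m"

definition num_blocks :: "nat \<Rightarrow> nat \<Rightarrow> nat" where
  "num_blocks n b = n - b + 1"

text \<open>
  From here on \<open>x\<close> stands for the observed stretch \<open>x 1, \<dots>, x n\<close>, \<open>g\<close> for the realised
  spectral density estimate, and \<open>i 1, \<dots>, i k\<close> for the drawn block starting points.
\<close>

definition sub_periodogram :: "(nat \<Rightarrow> real) \<Rightarrow> nat \<Rightarrow> nat \<Rightarrow> real \<Rightarrow> real" where
  "sub_periodogram x b t = periodogram (\<lambda>s. x (t + s - 1)) b"

definition avg_periodogram :: "(nat \<Rightarrow> real) \<Rightarrow> nat \<Rightarrow> nat \<Rightarrow> real \<Rightarrow> real" where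
  "avg_periodogram x n b l =
     1 / num_blocks n b * (\<Sum>t=1..num_blocks n b. sub_periodogram x b t l)"

definition rescaled_sub_periodogram :: "(nat \<Rightarrow> real) \<Rightarrow> nat \<Rightarrow> nat \<Rightarrow> nat \<Rightarrow> real \<Rightarrow> real" where
  "rescaled_sub_periodogram x n b t l = sub_periodogram x b t l / avg_periodogram x n b l"

definition boot_periodogram ::
    "(nat \<Rightarrow> real) \<Rightarrow> (real \<Rightarrow> real) \<Rightarrow> nat \<Rightarrow> nat \<Rightarrow> nat \<Rightarrow> (nat \<Rightarrow> nat) \<Rightarrow> int \<Rightarrow> real" where
  "boot_periodogram x g n b k i j =
     1 / k * (\<Sum>l=1..k. g (fourier_freq j b) *
                          rescaled_sub_periodogram x n b (i l) (fourier_freq j b))"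

definition L_boot ::
    "(real \<Rightarrow> real) \<Rightarrow> (nat \<Rightarrow> real) \<Rightarrow> (real \<Rightarrow> real) \<Rightarrow> nat \<Rightarrow> nat \<Rightarrow> nat \<Rightarrow> (nat \<Rightarrow> nat) \<Rightarrow> real" where
  "L_boot \<phi> x g n b k i =
     sqrt n * (2 * pi / b) *
     (\<Sum>j\<in>fourier_indices b. \<phi> (fourier_freq j b) *
        (boot_periodogram x g n b k i j - g (fourier_freq j b)))"

definition LR_boot ::
    "(real \<Rightarrow> real) \<Rightarrow> (nat \<Rightarrow> real) \<Rightarrow> (real \<Rightarrow> real) \<Rightarrow> nat \<Rightarrow> nat \<Rightarrow> nat \<Rightarrow> (nat \<Rightarrow> nat) \<Rightarrow> real" where
  "LR_boot \<phi> x g n b k i =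
     sqrt n *
     ((\<Sum>j\<in>fourier_indices b. \<phi> (fourier_freq j b) * boot_periodogram x g n b k i j) /
        (\<Sum>j\<in>fourier_indices b. boot_periodogram x g n b k i j)
      - (\<Sum>j\<in>fourier_indices b. \<phi> (fourier_freq j b) * g (fourier_freq j b)) /
        (\<Sum>j\<in>fourier_indices b. g (fourier_freq j b)))"

text \<open>
  The conditional law, given the data, of the i.i.d. uniform block starting points
  \<open>i\<^sub>1\<^sup>*, \<dots>, i\<^sub>k\<^sup>*\<close>. Bootstrap probabilities and variances are those of this law, with the data
  held fixed.
\<close>

definition boot_index_law :: "nat \<Rightarrow> nat \<Rightarrow> nat \<Rightarrow> (nat \<Rightarrow> nat) pmf" where
  "boot_index_law n b k = Pi_pmf {1..k} 0 (\<lambda>_. pmf_of_set {1..num_blocks n b})"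

end

theory Submission
 imports Defs
begin

text \<open>Conditionally on the data, the bootstrap statistic is a normalised sum of \<open>k\<close> independent draws
 of a block statistic, so its variance is a quadratic form in the empirical covariances of the block
 periodograms. These concentrate: terms linear in the block sums cancel by summation by parts because
 the Fourier weights sum to zero, and the averages that remain have small variance. Since cumulants of
 orders 3, 5, 6 and 7 are not controlled, moments are bounded by a self-bounding argument and by
 Bessel's inequality, which only need the orders 2, 4 and 8. The expected block covariances, summed
 against \<open>\<phi>\<close>, are Riemann sums for the limiting variance. Asymptotic normality is the central
 limit theorem for triangular arrays, made uniform by Polya's theorem. The ratio statistic is the
 linear one for the weight \<open>w\<close> up to a denominator that converges.\<close>

text \<open>Roughly \<open>b * b\<close> pairs of frequencies have to be controlled at once under a
  normalisation by \<open>1 / b\<close>. A variance of order \<open>sqrt (b / N)\<close> for every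
  empirical covariance would be too large. The estimate aimed at is
  \<open>b / N + r * sqrt (b / N)\<close>, where \<open>r\<close> bounds the correlation of the two
  trigonometric statistics; at different frequencies \<open>r\<close> has order
  \<open>1 / b\<close>, and the total error becomes a function of \<open>b^3 / N\<close>. Such a
  variance is a covariance of two products of four linear statistics. Peeling off one index at a
  time leaves two kinds of terms: products of two factors that both link the blocks, each
  square-summable over pairs of blocks, so that Cauchy-Schwarz closes the estimate; and terms in
  which one linear statistic stands alone, of which only the signed sum is small. All randomness of
  the data is put into one event, \<open>good\<close>, whose complement vanishes in outer
  probability. On it the bootstrap law is studied for fixed data, which is why the limit theorem for
  the draws has to be uniform over arrays of numbers.\<close>

abbreviation "FI \<equiv> fourier_indices"
abbreviation "ff \<equiv> fourier_freq"
abbreviation (in prob_space) (input) expect ("\<E>") where "\<E> \<equiv> expectation"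

section \<open>Cumulants of set functions\<close>

text \<open>The Moebius function of the partition lattice between a partition with \<open>n\<close>
  blocks and the one-block partition, so that \<open>kappa\<close> is Moebius inversion of the
  expansion of moments into cumulants.\<close>

definition cumw :: "nat => real" where
 "cumw n = (- 1) ^ (n - 1) * fact (n - 1)"

text \<open>The argument is an arbitrary set function instead of a family of random variables: the
  recursion and the linearity then become pure combinatorics.\<close>

definition kappa :: "('i set => real) => 'i set => real" where
 "kappa m S = (\<Sum>P | partition_on S P. cumw (card P) * (\<Prod>B\<in>P. m B))"

lemma cumw_step: "q \<ge> 2 ==> real (q - 1) * cumw (q - 1) = - cumw q"
proof -
 assume "q \<ge> 2"
 then obtain r where r: "q = Suc (Suc r)" by (metis add_2_eq_Suc le_Suc_ex)
 show ?thesis by (simp add: r cumw_def algebra_simps)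
qed

lemma partition_on_unique:
 "partition_on S P ==> B \<in> P ==> C \<in> P ==> i \<in> B ==> i \<in> C ==> B = C"
 using disjointD[OF partition_onD2] by (metis IntI empty_iff)

lemma card_blocks_avoiding:
 assumes "finite S" "partition_on S P" "i \<in> S"
 shows "card {C \<in> P. i \<notin> C} = card P - 1"
proof -
 obtain B where B: "B \<in> P" "i \<in> B" using assms partition_onD1 by blast
 have "{C \<in> P. i \<notin> C} = P - {B}"
  using partition_on_unique[OF assms(2) B(1) _ B(2)] B(2) by (auto simp: set_eq_iff)
 then show ?thesis using B finite_elements[OF assms(1,2)] by simp
qed

text \<open>A proper \<open>B\<close> together with a partition of \<open>B\<close> is the same as a
  partition of \<open>S\<close> with a marked block avoiding \<open>i\<close>, the marked block
  being \<open>S - B\<close>. A partition with \<open>q\<close> blocks admits \<open>q - 1\<close>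
  marks, so it collects the weight \<open>cumw q + (q - 1) * cumw (q - 1)\<close>, which vanishes
  unless \<open>q = 1\<close>.\<close>

lemma kappa_recursion:
 assumes S: "finite S" "i \<in> S" and m: "m {} = 1"
 shows "m S = (\<Sum>B | i \<in> B \<and> B \<subseteq> S. kappa m B * m (S - B))"
proof -
 let ?PP = "{P. partition_on S P}"
 let ?T = "{B. i \<in> B \<and> B \<subset> S}"
 have fP: "finite ?PP" using S(1) by (rule finitely_many_partition_on)
 have fT: "finite ?T" using S(1) by (auto intro: finite_subset[of _ "Pow S"])
 have eq: "{B. i \<in> B \<and> B \<subseteq> S} = insert S ?T" using S(2) by auto
 have "(\<Sum>B | i \<in> B \<and> B \<subseteq> S. kappa m B * m (S - B)) =
   kappa m S + (\<Sum>B\<in>?T. kappa m B * m (S - B))"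
  unfolding eq using fT by (subst sum.insert) (auto simp: m)
 also have "(\<Sum>B\<in>?T. kappa m B * m (S - B)) =
   (\<Sum>B\<in>?T. \<Sum>P | partition_on B P. cumw (card P) * (\<Prod>D\<in>P. m D) * m (S - B))"
  by (simp add: kappa_def sum_distrib_right)
 also have "\<dots> = (\<Sum>(B,P)\<in>(SIGMA B:?T. {P. partition_on B P}).
   cumw (card P) * (\<Prod>D\<in>P. m D) * m (S - B))"
  using fT S(1) by (subst sum.Sigma) (auto intro!: finitely_many_partition_on intro: finite_subset)
 also have "\<dots> = (\<Sum>(P,C)\<in>(SIGMA P:?PP. {C \<in> P. i \<notin> C}). cumw (card P - 1) * (\<Prod>D\<in>P. m D))"
 proof (rule sum.reindex_bij_witness[where
    i = "\<lambda>(P,C). (S - C, P - {C})" and j = "\<lambda>(B,P). (insert (S - B) P, S - B)"])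
  fix a assume a: "a \<in> (SIGMA B:?T. {P. partition_on B P})"
  obtain B P where aBP: "a = (B, P)" by (cases a)
  have B: "i \<in> B" "B \<subset> S" and P: "partition_on B P" using a by (auto simp: aBP)
  have fin: "finite P" using P B S(1) by (meson finite_elements finite_subset psubset_imp_subset)
  have nin: "S - B \<notin> P" using B P by (auto dest: partition_onD1)
  have SB: "S - (S - B) = B" using B by auto
  have dj: "disjnt (S - B) (\<Union>P)" using P by (auto simp: disjnt_def dest: partition_onD1)
  have "partition_on S (insert (S - B) P)"
   using dj B P SB by (subst partition_on_insert) auto
  then show "(case a of (B,P) => (insert (S - B) P, S - B)) \<in> (SIGMA P:?PP. {C \<in> P. i \<notin> C})"
   using B by (auto simp: aBP)
  show "(\<lambda>(P,C). (S - C, P - {C})) ((\<lambda>(B,P). (insert (S - B) P, S - B)) a) = a"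
   using nin SB by (auto simp: aBP)
  show "(case (case a of (B,P) => (insert (S - B) P, S - B)) of (P,C) =>
    cumw (card P - 1) * (\<Prod>D\<in>P. m D)) =
   (case a of (B,P) => cumw (card P) * (\<Prod>D\<in>P. m D) * m (S - B))"
   using nin fin by (simp add: aBP)
 next
  fix a assume a: "a \<in> (SIGMA P:?PP. {C \<in> P. i \<notin> C})"
  obtain P C where aPC: "a = (P, C)" by (cases a)
  have P: "partition_on S P" and C: "C \<in> P" "i \<notin> C" using a by (auto simp: aPC)
  have sub: "C \<subseteq> S" "C \<noteq> {}" using P C by (auto dest: partition_onD1 partition_onD3)
  have ins: "insert C (P - {C}) = P" using C by auto
  have dj: "disjnt C (\<Union>(P - {C}))"
   using P C by (fastforce dest!: partition_onD2 simp: disjoint_def disjnt_def)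
  have "partition_on (S - C) (P - {C})"
   using iffD1[OF partition_on_insert[OF dj, of S]] P unfolding ins by blast
  then show "(case a of (P,C) => (S - C, P - {C})) \<in> (SIGMA B:?T. {P. partition_on B P})"
   using sub C S by (auto simp: aPC)
  have "S - (S - C) = C" using sub by auto
  then show "(\<lambda>(B,P). (insert (S - B) P, S - B)) ((\<lambda>(P,C). (S - C, P - {C})) a) = a"
   using ins by (auto simp: aPC)
 qed
 also have "\<dots> = (\<Sum>P\<in>?PP. \<Sum>C | C \<in> P \<and> i \<notin> C. cumw (card P - 1) * (\<Prod>D\<in>P. m D))"
  using fP finite_elements[OF S(1)] by (subst sum.Sigma) auto
 also have "\<dots> = (\<Sum>P\<in>?PP. real (card P - 1) * cumw (card P - 1) * (\<Prod>D\<in>P. m D))"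
  using S by (intro sum.cong) (auto simp: card_blocks_avoiding)
 also have "kappa m S + \<dots> =
   (\<Sum>P\<in>?PP. (cumw (card P) + real (card P - 1) * cumw (card P - 1)) * (\<Prod>D\<in>P. m D))"
  by (simp add: kappa_def sum.distrib algebra_simps)
 also have "\<dots> = (\<Sum>P\<in>?PP. if P = {S} then m S else 0)"
 proof (intro sum.cong refl)
  fix P assume "P \<in> ?PP"
  then have P: "partition_on S P" by simp
  have fin: "finite P" using P S(1) by (rule finite_elements[rotated])
  have ne: "P \<noteq> {}" using P S(2) by (auto dest: partition_onD1)
  show "(cumw (card P) + real (card P - 1) * cumw (card P - 1)) * (\<Prod>D\<in>P. m D) =
    (if P = {S} then m S else 0)"
  proof (cases "card P \<ge> 2")
   case True
   then have "P \<noteq> {S}" by auto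
   then show ?thesis using cumw_step[OF True] by simp
  next
   case False
   then have "card P = 1" using ne fin by (metis One_nat_def Suc_leI card_gt_0_iff le_antisym not_less_eq_eq numeral_2_eq_2)
   then obtain C where C: "P = {C}" by (auto simp: card_1_singleton_iff)
   then have "C = S" using P by (auto dest: partition_onD1)
   then show ?thesis using C by (simp add: cumw_def)
  qed
 qed
 also have "\<dots> = m S" using fP S partition_on_space[of S] by (subst sum.delta) auto
 finally show ?thesis by simp
qed

lemma kappa_cong:
 assumes "\<And>B. B \<subseteq> S ==> B \<noteq> {} ==> m B = m' B"
 shows "kappa m S = kappa m' S"
 unfolding kappa_def
proof (intro sum.cong refl, goal_cases)
 case (1 P)
 then have "\<And>B. B \<in> P ==> m B = m' B"
  by (intro assms) (auto dest: partition_onD1 partition_onD3)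
 then show ?case by simp
qed

text \<open>Exactly one block of every partition contains \<open>i\<close>, and each product is
  linear in the factor of that block.\<close>

lemma kappa_linear:
 assumes S: "finite S" "i \<in> S" and A: "finite A"
  and out: "\<And>B u. B \<subseteq> S ==> i \<notin> B ==> u \<in> A ==> n u B = m B"
  and inn: "\<And>B. B \<subseteq> S ==> i \<in> B ==> m B = (\<Sum>u\<in>A. c u * n u B)"
 shows "kappa m S = (\<Sum>u\<in>A. c u * kappa (n u) S)"
proof -
 have "(\<Prod>B\<in>P. m B) = (\<Sum>u\<in>A. c u * (\<Prod>B\<in>P. n u B))" if P: "partition_on S P" for P
 proof -
  have fin: "finite P" using P S(1) by (rule finite_elements[rotated])
  obtain C where C: "C \<in> P" "i \<in> C" using P S(2) partition_onD1 by blast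
  have sub: "\<And>B. B \<in> P ==> B \<subseteq> S" using P by (auto dest: partition_onD1)
  have oth: "i \<notin> B" if "B \<in> P - {C}" for B
   using partition_on_unique[OF P C(1) _ C(2), of B] that by auto
  have "(\<Prod>B\<in>P. m B) = m C * (\<Prod>B\<in>P-{C}. m B)" using fin C(1) by (rule prod.remove)
  also have "m C = (\<Sum>u\<in>A. c u * n u C)" using C sub by (intro inn) auto
  also have "\<dots> * (\<Prod>B\<in>P-{C}. m B) = (\<Sum>u\<in>A. c u * (n u C * (\<Prod>B\<in>P-{C}. n u B)))"
   unfolding sum_distrib_right
  proof (intro sum.cong refl)
   fix u assume u: "u \<in> A"
   have "(\<Prod>B\<in>P-{C}. m B) = (\<Prod>B\<in>P-{C}. n u B)"
    using out[OF _ _ u] oth sub by (intro prod.cong) auto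
   then show "c u * n u C * (\<Prod>B\<in>P-{C}. m B) = c u * (n u C * (\<Prod>B\<in>P-{C}. n u B))" by simp
  qed
  also have "\<dots> = (\<Sum>u\<in>A. c u * (\<Prod>B\<in>P. n u B))"
   using prod.remove[OF fin C(1), of "n _"] by simp
  finally show ?thesis .
 qed
 then have "kappa m S = (\<Sum>P | partition_on S P. \<Sum>u\<in>A. c u * (cumw (card P) * (\<Prod>B\<in>P. n u B)))"
  unfolding kappa_def by (intro sum.cong) (auto simp: sum_distrib_left algebra_simps)
 also have "\<dots> = (\<Sum>u\<in>A. c u * kappa (n u) S)"
  unfolding kappa_def by (subst sum.swap) (simp add: sum_distrib_left)
 finally show ?thesis .
qed

text \<open>Partitions are carried along \<open>f\<close>; this yields the symmetry of fourth-order
  cumulants in their time arguments.\<close>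

lemma kappa_reindex:
 assumes f: "inj_on f S"
 shows "kappa m (f ` S) = kappa (\<lambda>B. m (f ` B)) S"
proof -
 have bw: "bij_betw ((`) ((`) f)) {P. partition_on S P} {P. partition_on (f ` S) P}"
 proof (rule bij_betwI[where g = "(`) ((`) (the_inv_into S f))"])
  have one: "partition_on (g ` T) ((`) g ` P)" if "partition_on T P" "inj_on g T"
   for g :: "'c => 'd" and T P
  proof -
   have "{} \<notin> (`) g ` P" using partition_onD3[OF that(1)] by auto
   then show ?thesis using partition_on_inj_image[OF that] by simp
  qed
  show "(`) ((`) f) \<in> {P. partition_on S P} \<rightarrow> {P. partition_on (f ` S) P}"
   using one f by auto
  have inv: "the_inv_into S f ` f ` S = S" using f by (simp add: the_inv_into_onto)
  show "(`) ((`) (the_inv_into S f)) \<in> {P. partition_on (f ` S) P} \<rightarrow> {P. partition_on S P}"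
   using one[of "f ` S" _ "the_inv_into S f"] f inv by (auto simp: inj_on_the_inv_into)
  show "(`) ((`) (the_inv_into S f)) ((`) ((`) f) P) = P" if "P \<in> {P. partition_on S P}" for P
  proof -
   have "the_inv_into S f ` f ` B = B" if "B \<in> P" for B
   proof -
    have "B \<subseteq> S" using that \<open>P \<in> _\<close> by (auto dest: partition_onD1)
    then have "(\<lambda>x. the_inv_into S f (f x)) ` B = (\<lambda>x. x) ` B"
     using f by (intro image_cong) (auto simp: the_inv_into_f_f)
    then show ?thesis by (simp add: image_image)
   qed
   then show ?thesis by (simp add: image_image)
  qed
  show "(`) ((`) f) ((`) ((`) (the_inv_into S f)) P) = P" if "P \<in> {P. partition_on (f ` S) P}" for P
  proof -
   have "f ` the_inv_into S f ` B = B" if "B \<in> P" for B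
   proof -
    have "partition_on (f ` S) P" using \<open>P \<in> _\<close> by simp
    then have "B \<subseteq> f ` S" using Union_upper[OF that] partition_onD1[of "f ` S" P] by simp
    then have "(\<lambda>x. f (the_inv_into S f x)) ` B = (\<lambda>x. x) ` B"
     using f by (intro image_cong) (auto simp: f_the_inv_into_f)
    then show ?thesis by (simp add: image_image)
   qed
   then show ?thesis by (simp add: image_image)
  qed
 qed
 have "kappa m (f ` S) = (\<Sum>P | partition_on S P. cumw (card ((`) f ` P)) * (\<Prod>B\<in>(`) f ` P. m B))"
  unfolding kappa_def by (rule sum.reindex_bij_betw[OF bw, symmetric])
 also have "\<dots> = kappa (\<lambda>B. m (f ` B)) S"
  unfolding kappa_def
 proof (intro sum.cong refl)
  fix P assume "P \<in> {P. partition_on S P}"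
  then have "P \<subseteq> Pow S" by (auto dest: partition_onD1)
  then have "inj_on ((`) f) P"
   using inj_on_image_Pow[OF f] by (rule inj_on_subset[rotated])
  then show "cumw (card ((`) f ` P)) * (\<Prod>B\<in>(`) f ` P. m B) = cumw (card P) * (\<Prod>B\<in>P. m (f ` B))"
   by (simp add: card_image prod.reindex)
 qed
 finally show ?thesis .
qed

text \<open>With \<open>\<mu>\<close> the largest modulus, the product is at most a power of
  \<open>\<mu>\<close> with exponent at most 8, hence at most 1 or at most one of the eighth
  powers.\<close>

lemma abs_prod_le_sum_pow8:
 fixes y :: "'i => real"
 assumes "finite S" "card S \<le> 8"
 shows "\<bar>\<Prod>i\<in>S. y i\<bar> \<le> 1 + (\<Sum>i\<in>S. y i ^ 8)"
proof (cases "S = {}")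
 case False
 define \<mu> where "\<mu> = Max ((\<lambda>i. \<bar>y i\<bar>) ` S)"
 have "\<mu> \<in> (\<lambda>i. \<bar>y i\<bar>) ` S" unfolding \<mu>_def using assms False by (intro Max_in) auto
 then obtain k where k: "k \<in> S" "\<mu> = \<bar>y k\<bar>" by auto
 have nn: "(\<Sum>i\<in>S. y i ^ 8) \<ge> 0" by (intro sum_nonneg) simp
 have "\<bar>\<Prod>i\<in>S. y i\<bar> = (\<Prod>i\<in>S. \<bar>y i\<bar>)" by (simp add: abs_prod)
 also have "\<dots> \<le> (\<Prod>i\<in>S. \<mu>)"
  unfolding \<mu>_def using assms by (intro prod_mono) auto
 also have "\<dots> = \<mu> ^ card S" by simp
 also have "\<dots> \<le> 1 + (\<Sum>i\<in>S. y i ^ 8)"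
 proof (cases "\<mu> \<le> 1")
  case True
  then have "\<mu> ^ card S \<le> 1" using k by (intro power_le_one) auto
  then show ?thesis using nn by simp
 next
  case False
  then have "\<mu> ^ card S \<le> \<mu> ^ 8" using assms by (intro power_increasing) auto
  also have "\<dots> = y k ^ 8" by (simp add: k)
  also have "\<dots> \<le> (\<Sum>i\<in>S. y i ^ 8)"
   using assms k by (intro member_le_sum) auto
  finally show ?thesis by simp
 qed
 finally show ?thesis .
qed simp

lemma add_pow8_le: "((x::real) + y) ^ 8 \<le> 128 * (x ^ 8 + y ^ 8)"
proof -
 have sq: "(a + b)\<^sup>2 \<le> 2 * (a\<^sup>2 + b\<^sup>2)" for a b :: real
  using sum_squares_bound[of a b] by (simp add: power2_sum)
 have d: "((2 * z)\<^sup>2)\<^sup>2 = 16 * (z\<^sup>2)\<^sup>2" for z :: real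
  by (simp add: power2_eq_square)
 have d': "16 * (2 * z)\<^sup>2 = 64 * z\<^sup>2" for z :: real
  by (simp add: power2_eq_square)
 have "(x + y) ^ 8 = (((x + y)\<^sup>2)\<^sup>2)\<^sup>2" by (simp flip: power_mult)
 also have "\<dots> \<le> ((2 * (x\<^sup>2 + y\<^sup>2))\<^sup>2)\<^sup>2"
  by (intro power_mono sq) auto
 also have "\<dots> = 16 * ((x\<^sup>2 + y\<^sup>2)\<^sup>2)\<^sup>2" by (rule d)
 also have "\<dots> \<le> 16 * (2 * ((x\<^sup>2)\<^sup>2 + (y\<^sup>2)\<^sup>2))\<^sup>2"
  by (intro mult_left_mono power_mono sq) auto
 also have "\<dots> = 64 * ((x\<^sup>2)\<^sup>2 + (y\<^sup>2)\<^sup>2)\<^sup>2" by (rule d')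
 also have "\<dots> \<le> 64 * (2 * (((x\<^sup>2)\<^sup>2)\<^sup>2 + ((y\<^sup>2)\<^sup>2)\<^sup>2))"
  by (intro mult_left_mono sq) auto
 also have "\<dots> = 128 * (x ^ 8 + y ^ 8)" by (simp flip: power_mult)
 finally show ?thesis .
qed

text \<open>A counting device: \<open>h\<close> may take a value repeatedly, but \<open>q\<close>
  tells the repetitions apart, so each value occurs at most \<open>card Q\<close> times. Later
  \<open>h\<close> is a vector of lags and \<open>q\<close> the positions that the lags leave
  free.\<close>

lemma sum_le_card_infsum:
 fixes F :: "'h => real"
 assumes A: "finite A" and Q: "finite Q" "q ` A \<subseteq> Q" and h: "h ` A \<subseteq> H"
  and inj: "inj_on (\<lambda>a. (q a, h a)) A"
  and F: "F summable_on H" "\<And>x. x \<in> H ==> F x \<ge> 0"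
 shows "(\<Sum>a\<in>A. F (h a)) \<le> real (card Q) * infsum F H"
proof -
 have "(\<Sum>a\<in>A. F (h a)) = (\<Sum>p\<in>(\<lambda>a. (q a, h a)) ` A. F (snd p))"
  using inj by (simp add: sum.reindex)
 also have "\<dots> \<le> (\<Sum>p\<in>Q \<times> h ` A. F (snd p))"
  using A Q h F by (intro sum_mono2) auto
 also have "\<dots> = (\<Sum>x\<in>Q. \<Sum>y\<in>h ` A. F y)"
  by (simp only: sum.cartesian_product case_prod_unfold)
 also have "\<dots> = real (card Q) * (\<Sum>y\<in>h ` A. F y)" by simp
 also have "\<dots> \<le> real (card Q) * infsum F H"
  using A h F by (intro mult_left_mono finite_sum_le_infsum) auto
 finally show ?thesis .
qed

section \<open>Moments and cumulants of a stationary process\<close>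

context prob_space
begin

text \<open>A linear space of random variables in which every product of up to eight members is
  integrable, which covers all moments and cumulants up to order eight.\<close>

definition rv8 :: "('a => real) => bool" where
 "rv8 Y \<longleftrightarrow> Y \<in> borel_measurable M \<and> integrable M (\<lambda>om. Y om ^ 8)"

lemma rv8_prod_integrable:
 assumes "finite S" "card S \<le> 8" "\<And>i. i \<in> S ==> rv8 (Y i)"
 shows "integrable M (\<lambda>om. \<Prod>i\<in>S. Y i om)"
proof (rule Bochner_Integration.integrable_bound)
 show "integrable M (\<lambda>om. 1 + (\<Sum>i\<in>S. Y i om ^ 8))"
  using assms by (auto simp: rv8_def)
 show "(\<lambda>om. \<Prod>i\<in>S. Y i om) \<in> borel_measurable M"
  using assms by (auto simp: rv8_def intro!: borel_measurable_prod)
 show "AE om in M. norm (\<Prod>i\<in>S. Y i om) \<le> norm (1 + (\<Sum>i\<in>S. Y i om ^ 8))"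
  using abs_prod_le_sum_pow8[OF assms(1,2)]
  by (intro AE_I2) (simp add: order_trans[OF _ abs_ge_self])
qed

lemma rv8_pow_integrable:
 assumes "rv8 Y" "n \<le> 8"
 shows "integrable M (\<lambda>om. Y om ^ n)"
 using rv8_prod_integrable[of "{..<n}" "\<lambda>_. Y"] assms by simp

lemma rv8_zero: "rv8 (\<lambda>_. 0)"
 by (simp add: rv8_def)

lemma rv8_scale: "rv8 Y ==> rv8 (\<lambda>om. c * Y om)"
 by (auto simp: rv8_def power_mult_distrib)

lemma rv8_add:
 assumes "rv8 Y" "rv8 Z"
 shows "rv8 (\<lambda>om. Y om + Z om)"
 unfolding rv8_def
proof
 show m: "(\<lambda>om. Y om + Z om) \<in> borel_measurable M" using assms by (auto simp: rv8_def)
 show "integrable M (\<lambda>om. (Y om + Z om) ^ 8)"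
 proof (rule Bochner_Integration.integrable_bound)
  show "integrable M (\<lambda>om. 128 * (Y om ^ 8 + Z om ^ 8))" using assms by (auto simp: rv8_def)
  show "(\<lambda>om. (Y om + Z om) ^ 8) \<in> borel_measurable M" using m by simp
  show "AE om in M. norm ((Y om + Z om) ^ 8) \<le> norm (128 * (Y om ^ 8 + Z om ^ 8))"
   using add_pow8_le by (intro AE_I2) (simp add: abs_of_nonneg)
 qed
qed

lemma rv8_sum: "(\<And>i. i \<in> A ==> rv8 (Y i)) ==> rv8 (\<lambda>om. \<Sum>i\<in>A. Y i om)"
 by (induction A rule: infinite_finite_induct) (auto intro: rv8_add rv8_zero)

definition mom :: "('i => 'a => real) => 'i set => real" where
 "mom D S = \<E> (\<lambda>om. \<Prod>i\<in>S. D i om)"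

lemma mom_empty [simp]: "mom D {} = 1"
 by (simp add: mom_def prob_space)

lemma mom_cong: "(\<And>i. i \<in> S ==> D i = D' i) ==> mom D S = mom D' S"
 unfolding mom_def by (intro Bochner_Integration.integral_cong prod.cong) auto

lemma mom_lin:
 assumes S: "finite S" "card S \<le> 8" "i \<in> S" "finite A"
  and D: "\<And>j. j \<in> S ==> j \<noteq> i ==> rv8 (D j)" and Y: "\<And>u. u \<in> A ==> rv8 (Y u)"
  and eq: "D i = (\<lambda>om. \<Sum>u\<in>A. c u * Y u om)"
 shows "mom D S = (\<Sum>u\<in>A. c u * mom (D(i := Y u)) S)"
proof -
 have int: "integrable M (\<lambda>om. \<Prod>j\<in>S. (D(i := Y u)) j om)" if "u \<in> A" for u
  using S D Y that by (intro rv8_prod_integrable) auto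
 have "(\<Prod>j\<in>S. D j om) = (\<Sum>u\<in>A. c u * (\<Prod>j\<in>S. (D(i := Y u)) j om))" for om
  using S(1,3) by (simp add: prod.remove[of S i] eq sum_distrib_right mult.assoc)
 then have "mom D S = (\<integral>om. (\<Sum>u\<in>A. c u * (\<Prod>j\<in>S. (D(i := Y u)) j om)) \<partial>M)"
  unfolding mom_def by simp
 also have "\<dots> = (\<Sum>u\<in>A. c u * mom (D(i := Y u)) S)"
  unfolding mom_def using int by (subst Bochner_Integration.integral_sum) auto
 finally show ?thesis .
qed

lemma kappa_multilinear:
 fixes D :: "'i => 'a => real"
 assumes S: "finite S" "card S \<le> 8" and A: "finite A"
  and Y: "\<And>i u. i \<in> S ==> u \<in> A ==> rv8 (Y i u)"
  and D: "\<And>i. i \<in> S ==> D i = (\<lambda>om. \<Sum>u\<in>A. c i u * Y i u om)"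
 shows "kappa (mom D) S =
  (\<Sum>u\<in>PiE S (\<lambda>_. A). (\<Prod>i\<in>S. c i (u i)) * kappa (mom (\<lambda>i. Y i (u i))) S)"
proof -
 \<comment> \<open>In \<open>G F u\<close> the positions in \<open>F\<close> already carry the
   summand selected by \<open>u\<close>, the others still the full sum. The induction enlarges
   \<open>F\<close> by one position at a time through \<open>kappa_linear\<close>.\<close>
 define G where "G F u i = (if i \<in> F then Y i (u i) else D i)" for F u i
 have rvD: "rv8 (D i)" if "i \<in> S" for i
  unfolding D[OF that] by (intro rv8_sum rv8_scale Y that)
 have "kappa (mom D) S =
   (\<Sum>u\<in>PiE F (\<lambda>_. A). (\<Prod>i\<in>F. c i (u i)) * kappa (mom (G F u)) S)" if "F \<subseteq> S" for F
  using finite_subset[OF that S(1)] that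
 proof (induction F rule: finite_induct)
  case empty
  then show ?case by (simp add: G_def[abs_def])
 next
  case (insert j F)
  have j: "j \<in> S" "j \<notin> F" using insert by auto
  have step: "kappa (mom (G F u)) S =
    (\<Sum>v\<in>A. c j v * kappa (mom (G (insert j F) (u(j := v)))) S)" if u: "u \<in> PiE F (\<lambda>_. A)" for u
  proof (rule kappa_linear[OF S(1) j(1) A])
   fix B v assume B: "B \<subseteq> S" "j \<notin> B"
   then show "mom (G (insert j F) (u(j := v))) B = mom (G F u) B"
    by (intro mom_cong) (auto simp: G_def)
  next
   fix B assume B: "B \<subseteq> S" "j \<in> B"
   have "mom (G F u) B = (\<Sum>v\<in>A. c j v * mom ((G F u)(j := Y j v)) B)"
   proof (rule mom_lin[OF _ _ B(2) A])
    show "finite B" "card B \<le> 8"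
     using B(1) S finite_subset[OF B(1)] card_mono[OF S(1) B(1)] by auto
    show "rv8 (G F u i)" if "i \<in> B" "i \<noteq> j" for i
     using that B(1) u rvD Y by (auto simp: G_def PiE_def Pi_def)
    show "rv8 (Y j v)" if "v \<in> A" for v using Y j that by auto
    show "G F u j = (\<lambda>om. \<Sum>v\<in>A. c j v * Y j v om)" using j D by (simp add: G_def)
   qed
   also have "\<dots> = (\<Sum>v\<in>A. c j v * mom (G (insert j F) (u(j := v))) B)"
    by (intro sum.cong refl arg_cong2[where f = "(*)"] mom_cong) (auto simp: G_def)
   finally show "mom (G F u) B = (\<Sum>v\<in>A. c j v * mom (G (insert j F) (u(j := v))) B)" .
  qed
  have "kappa (mom D) S = (\<Sum>u\<in>PiE F (\<lambda>_. A). (\<Prod>i\<in>F. c i (u i)) * kappa (mom (G F u)) S)"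
   using insert by auto
  also have "\<dots> = (\<Sum>u\<in>PiE F (\<lambda>_. A). \<Sum>v\<in>A. (\<Prod>i\<in>insert j F. c i ((u(j := v)) i)) *
    kappa (mom (G (insert j F) (u(j := v)))) S)"
  proof (intro sum.cong refl)
   fix u assume u: "u \<in> PiE F (\<lambda>_. A)"
   have "(\<Prod>i\<in>insert j F. c i ((u(j := v)) i)) = c j v * (\<Prod>i\<in>F. c i (u i))" for v
    using j(2) insert(1) by (simp, intro disjI2 prod.cong) auto
   then show "(\<Prod>i\<in>F. c i (u i)) * kappa (mom (G F u)) S =
    (\<Sum>v\<in>A. (\<Prod>i\<in>insert j F. c i ((u(j := v)) i)) * kappa (mom (G (insert j F) (u(j := v)))) S)"
    unfolding step[OF u] by (simp add: sum_distrib_left algebra_simps)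
  qed
  also have "\<dots> = (\<Sum>(v,u)\<in>A \<times> PiE F (\<lambda>_. A). (\<Prod>i\<in>insert j F. c i ((u(j := v)) i)) *
    kappa (mom (G (insert j F) (u(j := v)))) S)"
   by (subst sum.swap) (simp add: sum.cartesian_product)
  also have "\<dots> = (\<Sum>u\<in>(\<lambda>(v,u). u(j := v)) ` (A \<times> PiE F (\<lambda>_. A)).
    (\<Prod>i\<in>insert j F. c i (u i)) * kappa (mom (G (insert j F) u)) S)"
   using inj_combinator[OF j(2), of "\<lambda>_. A"]
   by (subst sum.reindex) (auto simp: case_prod_unfold intro!: sum.cong)
  finally show ?case by (simp add: PiE_insert_eq)
 qed
 from this[of S] have "kappa (mom D) S =
  (\<Sum>u\<in>PiE S (\<lambda>_. A). (\<Prod>i\<in>S. c i (u i)) * kappa (mom (G S u)) S)" by simp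
 moreover have "kappa (mom (G S u)) S = kappa (mom (\<lambda>i. Y i (u i))) S" for u
  by (intro kappa_cong mom_cong) (auto simp: G_def)
 ultimately show ?thesis by simp
qed

end

section \<open>Linear statistics of blocks and their cumulants\<close>

locale spec_process = prob_space +
 fixes X :: "int => 'a => real"
 assumes X_meas [measurable]: "\<And>t. X t \<in> borel_measurable M"
  and stat: "strictly_stationary M X"
  and X8: "\<And>t. integrable M (\<lambda>om. X t om ^ 8)"
  and X_mean: "\<And>t. \<E> (X t) = 0"
  and acov: "(\<lambda>h. (1 + \<bar>real_of_int h\<bar>) * \<bar>autocov M X h\<bar>) summable_on UNIV"
  and cum4: "(\<lambda>(h1, h2, h3). \<bar>cum M [X 0, X h1, X h2, X h3]\<bar>) summable_on UNIV"
  and cum8: "(\<lambda>hs. \<bar>cum M (map X (0 # hs))\<bar>) summable_on {hs. length hs = 7}"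
begin

lemma rv8_X: "rv8 (X t)"
 by (simp add: rv8_def X8)

lemma mom_shift:
 assumes "finite S"
 shows "mom (\<lambda>i. X (a i + h)) S = mom (\<lambda>i. X (a i)) S"
proof -
 have fin: "finite (a ` S)" using assms by simp
 let ?N = "Pi\<^sub>M (a ` S) (\<lambda>_. borel :: real measure)"
 let ?g = "\<lambda>x::int => real. \<Prod>i\<in>S. x (a i)"
 have g: "?g \<in> borel_measurable ?N"
  by (intro borel_measurable_prod measurable_component_singleton) auto
 have key: "(\<integral>x. ?g x \<partial>distr M ?N (\<lambda>om. \<lambda>t\<in>a ` S. X (t + k) om)) = mom (\<lambda>i. X (a i + k)) S" for k
 proof -
  have "(\<lambda>om. \<lambda>t\<in>a ` S. X (t + k) om) \<in> measurable M ?N" by (intro measurable_restrict) simp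
  then show ?thesis unfolding mom_def by (subst integral_distr[OF _ g]) simp_all
 qed
 have "distr M ?N (\<lambda>om. \<lambda>t\<in>a ` S. X (t + h) om) = distr M ?N (\<lambda>om. \<lambda>t\<in>a ` S. X (t + 0) om)"
  using stat fin unfolding strictly_stationary_def by simp
 then show ?thesis using key[of h] key[of 0] by simp
qed

definition cumX :: "(nat => int) => nat set => real" where
 "cumX a S = kappa (mom (\<lambda>i. X (a i))) S"

lemma cumX_shift: "finite S ==> cumX (\<lambda>i. a i + h) S = cumX a S"
 unfolding cumX_def by (intro kappa_cong mom_shift) (rule finite_subset)

lemma cum_eq_cumX: "cum M (map X hs) = cumX (\<lambda>i. hs ! i) {..<length hs}"
proof -
 have "cum M (map X hs) = kappa (mom (\<lambda>i. map X hs ! i)) {..<length hs}"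
  by (simp add: cum_def kappa_def mom_def cumw_def)
 also have "\<dots> = cumX (\<lambda>i. hs ! i) {..<length hs}"
  unfolding cumX_def by (intro kappa_cong mom_cong) auto
 finally show ?thesis .
qed

text \<open>Shifting time by \<open>- a 0\<close> brings any cumulant to the form with first
  argument \<open>X 0\<close>, for which summability over the lags is assumed.\<close>

lemma cumX_list:
 assumes "r \<ge> 1"
 shows "cumX a {..<r} = cum M (map X (0 # map (\<lambda>i. a i - a 0) [1..<r]))"
proof -
 have "cumX a {..<r} = cumX (\<lambda>i. a i + (- a 0)) {..<r}" by (rule cumX_shift[symmetric]) simp
 also have "\<dots> = cumX (\<lambda>i. (0 # map (\<lambda>i. a i - a 0) [1..<r]) ! i) {..<r}"
  unfolding cumX_def
 proof (intro kappa_cong mom_cong)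
  fix B i assume "B \<subseteq> {..<r}" "i \<in> B"
  then have "i < r" by auto
  then show "X (a i + - a 0) = X ((0 # map (\<lambda>i. a i - a 0) [1..<r]) ! i)"
   by (cases i) auto
 qed
 also have "\<dots> = cum M (map X (0 # map (\<lambda>i. a i - a 0) [1..<r]))"
  using assms by (subst cum_eq_cumX) simp
 finally show ?thesis .
qed

text \<open>Stationarity fixes the first time at 0, so order \<open>r\<close> leaves
  \<open>r - 1\<close> lags, and \<open>r \<le> 8\<close> keeps the moments finite. The property is
  established for the orders 2, 4 and 8.\<close>

definition cumsummable :: "nat => bool" where
 "cumsummable r \<longleftrightarrow> r \<ge> 1 \<and> r \<le> 8 \<and> (\<lambda>hs. \<bar>cum M (map X (0 # hs))\<bar>) summable_on {hs. length hs = r - 1}"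

definition cumbound :: "nat => real" where
 "cumbound r = infsum (\<lambda>hs. \<bar>cum M (map X (0 # hs))\<bar>) {hs. length hs = r - 1}"

lemma cumbound_nonneg: "cumbound r \<ge> 0"
 unfolding cumbound_def by (intro infsum_nonneg) simp

lemma sum_cumX_le:
 assumes r: "cumsummable r" and A: "finite A" and Q: "finite Q" "q ` A \<subseteq> Q"
  and inj: "inj_on (\<lambda>z. (q z, map (\<lambda>i. pos z i - pos z 0) [1..<r])) A"
 shows "(\<Sum>z\<in>A. \<bar>cumX (pos z) {..<r}\<bar>) \<le> real (card Q) * cumbound r"
proof -
 have "(\<Sum>z\<in>A. \<bar>cumX (pos z) {..<r}\<bar>) =
   (\<Sum>z\<in>A. \<bar>cum M (map X (0 # map (\<lambda>i. pos z i - pos z 0) [1..<r]))\<bar>)"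
  using r by (simp add: cumX_list cumsummable_def)
 also have "\<dots> \<le> real (card Q) * cumbound r"
  unfolding cumbound_def
  by (rule sum_le_card_infsum[OF A Q _ inj]) (use r in \<open>auto simp: cumsummable_def\<close>)
 finally show ?thesis .
qed

text \<open>The offset \<open>- 1\<close> makes the block start at time \<open>t\<close> itself. For
  weights bounded by 1 the factor \<open>1 / sqrt b\<close> keeps the moments up to order eight
  bounded uniformly in \<open>b\<close>.\<close>

definition lin :: "(nat => real) => nat => nat => 'a => real" where
 "lin w b t om = (1 / sqrt b) * (\<Sum>u=1..b. w u * X (int t + int u - 1) om)"

lemma lin_alt: "lin w b t = (\<lambda>om. \<Sum>u\<in>{1..b}. (w u / sqrt b) * X (int t + int u - 1) om)"
 by (auto simp: lin_def sum_distrib_left fun_eq_iff)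

lemma rv8_lin: "rv8 (lin w b t)"
 unfolding lin_alt by (intro rv8_sum rv8_scale rv8_X)

lemma abs_kappa_lin_le:
 assumes w: "\<And>i u. \<bar>w i u\<bar> \<le> 1" and b: "b \<ge> 1" and r: "r \<le> 8"
 shows "\<bar>kappa (mom (\<lambda>i. lin (w i) b (\<tau> i))) {..<r}\<bar> \<le>
  (1 / sqrt b) ^ r * (\<Sum>u\<in>PiE {..<r} (\<lambda>_. {1..b}). \<bar>cumX (\<lambda>i. int (\<tau> i) + int (u i) - 1) {..<r}\<bar>)"
proof -
 have "kappa (mom (\<lambda>i. lin (w i) b (\<tau> i))) {..<r} =
  (\<Sum>u\<in>PiE {..<r} (\<lambda>_. {1..b}). (\<Prod>i<r. w i (u i) / sqrt b) *
    cumX (\<lambda>i. int (\<tau> i) + int (u i) - 1) {..<r})"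
  unfolding cumX_def using r rv8_X by (intro kappa_multilinear) (auto simp: lin_alt)
 also have "\<bar>\<dots>\<bar> \<le> (\<Sum>u\<in>PiE {..<r} (\<lambda>_. {1..b}). \<bar>(\<Prod>i<r. w i (u i) / sqrt b) *
    cumX (\<lambda>i. int (\<tau> i) + int (u i) - 1) {..<r}\<bar>)"
  by (rule sum_abs)
 also have "\<dots> \<le> (\<Sum>u\<in>PiE {..<r} (\<lambda>_. {1..b}). (1 / sqrt b) ^ r * \<bar>cumX (\<lambda>i. int (\<tau> i) + int (u i) - 1) {..<r}\<bar>)"
 proof (rule sum_mono)
  fix u
  have "\<bar>\<Prod>i<r. w i (u i) / sqrt b\<bar> \<le> (\<Prod>i<r. 1 / sqrt b)"
   unfolding abs_prod using w b by (intro prod_mono) (auto simp: divide_right_mono)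
  then show "\<bar>(\<Prod>i<r. w i (u i) / sqrt b) * cumX (\<lambda>i. int (\<tau> i) + int (u i) - 1) {..<r}\<bar>
   \<le> (1 / sqrt b) ^ r * \<bar>cumX (\<lambda>i. int (\<tau> i) + int (u i) - 1) {..<r}\<bar>"
   unfolding abs_mult by (intro mult_right_mono) auto
 qed
 finally show ?thesis by (simp add: sum_distrib_left)
qed

text \<open>Given the lags, a tuple of positions in one block is determined by its first entry. So
  at most \<open>b\<close> of the \<open>b ^ r\<close> tuples share a lag vector.\<close>

lemma kappa_lin_le:
 assumes w: "\<And>i u. \<bar>w i u\<bar> \<le> 1" and b: "b \<ge> 1" and r: "cumsummable r"
 shows "\<bar>kappa (mom (\<lambda>i. lin (w i) b t)) {..<r}\<bar> \<le> (1 / sqrt b) ^ r * (real b * cumbound r)"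
proof -
 have r': "r \<le> 8" "r \<ge> 1" using r by (auto simp: cumsummable_def)
 have "(\<Sum>u\<in>PiE {..<r} (\<lambda>_. {1..b}). \<bar>cumX (\<lambda>i. int t + int (u i) - 1) {..<r}\<bar>)
   \<le> real (card {1..b}) * cumbound r"
 proof (rule sum_cumX_le[OF r, where q = "\<lambda>u. u 0"])
  show "finite (PiE {..<r} (\<lambda>_. {1..b}))" by (intro finite_PiE) auto
  show "(\<lambda>u. u 0) ` PiE {..<r} (\<lambda>_. {1..b}) \<subseteq> {1..b}" using r' by (auto simp: PiE_def Pi_def)
  show "inj_on (\<lambda>z. (z 0, map (\<lambda>i. int t + int (z i) - 1 - (int t + int (z 0) - 1)) [1..<r]))
    (PiE {..<r} (\<lambda>_. {1..b}))"
  proof (rule inj_onI)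
   fix x y assume x: "x \<in> PiE {..<r} (\<lambda>_. {1..b})" and y: "y \<in> PiE {..<r} (\<lambda>_. {1..b})"
    and eq: "(x 0, map (\<lambda>i. int t + int (x i) - 1 - (int t + int (x 0) - 1)) [1..<r]) =
     (y 0, map (\<lambda>i. int t + int (y i) - 1 - (int t + int (y 0) - 1)) [1..<r])"
   show "x = y"
   proof (rule PiE_ext[OF x y])
    fix i assume "i \<in> {..<r}"
    then show "x i = y i" using eq by (cases "i = 0") auto
   qed
  qed
 qed simp
 then show ?thesis
  by (intro order_trans[OF abs_kappa_lin_le[where \<tau> = "\<lambda>_. t", OF w b r'(1)]] mult_left_mono) simp_all
qed

text \<open>The positions \<open>0\<close> and \<open>r - 1\<close> lie in different blocks. Their
  entries \<open>u 0\<close> and \<open>u (r - 1)\<close>, together with the lags, recover the block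
  start \<open>s\<close> and the whole tuple, so the bound contains \<open>b * b\<close> and is free
  of \<open>N\<close>.\<close>

lemma sum_kappa_lin_le:
 assumes w: "\<And>i u. \<bar>w i u\<bar> \<le> 1" and b: "b \<ge> 1" and r: "cumsummable r"
  and T: "0 \<in> T" "r - 1 \<notin> T"
 shows "(\<Sum>s=1..N. \<bar>kappa (mom (\<lambda>i. lin (w i) b (if i \<in> T then t else s))) {..<r}\<bar>)
  \<le> (1 / sqrt b) ^ r * ((real b)\<^sup>2 * cumbound r)"
proof -
 have r': "r \<le> 8" "r \<ge> 1" using r by (auto simp: cumsummable_def)
 let ?P = "PiE {..<r} (\<lambda>_. {1..b})"
 let ?pos = "\<lambda>(s,u) i. int (if i \<in> T then t else s) + int (u i) - 1"
 have "(\<Sum>z\<in>{1..N} \<times> ?P. \<bar>cumX (?pos z) {..<r}\<bar>) \<le> real (card ({1..b} \<times> {1..b})) * cumbound r"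
 proof (rule sum_cumX_le[OF r, where q = "\<lambda>(s,u). (u 0, u (r - 1))"])
  show "finite ({1..N} \<times> ?P)" by (intro finite_cartesian_product finite_PiE) auto
  show "(\<lambda>(s,u). (u 0, u (r - 1))) ` ({1..N} \<times> ?P) \<subseteq> {1..b} \<times> {1..b}"
   using r' by (auto simp: PiE_def Pi_def)
  show "inj_on (\<lambda>z. (case z of (s,u) => (u 0, u (r - 1)), map (\<lambda>i. ?pos z i - ?pos z 0) [1..<r]))
    ({1..N} \<times> ?P)"
  proof (rule inj_onI)
   fix x y assume xy: "x \<in> {1..N} \<times> ?P" "y \<in> {1..N} \<times> ?P"
    and eq: "(case x of (s,u) => (u 0, u (r - 1)), map (\<lambda>i. ?pos x i - ?pos x 0) [1..<r]) =
     (case y of (s,u) => (u 0, u (r - 1)), map (\<lambda>i. ?pos y i - ?pos y 0) [1..<r])"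
   obtain s u s' u' where x: "x = (s,u)" and y: "y = (s',u')" by (cases x, cases y) auto
   have 0: "u 0 = u' 0" and last: "u (r - 1) = u' (r - 1)" using eq by (auto simp: x y)
   have pos: "?pos x i = ?pos y i" if "i < r" for i
   proof (cases "i = 0")
    case False
    then have "?pos x i - ?pos x 0 = ?pos y i - ?pos y 0" using eq that by simp
    then show ?thesis using 0 T by (simp add: x y)
   qed (use 0 T in \<open>simp add: x y\<close>)
   have ss: "s = s'" using pos[of "r - 1"] r' T last by (simp add: x y)
   have "u = u'"
   proof (rule PiE_ext[of u "{..<r}" "\<lambda>_. {1..b}"])
    fix i assume "i \<in> {..<r}"
    then show "u i = u' i" using pos[of i] ss by (auto simp: x y split: if_splits)
   qed (use xy in \<open>auto simp: x y\<close>)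
   with ss show "x = y" by (simp add: x y)
  qed
 qed auto
 moreover have eq: "(\<Sum>s=1..N. \<Sum>u\<in>?P. g (s, u)) = (\<Sum>z\<in>{1..N} \<times> ?P. g z)" for g :: "_ => real"
  by (simp add: sum.cartesian_product)
 ultimately have le: "(\<Sum>s=1..N. \<Sum>u\<in>?P. \<bar>cumX (?pos (s,u)) {..<r}\<bar>) \<le> (real b)\<^sup>2 * cumbound r"
  unfolding eq[of "\<lambda>z. \<bar>cumX (?pos z) {..<r}\<bar>"] by (simp only: card_cartesian_product) (simp add: power2_eq_square)
 have "(\<Sum>s=1..N. \<bar>kappa (mom (\<lambda>i. lin (w i) b (if i \<in> T then t else s))) {..<r}\<bar>) \<le>
  (\<Sum>s=1..N. (1 / sqrt b) ^ r * (\<Sum>u\<in>?P. \<bar>cumX (?pos (s,u)) {..<r}\<bar>))"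
  using abs_kappa_lin_le[OF w b r'(1)] by (intro sum_mono) simp
 also have "\<dots> = (1 / sqrt b) ^ r * (\<Sum>s=1..N. \<Sum>u\<in>?P. \<bar>cumX (?pos (s,u)) {..<r}\<bar>)"
  by (simp add: sum_distrib_left)
 also have "\<dots> \<le> (1 / sqrt b) ^ r * ((real b)\<^sup>2 * cumbound r)"
  by (intro mult_left_mono le) simp
 finally show ?thesis .
qed

end

section \<open>Low-order cumulants\<close>

lemma sum_supersets:
 assumes "i \<notin> T"
 shows "(\<Sum>B | i \<in> B \<and> B \<subseteq> insert i T. f B) = (\<Sum>B\<in>Pow T. f (insert i B))"
proof -
 have "{B. i \<in> B \<and> B \<subseteq> insert i T} = insert i ` Pow T"
 proof (intro set_eqI iffI)
  fix B assume "B \<in> {B. i \<in> B \<and> B \<subseteq> insert i T}"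
  then have "B = insert i (B - {i})" "B - {i} \<in> Pow T" by auto
  then show "B \<in> insert i ` Pow T" by (rule image_eqI)
 qed auto
 moreover have "inj_on (insert i) (Pow T)"
  using assms by (intro inj_onI) (metis Diff_insert_absorb PowD subsetD)
 ultimately show ?thesis by (simp add: sum.reindex)
qed

lemma sum_Pow_insert:
 assumes "finite T" "j \<notin> T"
 shows "(\<Sum>B\<in>Pow (insert j T). f B) = (\<Sum>B\<in>Pow T. f B) + (\<Sum>B\<in>Pow T. f (insert j B))"
proof -
 have "inj_on (insert j) (Pow T)"
  using assms by (intro inj_onI) (metis Diff_insert_absorb PowD subsetD)
 moreover have "Pow T \<inter> insert j ` Pow T = {}" using assms by auto
 ultimately show ?thesis
  using assms by (simp add: Pow_insert sum.union_disjoint sum.reindex)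
qed

lemma kappa_rec':
 assumes "finite T" "i \<notin> T" "m {} = (1::real)"
 shows "m (insert i T) = (\<Sum>B\<in>Pow T. kappa m (insert i B) * m (T - B))"
proof -
 have "m (insert i T) = (\<Sum>B | i \<in> B \<and> B \<subseteq> insert i T. kappa m B * m (insert i T - B))"
  using assms by (intro kappa_recursion) auto
 also have "\<dots> = (\<Sum>B\<in>Pow T. kappa m (insert i B) * m (T - B))"
  using assms(2) by (subst sum_supersets) (auto intro!: sum.cong)
 finally show ?thesis .
qed

lemma kappa1: "m {} = 1 ==> kappa m {i} = m {i}"
 using kappa_rec'[of "{}" i m] by simp

lemma kappa2:
 assumes "m {} = 1" "i \<noteq> j" "m {i} = 0"
 shows "kappa m {i, j} = m {i, j}"
 using kappa_rec'[of "{j}" i m] assms kappa1[of m i] by (simp add: sum_Pow_insert)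

lemma kappa3:
 assumes "m {} = 1" "i \<noteq> j" "i \<noteq> k" "j \<noteq> k" "m {i} = 0" "m {j} = 0" "m {k} = 0"
 shows "kappa m {i, j, k} = m {i, j, k}"
 using kappa_rec'[of "{j, k}" i m] assms kappa1[of m i]
 by (simp add: sum_Pow_insert insert_Diff_if)

text \<open>For centred variables every other partition has a singleton block, so only the three
  pairings stand beside the full cumulant, as in Isserlis' formula.\<close>

lemma kappa4:
 assumes m: "m {} = 1" "m {i} = 0" "m {j} = 0" "m {k} = 0" "m {l} = 0"
  and d: "i \<noteq> j" "i \<noteq> k" "i \<noteq> l" "j \<noteq> k" "j \<noteq> l" "k \<noteq> l"
 shows "m {i, j, k, l} = kappa m {i, j, k, l} + m {i, j} * m {k, l} + m {i, k} * m {j, l} + m {i, l} * m {j, k}"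
 using kappa_rec'[of "{j, k, l}" i m] m d kappa1[of m i] kappa2[of m i]
 by (simp add: sum_Pow_insert insert_Diff_if)

section \<open>A self-bounding estimate for the eighth moment\<close>

text \<open>Only blocks of size at most six contribute besides the full one, and two blocks of size at
 least five do not fit into eight points; hence a single factor \<open>1 + y\<close> suffices.\<close>

lemma kappa8_bound:
 fixes m :: "nat set => real"
 assumes y: "y \<ge> 0" and C: "C \<ge> 1"
  and sing: "\<And>i. i < 8 ==> m {i} = 0"
  and small: "\<And>B. B \<subseteq> {..<8} ==> card B \<le> 4 ==> \<bar>m B\<bar> \<le> C"
  and big: "\<And>B. B \<subseteq> {..<8} ==> card B \<in> {5, 6} ==> \<bar>m B\<bar> \<le> C * (1 + y)"
 shows "\<bar>m {..<8}\<bar> \<le> \<bar>kappa m {..<8}\<bar> +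
  (\<Sum>P | partition_on {..<8::nat} P. \<bar>cumw (card P)\<bar>) * (C ^ 8 * (1 + y))"
proof -
 let ?S = "{..<8::nat}"
 let ?PP = "{P. partition_on ?S P}"
 have fP: "finite ?PP" by (rule finitely_many_partition_on) simp
 have "0 \<in> ?S" by simp
 then have one: "{?S} \<in> ?PP" using partition_on_space[of ?S] by blast
 have C8: "C ^ n \<le> C ^ 8" if "n \<le> 8" for n using C that by (intro power_increasing) auto
 have block: "\<bar>\<Prod>B\<in>P. m B\<bar> \<le> C ^ 8 * (1 + y)" if P: "partition_on ?S P" "P \<noteq> {?S}" for P
 proof -
  have fin: "finite P" using P(1) by (rule finite_elements[rotated]) simp
  have sub: "B \<subseteq> ?S" if "B \<in> P" for B using P(1) that by (auto dest: partition_onD1)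
  have fB: "finite B" if "B \<in> P" for B using sub[OF that] finite_subset by blast
  have ne: "B \<noteq> {}" if "B \<in> P" for B using P(1) that by (auto dest: partition_onD3)
  have total: "(\<Sum>B\<in>P. card B) = 8"
  proof -
   have "card (\<Union>P) = (\<Sum>B\<in>P. card B)"
    using P(1) fB by (intro card_Union_disjoint) (auto dest: partition_onD2)
   then show ?thesis using P(1) by (simp flip: partition_onD1)
  qed
  have cardP: "card P \<le> 8"
  proof -
   have "card P = (\<Sum>B\<in>P. 1)" by simp
   also have "\<dots> \<le> (\<Sum>B\<in>P. card B)"
    using ne fB by (intro sum_mono) (metis One_nat_def Suc_leI card_gt_0_iff)
   finally show ?thesis using total by simp
  qed
  have n8: "card B \<noteq> 8" if "B \<in> P" for B
  proof
   assume "card B = 8"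
   then have "B = ?S" using sub[OF that] by (intro card_subset_eq) auto
   moreover have "D = B" if D: "D \<in> P" for D
   proof -
    obtain x where x: "x \<in> D" using ne[OF D] by auto
    then have "x \<in> B" using sub[OF D] \<open>B = ?S\<close> by blast
    then show ?thesis by (rule partition_on_unique[OF P(1) D \<open>B \<in> P\<close> x])
   qed
   ultimately have "P = {?S}" using that by blast
   then show False using P(2) by simp
  qed
  show ?thesis
  proof (cases "\<exists>i. {i} \<in> P")
   case True
   then obtain i where i: "{i} \<in> P" by auto
   then have "m {i} = 0" using sub by (intro sing) auto
   then have "(\<Prod>B\<in>P. m B) = 0" using fin i by (intro prod_zero) auto
   then show ?thesis using y C by simp
  next
   case False
   then have two: "card B \<ge> 2" if "B \<in> P" for B
    using that ne fB by (metis One_nat_def Suc_leI card_gt_0_iff card_1_singletonE le_neq_implies_less Suc_1)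
   show ?thesis
   proof (cases "\<exists>B\<in>P. card B \<ge> 5")
    case False
    then have "\<bar>\<Prod>B\<in>P. m B\<bar> \<le> (\<Prod>B\<in>P. C)"
     unfolding abs_prod using sub by (intro prod_mono) (auto intro!: small)
    also have "\<dots> \<le> C ^ 8 * 1" using C8[OF cardP] by simp
    also have "\<dots> \<le> C ^ 8 * (1 + y)" using y C by (intro mult_left_mono) auto
    finally show ?thesis .
   next
    case True
    then obtain B where B: "B \<in> P" "card B \<ge> 5" by auto
    have rest: "card B + (\<Sum>D\<in>P - {B}. card D) = 8"
     using total sum.remove[OF fin B(1), of card] by simp
    have "card D \<le> 3" if "D \<in> P - {B}" for D
     using member_le_sum[of D "P - {B}" card] that fin rest B by auto
    then have m1: "\<bar>m D\<bar> \<le> C" if "D \<in> P - {B}" for D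
     using that sub by (intro small) (fastforce+)
    have "P - {B} \<noteq> {}"
    proof
     assume "P - {B} = {}"
     then have "(\<Sum>D\<in>P - {B}. card D) = 0" by (simp only: sum.empty)
     then have "card B = 8" using rest by linarith
     then show False using n8 B by auto
    qed
    then obtain D where D: "D \<in> P - {B}" by auto
    have "card D \<le> (\<Sum>D\<in>P - {B}. card D)" using D fin by (intro member_le_sum) auto
    then have "card B \<le> 6" using two[of D] D rest by auto
    then have mB: "\<bar>m B\<bar> \<le> C * (1 + y)"
     using B sub by (intro big) auto
    have "\<bar>\<Prod>B\<in>P. m B\<bar> = \<bar>m B\<bar> * (\<Prod>D\<in>P - {B}. \<bar>m D\<bar>)"
     using prod.remove[OF fin B(1), of m] by (simp add: abs_mult abs_prod)
    also have "\<dots> \<le> C * (1 + y) * (\<Prod>D\<in>P - {B}. C)"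
     using mB m1 C y by (intro mult_mono prod_mono prod_nonneg) auto
    also have "\<dots> = C ^ card P * (1 + y)"
    proof -
     have "card P > 0" using B(1) fin by (auto simp: card_gt_0_iff)
     then have "C * C ^ (card P - 1) = C ^ card P" by (simp add: power_eq_if)
     then show ?thesis using B fin by (simp add: mult_ac)
    qed
    also have "\<dots> \<le> C ^ 8 * (1 + y)" using C8[OF cardP] y by (intro mult_right_mono) auto
    finally show ?thesis .
   qed
  qed
 qed
 have "kappa m ?S = m ?S + (\<Sum>P\<in>?PP - {{?S}}. cumw (card P) * (\<Prod>B\<in>P. m B))"
  unfolding kappa_def using fP one by (subst sum.remove[of _ "{?S}"]) (auto simp: cumw_def)
 then have "\<bar>m ?S\<bar> \<le> \<bar>kappa m ?S\<bar> + \<bar>\<Sum>P\<in>?PP - {{?S}}. cumw (card P) * (\<Prod>B\<in>P. m B)\<bar>" by linarith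
 also have "\<bar>\<Sum>P\<in>?PP - {{?S}}. cumw (card P) * (\<Prod>B\<in>P. m B)\<bar> \<le>
   (\<Sum>P\<in>?PP - {{?S}}. \<bar>cumw (card P)\<bar> * (C ^ 8 * (1 + y)))"
  using block by (intro order_trans[OF sum_abs] sum_mono) (auto simp: abs_mult intro!: mult_left_mono)
 also have "\<dots> \<le> (\<Sum>P\<in>?PP. \<bar>cumw (card P)\<bar> * (C ^ 8 * (1 + y)))"
  using fP C y by (intro sum_mono2) auto
 also have "\<dots> = (\<Sum>P\<in>?PP. \<bar>cumw (card P)\<bar>) * (C ^ 8 * (1 + y))"
  by (simp add: sum_distrib_right)
 finally show ?thesis by simp
qed

section \<open>Bessel's inequality\<close>

lemma integrable_mult_squares:
 fixes f g :: "'a => real"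
 assumes "f \<in> borel_measurable M" "g \<in> borel_measurable M"
  "integrable M (\<lambda>om. (f om)\<^sup>2)" "integrable M (\<lambda>om. (g om)\<^sup>2)"
 shows "integrable M (\<lambda>om. f om * g om)"
 proof (rule Bochner_Integration.integrable_bound)
  show "integrable M (\<lambda>om. (f om)\<^sup>2 + (g om)\<^sup>2)" using assms by simp
  show "AE om in M. norm (f om * g om) \<le> norm ((f om)\<^sup>2 + (g om)\<^sup>2)"
  proof (intro AE_I2)
   fix om
   have "2 * \<bar>f om\<bar> * \<bar>g om\<bar> \<le> (f om)\<^sup>2 + (g om)\<^sup>2"
    using sum_squares_bound[of "\<bar>f om\<bar>" "\<bar>g om\<bar>"] by auto
   moreover have "0 \<le> \<bar>f om\<bar> * \<bar>g om\<bar>" by simp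
   ultimately have "\<bar>f om\<bar> * \<bar>g om\<bar> \<le> (f om)\<^sup>2 + (g om)\<^sup>2" by linarith
   then show "norm (f om * g om) \<le> norm ((f om)\<^sup>2 + (g om)\<^sup>2)"
    unfolding real_norm_def abs_mult by (rule order_trans[OF _ abs_ge_self])
  qed
 qed (use assms in measurable)

text \<open>The square of \<open>K * Z\<close> minus the combination of the \<open>F t\<close> with
  coefficients \<open>a t\<close> has nonnegative expectation, where \<open>a t\<close> is the inner
  product of \<open>F t\<close> and \<open>Z\<close>. Its quadratic term is a Gram form, dominated
  through the row sums in \<open>schur\<close> by \<open>K\<close> times the sum of squares.\<close>

lemma (in prob_space) bessel:
 fixes F :: "'t => 'a => real" and Z :: "'a => real"
 assumes A: "finite A" and K: "K > 0"
  and F: "\<And>t. t \<in> A ==> F t \<in> borel_measurable M" "\<And>t. t \<in> A ==> integrable M (\<lambda>om. (F t om)\<^sup>2)"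
  and Z: "Z \<in> borel_measurable M" "integrable M (\<lambda>om. (Z om)\<^sup>2)"
  and schur: "\<And>t. t \<in> A ==> (\<Sum>t'\<in>A. \<bar>\<E> (\<lambda>om. F t om * F t' om)\<bar>) \<le> K"
 shows "(\<Sum>t\<in>A. (\<E> (\<lambda>om. F t om * Z om))\<^sup>2) \<le> K * \<E> (\<lambda>om. (Z om)\<^sup>2)"
proof -
 define a where "a t = \<E> (\<lambda>om. F t om * Z om)" for t
 define c where "c t t' = \<E> (\<lambda>om. F t om * F t' om)" for t t'
 define S where "S = (\<Sum>t\<in>A. (a t)\<^sup>2)"
 have FZ: "integrable M (\<lambda>om. F t om * Z om)" if "t \<in> A" for t using F Z that by (intro integrable_mult_squares) auto
 have FF: "integrable M (\<lambda>om. F t om * F t' om)" if "t \<in> A" "t' \<in> A" for t t'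
  using F that by (intro integrable_mult_squares) auto
 have HH: "(\<Sum>t\<in>A. a t * F t om)\<^sup>2 = (\<Sum>t\<in>A. \<Sum>t'\<in>A. a t * a t' * (F t om * F t' om))" for om
  unfolding power2_eq_square sum_product by (intro sum.cong refl) (simp add: mult_ac)
 have ex: "(K * Z om - (\<Sum>t\<in>A. a t * F t om))\<^sup>2 = K\<^sup>2 * (Z om)\<^sup>2
   - 2 * K * (\<Sum>t\<in>A. a t * (F t om * Z om)) + (\<Sum>t\<in>A. \<Sum>t'\<in>A. a t * a t' * (F t om * F t' om))" for om
  unfolding power2_diff HH by (simp add: power_mult_distrib sum_distrib_left mult_ac)
 have "0 \<le> \<E> (\<lambda>om. (K * Z om - (\<Sum>t\<in>A. a t * F t om))\<^sup>2)" by simp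
 also have "\<dots> = K\<^sup>2 * \<E> (\<lambda>om. (Z om)\<^sup>2) - 2 * K * (\<Sum>t\<in>A. a t * a t)
   + (\<Sum>t\<in>A. \<Sum>t'\<in>A. a t * a t' * c t t')"
  unfolding ex using FZ FF Z A
  by (simp add: a_def[symmetric] c_def[symmetric])
 also have "(\<Sum>t\<in>A. a t * a t) = S" by (simp add: S_def power2_eq_square)
 also have "(\<Sum>t\<in>A. \<Sum>t'\<in>A. a t * a t' * c t t') \<le> K * S"
 proof -
  have csym: "c t t' = c t' t" for t t' by (simp add: c_def mult.commute)
  \<comment> \<open>Schur's test: \<open>a t * a t'\<close> is split by the arithmetic-geometric
    mean, and the symmetry of \<open>c\<close> reduces both halves to row sums.\<close>
  have "(\<Sum>t\<in>A. \<Sum>t'\<in>A. a t * a t' * c t t') \<le>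
    (\<Sum>t\<in>A. \<Sum>t'\<in>A. (a t)\<^sup>2 * \<bar>c t t'\<bar> / 2 + (a t')\<^sup>2 * \<bar>c t t'\<bar> / 2)"
  proof (intro sum_mono)
   fix t t'
   have "2 * \<bar>a t\<bar> * \<bar>a t'\<bar> \<le> (a t)\<^sup>2 + (a t')\<^sup>2"
    using sum_squares_bound[of "\<bar>a t\<bar>" "\<bar>a t'\<bar>"] by auto
   then have "(2 * \<bar>a t\<bar> * \<bar>a t'\<bar>) * \<bar>c t t'\<bar> \<le> ((a t)\<^sup>2 + (a t')\<^sup>2) * \<bar>c t t'\<bar>"
    by (intro mult_right_mono) auto
   moreover have "a t * a t' * c t t' \<le> \<bar>a t\<bar> * \<bar>a t'\<bar> * \<bar>c t t'\<bar>"
    by (metis abs_ge_self abs_mult)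
   ultimately show "a t * a t' * c t t' \<le> (a t)\<^sup>2 * \<bar>c t t'\<bar> / 2 + (a t')\<^sup>2 * \<bar>c t t'\<bar> / 2"
    by (simp add: algebra_simps)
  qed
  also have "\<dots> = (\<Sum>t\<in>A. \<Sum>t'\<in>A. (a t)\<^sup>2 * \<bar>c t t'\<bar>)"
  proof -
   have "(\<Sum>t\<in>A. \<Sum>t'\<in>A. (a t')\<^sup>2 * \<bar>c t t'\<bar> / 2) = (\<Sum>t\<in>A. \<Sum>t'\<in>A. (a t)\<^sup>2 * \<bar>c t t'\<bar> / 2)"
    by (subst sum.swap) (simp add: csym)
   then show ?thesis by (simp add: sum.distrib sum_divide_distrib[symmetric])
  qed
  also have "\<dots> \<le> (\<Sum>t\<in>A. (a t)\<^sup>2 * K)"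
   using schur by (auto simp: sum_distrib_left[symmetric] c_def intro!: sum_mono mult_left_mono)
  also have "\<dots> = K * S" by (simp add: S_def sum_distrib_left mult.commute)
  finally show ?thesis .
 qed
 finally have "K * S \<le> K * (K * \<E> (\<lambda>om. (Z om)\<^sup>2))"
  by (simp add: power2_eq_square algebra_simps)
 then show ?thesis using K by (simp add: S_def a_def)
qed

context spec_process
begin

section \<open>Uniform moment bounds\<close>

lemma mom_multilinear:
 assumes S: "finite S" "card S \<le> 8" and A: "finite A"
  and Y: "\<And>i u. i \<in> S ==> u \<in> A ==> rv8 (Y i u)"
  and D: "\<And>i. i \<in> S ==> D i = (\<lambda>om. \<Sum>u\<in>A. c i u * Y i u om)"
 shows "mom D S = (\<Sum>u\<in>PiE S (\<lambda>_. A). (\<Prod>i\<in>S. c i (u i)) * mom (\<lambda>i. Y i (u i)) S)"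
proof -
 have "(\<Prod>i\<in>S. D i om) = (\<Sum>u\<in>PiE S (\<lambda>_. A). (\<Prod>i\<in>S. c i (u i)) * (\<Prod>i\<in>S. Y i (u i) om))" for om
  using S(1) A D by (simp add: prod_sum_PiE prod.distrib)
 moreover have "integrable M (\<lambda>om. \<Prod>i\<in>S. Y i (u i) om)" if "u \<in> PiE S (\<lambda>_. A)" for u
  using S Y that by (intro rv8_prod_integrable) (auto simp: PiE_def Pi_def)
 ultimately show ?thesis unfolding mom_def by (simp add: Bochner_Integration.integral_sum)
qed

lemma mom_lin_shift:
 assumes "finite S" "card S \<le> 8"
 shows "mom (\<lambda>i. lin (w i) b (\<tau> i + h)) S = mom (\<lambda>i. lin (w i) b (\<tau> i)) S"
proof -
 have ml: "mom (\<lambda>i. lin (w i) b (\<sigma> i)) S = (\<Sum>u\<in>PiE S (\<lambda>_. {1..b}). (\<Prod>i\<in>S. w i (u i) / sqrt b) *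
   mom (\<lambda>i. X (int (\<sigma> i) + int (u i) - 1)) S)" for \<sigma>
  using assms by (intro mom_multilinear) (auto simp: rv8_X lin_alt)
 have "mom (\<lambda>i. X (int (\<tau> i + h) + int (u i) - 1)) S = mom (\<lambda>i. X (int (\<tau> i) + int (u i) - 1)) S" for u
  using mom_shift[OF assms(1), of "\<lambda>i. int (\<tau> i) + int (u i) - 1" "int h"]
  by (simp add: algebra_simps)
 then show ?thesis unfolding ml by simp
qed

lemma X_integrable: "integrable M (X t)"
 using rv8_pow_integrable[OF rv8_X, of 1] by simp

lemma lin_mean: "\<E> (lin w b t) = 0"
 unfolding lin_alt using X_integrable X_mean by (subst Bochner_Integration.integral_sum) auto

lemma mom_single: "mom (\<lambda>i. lin (w i) b (\<tau> i)) {i} = 0"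
 by (simp add: mom_def lin_mean)

lemma mom_X_single: "mom (\<lambda>i. X (a i)) {i} = 0"
 by (simp add: mom_def X_mean)

lemma cum_pair: "cum M [X 0, X h] = autocov M X h"
proof -
 have "cum M [X 0, X h] = cumX (\<lambda>i. [0,h] ! i) {..<2}"
  using cum_eq_cumX[of "[0,h]"] by (simp add: numeral_2_eq_2)
 also have "{..<2::nat} = {0, 1}" by auto
 also have "cumX (\<lambda>i. [0,h] ! i) {0,1} = mom (\<lambda>i. X ([0,h] ! i)) {0, 1}"
  unfolding cumX_def by (intro kappa2) (auto simp: mom_X_single prob_space)
 also have "\<dots> = autocov M X h" by (simp add: mom_def autocov_def X_mean)
 finally show ?thesis .
qed

lemma autocov_mom: "mom (\<lambda>i. X (if i = 0 then s else t)) {0, 1::nat} = autocov M X (t - s)"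
proof -
 have "mom (\<lambda>i. X (if i = 0 then s else t)) {0, 1::nat} = mom (\<lambda>i. X ((if i = 0 then 0 else t - s) + s)) {0, 1::nat}"
  by (intro mom_cong) auto
 also have "\<dots> = mom (\<lambda>i. X (if i = 0 then 0 else t - s)) {0, 1::nat}" by (rule mom_shift) simp
 also have "\<dots> = autocov M X (t - s)" by (simp add: mom_def autocov_def X_mean)
 finally show ?thesis .
qed

lemma expectation_XX: "\<E> (\<lambda>om. X s om * X t om) = autocov M X (t - s)"
 using autocov_mom[of s t] by (simp add: mom_def)

lemma acov_abs: "(\<lambda>h. \<bar>autocov M X h\<bar>) summable_on UNIV"
 by (rule summable_on_comparison_test[OF acov]) (auto simp: algebra_simps)

lemma cumsummable2: "cumsummable 2"
proof -
 have "bij_betw (\<lambda>h. [h]) UNIV {hs::int list. length hs = 1}"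
  by (intro bij_betwI[where g = hd]) (auto simp: length_Suc_conv)
 from summable_on_reindex_bij_betw[OF this, of "\<lambda>hs. \<bar>cum M (map X (0 # hs))\<bar>"]
 show ?thesis using acov_abs by (simp add: cumsummable_def cum_pair)
qed

lemma cumsummable4: "cumsummable 4"
proof -
 have "bij_betw (\<lambda>(h1,h2,h3). [h1,h2,h3]) UNIV {hs::int list. length hs = 3}"
  by (intro bij_betwI[where g = "\<lambda>hs. (hs ! 0, hs ! 1, hs ! 2)"])
   (auto simp: length_Suc_conv numeral_3_eq_3)
 from summable_on_reindex_bij_betw[OF this, of "\<lambda>hs. \<bar>cum M (map X (0 # hs))\<bar>"]
 show ?thesis using cum4 by (simp add: cumsummable_def case_prod_unfold)
qed

lemma cumsummable8: "cumsummable 8"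
 using cum8 by (simp add: cumsummable_def)

lemma lin2_bound:
 assumes w: "\<And>u. \<bar>w u\<bar> \<le> 1" "\<And>u. \<bar>w' u\<bar> \<le> 1" and b: "b \<ge> 1"
 shows "\<bar>\<E> (\<lambda>om. lin w b t om * lin w' b t om)\<bar> \<le> cumbound 2"
proof -
 let ?m = "mom (\<lambda>i::nat. lin (if i = 0 then w else w') b t)"
 have "kappa ?m {0,1} = ?m {0,1}" by (intro kappa2) (auto simp: mom_def lin_mean prob_space)
 moreover have "{..<2::nat} = {0,1}" by auto
 moreover have "\<bar>kappa ?m {..<2}\<bar> \<le> (1 / sqrt b) ^ 2 * (real b * cumbound 2)"
  using w b by (intro kappa_lin_le cumsummable2) auto
 ultimately show ?thesis using b by (simp add: mom_def power_divide)
qed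

lemma schur2:
 assumes w: "\<And>u. \<bar>w u\<bar> \<le> 1" "\<And>u. \<bar>w' u\<bar> \<le> 1" and b: "b \<ge> 1"
 shows "(\<Sum>s=1..N. \<bar>\<E> (\<lambda>om. lin w b t om * lin w' b s om)\<bar>) \<le> b * cumbound 2"
proof -
 let ?m = "\<lambda>s. mom (\<lambda>i::nat. lin (if i = 0 then w else w') b (if i \<in> {0} then t else s))"
 have "kappa (?m s) {0,1} = ?m s {0,1}" for s by (intro kappa2) (auto simp: mom_def lin_mean prob_space)
 moreover have "?m s {0,1} = \<E> (\<lambda>om. lin w b t om * lin w' b s om)" for s by (simp add: mom_def)
 moreover have "{..<2::nat} = {0,1}" by auto
 moreover have "(\<Sum>s=1..N. \<bar>kappa (?m s) {..<2}\<bar>) \<le> (1 / sqrt b) ^ 2 * ((real b)\<^sup>2 * cumbound 2)"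
  using w b by (intro sum_kappa_lin_le cumsummable2) auto
 ultimately show ?thesis using b by (simp add: power_divide power2_eq_square)
qed

text \<open>A constant fixed once by choice, so that all later bounds share it; its existence is
  \<open>lin8_bound_ex\<close>.\<close>

definition mom8 :: real where
 "mom8 = (SOME C. C \<ge> 0 \<and> (\<forall>w b t. (\<forall>u. \<bar>w u\<bar> \<le> 1) \<longrightarrow> b \<ge> 1 \<longrightarrow> \<E> (\<lambda>om. lin w b t om ^ 8) \<le> C))"

lemma lin4_bound:
 assumes w: "\<And>u. \<bar>w u\<bar> \<le> 1" and b: "b \<ge> 1"
 shows "\<E> (\<lambda>om. lin w b t om ^ 4) \<le> cumbound 4 + 3 * (cumbound 2)\<^sup>2"
proof -
 let ?m = "mom (\<lambda>i::nat. lin w b t)"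
 have S: "{..<4::nat} = {0,1,2,3}" by auto
 have le: "\<bar>kappa ?m {..<4}\<bar> \<le> (1 / sqrt b) ^ 4 * (real b * cumbound 4)"
  using w b by (intro kappa_lin_le cumsummable4) auto
 have "(1 / sqrt b) ^ 4 * (real b * cumbound 4) = (1 / b) * cumbound 4"
 proof -
  have "(1 / sqrt b) ^ 4 = ((1 / sqrt b)\<^sup>2)\<^sup>2" by simp
  then show ?thesis using b by (simp add: power_divide) (simp add: power2_eq_square)
 qed
 also have "\<dots> \<le> 1 * cumbound 4" using b cumbound_nonneg by (intro mult_right_mono) auto
 finally have k: "\<bar>kappa ?m {..<4}\<bar> \<le> cumbound 4" using le by simp
 have p: "?m {i,j} \<le> cumbound 2 \<and> ?m {i,j} \<ge> 0" if "i \<noteq> j" for i j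
  using lin2_bound[OF w w b] that by (auto simp: mom_def abs_le_iff)
 have pp: "?m {i,j} * ?m {k,l} \<le> (cumbound 2)\<^sup>2" if "i \<noteq> j" "k \<noteq> l" for i j k l
  unfolding power2_eq_square using p[OF that(1)] p[OF that(2)] by (intro mult_mono) auto
 have "?m {0,1,2,3} = kappa ?m {0,1,2,3} + ?m {0,1} * ?m {2,3} + ?m {0,2} * ?m {1,3} + ?m {0,3} * ?m {1,2}"
  by (intro kappa4) (auto simp: mom_def lin_mean prob_space)
 also have "\<dots> \<le> cumbound 4 + 3 * (cumbound 2)\<^sup>2"
  using k pp[of 0 1 2 3] pp[of 0 2 1 3] pp[of 0 3 1 2] by (simp add: S)
 finally show ?thesis by (simp add: mom_def eval_nat_numeral mult_ac)
qed

text \<open>Let \<open>y\<close> be the square root of the eighth moment. In the expansion over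
  partitions only moments of order five and six are not bounded outright, and interpolation makes
  them linear in \<open>y\<close>. The result
  \<open>y^2 \<le> cumbound 8 + W * G^8 * (1 + y)\<close> has a quadratic left and a linear right
  side, which bounds \<open>y\<close>.\<close>

lemma lin8_bound_ex:
 "\<exists>C\<ge>0. \<forall>w b t. (\<forall>u. \<bar>w u\<bar> \<le> 1) \<longrightarrow> b \<ge> 1 \<longrightarrow> \<E> (\<lambda>om. lin w b t om ^ 8) \<le> C"
proof -
 define W where "W = (\<Sum>P | partition_on {..<8::nat} P. \<bar>cumw (card P)\<bar>)"
 define G where "G = 1 + cumbound 2 + (cumbound 4 + 3 * (cumbound 2)\<^sup>2)"
 define H where "H = cumbound 8 + 2 * (W * G ^ 8)"
 have nn: "cumbound 2 \<ge> 0" "cumbound 4 \<ge> 0" "cumbound 8 \<ge> 0" by (auto intro: cumbound_nonneg)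
 have W: "W \<ge> 0" unfolding W_def by (intro sum_nonneg) simp
 have G: "G \<ge> 1" using nn by (simp add: G_def)
 have G2: "cumbound 2 \<le> G" and G4: "cumbound 4 + 3 * (cumbound 2)\<^sup>2 \<le> G"
  unfolding G_def using nn zero_le_power2[of "cumbound 2"] by linarith+
 have H: "H \<ge> 0" using nn W G by (simp add: H_def)
 show ?thesis
 proof (intro exI[of _ "(1 + H)\<^sup>2"] conjI allI impI)
  fix w :: "nat => real" and b t assume w: "\<forall>u. \<bar>w u\<bar> \<le> 1" and b: "b \<ge> (1::nat)"
  define Y where "Y = lin w b t"
  have rv: "rv8 Y" unfolding Y_def by (rule rv8_lin)
  have int: "integrable M (\<lambda>om. Y om ^ n)" if "n \<le> 8" for n
   using rv8_pow_integrable[OF rv that] .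
  have mon: "\<E> (\<lambda>om. f om) \<le> \<E> g" if "integrable M f" "integrable M g" "\<And>om. f om \<le> g om"
   for f g :: "'a => real"
   by (rule integral_mono[OF that(1,2)]) (rule that(3))
  define y where "y = sqrt (\<E> (\<lambda>om. Y om ^ 8))"
  have m8: "\<E> (\<lambda>om. Y om ^ 8) \<ge> 0" by simp
  have y: "y \<ge> 0" "y\<^sup>2 = \<E> (\<lambda>om. Y om ^ 8)" using m8 by (auto simp: y_def)
  have g2: "\<E> (\<lambda>om. Y om ^ 2) \<le> cumbound 2"
   using lin2_bound[of w w b t] w b by (simp add: Y_def power2_eq_square abs_le_iff)
  have g4: "\<E> (\<lambda>om. Y om ^ 4) \<le> cumbound 4 + 3 * (cumbound 2)\<^sup>2"
   using lin4_bound[of w b t] w b by (simp add: Y_def)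
  \<comment> \<open>The weight \<open>1 + y\<close> balances the interpolation: the fourth moment is
    at most \<open>G - 1\<close>, and the eighth moment \<open>y^2\<close> divided by
    \<open>1 + y\<close> is at most \<open>1 + y\<close>, for which the summand 1 in
    \<open>G\<close> leaves room.\<close>
  have g6: "\<E> (\<lambda>om. Y om ^ 6) \<le> G * (1 + y) / 2"
  proof -
   have "x ^ 6 \<le> ((1 + y) * x ^ 4 + x ^ 8 / (1 + y)) / 2" for x :: real
   proof -
    have "0 \<le> ((1 + y) * x ^ 2 - x ^ 4)\<^sup>2" by simp
    also have "\<dots> = (1 + y) * ((1 + y) * x ^ 4 + x ^ 8 / (1 + y) - 2 * x ^ 6)"
     using y(1) by (simp add: field_simps eval_nat_numeral)
    finally show ?thesis using y(1) by (simp add: zero_le_mult_iff)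
   qed
   then have "\<E> (\<lambda>om. Y om ^ 6) \<le> \<E> (\<lambda>om. ((1 + y) * Y om ^ 4 + Y om ^ 8 / (1 + y)) / 2)"
    using int by (intro mon) auto
   also have "\<dots> = ((1 + y) * \<E> (\<lambda>om. Y om ^ 4) + y\<^sup>2 / (1 + y)) / 2"
    using int by (simp add: y(2))
   also have "y\<^sup>2 / (1 + y) \<le> 1 + y"
    using y(1) by (simp add: field_simps power2_eq_square)
   also have "(1 + y) * \<E> (\<lambda>om. Y om ^ 4) \<le> (1 + y) * (G - 1)"
    using g4 y(1) nn by (intro mult_left_mono) (auto simp: G_def)
   finally show ?thesis by (simp add: algebra_simps)
  qed
  let ?m = "mom (\<lambda>i::nat. Y)"
  have mm: "?m B = \<E> (\<lambda>om. Y om ^ card B)" for B by (simp add: mom_def)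
  \<comment> \<open>An odd moment is bounded by the mean of its even neighbours. Order seven never
    occurs, since it would leave a singleton block.\<close>
  have odd: "\<bar>x ^ Suc (2 * n)\<bar> \<le> (x ^ (2 * n) + x ^ (2 * n + 2)) / 2" for x :: real and n
  proof -
   have "2 * \<bar>x\<bar> \<le> 1 + x\<^sup>2" using sum_squares_bound[of 1 "\<bar>x\<bar>"] by simp
   then have "2 * \<bar>x\<bar> * x ^ (2 * n) \<le> (1 + x\<^sup>2) * x ^ (2 * n)" by (intro mult_right_mono) auto
   moreover have "\<bar>x ^ Suc (2 * n)\<bar> = \<bar>x\<bar> * x ^ (2 * n)" by (simp add: abs_mult)
   moreover have "(1 + x\<^sup>2) * x ^ (2 * n) = x ^ (2 * n) + x ^ (2 * n + 2)"
    by (simp add: algebra_simps power2_eq_square)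
   ultimately show ?thesis by (simp add: mult.assoc)
  qed
  have oddE: "\<bar>\<E> (\<lambda>om. Y om ^ Suc (2 * n))\<bar> \<le>
    (\<E> (\<lambda>om. Y om ^ (2 * n)) + \<E> (\<lambda>om. Y om ^ (2 * n + 2))) / 2" if "2 * n + 2 \<le> 8" for n
  proof -
   have "\<bar>\<E> (\<lambda>om. Y om ^ Suc (2 * n))\<bar> \<le> \<E> (\<lambda>om. \<bar>Y om ^ Suc (2 * n)\<bar>)"
    by (rule integral_abs_bound)
   also have "\<dots> \<le> \<E> (\<lambda>om. (Y om ^ (2 * n) + Y om ^ (2 * n + 2)) / 2)"
    using that odd by (intro mon integrable_abs int Bochner_Integration.integrable_divide
      Bochner_Integration.integrable_add) auto
   also have "\<dots> = (\<E> (\<lambda>om. Y om ^ (2 * n)) + \<E> (\<lambda>om. Y om ^ (2 * n + 2))) / 2"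
    using Bochner_Integration.integral_add[OF int[of "2 * n"] int[of "2 * n + 2"]] that by simp
   finally show ?thesis .
  qed
  have "\<bar>?m {..<8}\<bar> \<le> \<bar>kappa ?m {..<8}\<bar> + W * (G ^ 8 * (1 + y))"
   unfolding W_def
  proof (rule kappa8_bound[OF y(1) G])
   show "?m {i} = 0" for i by (simp add: mom_def Y_def lin_mean)
   fix B :: "nat set"
   show "\<bar>?m B\<bar> \<le> G" if c: "card B \<le> 4"
   proof -
    have "card B = 0 \<or> card B = 1 \<or> card B = 2 \<or> card B = 3 \<or> card B = 4"
     using c by linarith
    then show ?thesis
    proof (elim disjE)
     assume "card B = 0" then show ?thesis using G by (simp add: mm prob_space)
    next
     assume "card B = 1" then show ?thesis using G lin_mean[of w b t] by (simp only: mm Y_def[symmetric]) simp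
    next
     assume "card B = 2" then show ?thesis using g2 G2 by (simp add: mm)
    next
     assume "card B = 3" then show ?thesis using oddE[of 1] g2 g4 G2 G4
      by (simp add: mm eval_nat_numeral)
    next
     assume "card B = 4" then show ?thesis using g4 G4 by (simp add: mm)
    qed
   qed
   show "\<bar>?m B\<bar> \<le> G * (1 + y)" if "card B \<in> {5, 6}"
   proof -
    have Gy: "G \<le> G * (1 + y)" "0 \<le> G * (1 + y)" using G y(1) by (auto simp: algebra_simps)
    have g4G: "\<E> (\<lambda>om. Y om ^ 4) \<le> G" using g4 G4 by simp
    have g6': "\<E> (\<lambda>om. Y om ^ 6) \<ge> 0" by simp
    show ?thesis
    proof (cases "card B = 5")
     case True
     then show ?thesis using oddE[of 2] g4G g6 Gy by (simp add: mm eval_nat_numeral)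
    next
     case False
     then have "card B = 6" using that by simp
     then show ?thesis using g6 g6' Gy by (simp add: mm)
    qed
   qed
  qed
  moreover have "\<bar>kappa ?m {..<8}\<bar> \<le> cumbound 8"
  proof -
   have "\<bar>kappa ?m {..<8}\<bar> \<le> (1 / sqrt b) ^ 8 * (real b * cumbound 8)"
    unfolding Y_def using w b by (intro kappa_lin_le cumsummable8) auto
   also have "(1 / sqrt b) ^ 8 * (real b * cumbound 8) = (1 / real b ^ 3) * cumbound 8"
   proof -
    have "(1 / sqrt b) ^ 8 = ((1 / sqrt b)\<^sup>2) ^ 4" by (simp flip: power_mult)
    also have "\<dots> = 1 / real b ^ 4" by (simp add: power_divide)
    finally show ?thesis using b by (simp add: eval_nat_numeral)
   qed
   also have "\<dots> \<le> 1 * cumbound 8" using b nn by (intro mult_right_mono) (auto simp: divide_le_eq)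
   finally show ?thesis by simp
  qed
  ultimately have le: "y\<^sup>2 \<le> cumbound 8 + W * G ^ 8 * (1 + y)" using y(2) by (simp add: mm mult_ac)
  \<comment> \<open>If \<open>y > 1\<close>, the constants on the right of \<open>le\<close> may be
    multiplied by \<open>y\<close>, which gives \<open>H * y\<close>; then one factor
    \<open>y\<close> cancels.\<close>
  have "y \<le> 1 + H"
  proof (cases "y \<le> 1")
   case False
   have "y\<^sup>2 \<le> cumbound 8 * y + W * G ^ 8 * (y + y)"
   proof (intro order_trans[OF le] add_mono mult_left_mono)
    show "cumbound 8 \<le> cumbound 8 * y"
     using mult_left_mono[of 1 y "cumbound 8"] False nn by simp
   qed (use False W G in auto)
   also have "\<dots> = H * y" by (simp add: H_def algebra_simps)
   finally have "y * y \<le> H * y" by (simp add: power2_eq_square)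
   then show ?thesis using False by simp
  qed (use H in simp)
  then have "y\<^sup>2 \<le> (1 + H)\<^sup>2" using y(1) by (intro power_mono)
  then show "\<E> (\<lambda>om. lin w b t om ^ 8) \<le> (1 + H)\<^sup>2" using y(2) by (simp add: Y_def)
 qed simp
qed

lemma mom8_nonneg: "mom8 \<ge> 0"
 and lin8_bound: "(\<And>u. \<bar>w u\<bar> \<le> 1) ==> b \<ge> 1 ==> \<E> (\<lambda>om. lin w b t om ^ 8) \<le> mom8"
 using someI_ex[OF lin8_bound_ex] unfolding mom8_def by blast+

lemma prod_lin_bound:
 assumes S: "finite S" "card S \<le> 8" and w: "\<And>i u. \<bar>w i u\<bar> \<le> 1" and b: "b \<ge> 1"
 shows "\<E> (\<lambda>om. \<bar>\<Prod>i\<in>S. lin (w i) b (\<tau> i) om\<bar>) \<le> 1 + 8 * mom8"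
proof -
 have "\<E> (\<lambda>om. \<bar>\<Prod>i\<in>S. lin (w i) b (\<tau> i) om\<bar>) \<le>
   \<E> (\<lambda>om. 1 + (\<Sum>i\<in>S. lin (w i) b (\<tau> i) om ^ 8))"
  using S rv8_lin by (intro integral_mono abs_prod_le_sum_pow8 integrable_abs rv8_prod_integrable) (auto simp: rv8_def)
 also have "\<dots> = 1 + (\<Sum>i\<in>S. \<E> (\<lambda>om. lin (w i) b (\<tau> i) om ^ 8))"
  using rv8_lin by (simp add: rv8_def prob_space)
 also have "\<dots> \<le> 1 + (\<Sum>i\<in>S. mom8)" using w b by (intro add_left_mono sum_mono lin8_bound) auto
 also have "\<dots> \<le> 1 + 8 * mom8" using S mom8_nonneg by (simp add: mult_right_mono)
 finally show ?thesis .
qed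

lemma abs_mom_bound:
 assumes S: "finite S" "card S \<le> 8" and w: "\<And>i u. \<bar>w i u\<bar> \<le> 1" and b: "b \<ge> 1"
 shows "\<bar>mom (\<lambda>i. lin (w i) b (\<tau> i)) S\<bar> \<le> 1 + 8 * mom8"
 unfolding mom_def
 by (rule order_trans[OF integral_abs_bound prod_lin_bound[OF assms]])

lemma prod_lin_square:
 assumes S: "finite S" "card S \<le> 4" and w: "\<And>i u. \<bar>w i u\<bar> \<le> 1" and b: "b \<ge> 1"
 shows "integrable M (\<lambda>om. (\<Prod>i\<in>S. lin (w i) b (\<tau> i) om)\<^sup>2)"
  and "\<E> (\<lambda>om. (\<Prod>i\<in>S. lin (w i) b (\<tau> i) om)\<^sup>2) \<le> 1 + 8 * mom8"
proof -
 \<comment> \<open>Squaring doubles the index set: at most four factors become at most eight, to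
   which the eighth-moment bound applies.\<close>
 have eq: "(\<Prod>i\<in>S. lin (w i) b (\<tau> i) om)\<^sup>2 = (\<Prod>p\<in>S \<times> {0,1::nat}. lin (w (fst p)) b (\<tau> (fst p)) om)" for om
 proof -
  have "(\<Prod>p\<in>S \<times> {0,1::nat}. lin (w (fst p)) b (\<tau> (fst p)) om) =
    (\<Prod>i\<in>S. \<Prod>j\<in>{0,1::nat}. lin (w i) b (\<tau> i) om)"
   unfolding prod.cartesian_product by (simp add: case_prod_unfold)
  then show ?thesis by (simp add: power2_eq_square prod.distrib)
 qed
 have T: "finite (S \<times> {0,1::nat})" "card (S \<times> {0,1::nat}) \<le> 8" using S by (auto simp: card_cartesian_product)
 show int: "integrable M (\<lambda>om. (\<Prod>i\<in>S. lin (w i) b (\<tau> i) om)\<^sup>2)"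
  unfolding eq using T by (intro rv8_prod_integrable rv8_lin)
 have "\<E> (\<lambda>om. \<bar>\<Prod>p\<in>S \<times> {0,1::nat}. lin (w (fst p)) b (\<tau> (fst p)) om\<bar>) \<le> 1 + 8 * mom8"
  using T w b by (intro prod_lin_bound)
 then show "\<E> (\<lambda>om. (\<Prod>i\<in>S. lin (w i) b (\<tau> i) om)\<^sup>2) \<le> 1 + 8 * mom8"
  unfolding eq[symmetric] by simp
qed

text \<open>By \<open>kappa4\<close> the covariance is the fourth cumulant plus the two pairings
  across the blocks. In each pairing one factor is summed over \<open>s\<close> by
  \<open>schur2\<close>, the other is merely bounded.\<close>

lemma schur4:
 fixes w :: "nat => nat => real"
 assumes w: "\<And>i u. \<bar>w i u\<bar> \<le> 1" and b: "b \<ge> 1"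
 shows "(\<Sum>s=1..N. \<bar>\<E> (\<lambda>om. lin (w 0) b t om * lin (w 1) b t om * (lin (w 2) b s om * lin (w 3) b s om))
   - \<E> (\<lambda>om. lin (w 0) b t om * lin (w 1) b t om) * \<E> (\<lambda>om. lin (w 2) b s om * lin (w 3) b s om)\<bar>)
  \<le> b * (cumbound 4 + 2 * (cumbound 2 * (1 + 8 * mom8)))"
proof -
 let ?m = "\<lambda>s. mom (\<lambda>i::nat. lin (w i) b (if i \<in> {0,1} then t else s))"
 have S: "{..<4::nat} = {0,1,2,3}" by auto
 have k: "(\<Sum>s=1..N. \<bar>kappa (?m s) {..<4}\<bar>) \<le> (1 / sqrt b) ^ 4 * ((real b)\<^sup>2 * cumbound 4)"
  using w b by (intro sum_kappa_lin_le cumsummable4) auto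
 have "(1 / sqrt b) ^ 4 = ((1 / sqrt b)\<^sup>2)\<^sup>2" by simp
 then have "(1 / sqrt b) ^ 4 * ((real b)\<^sup>2 * cumbound 4) = cumbound 4" using b by (simp add: power_divide)
 also have "\<dots> \<le> b * cumbound 4" using b cumbound_nonneg[of 4] by (simp add: mult_le_cancel_right1)
 finally have k': "(\<Sum>s=1..N. \<bar>kappa (?m s) {..<4}\<bar>) \<le> b * cumbound 4" using k by linarith
 have tm: "\<bar>?m s {0,1,2,3} - ?m s {0,1} * ?m s {2,3}\<bar> \<le> \<bar>kappa (?m s) {..<4}\<bar>
   + \<bar>?m s {0,2}\<bar> * (1 + 8 * mom8) + \<bar>?m s {0,3}\<bar> * (1 + 8 * mom8)" for s
 proof -
  have e: "?m s {0,1,2,3} = kappa (?m s) {0,1,2,3} + ?m s {0,1} * ?m s {2,3} + ?m s {0,2} * ?m s {1,3} + ?m s {0,3} * ?m s {1,2}"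
   by (intro kappa4) (auto simp: mom_def lin_mean prob_space)
  have "\<bar>?m s {1,3}\<bar> \<le> 1 + 8 * mom8" "\<bar>?m s {1,2}\<bar> \<le> 1 + 8 * mom8"
   using w b by (intro abs_mom_bound; simp)+
  then have "\<bar>?m s {0,2} * ?m s {1,3}\<bar> \<le> \<bar>?m s {0,2}\<bar> * (1 + 8 * mom8)"
    "\<bar>?m s {0,3} * ?m s {1,2}\<bar> \<le> \<bar>?m s {0,3}\<bar> * (1 + 8 * mom8)"
   by (auto simp only: abs_mult intro!: mult_left_mono)
  then show ?thesis unfolding e S by linarith
 qed
 have "(\<Sum>s=1..N. \<bar>?m s {0,1,2,3} - ?m s {0,1} * ?m s {2,3}\<bar>) \<le>
  (\<Sum>s=1..N. \<bar>kappa (?m s) {..<4}\<bar> + \<bar>?m s {0,2}\<bar> * (1 + 8 * mom8) + \<bar>?m s {0,3}\<bar> * (1 + 8 * mom8))"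
  by (intro sum_mono tm)
 also have "\<dots> = (\<Sum>s=1..N. \<bar>kappa (?m s) {..<4}\<bar>) + (\<Sum>s=1..N. \<bar>?m s {0,2}\<bar>) * (1 + 8 * mom8)
   + (\<Sum>s=1..N. \<bar>?m s {0,3}\<bar>) * (1 + 8 * mom8)"
  by (simp add: sum.distrib sum_distrib_right)
 also have "\<dots> \<le> b * cumbound 4 + b * cumbound 2 * (1 + 8 * mom8) + b * cumbound 2 * (1 + 8 * mom8)"
  using schur2[of "w 0" "w 2" b t N] schur2[of "w 0" "w 3" b t N] w b mom8_nonneg k'
  by (intro add_mono mult_right_mono) (auto simp: mom_def)
 also have "\<dots> = b * (cumbound 4 + 2 * (cumbound 2 * (1 + 8 * mom8)))" by (simp add: algebra_simps)
 finally show ?thesis by (simp add: mom_def mult.assoc)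
qed

end

section \<open>Covariance kernels of block statistics\<close>

type_synonym kernel = "nat => (nat => nat => real) => nat => nat => real"

text \<open>The constants in the classes of kernels below are uniform over all designs. Weights that
  sum to zero are what trigonometric weights over full periods provide.\<close>

definition block_design :: "nat => nat => (nat => nat => real) => bool" where
 "block_design b N w \<longleftrightarrow> 1 \<le> b \<and> b \<le> N \<and> (\<forall>i u. \<bar>w i u\<bar> \<le> 1) \<and> (\<forall>i. (\<Sum>u=1..b. w i u) = 0)"

text \<open>The double sums below have \<open>N\<^sup>2\<close> terms, so a kernel of class \<open>L1k\<close> has averages of order
 \<open>b / N\<close>. For \<open>Negk\<close> only the signed sum is controlled.\<close>

definition L2k :: "kernel => bool" where
 "L2k a \<longleftrightarrow> (\<exists>C. \<forall>b N w. block_design b N w \<longrightarrow>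
   (\<Sum>t=1..N. \<Sum>s=1..N. (a b w t s)\<^sup>2) \<le> C * (real N * real b))"

definition L1k :: "kernel => bool" where
 "L1k a \<longleftrightarrow> (\<exists>C. \<forall>b N w. block_design b N w \<longrightarrow>
   (\<Sum>t=1..N. \<Sum>s=1..N. \<bar>a b w t s\<bar>) \<le> C * (real N * real b))"

definition Negk :: "kernel => bool" where
 "Negk a \<longleftrightarrow> (\<exists>C. \<forall>b N w. block_design b N w \<longrightarrow>
   \<bar>\<Sum>t=1..N. \<Sum>s=1..N. a b w t s\<bar> \<le> C * (real N * real b))"

definition Bdk :: "kernel => bool" where
 "Bdk a \<longleftrightarrow> (\<exists>C. \<forall>b N w t s. block_design b N w \<longrightarrow> \<bar>a b w t s\<bar> \<le> C)"

lemma L1k_mono: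
 assumes "L1k a" "\<And>b w t s. \<bar>a' b w t s\<bar> \<le> \<bar>a b w t s\<bar>"
 shows "L1k a'"
proof -
 obtain C where
  C: "\<And>b N w. block_design b N w ==> (\<Sum>t=1..N. \<Sum>s=1..N. \<bar>a b w t s\<bar>) \<le> C * (real N * real b)"
  using assms(1) unfolding L1k_def by blast
 have "(\<Sum>t=1..N. \<Sum>s=1..N. \<bar>a' b w t s\<bar>) \<le> (\<Sum>t=1..N. \<Sum>s=1..N. \<bar>a b w t s\<bar>)" for b N w
  by (intro sum_mono assms(2))
 then show ?thesis unfolding L1k_def using C order_trans by blast
qed

lemma L1k_add:
 assumes "L1k a" "L1k a'"
 shows "L1k (\<lambda>b w t s. a b w t s + a' b w t s)"
proof -
 obtain C C' where
  C: "\<And>b N w. block_design b N w ==> (\<Sum>t=1..N. \<Sum>s=1..N. \<bar>a b w t s\<bar>) \<le> C * (real N * real b)"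
    "\<And>b N w. block_design b N w ==> (\<Sum>t=1..N. \<Sum>s=1..N. \<bar>a' b w t s\<bar>) \<le> C' * (real N * real b)"
  using assms unfolding L1k_def by blast
 show ?thesis unfolding L1k_def
 proof (intro exI[of _ "C + C'"] allI impI)
  fix b N w assume v: "block_design b N w"
  have "(\<Sum>t=1..N. \<Sum>s=1..N. \<bar>a b w t s + a' b w t s\<bar>) \<le>
    (\<Sum>t=1..N. \<Sum>s=1..N. \<bar>a b w t s\<bar> + \<bar>a' b w t s\<bar>)"
   by (intro sum_mono abs_triangle_ineq)
  also have "\<dots> \<le> (C + C') * (real N * real b)"
   using C(1)[OF v] C(2)[OF v] by (simp add: sum.distrib algebra_simps)
  finally show "(\<Sum>t=1..N. \<Sum>s=1..N. \<bar>a b w t s + a' b w t s\<bar>) \<le> (C + C') * (real N * real b)" .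
 qed
qed

lemma L1k_zero: "L1k (\<lambda>b w t s. 0)"
 unfolding L1k_def by (intro exI[of _ 0]) simp

lemma L1k_sum: "(\<And>x. x \<in> A ==> L1k (a x)) ==> L1k (\<lambda>b w t s. \<Sum>x\<in>A. a x b w t s)"
 by (induction A rule: infinite_finite_induct) (auto intro: L1k_add L1k_zero)

lemma L1k_mult_Bdk:
 assumes "L1k a" "Bdk g"
 shows "L1k (\<lambda>b w t s. a b w t s * g b w t s)"
proof -
 obtain C G where
  C: "\<And>b N w. block_design b N w ==> (\<Sum>t=1..N. \<Sum>s=1..N. \<bar>a b w t s\<bar>) \<le> C * (real N * real b)"
  and G: "\<And>b N w t s. block_design b N w ==> \<bar>g b w t s\<bar> \<le> G"
  using assms unfolding L1k_def Bdk_def by blast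
 show ?thesis unfolding L1k_def
 proof (intro exI[of _ "C * \<bar>G\<bar>"] allI impI)
  fix b N w assume v: "block_design b N w"
  have "(\<Sum>t=1..N. \<Sum>s=1..N. \<bar>a b w t s * g b w t s\<bar>) \<le> (\<Sum>t=1..N. \<Sum>s=1..N. \<bar>a b w t s\<bar> * \<bar>G\<bar>)"
   unfolding abs_mult using order_trans[OF G[OF v] abs_ge_self] by (intro sum_mono mult_left_mono) auto
  also have "\<dots> = (\<Sum>t=1..N. \<Sum>s=1..N. \<bar>a b w t s\<bar>) * \<bar>G\<bar>" by (simp add: sum_distrib_right)
  also have "\<dots> \<le> (C * (real N * real b)) * \<bar>G\<bar>" by (intro mult_right_mono C v) auto
  finally show "(\<Sum>t=1..N. \<Sum>s=1..N. \<bar>a b w t s * g b w t s\<bar>) \<le> C * \<bar>G\<bar> * (real N * real b)"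
   by (simp add: mult_ac)
 qed
qed

lemma L2k_add:
 assumes "L2k a" "L2k a'"
 shows "L2k (\<lambda>b w t s. a b w t s + a' b w t s)"
proof -
 obtain C C' where
  C: "\<And>b N w. block_design b N w ==> (\<Sum>t=1..N. \<Sum>s=1..N. (a b w t s)\<^sup>2) \<le> C * (real N * real b)"
    "\<And>b N w. block_design b N w ==> (\<Sum>t=1..N. \<Sum>s=1..N. (a' b w t s)\<^sup>2) \<le> C' * (real N * real b)"
  using assms unfolding L2k_def by blast
 show ?thesis unfolding L2k_def
 proof (intro exI[of _ "2 * (C + C')"] allI impI)
  fix b N w assume v: "block_design b N w"
  have "(x + y)\<^sup>2 \<le> 2 * x\<^sup>2 + 2 * y\<^sup>2" for x y :: real
   using sum_squares_bound[of x y] by (simp add: power2_sum)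
  then have "(\<Sum>t=1..N. \<Sum>s=1..N. (a b w t s + a' b w t s)\<^sup>2) \<le>
    (\<Sum>t=1..N. \<Sum>s=1..N. 2 * (a b w t s)\<^sup>2 + 2 * (a' b w t s)\<^sup>2)"
   by (intro sum_mono)
  also have "\<dots> \<le> 2 * (C + C') * (real N * real b)"
   using C(1)[OF v] C(2)[OF v] by (simp add: sum.distrib sum_distrib_left[symmetric] algebra_simps)
  finally show "(\<Sum>t=1..N. \<Sum>s=1..N. (a b w t s + a' b w t s)\<^sup>2) \<le> 2 * (C + C') * (real N * real b)" .
 qed
qed

lemma L2k_zero: "L2k (\<lambda>b w t s. 0)"
 unfolding L2k_def by (intro exI[of _ 0]) simp

lemma L2k_sum: "(\<And>x. x \<in> A ==> L2k (a x)) ==> L2k (\<lambda>b w t s. \<Sum>x\<in>A. a x b w t s)"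
 by (induction A rule: infinite_finite_induct) (auto intro: L2k_add L2k_zero)

lemma L2k_mult_Bdk:
 assumes "L2k a" "Bdk g"
 shows "L2k (\<lambda>b w t s. a b w t s * g b w t s)"
proof -
 obtain C G where
  C: "\<And>b N w. block_design b N w ==> (\<Sum>t=1..N. \<Sum>s=1..N. (a b w t s)\<^sup>2) \<le> C * (real N * real b)"
  and G: "\<And>b N w t s. block_design b N w ==> \<bar>g b w t s\<bar> \<le> G"
  using assms unfolding L2k_def Bdk_def by blast
 show ?thesis unfolding L2k_def
 proof (intro exI[of _ "C * G\<^sup>2"] allI impI)
  fix b N w assume v: "block_design b N w"
  have "(g b w t s)\<^sup>2 \<le> G\<^sup>2" for t s using power_mono[OF G[OF v], of t s 2] by simp
  then have "(\<Sum>t=1..N. \<Sum>s=1..N. (a b w t s * g b w t s)\<^sup>2) \<le> (\<Sum>t=1..N. \<Sum>s=1..N. (a b w t s)\<^sup>2 * G\<^sup>2)"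
   unfolding power_mult_distrib by (intro sum_mono mult_left_mono) auto
  also have "\<dots> = (\<Sum>t=1..N. \<Sum>s=1..N. (a b w t s)\<^sup>2) * G\<^sup>2" by (simp add: sum_distrib_right)
  also have "\<dots> \<le> (C * (real N * real b)) * G\<^sup>2" by (intro mult_right_mono C v) auto
  finally show "(\<Sum>t=1..N. \<Sum>s=1..N. (a b w t s * g b w t s)\<^sup>2) \<le> C * G\<^sup>2 * (real N * real b)"
   by (simp add: mult_ac)
 qed
qed

lemma L1k_L2k_mult:
 assumes "L2k a" "L2k a'"
 shows "L1k (\<lambda>b w t s. a b w t s * a' b w t s)"
proof -
 obtain C C' where
  C: "\<And>b N w. block_design b N w ==> (\<Sum>t=1..N. \<Sum>s=1..N. (a b w t s)\<^sup>2) \<le> C * (real N * real b)"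
    "\<And>b N w. block_design b N w ==> (\<Sum>t=1..N. \<Sum>s=1..N. (a' b w t s)\<^sup>2) \<le> C' * (real N * real b)"
  using assms unfolding L2k_def by blast
 show ?thesis unfolding L1k_def
 proof (intro exI[of _ "C + C'"] allI impI)
  fix b N w assume v: "block_design b N w"
  have "\<bar>x * y\<bar> \<le> x\<^sup>2 + y\<^sup>2" for x y :: real
  proof -
   have "2 * (\<bar>x\<bar> * \<bar>y\<bar>) \<le> x\<^sup>2 + y\<^sup>2" using sum_squares_bound[of "\<bar>x\<bar>" "\<bar>y\<bar>"] by simp
   moreover have "0 \<le> \<bar>x\<bar> * \<bar>y\<bar>" by simp
   ultimately show ?thesis unfolding abs_mult by linarith
  qed
  then have "(\<Sum>t=1..N. \<Sum>s=1..N. \<bar>a b w t s * a' b w t s\<bar>) \<le>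
    (\<Sum>t=1..N. \<Sum>s=1..N. (a b w t s)\<^sup>2 + (a' b w t s)\<^sup>2)"
   by (intro sum_mono)
  also have "\<dots> \<le> (C + C') * (real N * real b)"
   using C(1)[OF v] C(2)[OF v] by (simp add: sum.distrib algebra_simps)
  finally show "(\<Sum>t=1..N. \<Sum>s=1..N. \<bar>a b w t s * a' b w t s\<bar>) \<le> (C + C') * (real N * real b)" .
 qed
qed

lemma Bdk_const: "Bdk (\<lambda>b w t s. c)"
 unfolding Bdk_def by auto

lemma Bdk_mult: "Bdk a ==> Bdk a' ==> Bdk (\<lambda>b w t s. a b w t s * a' b w t s)"
proof -
 assume "Bdk a" "Bdk a'"
 then obtain C C' where C: "\<And>b N w t s. block_design b N w ==> \<bar>a b w t s\<bar> \<le> C"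
  "\<And>b N w t s. block_design b N w ==> \<bar>a' b w t s\<bar> \<le> C'" unfolding Bdk_def by blast
 then have "\<bar>a b w t s * a' b w t s\<bar> \<le> C * C'" if "block_design b N w" for b N w t s
  unfolding abs_mult using that by (intro mult_mono) (auto intro: C order_trans[OF abs_ge_zero C(1)])
 then show ?thesis unfolding Bdk_def by blast
qed

lemma Bdk_add: "Bdk a ==> Bdk a' ==> Bdk (\<lambda>b w t s. a b w t s + a' b w t s)"
proof -
 assume "Bdk a" "Bdk a'"
 then obtain C C' where "\<And>b N w t s. block_design b N w ==> \<bar>a b w t s\<bar> \<le> C"
  "\<And>b N w t s. block_design b N w ==> \<bar>a' b w t s\<bar> \<le> C'" unfolding Bdk_def by blast
 then have "\<bar>a b w t s + a' b w t s\<bar> \<le> C + C'" if "block_design b N w" for b N w t s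
  using that by (intro order_trans[OF abs_triangle_ineq] add_mono)
 then show ?thesis unfolding Bdk_def by blast
qed

lemma Bdk_sum: "(\<And>x. x \<in> A ==> Bdk (a x)) ==> Bdk (\<lambda>b w t s. \<Sum>x\<in>A. a x b w t s)"
 by (induction A rule: infinite_finite_induct) (auto intro: Bdk_add Bdk_const)

lemma Bdk_prod: "(\<And>x. x \<in> A ==> Bdk (a x)) ==> Bdk (\<lambda>b w t s. \<Prod>x\<in>A. a x b w t s)"
 by (induction A rule: infinite_finite_induct) (auto intro: Bdk_mult Bdk_const)

lemma L1k_uminus: "L1k a ==> L1k (\<lambda>b w t s. - a b w t s)"
 by (rule L1k_mono) auto

lemma L1k_diff: "L1k a ==> L1k a' ==> L1k (\<lambda>b w t s. a b w t s - a' b w t s)"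
 using L1k_add[OF _ L1k_uminus[of a'], of a] by simp

lemma L2k_diff: "L2k a ==> L2k a' ==> L2k (\<lambda>b w t s. a b w t s - a' b w t s)"
 using L2k_add[OF _ L2k_mult_Bdk[OF _ Bdk_const[of "-1"]], of a a'] by simp

lemma Bdk_diff: "Bdk a ==> Bdk a' ==> Bdk (\<lambda>b w t s. a b w t s - a' b w t s)"
 using Bdk_add[OF _ Bdk_mult[OF Bdk_const[of "-1"]], of a a'] by simp

lemma L1k_imp_Negk: "L1k a ==> Negk a"
proof -
 assume "L1k a"
 then obtain C where
  C: "\<And>b N w. block_design b N w ==> (\<Sum>t=1..N. \<Sum>s=1..N. \<bar>a b w t s\<bar>) \<le> C * (real N * real b)"
  unfolding L1k_def by blast
 have "\<bar>\<Sum>t=1..N. \<Sum>s=1..N. a b w t s\<bar> \<le> (\<Sum>t=1..N. \<Sum>s=1..N. \<bar>a b w t s\<bar>)" for b N w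
  by (intro order_trans[OF sum_abs] sum_mono sum_abs)
 then show ?thesis unfolding Negk_def using C order_trans by blast
qed

lemma Negk_add:
 assumes "Negk a" "Negk a'"
 shows "Negk (\<lambda>b w t s. a b w t s + a' b w t s)"
proof -
 obtain C C' where
  C: "\<And>b N w. block_design b N w ==> \<bar>\<Sum>t=1..N. \<Sum>s=1..N. a b w t s\<bar> \<le> C * (real N * real b)"
    "\<And>b N w. block_design b N w ==> \<bar>\<Sum>t=1..N. \<Sum>s=1..N. a' b w t s\<bar> \<le> C' * (real N * real b)"
  using assms unfolding Negk_def by blast
 show ?thesis unfolding Negk_def
 proof (intro exI[of _ "C + C'"] allI impI)
  fix b N w assume v: "block_design b N w"
  show "\<bar>\<Sum>t=1..N. \<Sum>s=1..N. a b w t s + a' b w t s\<bar> \<le> (C + C') * (real N * real b)"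
   using C(1)[OF v] C(2)[OF v] by (simp add: sum.distrib algebra_simps)
 qed
qed

lemma Negk_uminus: "Negk a ==> Negk (\<lambda>b w t s. - a b w t s)"
 unfolding Negk_def by (simp add: sum_negf)

lemma Negk_diff: "Negk a ==> Negk a' ==> Negk (\<lambda>b w t s. a b w t s - a' b w t s)"
 using Negk_add[OF _ Negk_uminus[of a'], of a] by simp

section \<open>Moments and covariances of products taken at two blocks\<close>

context spec_process
begin

text \<open>Indices 0 to 3 live in the block starting at \<open>t\<close>, indices 4 to 7 in the
  block starting at \<open>s\<close>: a covariance of two fourfold products needs eight
  positions.\<close>

definition mm :: "nat set => kernel" where
 "mm S b w t s = mom (\<lambda>i. lin (w i) b (if i < 4 then t else s)) S"

definition kk :: "nat set => kernel" where
 "kk S b w t s = kappa (mom (\<lambda>i. lin (w i) b (if i < 4 then t else s))) S"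

text \<open>For \<open>U\<close> below 4 and \<open>W\<close> from 4 on, this is the covariance of a
  product at \<open>t\<close> with a product at \<open>s\<close>.\<close>

definition cc :: "nat set => nat set => kernel" where
 "cc U W b w t s = mm (U \<union> W) b w t s - mm U b w t s * mm W b w t s"

lemma mm_empty [simp]: "mm {} b w t s = 1" by (simp add: mm_def)
lemma mm_single [simp]: "mm {i} b w t s = 0" by (simp add: mm_def mom_single)
lemma cc_empty1 [simp]: "cc {} W b w t s = 0" by (simp add: cc_def)
lemma cc_empty2 [simp]: "cc U {} b w t s = 0" by (simp add: cc_def)
lemma cc_commute: "cc U W = cc W U"
 by (intro ext) (simp add: cc_def Un_commute)

lemma kk_single [simp]: "kk {i} b w t s = 0"
 by (simp add: kk_def kappa1 mom_single)

lemma kk_pair: "i \<noteq> j ==> kk {i, j} = mm {i, j}"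
 by (intro ext) (simp add: kk_def mm_def kappa2 mom_single)

lemma kk_triple: "i \<noteq> j ==> i \<noteq> k ==> j \<noteq> k ==> kk {i, j, k} = mm {i, j, k}"
 by (intro ext) (simp add: kk_def mm_def kappa3 mom_single)

lemma sub8: "S \<subseteq> {..<8::nat} ==> finite S \<and> card S \<le> 8"
 using card_mono[of "{..<8::nat}" S] finite_subset[of S "{..<8::nat}"] by auto

lemma Bdk_mm: "S \<subseteq> {..<8} ==> Bdk (mm S)"
 unfolding Bdk_def mm_def using sub8[of S]
 by (intro exI[of _ "1 + 8 * mom8"] allI impI abs_mom_bound) (auto simp: block_design_def)

lemma Bdk_kk:
 assumes "S \<subseteq> {..<8}"
 shows "Bdk (kk S)"
proof -
 have "Bdk (\<lambda>b w t s. \<Sum>P | partition_on S P. cumw (card P) * (\<Prod>B\<in>P. mm B b w t s))"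
 proof (intro Bdk_sum Bdk_mult Bdk_const Bdk_prod Bdk_mm)
  fix P B assume "P \<in> {P. partition_on S P}" "B \<in> P"
  then show "B \<subseteq> {..<8}" using assms by (auto dest: partition_onD1)
 qed
 moreover have "kk S = (\<lambda>b w t s. \<Sum>P | partition_on S P. cumw (card P) * (\<Prod>B\<in>P. mm B b w t s))"
  by (intro ext) (simp add: kk_def kappa_def mm_def)
 ultimately show ?thesis by simp
qed

lemma Bdk_cc: "U \<subseteq> {..<8} ==> W \<subseteq> {..<8} ==> Bdk (cc U W)"
 unfolding cc_def[abs_def] by (intro Bdk_diff Bdk_mult Bdk_mm) auto

text \<open>Blocks do not interact over long distances.\<close>

lemma schur_cc:
 obtains K :: real where "K > 0"
  "\<And>b N w V V' t. block_design b N w ==> card V = card V' ==> card V = 1 \<or> card V = 2 ==>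
   (\<Sum>s=1..N. \<bar>\<E> (\<lambda>om. (\<Prod>i\<in>V. lin (w i) b t om) * (\<Prod>i\<in>V'. lin (w i) b s om))
     - \<E> (\<lambda>om. \<Prod>i\<in>V. lin (w i) b t om) * \<E> (\<lambda>om. \<Prod>i\<in>V'. lin (w i) b s om)\<bar>) \<le> K * b"
proof -
 define K where "K = 1 + cumbound 2 + (cumbound 4 + 2 * (cumbound 2 * (1 + 8 * mom8)))"
 have nn: "cumbound 2 \<ge> 0" "cumbound 4 + 2 * (cumbound 2 * (1 + 8 * mom8)) \<ge> 0"
  using cumbound_nonneg mom8_nonneg by auto
 have K: "cumbound 2 \<le> K" "cumbound 4 + 2 * (cumbound 2 * (1 + 8 * mom8)) \<le> K" "K > 0"
  using nn unfolding K_def by auto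
 show thesis
 proof (rule that[OF K(3)])
  fix b N w t and V V' :: "nat set" assume v: "block_design b N w" and e: "card V = card V'" "card V = 1 \<or> card V = 2"
  have w: "\<And>i u. \<bar>w i u\<bar> \<le> 1" and b: "b \<ge> 1" using v by (auto simp: block_design_def)
  show "(\<Sum>s=1..N. \<bar>\<E> (\<lambda>om. (\<Prod>i\<in>V. lin (w i) b t om) * (\<Prod>i\<in>V'. lin (w i) b s om))
     - \<E> (\<lambda>om. \<Prod>i\<in>V. lin (w i) b t om) * \<E> (\<lambda>om. \<Prod>i\<in>V'. lin (w i) b s om)\<bar>) \<le> K * b"
   (is "?L \<le> _")
   using e(2)
  proof
   assume "card V = 1"
   then obtain i j where V: "V = {i}" "V' = {j}" using e by (metis card_1_singletonE)
   have "?L \<le> b * cumbound 2"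
    unfolding V using schur2[where w = "w i" and w' = "w j" and b = b and N = N and t = t] w b by (simp add: lin_mean)
   also have "\<dots> \<le> K * b" unfolding mult.commute[of _ "real b"] using K by (intro mult_left_mono) auto
   finally show ?thesis .
  next
   assume "card V = 2"
   then obtain i j k l where V: "V = {i,j}" "V' = {k,l}" "i \<noteq> j" "k \<noteq> l" using e by (metis card_2_iff)
   have "?L \<le> b * (cumbound 4 + 2 * (cumbound 2 * (1 + 8 * mom8)))"
    using schur4[where w = "\<lambda>n. if n = 0 then w i else if n = 1 then w j else if n = 2 then w k else w l"
      and b = b and N = N and t = t] w b V
    by (simp add: mult.assoc)
   also have "\<dots> \<le> K * b" unfolding mult.commute[of _ "real b"] using K by (intro mult_left_mono) auto
   finally show ?thesis .
  qed
 qed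
qed

lemma mm_split:
 assumes "U \<subseteq> {..<4}" "W \<subseteq> {4..<8}"
 shows "mm (U \<union> W) b w t s = \<E> (\<lambda>om. (\<Prod>i\<in>U. lin (w i) b t om) * (\<Prod>i\<in>W. lin (w i) b s om))"
  and "mm U b w t s = \<E> (\<lambda>om. \<Prod>i\<in>U. lin (w i) b t om)"
  and "mm W b w t s = \<E> (\<lambda>om. \<Prod>i\<in>W. lin (w i) b s om)"
proof -
 have fin: "finite U" "finite W" using assms finite_subset by blast+
 have d: "U \<inter> W = {}" using assms by fastforce
 have U: "(\<Prod>i\<in>U. lin (w i) b (if i < 4 then t else s) om) = (\<Prod>i\<in>U. lin (w i) b t om)" for om
  using assms by (intro prod.cong) auto
 have W: "(\<Prod>i\<in>W. lin (w i) b (if i < 4 then t else s) om) = (\<Prod>i\<in>W. lin (w i) b s om)" for om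
  using assms by (intro prod.cong) auto
 show "mm (U \<union> W) b w t s = \<E> (\<lambda>om. (\<Prod>i\<in>U. lin (w i) b t om) * (\<Prod>i\<in>W. lin (w i) b s om))"
  by (simp add: mm_def mom_def prod.union_disjoint[OF fin d] U W)
 show "mm U b w t s = \<E> (\<lambda>om. \<Prod>i\<in>U. lin (w i) b t om)"
  by (simp add: mm_def mom_def U)
 show "mm W b w t s = \<E> (\<lambda>om. \<Prod>i\<in>W. lin (w i) b s om)"
  by (simp add: mm_def mom_def W)
qed

lemma L1k_cc:
 assumes "U \<subseteq> {..<4}" "W \<subseteq> {4..<8}" "card U = card W" "card U = 1 \<or> card U = 2"
 shows "L1k (cc U W)"
proof -
 obtain K :: real where K: "K > 0" "\<And>b N w V V' t. block_design b N w ==> card V = card V' ==> card V = 1 \<or> card V = 2 ==>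
   (\<Sum>s=1..N. \<bar>\<E> (\<lambda>om. (\<Prod>i\<in>V. lin (w i) b t om) * (\<Prod>i\<in>V'. lin (w i) b s om))
     - \<E> (\<lambda>om. \<Prod>i\<in>V. lin (w i) b t om) * \<E> (\<lambda>om. \<Prod>i\<in>V'. lin (w i) b s om)\<bar>) \<le> K * b"
  using schur_cc by blast
 show ?thesis unfolding L1k_def
 proof (intro exI[of _ K] allI impI)
  fix b N w assume v: "block_design b N w"
  have "(\<Sum>t=1..N. \<Sum>s=1..N. \<bar>cc U W b w t s\<bar>) \<le> (\<Sum>t=1..N. K * b)"
   unfolding cc_def mm_split[OF assms(1,2)] using K(2)[OF v assms(3,4)] by (intro sum_mono)
  then show "(\<Sum>t=1..N. \<Sum>s=1..N. \<bar>cc U W b w t s\<bar>) \<le> K * (real N * real b)"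
   by (simp add: mult_ac)
 qed
qed

text \<open>Centred products of one or two statistics, indexed by the block, have an almost diagonal
  Gram matrix by \<open>schur_cc\<close>, so Bessel's inequality holds with constant
  \<open>K * b\<close>. As \<open>Z\<close> is arbitrary, covariances with longer products are
  controlled without any cumulant of mixed order.\<close>

lemma bessel_block:
 obtains K :: real where "K > 0"
  "\<And>b N w V Z. block_design b N w ==> card V = 1 \<or> card V = 2 ==> Z \<in> borel_measurable M ==>
   integrable M (\<lambda>om. (Z om)\<^sup>2) ==>
   (\<Sum>t=1..N. (\<E> (\<lambda>om. (\<Prod>i\<in>V. lin (w i) b t om) * Z om)
     - \<E> (\<lambda>om. \<Prod>i\<in>V. lin (w i) b t om) * \<E> Z)\<^sup>2) \<le> K * b * \<E> (\<lambda>om. (Z om)\<^sup>2)"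
proof -
 obtain K :: real where K: "K > 0" "\<And>b N w V V' t. block_design b N w ==> card V = card V' ==> card V = 1 \<or> card V = 2 ==>
   (\<Sum>s=1..N. \<bar>\<E> (\<lambda>om. (\<Prod>i\<in>V. lin (w i) b t om) * (\<Prod>i\<in>V'. lin (w i) b s om))
     - \<E> (\<lambda>om. \<Prod>i\<in>V. lin (w i) b t om) * \<E> (\<lambda>om. \<Prod>i\<in>V'. lin (w i) b s om)\<bar>) \<le> K * b"
  using schur_cc by blast
 show thesis
 proof (rule that[OF K(1)])
  fix b N w and V :: "nat set" and Z :: "'a => real"
  assume v: "block_design b N w" and V: "card V = 1 \<or> card V = 2" and Z: "Z \<in> borel_measurable M"
   and Z2: "integrable M (\<lambda>om. (Z om)\<^sup>2)"
  have w: "\<And>i u. \<bar>w i u\<bar> \<le> 1" and b: "b \<ge> 1" using v by (auto simp: block_design_def)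
  have finV: "finite V" "card V \<le> 4" using V by (auto intro: card_ge_0_finite)
  define P where "P t om = (\<Prod>i\<in>V. lin (w i) b t om)" for t om
  define F where "F t om = P t om - \<E> (P t)" for t om
  have Pm: "P t \<in> borel_measurable M" for t
   unfolding P_def[abs_def] using rv8_lin by (intro borel_measurable_prod) (auto simp: rv8_def)
  have P2: "integrable M (\<lambda>om. (P t om)\<^sup>2)" for t
   unfolding P_def using finV w b by (intro prod_lin_square)
  have P1: "integrable M (P t)" for t
   using square_integrable_imp_integrable[OF Pm P2] .
  have Z1: "integrable M Z" using square_integrable_imp_integrable[OF Z Z2] .
  have PP: "integrable M (\<lambda>om. P t om * P t' om)" for t t'
   using Pm P2 by (intro integrable_mult_squares)
  have PZ: "integrable M (\<lambda>om. P t om * Z om)" for t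
   using Pm P2 Z Z2 by (intro integrable_mult_squares)
  have EFF: "\<E> (\<lambda>om. F t om * F t' om) = \<E> (\<lambda>om. P t om * P t' om) - \<E> (P t) * \<E> (P t')" for t t'
   using PP P1 by (simp add: F_def algebra_simps prob_space)
  have EFZ: "\<E> (\<lambda>om. F t om * Z om) = \<E> (\<lambda>om. P t om * Z om) - \<E> (P t) * \<E> Z" for t
   using PZ Z1 by (simp add: F_def algebra_simps)
  have "(\<Sum>t=1..N. (\<E> (\<lambda>om. F t om * Z om))\<^sup>2) \<le> (K * b) * \<E> (\<lambda>om. (Z om)\<^sup>2)"
  proof (rule bessel)
   show "K * real b > 0" using K(1) b by simp
   show "integrable M (\<lambda>om. (F t om)\<^sup>2)" for t
    unfolding F_def power2_diff using P1 P2 by auto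
   show "F t \<in> borel_measurable M" for t using Pm unfolding F_def[abs_def] by simp
   show "(\<Sum>t'=1..N. \<bar>\<E> (\<lambda>om. F t om * F t' om)\<bar>) \<le> K * b" for t
    unfolding EFF using K(2)[OF v refl V, of t] by (simp add: P_def[abs_def])
  qed (use Z Z2 in auto)
  then show "(\<Sum>t=1..N. (\<E> (\<lambda>om. (\<Prod>i\<in>V. lin (w i) b t om) * Z om)
     - \<E> (\<lambda>om. \<Prod>i\<in>V. lin (w i) b t om) * \<E> Z)\<^sup>2) \<le> K * b * \<E> (\<lambda>om. (Z om)\<^sup>2)"
   unfolding EFZ by (simp add: P_def[abs_def])
 qed
qed

text \<open>For fixed \<open>s\<close> the product over \<open>W\<close> plays the role of
  \<open>Z\<close>, and the sum over \<open>t\<close> costs only order \<open>b\<close>; the sum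
  over \<open>s\<close> then contributes the factor \<open>N\<close>.\<close>

lemma L2k_cc_left:
 assumes U: "U \<subseteq> {..<4}" "card U = 1 \<or> card U = 2" and W: "W \<subseteq> {4..<8}"
 shows "L2k (cc U W)"
proof -
 obtain K :: real where K: "K > 0"
  "\<And>b N w V Z. block_design b N w ==> card V = 1 \<or> card V = 2 ==> Z \<in> borel_measurable M ==>
   integrable M (\<lambda>om. (Z om)\<^sup>2) ==>
   (\<Sum>t=1..N. (\<E> (\<lambda>om. (\<Prod>i\<in>V. lin (w i) b t om) * Z om)
     - \<E> (\<lambda>om. \<Prod>i\<in>V. lin (w i) b t om) * \<E> Z)\<^sup>2) \<le> K * b * \<E> (\<lambda>om. (Z om)\<^sup>2)"
  using bessel_block by blast
 have W4: "finite W" "card W \<le> 4" using card_mono[of "{4..<8}" W] W finite_subset by auto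
 show ?thesis unfolding L2k_def
 proof (intro exI[of _ "K * (1 + 8 * mom8)"] allI impI)
  fix b N w assume v: "block_design b N w"
  have w: "\<And>i u. \<bar>w i u\<bar> \<le> 1" and b: "b \<ge> 1" using v by (auto simp: block_design_def)
  have "(\<Sum>t=1..N. \<Sum>s=1..N. (cc U W b w t s)\<^sup>2) = (\<Sum>s=1..N. \<Sum>t=1..N. (cc U W b w t s)\<^sup>2)"
   by (rule sum.swap)
  also have "\<dots> \<le> (\<Sum>s=1..N. K * b * \<E> (\<lambda>om. (\<Prod>i\<in>W. lin (w i) b s om)\<^sup>2))"
   unfolding cc_def mm_split[OF U(1) W]
   using W4 w b rv8_lin
   by (intro sum_mono K(2)[OF v U(2)] prod_lin_square borel_measurable_prod) (auto simp: rv8_def)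
  also have "\<dots> \<le> (\<Sum>s=1..N. K * b * (1 + 8 * mom8))"
   using W4 w b K(1) by (intro sum_mono mult_left_mono prod_lin_square) auto
  finally show "(\<Sum>t=1..N. \<Sum>s=1..N. (cc U W b w t s)\<^sup>2) \<le> K * (1 + 8 * mom8) * (real N * real b)"
   by (simp add: mult_ac)
 qed
qed

lemma L2k_cc_right:
 assumes U: "U \<subseteq> {..<4}" and W: "W \<subseteq> {4..<8}" "card W = 1 \<or> card W = 2"
 shows "L2k (cc U W)"
proof -
 obtain K :: real where K: "K > 0"
  "\<And>b N w V Z. block_design b N w ==> card V = 1 \<or> card V = 2 ==> Z \<in> borel_measurable M ==>
   integrable M (\<lambda>om. (Z om)\<^sup>2) ==>
   (\<Sum>t=1..N. (\<E> (\<lambda>om. (\<Prod>i\<in>V. lin (w i) b t om) * Z om)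
     - \<E> (\<lambda>om. \<Prod>i\<in>V. lin (w i) b t om) * \<E> Z)\<^sup>2) \<le> K * b * \<E> (\<lambda>om. (Z om)\<^sup>2)"
  using bessel_block by blast
 have U4: "finite U" "card U \<le> 4" using card_mono[of "{..<4}" U] U finite_subset by auto
 show ?thesis unfolding L2k_def
 proof (intro exI[of _ "K * (1 + 8 * mom8)"] allI impI)
  fix b N w assume v: "block_design b N w"
  have w: "\<And>i u. \<bar>w i u\<bar> \<le> 1" and b: "b \<ge> 1" using v by (auto simp: block_design_def)
  have "(\<Sum>t=1..N. \<Sum>s=1..N. (cc U W b w t s)\<^sup>2) \<le> (\<Sum>t=1..N. K * b * \<E> (\<lambda>om. (\<Prod>i\<in>U. lin (w i) b t om)\<^sup>2))"
   unfolding cc_commute[of U W] unfolding cc_def Un_commute[of W U] mm_split[OF U W(1)]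
   unfolding mult.commute[of "\<Prod>i\<in>U. lin (w i) b _ _"]
   using U4 w b rv8_lin
   by (intro sum_mono K(2)[OF v W(2)] prod_lin_square borel_measurable_prod) (auto simp: rv8_def)
  also have "\<dots> \<le> (\<Sum>t=1..N. K * b * (1 + 8 * mom8))"
   using U4 w b K(1) by (intro sum_mono mult_left_mono prod_lin_square) auto
  finally show "(\<Sum>t=1..N. \<Sum>s=1..N. (cc U W b w t s)\<^sup>2) \<le> K * (1 + 8 * mom8) * (real N * real b)"
   by (simp add: mult_ac)
 qed
qed

end

lemma sum_Pow_Un:
 assumes "finite U" "finite W" "U \<inter> W = {}"
 shows "(\<Sum>B\<in>Pow (U \<union> W). f B) = (\<Sum>B1\<in>Pow U. \<Sum>B2\<in>Pow W. f (B1 \<union> B2))"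
 using assms(1,3)
proof (induction U arbitrary: f rule: finite_induct)
 case (insert x U)
 have x: "x \<notin> U \<union> W" using insert by auto
 have "(\<Sum>B\<in>Pow (insert x U \<union> W). f B) = (\<Sum>B\<in>Pow (U \<union> W). f B) + (\<Sum>B\<in>Pow (U \<union> W). f (insert x B))"
  using sum_Pow_insert[of "U \<union> W" x f] insert(1) assms(2) x by simp
 also have "\<dots> = (\<Sum>B1\<in>Pow (insert x U). \<Sum>B2\<in>Pow W. f (B1 \<union> B2))"
  using insert.IH[of f] insert.IH[of "\<lambda>B. f (insert x B)"] insert.prems
  by (simp add: sum_Pow_insert[OF insert(1,2)])
 finally show ?case .
qed simp

section \<open>Expansion of covariances by peeling off cumulants\<close>

context spec_process
begin

lemma mm_peel:
 assumes "finite U" "i \<notin> U"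
 shows "mm (insert i U) b w t s = (\<Sum>B\<in>Pow U. kk (insert i B) b w t s * mm (U - B) b w t s)"
 unfolding mm_def kk_def using assms by (intro kappa_rec') auto

text \<open>The terms of the moment recursion whose cumulant reaches from \<open>B1\<close> into the
  other block, taking a nonempty \<open>B2\<close> out of \<open>W\<close>.\<close>

definition Rk :: "nat set => nat set => nat set => kernel" where
 "Rk B1 V W b w t s = (\<Sum>B2\<in>Pow W - {{}}. kk (B1 \<union> B2) b w t s * mm (V \<union> (W - B2)) b w t s)"

text \<open>The part of \<open>Rk\<close> in which the leftover moment is replaced by a covariance:
  both factors now link the two blocks, which makes their product summable.\<close>

definition Remk :: "nat set => nat set => nat set => kernel" where
 "Remk B1 V W b w t s = (\<Sum>B2\<in>Pow W - {{}}. kk (B1 \<union> B2) b w t s * cc V (W - B2) b w t s)"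

lemma Rk_eq: "Rk B1 V W b w t s = mm V b w t s * Rk B1 {} W b w t s + Remk B1 V W b w t s"
 by (simp add: Rk_def Remk_def cc_def sum_distrib_left sum.distrib[symmetric] algebra_simps)

text \<open>The recursion at the index \<open>i\<close> is sorted by the part of the cumulant that
  lies in \<open>W\<close>. Where it is empty, the leftover moment and the matching term of
  \<open>mm (insert i U)\<close> times \<open>mm W\<close> combine to a smaller covariance; all
  other terms form \<open>Rk\<close>.\<close>

lemma cc_peel:
 assumes fin: "finite U" "finite W" and dj: "U \<inter> W = {}" "i \<notin> U" "i \<notin> W"
 shows "cc (insert i U) W b w t s =
  (\<Sum>B\<in>Pow U. kk (insert i B) b w t s * cc (U - B) W b w t s + Rk (insert i B) (U - B) W b w t s)"
proof -
 have "mm (insert i U \<union> W) b w t s =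
   (\<Sum>B\<in>Pow (U \<union> W). kk (insert i B) b w t s * mm (U \<union> W - B) b w t s)"
  using mm_peel[of "U \<union> W" i b w t s] fin dj by simp
 also have "\<dots> = (\<Sum>B1\<in>Pow U. \<Sum>B2\<in>Pow W.
   kk (insert i (B1 \<union> B2)) b w t s * mm (U \<union> W - (B1 \<union> B2)) b w t s)"
  by (rule sum_Pow_Un[OF fin dj(1)])
 also have "\<dots> = (\<Sum>B1\<in>Pow U. kk (insert i B1) b w t s * mm ((U - B1) \<union> W) b w t s + Rk (insert i B1) (U - B1) W b w t s)"
 proof (intro sum.cong refl)
  fix B1 assume B1: "B1 \<in> Pow U"
  have d: "U \<union> W - (B1 \<union> B2) = (U - B1) \<union> (W - B2)" if "B2 \<in> Pow W" for B2
   using B1 that dj(1) by auto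
  have "(\<Sum>B2\<in>Pow W. kk (insert i (B1 \<union> B2)) b w t s * mm (U \<union> W - (B1 \<union> B2)) b w t s) =
   (\<Sum>B2\<in>Pow W. kk (insert i (B1 \<union> B2)) b w t s * mm ((U - B1) \<union> (W - B2)) b w t s)"
   using d by (intro sum.cong refl) simp
  also have "\<dots> = kk (insert i B1) b w t s * mm ((U - B1) \<union> W) b w t s + Rk (insert i B1) (U - B1) W b w t s"
   unfolding Rk_def using fin by (subst sum.remove[of _ "{}"]) auto
  finally show "(\<Sum>B2\<in>Pow W. kk (insert i (B1 \<union> B2)) b w t s * mm (U \<union> W - (B1 \<union> B2)) b w t s) =
   kk (insert i B1) b w t s * mm ((U - B1) \<union> W) b w t s + Rk (insert i B1) (U - B1) W b w t s" .
 qed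
 finally have 1: "mm (insert i U \<union> W) b w t s = (\<Sum>B1\<in>Pow U. kk (insert i B1) b w t s * mm ((U - B1) \<union> W) b w t s +
   Rk (insert i B1) (U - B1) W b w t s)" .
 show ?thesis
  unfolding cc_def[of "insert i U"] 1 mm_peel[OF fin(1) dj(2)] sum_distrib_right sum_subtractf[symmetric]
  by (intro sum.cong refl) (simp add: cc_def algebra_simps)
qed

lemma Rk_top:
 assumes "finite W" "W \<noteq> {}"
 shows "Rk B {} W b w t s = kk (B \<union> W) b w t s +
  (\<Sum>B2\<in>Pow W - {{}} - {W}. kk (B \<union> B2) b w t s * mm (W - B2) b w t s)"
 unfolding Rk_def using assms by (subst sum.remove[of _ W]) auto

text \<open>\<open>cc_peel\<close> is solved for the cumulant of the full set, which is a covariance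
  minus terms with fewer points. Induction over \<open>W\<close> thus carries square-summability
  from covariances to cumulants. \<open>A\<close> and \<open>A'\<close> stand for the two blocks in
  either order.\<close>

lemma L2k_kk:
 assumes A: "A \<subseteq> {..<8}" "A' \<subseteq> {..<8}" "A \<inter> A' = {}"
  and H: "\<And>U W. U \<subseteq> A ==> W \<subseteq> A' ==> card U = 1 \<or> card U = 2 ==> L2k (cc U W)"
  and U: "U \<subseteq> A" "card U = 1 \<or> card U = 2" and W: "W \<subseteq> A'" "W \<noteq> {}"
 shows "L2k (kk (U \<union> W))"
proof -
 have fin: "finite W" if "W \<subseteq> A'" for W using that A sub8 by blast
 have single: "L2k (kk ({i} \<union> W))" if i: "i \<in> A" and W: "W \<subseteq> A'" "W \<noteq> {}" for i W
  using fin[OF W(1)] W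
 proof (induction W rule: finite_psubset_induct)
  case (psubset W)
  have "cc {i} W b w t s = Rk {i} {} W b w t s" for b w t s
   using cc_peel[of "{}" W i b w t s] psubset.hyps psubset.prems i A by auto
  then have eq: "kk ({i} \<union> W) = (\<lambda>b w t s. cc {i} W b w t s -
    (\<Sum>B2\<in>Pow W - {{}} - {W}. kk ({i} \<union> B2) b w t s * mm (W - B2) b w t s))"
   using Rk_top[OF psubset.hyps psubset.prems(2), of "{i}"] by (intro ext) (simp add: algebra_simps)
  show ?case unfolding eq
  proof (intro L2k_diff L2k_sum L2k_mult_Bdk Bdk_mm H)
   fix B2 assume "B2 \<in> Pow W - {{}} - {W}"
   then have "B2 \<subset> W" "B2 \<noteq> {}" by auto
   then show "L2k (kk ({i} \<union> B2))" "W - B2 \<subseteq> {..<8}"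
    using psubset.prems A psubset.IH[of B2] by (blast intro: order_trans)+
  qed (use i psubset.prems in auto)
 qed
 have pair: "L2k (kk ({i,j} \<union> W))" if i: "i \<in> A" "j \<in> A" "i \<noteq> j" and W: "W \<subseteq> A'" "W \<noteq> {}" for i j W
  using fin[OF W(1)] W
 proof (induction W rule: finite_psubset_induct)
  case (psubset W)
  have ij: "i \<notin> W" "j \<notin> W" using i psubset.prems A by auto
  have "cc {i,j} W b w t s = Rk {i} {j} W b w t s + Rk {i,j} {} W b w t s" for b w t s
   using cc_peel[of "{j}" W i b w t s] psubset.hyps ij i by (auto simp: sum_Pow_insert)
  then have eq: "kk ({i,j} \<union> W) = (\<lambda>b w t s. cc {i,j} W b w t s - Rk {i} {j} W b w t s -
    (\<Sum>B2\<in>Pow W - {{}} - {W}. kk ({i,j} \<union> B2) b w t s * mm (W - B2) b w t s))"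
   using Rk_top[OF psubset.hyps psubset.prems(2), of "{i,j}"] by (intro ext) (simp add: algebra_simps)
  show ?case unfolding eq Rk_def
  proof (intro L2k_diff L2k_sum L2k_mult_Bdk Bdk_mm H single)
   fix B2 assume "B2 \<in> Pow W - {{}} - {W}"
   then have "B2 \<subset> W" "B2 \<noteq> {}" by auto
   then show "L2k (kk ({i,j} \<union> B2))" "W - B2 \<subseteq> {..<8}"
    using psubset.prems A psubset.IH[of B2] by (blast intro: order_trans)+
  qed (use i psubset.prems A in auto)
 qed
 from U(2) show ?thesis
 proof
  assume "card U = 1"
  then obtain i where "U = {i}" by (auto simp: card_1_singleton_iff)
  then show ?thesis using single[of i W] U W by auto
 next
  assume "card U = 2"
  then obtain i j where "U = {i,j}" "i \<noteq> j" by (auto simp: card_2_iff)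
  then show ?thesis using pair[of i j W] U W by auto
 qed
qed

lemma sub48: "S \<subseteq> {..<4} ==> S \<subseteq> {..<8::nat}" "S \<subseteq> {4..<8} ==> S \<subseteq> {..<8::nat}"
 by (auto simp: subset_eq)

text \<open>It is enough that one side has at most two points; if it is the right one, the blocks
  exchange their roles.\<close>

lemma L2k_kk_cross:
 assumes "U \<subseteq> {..<4}" "W \<subseteq> {4..<8}" "U \<noteq> {}" "W \<noteq> {}" "card U \<le> 2 \<or> card W \<le> 2"
 shows "L2k (kk (U \<union> W))"
proof -
 have fin: "finite U" "finite W" using assms finite_subset by blast+
 then have pos: "card U \<noteq> 0" "card W \<noteq> 0" using assms by auto
 from assms(5) show ?thesis
 proof
  assume "card U \<le> 2"
  then show ?thesis using assms pos
   by (intro L2k_kk[of "{..<4}" "{4..<8}"] L2k_cc_left) auto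
 next
  assume "card W \<le> 2"
  moreover have "L2k (cc U' W')" if "U' \<subseteq> {4..<8}" "W' \<subseteq> {..<4}" "card U' = 1 \<or> card U' = 2" for U' W'
   using that by (subst cc_commute) (intro L2k_cc_right)
  ultimately have "L2k (kk (W \<union> U))" using assms pos
   by (intro L2k_kk[of "{4..<8}" "{..<4}"]) auto
  then show ?thesis by (simp add: Un_commute)
 qed
qed

lemma card_le4:
 "S \<subseteq> {..<4::nat} ==> finite S \<and> card S \<le> 4" "S \<subseteq> {4..<8::nat} ==> finite S \<and> card S \<le> 4"
 using card_mono[of "{..<4}" S] card_mono[of "{4..<8}" S] finite_subset by auto

text \<open>Each block offers only four indices. Either both factors are square-summable and
  Cauchy-Schwarz applies, or one factor has at least three points on each side. Then the other has a
  single point on each side; it is a covariance of two statistics, absolutely summable, and the big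
  factor need only be bounded.\<close>

lemma L1k_kk_cc:
 assumes B: "B1 \<subseteq> {..<4}" "B1 \<noteq> {}" "B2 \<subseteq> {4..<8}" "B2 \<noteq> {}"
  and V: "V \<subseteq> {..<4}" "V' \<subseteq> {4..<8}" and c: "card B1 + card V \<le> 4" "card B2 + card V' \<le> 4"
 shows "L1k (\<lambda>b w t s. kk (B1 \<union> B2) b w t s * cc V V' b w t s)"
proof (cases "V = {} \<or> V' = {}")
 case True
 then show ?thesis using L1k_zero by auto
next
 case False
 have fin: "finite B1" "finite B2" "finite V" "finite V'" using B V card_le4 by blast+
 have pos: "card B1 \<ge> 1" "card B2 \<ge> 1" "card V \<ge> 1" "card V' \<ge> 1"
  using False B fin by (auto simp: Suc_le_eq card_gt_0_iff)
 have Bd: "Bdk (kk (B1 \<union> B2))" "Bdk (cc V V')" using B V sub48 by (auto intro!: Bdk_kk Bdk_cc)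
 show ?thesis
 proof (cases "card B1 \<le> 2 \<or> card B2 \<le> 2")
  case small: True
  then have kk: "L2k (kk (B1 \<union> B2))" using B by (intro L2k_kk_cross) auto
  show ?thesis
  proof (cases "card V \<le> 2 \<or> card V' \<le> 2")
   case True
   then have "L2k (cc V V')" using V pos
    by (metis L2k_cc_left L2k_cc_right One_nat_def le_antisym not_less_eq_eq numeral_2_eq_2)
   with kk show ?thesis by (rule L1k_L2k_mult)
  next
   case False
   then have "card B1 = 1" "card B2 = 1" using c pos by auto
   then obtain x y where xy: "B1 = {x}" "B2 = {y}" by (auto simp: card_1_singleton_iff)
   then have "x \<noteq> y" using B by auto
   then have "kk (B1 \<union> B2) = cc {x} {y}"
    unfolding xy using kk_pair[of x y] by (intro ext) (simp add: cc_def insert_commute)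
   moreover have "L1k (cc {x} {y})" using B xy by (intro L1k_cc) auto
   ultimately show ?thesis using Bd by (auto intro: L1k_mult_Bdk)
  qed
 next
  case False
  then have "card V = 1" "card V' = 1" using c pos by auto
  then have "L1k (cc V V')" using V by (intro L1k_cc) auto
  then show ?thesis using L1k_mult_Bdk[of "cc V V'" "kk (B1 \<union> B2)"] Bd by (simp add: mult.commute)
 qed
qed

lemma L1k_Remk:
 assumes B: "B1 \<subseteq> {..<4}" "B1 \<noteq> {}" and V: "V \<subseteq> {..<4}" and c: "card B1 + card V \<le> 4"
  and W: "W \<subseteq> {4..<8}"
 shows "L1k (Remk B1 V W)"
proof -
 have "L1k (\<lambda>b w t s. \<Sum>B2\<in>Pow W - {{}}. kk (B1 \<union> B2) b w t s * cc V (W - B2) b w t s)"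
 proof (intro L1k_sum L1k_kk_cc B V c)
  fix B2 assume "B2 \<in> Pow W - {{}}"
  then have *: "B2 \<subseteq> W" "B2 \<noteq> {}" by auto
  show "B2 \<subseteq> {4..<8}" "B2 \<noteq> {}" "W - B2 \<subseteq> {4..<8}" using * W by auto
  have "card B2 + card (W - B2) = card W"
   using * W card_le4(2)[OF W] by (metis card_Diff_subset card_mono finite_subset le_add_diff_inverse)
  then show "card B2 + card (W - B2) \<le> 4" using card_le4(2)[OF W] by simp
 qed
 moreover have "Remk B1 V W = (\<lambda>b w t s. \<Sum>B2\<in>Pow W - {{}}. kk (B1 \<union> B2) b w t s * cc V (W - B2) b w t s)"
  by (intro ext) (simp add: Remk_def)
 ultimately show ?thesis by simp
qed

text \<open>Pairings of the first four points (\<open>pairsL\<close>) or of the last four (\<open>pairsR\<close>), with one of the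
 two pairs split off as a moment; \<open>singL\<close> collects the terms with a single point left.\<close>

definition pairsL :: "nat set => kernel" where
 "pairsL W b w t s =
   mm {0,1} b w t s * cc {2,3} W b w t s + mm {2,3} b w t s * cc {0,1} W b w t s
  + mm {0,2} b w t s * cc {1,3} W b w t s + mm {1,3} b w t s * cc {0,2} W b w t s
  + mm {0,3} b w t s * cc {1,2} W b w t s + mm {1,2} b w t s * cc {0,3} W b w t s"

definition singL :: "nat set => kernel" where
 "singL W b w t s =
   mm {1,2,3} b w t s * cc {0} W b w t s + mm {0,2,3} b w t s * cc {1} W b w t s
  + mm {0,1,3} b w t s * cc {2} W b w t s + mm {0,1,2} b w t s * cc {3} W b w t s"

definition pairsR :: kernel where
 "pairsR b w t s =
   mm {4,5} b w t s * cc {0,1,2,3} {6,7} b w t s + mm {6,7} b w t s * cc {0,1,2,3} {4,5} b w t s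
  + mm {4,6} b w t s * cc {0,1,2,3} {5,7} b w t s + mm {5,7} b w t s * cc {0,1,2,3} {4,6} b w t s
  + mm {4,7} b w t s * cc {0,1,2,3} {5,6} b w t s + mm {5,6} b w t s * cc {0,1,2,3} {4,7} b w t s"

text \<open>Index 0 is peeled off. \<open>Rk_eq\<close> splits each mixed term into a
  \<open>Remk\<close>, which is absolutely summable, and a moment times an \<open>Rk\<close> without
  leftover points, which folds back into \<open>cc\<close>. The full cumulant sum, the pairings and
  the terms with one left point survive.\<close>

lemma cc4_decomp:
 assumes W: "W \<subseteq> {4..<8}"
 shows "L1k (\<lambda>b w t s. cc {0,1,2,3} W b w t s -
   (Rk {0,1,2,3} {} W b w t s + pairsL W b w t s + singL W b w t s))"
proof -
 have fin: "finite W" using card_le4(2)[OF W] by simp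
 have nin: "0 \<notin> W" "1 \<notin> W" "2 \<notin> W" "3 \<notin> W" using W by auto
 define E where "E b w t s =
   Remk {0} {1,2,3} W b w t s
  + (Remk {0,1} {2,3} W b w t s - Remk {0} {1} W b w t s * mm {2,3} b w t s)
  + (Remk {0,2} {1,3} W b w t s - Remk {0} {2} W b w t s * mm {1,3} b w t s)
  + (Remk {0,3} {1,2} W b w t s - Remk {0} {3} W b w t s * mm {1,2} b w t s)
  + Remk {0,1,2} {3} W b w t s + Remk {0,1,3} {2} W b w t s + Remk {0,2,3} {1} W b w t s" for b w t s
 have "L1k (\<lambda>b w t s. E b w t s)" unfolding E_def
  by (intro L1k_add L1k_diff L1k_mult_Bdk L1k_Remk Bdk_mm W) auto
 moreover have "cc {0,1,2,3} W b w t s -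
   (Rk {0,1,2,3} {} W b w t s + pairsL W b w t s + singL W b w t s) = E b w t s" for b w t s
 proof -
  have q0: "Rk {0} {} W b w t s = cc {0} W b w t s"
   using cc_peel[of "{}" W 0 b w t s] fin nin by simp
  have q: "Rk {0,x} {} W b w t s = cc {0,x} W b w t s - Remk {0} {x} W b w t s" if "x \<noteq> 0" "x \<notin> W" for x
   using cc_peel[of "{x}" W 0 b w t s] Rk_eq[of "{0}" "{x}" W b w t s] fin nin that
   by (simp add: sum_Pow_insert)
  have k2: "kk {0,x} b w t s = mm {0,x} b w t s" if "x \<noteq> 0" for x using that by (simp add: kk_pair)
  have k3: "kk {0,x,y} b w t s = mm {0,x,y} b w t s" if "x \<noteq> 0" "y \<noteq> 0" "x \<noteq> y" for x y
   using that by (simp add: kk_triple)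
  have "cc {0,1,2,3} W b w t s = (\<Sum>B\<in>Pow {1,2,3}. kk (insert 0 B) b w t s * cc ({1,2,3} - B) W b w t s +
    Rk (insert 0 B) ({1,2,3} - B) W b w t s)"
   using cc_peel[of "{1,2,3}" W 0 b w t s] fin nin by simp
  also have "\<dots> =
    (kk {0} b w t s * cc {1,2,3} W b w t s + Rk {0} {1,2,3} W b w t s)
   + (kk {0,3} b w t s * cc {1,2} W b w t s + Rk {0,3} {1,2} W b w t s)
   + (kk {0,2} b w t s * cc {1,3} W b w t s + Rk {0,2} {1,3} W b w t s)
   + (kk {0,2,3} b w t s * cc {1} W b w t s + Rk {0,2,3} {1} W b w t s)
   + (kk {0,1} b w t s * cc {2,3} W b w t s + Rk {0,1} {2,3} W b w t s)
   + (kk {0,1,3} b w t s * cc {2} W b w t s + Rk {0,1,3} {2} W b w t s)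
   + (kk {0,1,2} b w t s * cc {3} W b w t s + Rk {0,1,2} {3} W b w t s)
   + (kk {0,1,2,3} b w t s * cc {} W b w t s + Rk {0,1,2,3} {} W b w t s)"
   by (simp add: sum_Pow_insert insert_Diff_if)
  finally have exp: "cc {0,1,2,3} W b w t s = \<dots>" .
  have qs: "Rk {0,1} {} W b w t s = cc {0,1} W b w t s - Remk {0} {1} W b w t s"
   "Rk {0,2} {} W b w t s = cc {0,2} W b w t s - Remk {0} {2} W b w t s"
   "Rk {0,3} {} W b w t s = cc {0,3} W b w t s - Remk {0} {3} W b w t s"
   using q[of 1] q[of 2] q[of 3] nin by auto
  have ks: "kk {0,1} b w t s = mm {0,1} b w t s" "kk {0,2} b w t s = mm {0,2} b w t s"
   "kk {0,3} b w t s = mm {0,3} b w t s" "kk {0,1,2} b w t s = mm {0,1,2} b w t s"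
   "kk {0,1,3} b w t s = mm {0,1,3} b w t s" "kk {0,2,3} b w t s = mm {0,2,3} b w t s"
   using k2[of 1] k2[of 2] k2[of 3] k3[of 1 2] k3[of 1 3] k3[of 2 3] by auto
  show ?thesis
   unfolding exp E_def pairsL_def singL_def
    Rk_eq[of _ "{1,2,3}"] Rk_eq[of _ "{1,2}"] Rk_eq[of _ "{1,3}"] Rk_eq[of _ "{2,3}"]
    Rk_eq[of _ "{1}"] Rk_eq[of _ "{2}"] Rk_eq[of _ "{3}"] qs q0 ks mm_single kk_single cc_empty1
   by (simp add: algebra_simps)
 qed
 ultimately show ?thesis by simp
qed

section \<open>Linear terms cancel in the average over blocks\<close>

text \<open>Summation by parts: since the weights sum to zero, the sum of the linear statistics over all
 blocks only sees the two ends of the sample.\<close>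

lemma lin_telescope:
 assumes b: "b \<ge> 1" and w0: "(\<Sum>u=1..b. w u) = 0"
 defines "v \<equiv> \<lambda>u. (\<Sum>j=1..min u b. w j) / b"
 shows "(\<Sum>t=1..N. lin w b t om) = b * (lin v b 1 om - lin v b (Suc N) om)"
proof -
 have step: "lin w b t om = b * (lin v b t om - lin v b (Suc t) om)" for t
 proof -
  define x where "x u = X (int t + int u - 1) om" for u
  have wv: "w u = b * (v u - v (u - 1))" if u: "u \<in> {1..b}" for u
  proof -
   obtain j where j: "u = Suc j" using u by (cases u) auto
   then show ?thesis using u b by (simp add: v_def min_def field_simps)
  qed
  have "(\<Sum>u=1..b. w u * x u) = (\<Sum>u=1..b. b * (v u * x u) - b * (v (u - 1) * x u))"
   by (intro sum.cong refl) (simp add: wv algebra_simps)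
  also have "\<dots> = b * ((\<Sum>u=1..b. v u * x u) - (\<Sum>u=1..b. v (u - 1) * x u))"
   by (simp add: sum_subtractf sum_distrib_left right_diff_distrib)
  also have "(\<Sum>u=1..b. v (u - 1) * x u) = (\<Sum>u=0..b-1. v u * x (Suc u))"
   using b by (intro sum.reindex_bij_witness[of _ Suc "\<lambda>u. u - 1"]) auto
  also have "\<dots> = (\<Sum>u=0..b. v u * x (Suc u))"
  proof -
   have "v b = 0" using w0 by (simp add: v_def)
   then show ?thesis using b by (cases b) auto
  qed
  also have "\<dots> = (\<Sum>u=1..b. v u * x (Suc u))"
   by (subst sum.atLeast_Suc_atMost) (auto simp: v_def)
  also have "\<dots> = (\<Sum>u=1..b. v u * X (int (Suc t) + int u - 1) om)"
   by (intro sum.cong refl) (simp add: x_def algebra_simps)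
  finally show ?thesis
   by (simp add: lin_def x_def right_diff_distrib)
 qed
 show ?thesis
  by (induction N) (simp_all add: step algebra_simps)
qed

text \<open>Two statistics at the ends of the sample remain, multiplied by \<open>b\<close>. This
  makes the bound free of \<open>N\<close>, whereas absolute covariances alone would give order
  \<open>N * b\<close>.\<close>

lemma lin_sum_square:
 assumes b: "b \<ge> 1" and w: "\<And>u. \<bar>w u\<bar> \<le> 1" and w0: "(\<Sum>u=1..b. w u) = 0"
 shows "\<E> (\<lambda>om. (\<Sum>t=1..N. lin w b t om)\<^sup>2) \<le> 4 * (real b)\<^sup>2 * cumbound 2"
proof -
 \<comment> \<open>Dividing the partial sums by \<open>b\<close> keeps the new weights within 1, so
   that the uniform moment bounds apply; the factor \<open>b\<close> is paid outside.\<close>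
 define v where "v u = (\<Sum>j=1..min u b. w j) / b" for u
 have v: "\<bar>v u\<bar> \<le> 1" for u
 proof -
  have "\<bar>\<Sum>j=1..min u b. w j\<bar> \<le> (\<Sum>j=1..min u b. 1)"
   by (intro order_trans[OF sum_abs] sum_mono w)
  also have "\<dots> \<le> b" by simp
  finally show ?thesis using b by (simp add: v_def)
 qed
 have sq: "\<E> (\<lambda>om. (lin v b t om)\<^sup>2) \<le> cumbound 2" for t
  using lin2_bound[OF v v b, where t = t] by (simp add: power2_eq_square abs_le_iff)
 have i2: "integrable M (\<lambda>om. (lin v b t om)\<^sup>2)" for t
  using rv8_pow_integrable[OF rv8_lin] by simp
 have eq: "(\<Sum>t=1..N. lin w b t om) = b * (lin v b 1 om - lin v b (Suc N) om)" for om
  using lin_telescope[OF b w0, where N = N and om = om] unfolding v_def .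
 have "\<E> (\<lambda>om. (\<Sum>t=1..N. lin w b t om)\<^sup>2) \<le>
   \<E> (\<lambda>om. (real b)\<^sup>2 * (2 * (lin v b 1 om)\<^sup>2 + 2 * (lin v b (Suc N) om)\<^sup>2))"
 proof (rule integral_mono)
  show "integrable M (\<lambda>om. (\<Sum>t=1..N. lin w b t om)\<^sup>2)"
   using rv8_pow_integrable[OF rv8_sum[of "{1..N}" "\<lambda>t. lin w b t"], of 2] rv8_lin by simp
  show "integrable M (\<lambda>om. (real b)\<^sup>2 * (2 * (lin v b 1 om)\<^sup>2 + 2 * (lin v b (Suc N) om)\<^sup>2))"
   using i2 by simp
  fix om
  have "(x - y)\<^sup>2 \<le> 2 * x\<^sup>2 + 2 * y\<^sup>2" for x y :: real
   using sum_squares_bound[of x "- y"] by (simp add: power2_diff)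
  then show "(\<Sum>t=1..N. lin w b t om)\<^sup>2 \<le> (real b)\<^sup>2 * (2 * (lin v b 1 om)\<^sup>2 + 2 * (lin v b (Suc N) om)\<^sup>2)"
   unfolding eq power_mult_distrib by (intro mult_left_mono) auto
 qed
 also have "\<dots> = (real b)\<^sup>2 * (2 * \<E> (\<lambda>om. (lin v b 1 om)\<^sup>2) + 2 * \<E> (\<lambda>om. (lin v b (Suc N) om)\<^sup>2))"
  using i2 by simp
 also have "\<dots> \<le> (real b)\<^sup>2 * (2 * cumbound 2 + 2 * cumbound 2)"
  by (intro mult_left_mono add_mono sq) auto
 finally show ?thesis by (simp add: mult_ac)
qed

lemma mm_const_left: "U \<subseteq> {..<4} ==> mm U b w t s = mm U b w 0 0"
proof -
 assume U: "U \<subseteq> {..<4}"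
 have "mm U b w t s = mom (\<lambda>i. lin (w i) b (0 + t)) U"
  unfolding mm_def using U by (intro mom_cong) auto
 also have "\<dots> = mom (\<lambda>i. lin (w i) b 0) U"
  using card_le4(1)[OF U] by (intro mom_lin_shift) auto
 also have "\<dots> = mm U b w 0 0" by (simp add: mm_def)
 finally show ?thesis .
qed

lemma mm_const_right: "U \<subseteq> {4..<8} ==> mm U b w t s = mm U b w 0 0"
proof -
 assume U: "U \<subseteq> {4..<8}"
 have "mm U b w t s = mom (\<lambda>i. lin (w i) b (0 + s)) U"
  unfolding mm_def using U by (intro mom_cong) auto
 also have "\<dots> = mom (\<lambda>i. lin (w i) b 0) U"
  using card_le4(2)[OF U] by (intro mom_lin_shift) auto
 also have "\<dots> = mm U b w 0 0" by (simp add: mm_def)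
 finally show ?thesis .
qed

lemma lin_sum_prod_bound:
 assumes v: "block_design b N w" and W: "finite W" "card W \<le> 4"
 shows "\<bar>\<Sum>t=1..N. \<E> (\<lambda>om. lin (w x) b t om * (\<Prod>i\<in>W. lin (w i) b s om))\<bar>
  \<le> b * (4 * cumbound 2 + (1 + 8 * mom8))"
proof -
 have w: "\<And>i u. \<bar>w i u\<bar> \<le> 1" and b: "b \<ge> 1" and w0: "\<And>i. (\<Sum>u=1..b. w i u) = 0"
  using v by (auto simp: block_design_def)
 define H where "H om = (\<Sum>t=1..N. lin (w x) b t om)" for om
 define Z where "Z om = (\<Prod>i\<in>W. lin (w i) b s om)" for om
 have lm: "lin w' b t \<in> borel_measurable M" for w' t using rv8_lin by (auto simp: rv8_def)
 have Zm: "Z \<in> borel_measurable M" unfolding Z_def using lm by (intro borel_measurable_prod)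
 have Z2: "integrable M (\<lambda>om. (Z om)\<^sup>2)" "\<E> (\<lambda>om. (Z om)\<^sup>2) \<le> 1 + 8 * mom8"
  unfolding Z_def using W w b by (auto intro!: prod_lin_square)
 have rvH: "rv8 H" unfolding H_def by (intro rv8_sum rv8_lin)
 have H2: "integrable M (\<lambda>om. (H om)\<^sup>2)" "\<E> (\<lambda>om. (H om)\<^sup>2) \<le> 4 * (real b)\<^sup>2 * cumbound 2"
  using rv8_pow_integrable[OF rvH, of 2] lin_sum_square[OF b w w0] by (auto simp: H_def)
 have Hm: "H \<in> borel_measurable M" using rvH by (simp add: rv8_def)
 have HZ: "integrable M (\<lambda>om. H om * Z om)" using Hm Zm H2 Z2 by (intro integrable_mult_squares) auto
 have lZ: "integrable M (\<lambda>om. lin (w x) b t om * Z om)" for t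
  using lm Zm Z2 rv8_pow_integrable[OF rv8_lin, of 2] by (intro integrable_mult_squares) auto
 have "(\<Sum>t=1..N. \<E> (\<lambda>om. lin (w x) b t om * Z om)) = \<E> (\<lambda>om. H om * Z om)"
  using lZ by (simp add: H_def sum_distrib_right)
 also have "\<bar>\<dots>\<bar> \<le> \<E> (\<lambda>om. \<bar>H om * Z om\<bar>)" by (rule integral_abs_bound)
 \<comment> \<open>The second moment of \<open>H\<close> has order \<open>b^2\<close> and that of
   \<open>Z\<close> is bounded, so this weighting makes both terms of order
   \<open>b\<close>.\<close>
 also have "\<dots> \<le> \<E> (\<lambda>om. (H om)\<^sup>2 / b + b * (Z om)\<^sup>2)"
 proof (rule integral_mono)
  fix om
  have "2 * (\<bar>H om\<bar> * (b * \<bar>Z om\<bar>)) \<le> (H om)\<^sup>2 + (b * \<bar>Z om\<bar>)\<^sup>2"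
   using sum_squares_bound[of "\<bar>H om\<bar>" "b * \<bar>Z om\<bar>"] by simp
  moreover have "0 \<le> \<bar>H om\<bar> * (b * \<bar>Z om\<bar>)" by simp
  ultimately have "\<bar>H om\<bar> * (b * \<bar>Z om\<bar>) \<le> (H om)\<^sup>2 + (b * \<bar>Z om\<bar>)\<^sup>2" by linarith
  then have "\<bar>H om\<bar> * \<bar>Z om\<bar> \<le> ((H om)\<^sup>2 + (b * \<bar>Z om\<bar>)\<^sup>2) / b"
   using b by (simp add: field_simps)
  also have "\<dots> = (H om)\<^sup>2 / b + b * (Z om)\<^sup>2"
   using b by (simp add: field_simps power2_eq_square)
  finally show "\<bar>H om * Z om\<bar> \<le> (H om)\<^sup>2 / b + b * (Z om)\<^sup>2" by (simp add: abs_mult)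
 qed (use HZ H2 Z2 in auto)
 also have "\<dots> = \<E> (\<lambda>om. (H om)\<^sup>2) / b + b * \<E> (\<lambda>om. (Z om)\<^sup>2)"
  using H2 Z2 by simp
 also have "\<dots> \<le> (4 * (real b)\<^sup>2 * cumbound 2) / b + b * (1 + 8 * mom8)"
  using H2 Z2 by (intro add_mono divide_right_mono mult_left_mono) auto
 also have "\<dots> = b * (4 * cumbound 2 + (1 + 8 * mom8))"
  using b by (simp add: field_simps power2_eq_square)
 finally show ?thesis by (simp add: Z_def)
qed

lemma abs_mm_le: "block_design b N w ==> S \<subseteq> {..<8} ==> \<bar>mm S b w t s\<bar> \<le> 1 + 8 * mom8"
 unfolding mm_def using sub8[of S] by (intro abs_mom_bound) (auto simp: block_design_def)

text \<open>By stationarity the moments within one block do not depend on \<open>t\<close> and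
  \<open>s\<close> and leave the sum. A single statistic has mean zero, so \<open>cc\<close> is an
  expectation linear in it, and the sum over \<open>t\<close> telescopes.\<close>

lemma Negk_left:
 assumes x: "x < 4" and W: "W \<subseteq> {4..<8}" and U: "U \<subseteq> {..<4}" and V: "V \<subseteq> {4..<8}"
 shows "Negk (\<lambda>b w t s. mm U b w t s * mm V b w t s * cc {x} W b w t s)"
 unfolding Negk_def
proof (intro exI[of _ "(1 + 8 * mom8)\<^sup>2 * (4 * cumbound 2 + (1 + 8 * mom8))"] allI impI)
 fix b N w assume v: "block_design b N w"
 let ?c = "mm U b w 0 0 * mm V b w 0 0"
 have cc: "cc {x} W b w t s = \<E> (\<lambda>om. lin (w x) b t om * (\<Prod>i\<in>W. lin (w i) b s om))" for t s
  unfolding cc_def using mm_split(1)[of "{x}" W b w t s] x W by simp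
 have c: "\<bar>?c\<bar> \<le> (1 + 8 * mom8)\<^sup>2"
  unfolding abs_mult power2_eq_square
  using abs_mm_le[OF v sub48(1)[OF U]] abs_mm_le[OF v sub48(2)[OF V]] mom8_nonneg by (intro mult_mono) auto
 have "(\<Sum>t=1..N. \<Sum>s=1..N. mm U b w t s * mm V b w t s * cc {x} W b w t s) =
   ?c * (\<Sum>t=1..N. \<Sum>s=1..N. cc {x} W b w t s)"
  unfolding mm_const_left[OF U, of b w "Suc _"] sum_distrib_left
  by (intro sum.cong refl) (metis mm_const_left[OF U] mm_const_right[OF V])
 also have "(\<Sum>t=1..N. \<Sum>s=1..N. cc {x} W b w t s) = (\<Sum>s=1..N. \<Sum>t=1..N. cc {x} W b w t s)"
  by (rule sum.swap)
 finally have "\<bar>\<Sum>t=1..N. \<Sum>s=1..N. mm U b w t s * mm V b w t s * cc {x} W b w t s\<bar> =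
   \<bar>?c\<bar> * \<bar>\<Sum>s=1..N. \<Sum>t=1..N. cc {x} W b w t s\<bar>" by (simp add: abs_mult)
 also have "\<dots> \<le> (1 + 8 * mom8)\<^sup>2 * (\<Sum>s=1..N. b * (4 * cumbound 2 + (1 + 8 * mom8)))"
  unfolding cc using card_le4(2)[OF W]
  by (intro mult_mono c order_trans[OF sum_abs] sum_mono lin_sum_prod_bound[OF v]) auto
 also have "\<dots> = (1 + 8 * mom8)\<^sup>2 * (4 * cumbound 2 + (1 + 8 * mom8)) * (real N * real b)"
  by (simp add: mult_ac)
 finally show "\<bar>\<Sum>t=1..N. \<Sum>s=1..N. mm U b w t s * mm V b w t s * cc {x} W b w t s\<bar> \<le>
  (1 + 8 * mom8)\<^sup>2 * (4 * cumbound 2 + (1 + 8 * mom8)) * (real N * real b)" .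
qed

lemma Negk_right:
 assumes y: "y \<in> {4..<8}" and T: "T \<subseteq> {..<4}" and U: "U \<subseteq> {..<4}" and V: "V \<subseteq> {4..<8}"
 shows "Negk (\<lambda>b w t s. mm U b w t s * mm V b w t s * cc T {y} b w t s)"
 unfolding Negk_def
proof (intro exI[of _ "(1 + 8 * mom8)\<^sup>2 * (4 * cumbound 2 + (1 + 8 * mom8))"] allI impI)
 fix b N w assume v: "block_design b N w"
 let ?c = "mm U b w 0 0 * mm V b w 0 0"
 have cc: "cc T {y} b w t s = \<E> (\<lambda>om. lin (w y) b s om * (\<Prod>i\<in>T. lin (w i) b t om))" for t s
  unfolding cc_def using mm_split(1)[of T "{y}" b w t s] y T by (simp add: mult.commute)
 have c: "\<bar>?c\<bar> \<le> (1 + 8 * mom8)\<^sup>2"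
  unfolding abs_mult power2_eq_square
  using abs_mm_le[OF v sub48(1)[OF U]] abs_mm_le[OF v sub48(2)[OF V]] mom8_nonneg by (intro mult_mono) auto
 have "(\<Sum>t=1..N. \<Sum>s=1..N. mm U b w t s * mm V b w t s * cc T {y} b w t s) =
   ?c * (\<Sum>t=1..N. \<Sum>s=1..N. cc T {y} b w t s)"
  unfolding sum_distrib_left
  by (intro sum.cong refl) (metis mm_const_left[OF U] mm_const_right[OF V])
 then have "\<bar>\<Sum>t=1..N. \<Sum>s=1..N. mm U b w t s * mm V b w t s * cc T {y} b w t s\<bar> =
   \<bar>?c\<bar> * \<bar>\<Sum>t=1..N. \<Sum>s=1..N. cc T {y} b w t s\<bar>" by (simp add: abs_mult)
 also have "\<dots> \<le> (1 + 8 * mom8)\<^sup>2 * (\<Sum>t=1..N. b * (4 * cumbound 2 + (1 + 8 * mom8)))"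
  unfolding cc using card_le4(1)[OF T]
  by (intro mult_mono c order_trans[OF sum_abs] sum_mono lin_sum_prod_bound[OF v]) auto
 also have "\<dots> = (1 + 8 * mom8)\<^sup>2 * (4 * cumbound 2 + (1 + 8 * mom8)) * (real N * real b)"
  by (simp add: mult_ac)
 finally show "\<bar>\<Sum>t=1..N. \<Sum>s=1..N. mm U b w t s * mm V b w t s * cc T {y} b w t s\<bar> \<le>
  (1 + 8 * mom8)\<^sup>2 * (4 * cumbound 2 + (1 + 8 * mom8)) * (real N * real b)" .
qed

end

text \<open>Cauchy-Schwarz over the \<open>N * N\<close> pairs. The bound \<open>r\<close> on the
  weights survives as a factor; later it carries the decay of correlations between different
  frequencies.\<close>

lemma L2k_weighted:
 assumes "L2k a"
 shows "\<exists>C\<ge>0. \<forall>b N w r g. block_design b N w \<longrightarrow> r \<ge> 0 \<longrightarrow> (\<forall>t s. \<bar>g t s\<bar> \<le> r) \<longrightarrow>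
   \<bar>\<Sum>t=1..N. \<Sum>s=1..N. g t s * a b w t s\<bar> \<le> C * (r * real N * sqrt (real N * real b))"
proof -
 obtain C where
  C: "\<And>b N w. block_design b N w ==> (\<Sum>t=1..N. \<Sum>s=1..N. (a b w t s)\<^sup>2) \<le> C * (real N * real b)"
  using assms unfolding L2k_def by blast
 show ?thesis
 proof (intro exI[of _ "sqrt \<bar>C\<bar>"] conjI allI impI)
  fix b N w r and g :: "nat => nat => real"
  assume v: "block_design b N w" and r: "r \<ge> 0" and "\<forall>t s. \<bar>g t s\<bar> \<le> r"
  then have g: "\<And>t s. \<bar>g t s\<bar> \<le> r" by simp
  let ?T = "\<Sum>p\<in>{1..N} \<times> {1..N}. \<bar>a b w (fst p) (snd p)\<bar>"
  have T0: "?T \<ge> 0" by (intro sum_nonneg) simp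
  have "?T\<^sup>2 \<le> (\<Sum>p\<in>{1..N} \<times> {1..N}. \<bar>a b w (fst p) (snd p)\<bar>\<^sup>2) * card ({1..N} \<times> {1..N})"
   by (rule sum_squared_le_sum_of_squares)
  also have "(\<Sum>p\<in>{1..N} \<times> {1..N}. \<bar>a b w (fst p) (snd p)\<bar>\<^sup>2) = (\<Sum>t=1..N. \<Sum>s=1..N. (a b w t s)\<^sup>2)"
   unfolding sum.cartesian_product by (simp add: case_prod_unfold)
  also have "(\<Sum>t=1..N. \<Sum>s=1..N. (a b w t s)\<^sup>2) * card ({1..N} \<times> {1..N}) \<le>
    (C * (real N * real b)) * card ({1..N} \<times> {1..N})"
   by (intro mult_right_mono C v) simp
  also have "\<dots> \<le> \<bar>C\<bar> * (real N * real b) * (real N)\<^sup>2"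
   by (auto simp: card_cartesian_product power2_eq_square intro!: mult_right_mono)
  finally have "?T \<le> sqrt (\<bar>C\<bar> * (real N * real b) * (real N)\<^sup>2)" by (rule real_le_rsqrt)
  then have T: "?T \<le> sqrt \<bar>C\<bar> * (N * sqrt (real N * real b))"
   by (simp add: real_sqrt_mult mult_ac)
  have "\<bar>\<Sum>t=1..N. \<Sum>s=1..N. g t s * a b w t s\<bar> \<le> (\<Sum>t=1..N. \<Sum>s=1..N. \<bar>g t s * a b w t s\<bar>)"
   by (intro order_trans[OF sum_abs] sum_mono sum_abs)
  also have "\<dots> \<le> (\<Sum>t=1..N. \<Sum>s=1..N. r * \<bar>a b w t s\<bar>)"
   unfolding abs_mult by (intro sum_mono mult_right_mono g) simp
  also have "\<dots> = r * ?T"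
   unfolding sum.cartesian_product by (simp add: case_prod_unfold sum_distrib_left)
  also have "\<dots> \<le> r * (sqrt \<bar>C\<bar> * (N * sqrt (real N * real b)))" by (intro mult_left_mono T r)
  finally show "\<bar>\<Sum>t=1..N. \<Sum>s=1..N. g t s * a b w t s\<bar> \<le> sqrt \<bar>C\<bar> * (r * real N * sqrt (real N * real b))"
   by (simp add: mult_ac)
 qed simp
qed

lemma sum_Pow4:
 fixes f :: "nat set => real"
 shows "(\<Sum>B\<in>Pow {4,5,6,7} - {{}}. f B) =
  f {4} + f {5} + f {6} + f {7}
  + (f {4,5} + f {4,6} + f {4,7} + f {5,6} + f {5,7} + f {6,7})
  + (f {4,5,6} + f {4,5,7} + f {4,6,7} + f {5,6,7}) + f {4,5,6,7}"
proof -
 have "(\<Sum>B\<in>Pow {4,5,6,7} - {{}}. f B) = (\<Sum>B\<in>Pow {4,5,6,7}. f B) - f {}"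
  by (subst sum_diff1) auto
 then show ?thesis by (simp add: sum_Pow_insert)
qed

section \<open>Covariances of products of two centred squares\<close>

context spec_process
begin

abbreviation "S1 \<equiv> {0,1,2,3::nat}"
abbreviation "S2 \<equiv> {4,5,6,7::nat}"

lemma S12: "S1 \<subseteq> {..<4}" "S2 \<subseteq> {4..<8}" "S1 \<union> S2 = {..<8}" by auto

text \<open>The eighth-order cumulant is the one cumulant joining all points of both blocks, and its
  summability over the lags applies directly.\<close>

lemma L1k_kk8: "L1k (kk (S1 \<union> S2))"
 unfolding L1k_def
proof (intro exI[of _ "cumbound 8"] allI impI)
 fix b N w assume v: "block_design b N w"
 have w: "\<And>i u. \<bar>w i u\<bar> \<le> 1" and b: "b \<ge> 1" using v by (auto simp: block_design_def)
 have r: "(\<Sum>s=1..N. \<bar>kk {..<8} b w t s\<bar>) \<le> b * cumbound 8" for t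
 proof -
  have "(\<Sum>s=1..N. \<bar>kk {..<8} b w t s\<bar>) \<le> (1 / sqrt b) ^ 8 * ((real b)\<^sup>2 * cumbound 8)"
   using sum_kappa_lin_le[OF w b cumsummable8, where T = "{..<4}" and N = N and t = t] by (simp add: kk_def)
  also have "(1 / sqrt b) ^ 8 = ((1 / sqrt b)\<^sup>2) ^ 4" by (simp flip: power_mult)
  also have "\<dots> * ((real b)\<^sup>2 * cumbound 8) = 1 / (real b)\<^sup>2 * cumbound 8"
   using b by (simp add: power_divide) (simp add: field_simps eval_nat_numeral)
  also have "\<dots> \<le> b * cumbound 8"
  proof (intro mult_right_mono cumbound_nonneg)
   have "1 / (real b)\<^sup>2 \<le> 1" using b by (simp add: divide_le_eq)
   then show "1 / (real b)\<^sup>2 \<le> b" using b by linarith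
  qed
  finally show ?thesis .
 qed
 have "(\<Sum>t=1..N. \<Sum>s=1..N. \<bar>kk (S1 \<union> S2) b w t s\<bar>) \<le> (\<Sum>t=1..N. b * cumbound 8)"
  unfolding S12(3) by (intro sum_mono r)
 then show "(\<Sum>t=1..N. \<Sum>s=1..N. \<bar>kk (S1 \<union> S2) b w t s\<bar>) \<le> cumbound 8 * (real N * real b)"
  by (simp add: mult_ac)
qed

lemma Negk_cong: "Negk a ==> (\<And>b w t s. a' b w t s = a b w t s) ==> Negk a'"
proof -
 assume "Negk a" "\<And>b w t s. a' b w t s = a b w t s"
 moreover from this have "a' = a" by (intro ext)
 ultimately show ?thesis by simp
qed

lemma Negk_singL:
 assumes "W \<subseteq> {4..<8}" "V \<subseteq> {4..<8}"
 shows "Negk (\<lambda>b w t s. mm V b w t s * singL W b w t s)"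
proof -
 have "Negk (\<lambda>b w t s. mm {1,2,3} b w t s * mm V b w t s * cc {0} W b w t s
   + mm {0,2,3} b w t s * mm V b w t s * cc {1} W b w t s
   + mm {0,1,3} b w t s * mm V b w t s * cc {2} W b w t s
   + mm {0,1,2} b w t s * mm V b w t s * cc {3} W b w t s)"
  using assms by (intro Negk_add Negk_left) auto
 then show ?thesis by (rule Negk_cong) (simp add: singL_def algebra_simps)
qed

text \<open>For two points in \<open>W\<close> the sum \<open>Rk\<close> is exactly the sixth-order
  cumulant, because means of single points vanish. So \<open>cc4_decomp\<close> trades this
  cumulant, whose series is not controlled, for a covariance.\<close>

lemma kk_pair_term:
 assumes yz: "y \<in> {4..<8}" "z \<in> {4..<8}" "y \<noteq> z" and V: "V \<subseteq> {4..<8}"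
 shows "Negk (\<lambda>b w t s. mm V b w t s * kk (S1 \<union> {y,z}) b w t s - mm V b w t s * cc S1 {y,z} b w t s)"
proof -
 have W: "{y,z} \<subseteq> {4..<8}" using yz by auto
 have BdV: "Bdk (mm V)" using V sub48 by (intro Bdk_mm) auto
 have set: "Pow {y,z} - {{}} = {{y},{z},{y,z}}" using yz by auto
 have sum: "(\<Sum>B\<in>Pow {y,z} - {{}}. f B) = f {y} + f {z} + f {y,z}" for f :: "nat set => real"
  unfolding set using yz by (simp add: doubleton_eq_iff)
 have d: "{y,z} - {y} = {z}" "{y,z} - {z} = {y}" "{y,z} - {y,z} = {}" using yz by auto
 have R: "Rk S1 {} {y,z} b w t s = kk (S1 \<union> {y,z}) b w t s" for b w t s
  unfolding Rk_def sum d Un_empty_left mm_single mm_empty by simp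
 have P: "L1k (pairsL {y,z})"
 proof -
  have "L1k (\<lambda>b w t s. cc {2,3} {y,z} b w t s * mm {0,1} b w t s + cc {0,1} {y,z} b w t s * mm {2,3} b w t s
   + cc {1,3} {y,z} b w t s * mm {0,2} b w t s + cc {0,2} {y,z} b w t s * mm {1,3} b w t s
   + cc {1,2} {y,z} b w t s * mm {0,3} b w t s + cc {0,3} {y,z} b w t s * mm {1,2} b w t s)"
   using yz W by (intro L1k_add L1k_mult_Bdk L1k_cc Bdk_mm) auto
  then show ?thesis by (rule L1k_mono) (simp add: pairsL_def mult.commute)
 qed
 have "Negk (\<lambda>b w t s. - ((cc S1 {y,z} b w t s - (Rk S1 {} {y,z} b w t s + pairsL {y,z} b w t s + singL {y,z} b w t s)) * mm V b w t s)
   - pairsL {y,z} b w t s * mm V b w t s - mm V b w t s * singL {y,z} b w t s)"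
  by (intro Negk_diff Negk_uminus L1k_imp_Negk[OF L1k_mult_Bdk[OF cc4_decomp BdV]] L1k_imp_Negk[OF L1k_mult_Bdk[OF P BdV]]
    Negk_singL W V)
 then show ?thesis by (rule Negk_cong) (unfold R, simp add: algebra_simps)
qed

text \<open>Up to a summable remainder every term in the expansion of this fifth-order cumulant
  contains a statistic that stands alone on its side, so summation by parts controls the signed
  sum.\<close>

lemma kk_single_term:
 assumes y: "y \<in> {4..<8}" and V: "V \<subseteq> {4..<8}"
 shows "Negk (\<lambda>b w t s. mm V b w t s * kk (S1 \<union> {y}) b w t s)"
proof -
 have W: "{y} \<subseteq> {4..<8}" using y by auto
 have BdV: "Bdk (mm V)" using V sub48 by (intro Bdk_mm) auto
 have "Pow {y} - {{}} = {{y}}" by auto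
 then have R: "Rk S1 {} {y} b w t s = kk (S1 \<union> {y}) b w t s" for b w t s
  unfolding Rk_def by (simp only: sum.insert sum.empty finite.emptyI empty_iff not_False_eq_True Diff_cancel Un_empty_left mm_empty mult_1_right add_0_right)
 have P: "Negk (\<lambda>b w t s. mm {0,1} b w t s * mm V b w t s * cc {2,3} {y} b w t s
   + mm {2,3} b w t s * mm V b w t s * cc {0,1} {y} b w t s
   + mm {0,2} b w t s * mm V b w t s * cc {1,3} {y} b w t s
   + mm {1,3} b w t s * mm V b w t s * cc {0,2} {y} b w t s
   + mm {0,3} b w t s * mm V b w t s * cc {1,2} {y} b w t s
   + mm {1,2} b w t s * mm V b w t s * cc {0,3} {y} b w t s)"
  using y V by (intro Negk_add Negk_right) auto
 have c: "Negk (\<lambda>b w t s. mm {} b w t s * mm V b w t s * cc S1 {y} b w t s)"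
  using y V by (intro Negk_right) auto
 have "Negk (\<lambda>b w t s. mm {} b w t s * mm V b w t s * cc S1 {y} b w t s
   - (cc S1 {y} b w t s - (Rk S1 {} {y} b w t s + pairsL {y} b w t s + singL {y} b w t s)) * mm V b w t s
   - (mm {0,1} b w t s * mm V b w t s * cc {2,3} {y} b w t s
   + mm {2,3} b w t s * mm V b w t s * cc {0,1} {y} b w t s
   + mm {0,2} b w t s * mm V b w t s * cc {1,3} {y} b w t s
   + mm {1,3} b w t s * mm V b w t s * cc {0,2} {y} b w t s
   + mm {0,3} b w t s * mm V b w t s * cc {1,2} {y} b w t s
   + mm {1,2} b w t s * mm V b w t s * cc {0,3} {y} b w t s)
   - mm V b w t s * singL {y} b w t s)"
  by (intro Negk_diff c P L1k_imp_Negk[OF L1k_mult_Bdk[OF cc4_decomp BdV]] Negk_singL W V)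
 then show ?thesis by (rule Negk_cong) (unfold R pairsL_def mm_empty, simp add: algebra_simps)
qed

text \<open>In \<open>cc4_decomp\<close> for \<open>W = S2\<close> the sum \<open>Rk\<close>
  consists of cumulants joining \<open>S1\<close> to a part of \<open>S2\<close>. All four points
  give the eighth-order cumulant; three points leave a mean, which is zero; two points are traded
  for covariances, which build \<open>pairsR\<close>; one point is treated by telescoping.\<close>

lemma cc8_decomp: "Negk (\<lambda>b w t s. cc S1 S2 b w t s - (pairsL S2 b w t s + pairsR b w t s))"
proof -
 have R: "Rk S1 {} S2 b w t s = kk (S1 \<union> S2) b w t s
  + (mm {5,6,7} b w t s * kk (S1 \<union> {4}) b w t s + mm {4,6,7} b w t s * kk (S1 \<union> {5}) b w t s
    + mm {4,5,7} b w t s * kk (S1 \<union> {6}) b w t s + mm {4,5,6} b w t s * kk (S1 \<union> {7}) b w t s)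
  + (mm {6,7} b w t s * kk (S1 \<union> {4,5}) b w t s + mm {5,7} b w t s * kk (S1 \<union> {4,6}) b w t s
    + mm {5,6} b w t s * kk (S1 \<union> {4,7}) b w t s + mm {4,7} b w t s * kk (S1 \<union> {5,6}) b w t s
    + mm {4,6} b w t s * kk (S1 \<union> {5,7}) b w t s + mm {4,5} b w t s * kk (S1 \<union> {6,7}) b w t s)" for b w t s
 proof -
  have d: "S2 - {4} = {5,6,7}" "S2 - {5} = {4,6,7}" "S2 - {6} = {4,5,7}" "S2 - {7} = {4,5,6}"
   "S2 - {4,5} = {6,7}" "S2 - {4,6} = {5,7}" "S2 - {4,7} = {5,6}" "S2 - {5,6} = {4,7}"
   "S2 - {5,7} = {4,6}" "S2 - {6,7} = {4,5}" "S2 - {4,5,6} = {7}" "S2 - {4,5,7} = {6}"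
   "S2 - {4,6,7} = {5}" "S2 - {5,6,7} = {4}" "S2 - S2 = {}" by auto
  show ?thesis
   unfolding Rk_def sum_Pow4 d Un_empty_left mm_single mm_empty by (simp only: mult_ac add_ac mult_zero_left mult_zero_right add_0_left add_0_right mult_1_right mult_1_left)
 qed
 have "Negk (\<lambda>b w t s. (cc S1 S2 b w t s - (Rk S1 {} S2 b w t s + pairsL S2 b w t s + singL S2 b w t s))
  + mm {} b w t s * singL S2 b w t s + kk (S1 \<union> S2) b w t s
  + (mm {5,6,7} b w t s * kk (S1 \<union> {4}) b w t s + mm {4,6,7} b w t s * kk (S1 \<union> {5}) b w t s
    + mm {4,5,7} b w t s * kk (S1 \<union> {6}) b w t s + mm {4,5,6} b w t s * kk (S1 \<union> {7}) b w t s)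
  + ((mm {6,7} b w t s * kk (S1 \<union> {4,5}) b w t s - mm {6,7} b w t s * cc S1 {4,5} b w t s)
   + (mm {5,7} b w t s * kk (S1 \<union> {4,6}) b w t s - mm {5,7} b w t s * cc S1 {4,6} b w t s)
   + (mm {5,6} b w t s * kk (S1 \<union> {4,7}) b w t s - mm {5,6} b w t s * cc S1 {4,7} b w t s)
   + (mm {4,7} b w t s * kk (S1 \<union> {5,6}) b w t s - mm {4,7} b w t s * cc S1 {5,6} b w t s)
   + (mm {4,6} b w t s * kk (S1 \<union> {5,7}) b w t s - mm {4,6} b w t s * cc S1 {5,7} b w t s)
   + (mm {4,5} b w t s * kk (S1 \<union> {6,7}) b w t s - mm {4,5} b w t s * cc S1 {6,7} b w t s)))"
  by (intro Negk_add kk_pair_term kk_single_term L1k_imp_Negk[OF L1k_kk8] L1k_imp_Negk[OF cc4_decomp] Negk_singL) auto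
 then show ?thesis
  by (rule Negk_cong) (unfold R pairsR_def mm_empty, simp add: algebra_simps)
qed

text \<open>The covariance of two products of centred squares, multiplied out. Centring removes
  exactly the pairings \<open>{0,1}\<close>, \<open>{2,3}\<close>, \<open>{4,5}\<close> and
  \<open>{6,7}\<close> inside one weight from the expansion of \<open>cc S1 S2\<close>.\<close>

definition covk :: kernel where
 "covk b w t s = cc S1 S2 b w t s
   - mm {0,1} b w t s * cc {2,3} S2 b w t s - mm {2,3} b w t s * cc {0,1} S2 b w t s
   - mm {4,5} b w t s * cc S1 {6,7} b w t s - mm {6,7} b w t s * cc S1 {4,5} b w t s
   + mm {0,1} b w t s * mm {4,5} b w t s * cc {2,3} {6,7} b w t s
   + mm {0,1} b w t s * mm {6,7} b w t s * cc {2,3} {4,5} b w t s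
   + mm {2,3} b w t s * mm {4,5} b w t s * cc {0,1} {6,7} b w t s
   + mm {2,3} b w t s * mm {6,7} b w t s * cc {0,1} {4,5} b w t s"

text \<open>The pairings between the two different weights. Each carries a moment such as
  \<open>mm {0,2}\<close>, the correlation of the two statistics, which is small at different
  frequencies.\<close>

definition crossk :: kernel where
 "crossk b w t s =
   mm {0,2} b w t s * cc {1,3} S2 b w t s + mm {1,3} b w t s * cc {0,2} S2 b w t s
  + mm {0,3} b w t s * cc {1,2} S2 b w t s + mm {1,2} b w t s * cc {0,3} S2 b w t s
  + mm {4,6} b w t s * cc S1 {5,7} b w t s + mm {5,7} b w t s * cc S1 {4,6} b w t s
  + mm {4,7} b w t s * cc S1 {5,6} b w t s + mm {5,6} b w t s * cc S1 {4,7} b w t s"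

lemma covk_decomp: "Negk (\<lambda>b w t s. covk b w t s - crossk b w t s)"
proof -
 have "L1k (\<lambda>b w t s. cc {2,3} {6,7} b w t s * (mm {0,1} b w t s * mm {4,5} b w t s)
   + cc {2,3} {4,5} b w t s * (mm {0,1} b w t s * mm {6,7} b w t s)
   + cc {0,1} {6,7} b w t s * (mm {2,3} b w t s * mm {4,5} b w t s)
   + cc {0,1} {4,5} b w t s * (mm {2,3} b w t s * mm {6,7} b w t s))"
  by (intro L1k_add L1k_mult_Bdk L1k_cc Bdk_mult Bdk_mm) auto
 from Negk_add[OF cc8_decomp L1k_imp_Negk[OF this]] show ?thesis
  by (rule Negk_cong) (unfold covk_def crossk_def pairsL_def pairsR_def, simp add: algebra_simps)
qed

text \<open>The pairings in \<open>crossk\<close> are square-summable kernels weighted by a moment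
  of size at most \<open>r\<close> and are estimated by \<open>L2k_weighted\<close>; everything else
  has a signed sum of order \<open>N * b\<close>.\<close>

lemma covk_bound:
 obtains C where "C \<ge> 0"
  "\<And>b N w r. block_design b N w ==> r \<ge> 0 ==>
   (\<And>i j t s. i \<in> {0,1} ==> j \<in> {2,3} ==> \<bar>mm {i,j} b w t s\<bar> \<le> r \<and> \<bar>mm {i+4,j+4} b w t s\<bar> \<le> r) ==>
   \<bar>\<Sum>t=1..N. \<Sum>s=1..N. covk b w t s\<bar> \<le> C * (real N * real b + r * real N * sqrt (real N * real b))"
proof -
 obtain C0 where C0: "\<And>b N w. block_design b N w ==>
   \<bar>\<Sum>t=1..N. \<Sum>s=1..N. covk b w t s - crossk b w t s\<bar> \<le> C0 * (real N * real b)"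
  using covk_decomp unfolding Negk_def by blast
 have L: "L2k (cc {i,j} S2)" if "i < 4" "j < 4" "i \<noteq> j" for i j
  using that by (intro L2k_cc_left) auto
 have R: "L2k (cc S1 {i,j})" if "i \<in> {4..<8}" "j \<in> {4..<8}" "i \<noteq> j" for i j
  using that by (intro L2k_cc_right) auto
 define good where "good D a \<longleftrightarrow> D \<ge> 0 \<and> (\<forall>b N w r g. block_design b N w \<longrightarrow> r \<ge> 0 \<longrightarrow> (\<forall>t s. \<bar>g t s\<bar> \<le> r) \<longrightarrow>
   \<bar>\<Sum>t=1..N. \<Sum>s=1..N. g t s * a b w t s\<bar> \<le> D * (r * real N * sqrt (real N * real b)))" for D :: real and a :: kernel
 have ex: "\<exists>D. good D a" if "L2k a" for a
  unfolding good_def by (rule L2k_weighted[OF that])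
 obtain D1 where D1: "good D1 (cc {1,3} S2)" using ex[OF L[of 1 3]] by auto
 obtain D2 where D2: "good D2 (cc {0,2} S2)" using ex[OF L[of 0 2]] by auto
 obtain D3 where D3: "good D3 (cc {1,2} S2)" using ex[OF L[of 1 2]] by auto
 obtain D4 where D4: "good D4 (cc {0,3} S2)" using ex[OF L[of 0 3]] by auto
 obtain D5 where D5: "good D5 (cc S1 {5,7})" using ex[OF R[of 5 7]] by auto
 obtain D6 where D6: "good D6 (cc S1 {4,6})" using ex[OF R[of 4 6]] by auto
 obtain D7 where D7: "good D7 (cc S1 {5,6})" using ex[OF R[of 5 6]] by auto
 obtain D8 where D8: "good D8 (cc S1 {4,7})" using ex[OF R[of 4 7]] by auto
 note D = D1 D2 D3 D4 D5 D6 D7 D8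
 let ?D = "D1 + D2 + D3 + D4 + D5 + D6 + D7 + D8"
 have D0: "?D \<ge> 0" using D unfolding good_def by auto
 show thesis
 proof (rule that[of "\<bar>C0\<bar> + ?D"])
  show "\<bar>C0\<bar> + ?D \<ge> 0" using D0 by simp
  fix b N w r assume v: "block_design b N w" and r: "r \<ge> 0"
   and m: "\<And>i j t s. i \<in> {0,1} ==> j \<in> {2,3} ==> \<bar>mm {i,j} b w t s\<bar> \<le> r \<and> \<bar>mm {i+4,j+4} b w t s\<bar> \<le> r"
  let ?B = "r * real N * sqrt (real N * real b)"
  have B0: "?B \<ge> 0" using r by simp
  have use: "\<bar>\<Sum>t=1..N. \<Sum>s=1..N. g t s * a b w t s\<bar> \<le> D * ?B"
   if "good D a" "\<And>t s. \<bar>g t s\<bar> \<le> r" for D a g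
   using that(1)[unfolded good_def, THEN conjunct2, rule_format, OF v r that(2)] .
  have ms: "\<bar>mm {0,2} b w t s\<bar> \<le> r" "\<bar>mm {1,3} b w t s\<bar> \<le> r" "\<bar>mm {0,3} b w t s\<bar> \<le> r" "\<bar>mm {1,2} b w t s\<bar> \<le> r"
   "\<bar>mm {4,6} b w t s\<bar> \<le> r" "\<bar>mm {5,7} b w t s\<bar> \<le> r" "\<bar>mm {4,7} b w t s\<bar> \<le> r" "\<bar>mm {5,6} b w t s\<bar> \<le> r" for t s
   using m[of 0 2 t s] m[of 1 3 t s] m[of 0 3 t s] m[of 1 2 t s] by auto
  have split: "(\<Sum>t=1..N. \<Sum>s=1..N. crossk b w t s) =
    (\<Sum>t=1..N. \<Sum>s=1..N. mm {0,2} b w t s * cc {1,3} S2 b w t s)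
   + (\<Sum>t=1..N. \<Sum>s=1..N. mm {1,3} b w t s * cc {0,2} S2 b w t s)
   + (\<Sum>t=1..N. \<Sum>s=1..N. mm {0,3} b w t s * cc {1,2} S2 b w t s)
   + (\<Sum>t=1..N. \<Sum>s=1..N. mm {1,2} b w t s * cc {0,3} S2 b w t s)
   + (\<Sum>t=1..N. \<Sum>s=1..N. mm {4,6} b w t s * cc S1 {5,7} b w t s)
   + (\<Sum>t=1..N. \<Sum>s=1..N. mm {5,7} b w t s * cc S1 {4,6} b w t s)
   + (\<Sum>t=1..N. \<Sum>s=1..N. mm {4,7} b w t s * cc S1 {5,6} b w t s)
   + (\<Sum>t=1..N. \<Sum>s=1..N. mm {5,6} b w t s * cc S1 {4,7} b w t s)"
   unfolding crossk_def sum.distrib ..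
  have tri: "\<bar>x1 + x2 + x3 + x4 + x5 + x6 + x7 + x8\<bar> \<le> y1 + y2 + y3 + y4 + y5 + y6 + y7 + y8"
   if "\<bar>x1\<bar> \<le> y1" "\<bar>x2\<bar> \<le> y2" "\<bar>x3\<bar> \<le> y3" "\<bar>x4\<bar> \<le> y4" "\<bar>x5\<bar> \<le> y5" "\<bar>x6\<bar> \<le> y6" "\<bar>x7\<bar> \<le> y7" "\<bar>x8\<bar> \<le> y8"
   for x1 x2 x3 x4 x5 x6 x7 x8 y1 y2 y3 y4 y5 y6 y7 y8 :: real
   using that by linarith
  have cr: "\<bar>\<Sum>t=1..N. \<Sum>s=1..N. crossk b w t s\<bar> \<le> ?D * ?B"
   unfolding split distrib_right by (intro tri use D ms)
  have "\<bar>\<Sum>t=1..N. \<Sum>s=1..N. covk b w t s\<bar> \<le>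
   \<bar>\<Sum>t=1..N. \<Sum>s=1..N. covk b w t s - crossk b w t s\<bar> + \<bar>\<Sum>t=1..N. \<Sum>s=1..N. crossk b w t s\<bar>"
   by (simp add: sum_subtractf)
  also have "\<dots> \<le> \<bar>C0\<bar> * (real N * real b) + ?D * ?B"
   using C0[OF v] cr by (intro add_mono order_trans[OF C0[OF v]] mult_right_mono) auto
  also have "\<dots> \<le> (\<bar>C0\<bar> + ?D) * (real N * real b) + (\<bar>C0\<bar> + ?D) * ?B"
   by (rule add_mono[OF mult_right_mono mult_right_mono]) (use D0 B0 in auto)
  finally show "\<bar>\<Sum>t=1..N. \<Sum>s=1..N. covk b w t s\<bar> \<le> (\<bar>C0\<bar> + ?D) * (real N * real b + ?B)"
   by (simp add: distrib_left)
 qed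
qed

text \<open>By stationarity the expectation at block start 0 centres the squares at every
  \<open>t\<close>. Up to a constant factor, a product of two centred periodogram ordinates is a sum
  of four such terms.\<close>

definition qprod :: "(nat => real) => (nat => real) => nat => nat => 'a => real" where
 "qprod p q b t om = ((lin p b t om)\<^sup>2 - \<E> (\<lambda>om. (lin p b 0 om)\<^sup>2)) *
   ((lin q b t om)\<^sup>2 - \<E> (\<lambda>om. (lin q b 0 om)\<^sup>2))"

lemma qprod_cov:
 assumes pq: "\<And>u. \<bar>p u\<bar> \<le> 1" "\<And>u. \<bar>q u\<bar> \<le> 1" and b: "b \<ge> 1"
 defines "w \<equiv> \<lambda>i::nat. if i \<in> {0,1,4,5} then p else q"
 shows "\<E> (\<lambda>om. qprod p q b t om * qprod p q b s om)
   - \<E> (qprod p q b t) * \<E> (qprod p q b s) = covk b w t s"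
  and "integrable M (\<lambda>om. qprod p q b t om * qprod p q b s om)" "integrable M (qprod p q b t)"
proof -
 have w: "\<bar>w i u\<bar> \<le> 1" for i u using pq by (simp add: w_def)
 define Pr where "Pr U t om = (\<Prod>i\<in>U. lin (w i) b t om)" for U t om
 define a where "a = mm {0,1} b w 0 0"
 define c where "c = mm {2,3} b w 0 0"
 have ap: "a = \<E> (\<lambda>om. (lin p b 0 om)\<^sup>2)" "c = \<E> (\<lambda>om. (lin q b 0 om)\<^sup>2)"
  by (simp_all add: a_def c_def mm_def mom_def w_def power2_eq_square)
 have ac: "mm {0,1} b w t s = a" "mm {4,5} b w t s = a" "mm {2,3} b w t s = c" "mm {6,7} b w t s = c" for t s
 proof -
  show "mm {0,1} b w t s = a" unfolding a_def by (rule mm_const_left) auto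
  show "mm {2,3} b w t s = c" unfolding c_def by (rule mm_const_left) auto
  show "mm {4,5} b w t s = a"
   using mm_const_right[of "{4,5}" b w t s] by (auto simp: a_def mm_def mom_def w_def)
  show "mm {6,7} b w t s = c"
   using mm_const_right[of "{6,7}" b w t s] by (auto simp: c_def mm_def mom_def w_def)
 qed
 have intP: "integrable M (\<lambda>om. Pr U t om * Pr W s om)" "integrable M (Pr U t)"
  if "finite U" "card U \<le> 4" "finite W" "card W \<le> 4" for U W t s
 proof -
  have m: "Pr U t \<in> borel_measurable M" for U t
   unfolding Pr_def[abs_def] using rv8_lin by (intro borel_measurable_prod) (auto simp: rv8_def)
  have sq: "integrable M (\<lambda>om. (Pr U t om)\<^sup>2)" if "finite U" "card U \<le> 4" for U t
   unfolding Pr_def using prod_lin_square(1)[where w = w and \<tau> = "\<lambda>_. t", OF that w b] .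
  show "integrable M (\<lambda>om. Pr U t om * Pr W s om)"
   by (intro integrable_mult_squares m sq that)
  show "integrable M (Pr U t)"
   unfolding Pr_def[abs_def] using that by (intro rv8_prod_integrable rv8_lin) auto
 qed
 \<comment> \<open>Multiplying out the two centred factors gives four terms with coefficients
   \<open>\<alpha>\<close>. Writing the product at \<open>t\<close> with indices below 4 and the one
   at \<open>s\<close> with indices from 4 on turns the covariance into a combination of
   \<open>cc\<close>.\<close>
 define I where "I = {0,1,2,3::nat}"
 define \<alpha> where "\<alpha> i = [1, - a, - c, a * c] ! i" for i
 define UL where "UL i = [{0,1,2,3}, {2,3}, {0,1}, {}::nat set] ! i" for i
 define UR where "UR i = [{4,5,6,7}, {6,7}, {4,5}, {}::nat set] ! i" for i
 have UL: "UL i \<subseteq> {..<4}" "finite (UL i)" "card (UL i) \<le> 4" if "i \<in> I" for i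
  using that by (auto simp: UL_def I_def)
 have UR: "UR i \<subseteq> {4..<8}" "finite (UR i)" "card (UR i) \<le> 4" if "i \<in> I" for i
  using that by (auto simp: UR_def I_def)
 have qL: "qprod p q b t om = (\<Sum>i\<in>I. \<alpha> i * Pr (UL i) t om)" for t om
  unfolding qprod_def ap[symmetric] by (simp add: I_def \<alpha>_def UL_def Pr_def w_def power2_eq_square algebra_simps)
 have qR: "qprod p q b t om = (\<Sum>i\<in>I. \<alpha> i * Pr (UR i) t om)" for t om
  unfolding qprod_def ap[symmetric] by (simp add: I_def \<alpha>_def UR_def Pr_def w_def power2_eq_square algebra_simps)
 have qq: "qprod p q b t om * qprod p q b s om = (\<Sum>i\<in>I. \<Sum>j\<in>I. \<alpha> i * \<alpha> j * (Pr (UL i) t om * Pr (UR j) s om))" for om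
  unfolding qL[of t] qR[of s] sum_product by (intro sum.cong refl) (simp add: mult_ac)
 show int2: "integrable M (\<lambda>om. qprod p q b t om * qprod p q b s om)"
  unfolding qq by (intro Bochner_Integration.integrable_sum Bochner_Integration.integrable_mult_right intP UL UR)
 have int1: "integrable M (qprod p q b t)" for t
  using intP(2)[of _ "{}"] UL unfolding qL[abs_def]
  by (intro Bochner_Integration.integrable_sum Bochner_Integration.integrable_mult_right) auto
 then show "integrable M (qprod p q b t)" .
 have e1: "\<E> (qprod p q b t) = (\<Sum>i\<in>I. \<alpha> i * mm (UL i) b w t s)"
 proof -
  have "\<E> (qprod p q b t) = (\<Sum>i\<in>I. \<alpha> i * \<E> (Pr (UL i) t))"
   unfolding qL[abs_def] using intP(2)[of _ "{}"] UL
   by (subst Bochner_Integration.integral_sum) (auto intro!: sum.cong)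
  then show ?thesis using mm_split(2)[OF UL(1), of _ "{}" b w t s] by (simp add: Pr_def[abs_def])
 qed
 have e2: "\<E> (qprod p q b s) = (\<Sum>i\<in>I. \<alpha> i * mm (UR i) b w t s)"
 proof -
  have "\<E> (qprod p q b s) = (\<Sum>i\<in>I. \<alpha> i * \<E> (Pr (UR i) s))"
   unfolding qR[abs_def] using intP(2)[of _ "{}"] UR
   by (subst Bochner_Integration.integral_sum) (auto intro!: sum.cong)
  then show ?thesis using mm_split(3)[OF _ UR(1), of "{}" _ b w t s] by (simp add: Pr_def[abs_def])
 qed
 have e12: "\<E> (\<lambda>om. qprod p q b t om * qprod p q b s om) =
   (\<Sum>i\<in>I. \<Sum>j\<in>I. \<alpha> i * \<alpha> j * mm (UL i \<union> UR j) b w t s)"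
 proof -
  have "\<E> (\<lambda>om. qprod p q b t om * qprod p q b s om) =
   (\<Sum>i\<in>I. \<Sum>j\<in>I. \<alpha> i * \<alpha> j * \<E> (\<lambda>om. Pr (UL i) t om * Pr (UR j) s om))"
  proof -
   have h: "integrable M (\<lambda>om. Pr (UL i) t om * Pr (UR j) s om)" if "i \<in> I" "j \<in> I" for i j
    using that by (intro intP UL UR)
   show ?thesis unfolding qq by (simp add: h)
  qed
  then show ?thesis using mm_split(1)[OF UL(1) UR(1)] by (simp add: Pr_def[abs_def])
 qed
 have "\<E> (\<lambda>om. qprod p q b t om * qprod p q b s om)
   - \<E> (qprod p q b t) * \<E> (qprod p q b s) =
   (\<Sum>i\<in>I. \<Sum>j\<in>I. \<alpha> i * \<alpha> j * cc (UL i) (UR j) b w t s)"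
  unfolding e1 e2 e12 sum_product sum_subtractf[symmetric]
  by (intro sum.cong refl) (simp add: cc_def algebra_simps)
 also have "\<dots> = covk b w t s"
  by (simp add: I_def \<alpha>_def UL_def UR_def covk_def ac[unfolded One_nat_def] ac algebra_simps)
 finally show "\<E> (\<lambda>om. qprod p q b t om * qprod p q b s om)
   - \<E> (qprod p q b t) * \<E> (qprod p q b s) = covk b w t s" .
qed

text \<open>The correlation bound \<open>r\<close> decides the rate: \<open>sqrt (b / N)\<close> if
  \<open>r\<close> is merely bounded, but \<open>b / N\<close> for nearly uncorrelated
  statistics.\<close>

lemma qprod_avg_variance:
 obtains C where "C \<ge> 0"
  "\<And>b N p q r. 1 \<le> b ==> b \<le> N ==> (\<And>u. \<bar>p u\<bar> \<le> 1) ==> (\<And>u. \<bar>q u\<bar> \<le> 1) ==>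
   (\<Sum>u=1..b. p u) = 0 ==> (\<Sum>u=1..b. q u) = 0 ==>
   \<bar>\<E> (\<lambda>om. lin p b 0 om * lin q b 0 om)\<bar> \<le> r ==>
   \<E> (\<lambda>om. ((\<Sum>t=1..N. qprod p q b t om) / N - \<E> (qprod p q b 0))\<^sup>2) \<le>
    C * (b / N + r * sqrt (b / N))"
proof -
 obtain C where C: "C \<ge> 0"
  "\<And>b N w r. block_design b N w ==> r \<ge> 0 ==>
   (\<And>i j t s. i \<in> {0,1} ==> j \<in> {2,3} ==> \<bar>mm {i,j} b w t s\<bar> \<le> r \<and> \<bar>mm {i+4,j+4} b w t s\<bar> \<le> r) ==>
   \<bar>\<Sum>t=1..N. \<Sum>s=1..N. covk b w t s\<bar> \<le> C * (real N * real b + r * real N * sqrt (real N * real b))"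
  using covk_bound by metis
 show thesis
 proof (rule that[OF C(1)])
  fix b N p q r assume b: "1 \<le> b" "b \<le> N" and pq: "\<And>u. \<bar>p u\<bar> \<le> 1" "\<And>u. \<bar>q u\<bar> \<le> 1"
   and z: "(\<Sum>u=1..b. p u) = 0" "(\<Sum>u=1..b. q u) = 0"
   and r: "\<bar>\<E> (\<lambda>om. lin p b 0 om * lin q b 0 om)\<bar> \<le> r"
  define w where "w i = (if i \<in> {0,1,4,5::nat} then p else q)" for i
  have v: "block_design b N w" using b pq z by (auto simp: block_design_def w_def)
  have r0: "r \<ge> 0" using r by linarith
  have N: "real N > 0" using b by simp
  have bd: "\<bar>mm {i,j} b w t s\<bar> \<le> r \<and> \<bar>mm {i+4,j+4} b w t s\<bar> \<le> r" if ij: "i \<in> {0,1}" "j \<in> {2,3}" for i j t s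
  proof
   have "mm {i,j} b w t s = mm {i,j} b w 0 0" using ij by (intro mm_const_left) auto
   also have "\<bar>\<dots>\<bar> \<le> r" using ij r by (auto simp: mm_def mom_def w_def)
   finally show "\<bar>mm {i,j} b w t s\<bar> \<le> r" .
   have "mm {i+4,j+4} b w t s = mm {i+4,j+4} b w 0 0" using ij by (intro mm_const_right) auto
   also have "\<bar>\<dots>\<bar> \<le> r" using ij r by (auto simp: mm_def mom_def w_def)
   finally show "\<bar>mm {i+4,j+4} b w t s\<bar> \<le> r" .
  qed
  define Q where "Q t = qprod p q b t" for t
  define e where "e = \<E> (Q 0)"
  have cov: "\<E> (\<lambda>om. Q t om * Q s om) - \<E> (Q t) * \<E> (Q s) = covk b w t s" for t s
   using qprod_cov(1)[where t = t and s = s, OF pq b(1)] unfolding Q_def w_def[abs_def] by simp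
  have i2: "integrable M (\<lambda>om. Q t om * Q s om)" and i1: "integrable M (Q t)" for t s
   using qprod_cov(2,3)[OF pq b(1)] unfolding Q_def by auto
  have et: "\<E> (Q t) = e" for t
  proof -
   have e0: "mm U b w t s = mm U b w 0 0" if "U \<subseteq> {..<4}" for U t s by (rule mm_const_left[OF that])
   have "\<E> (Q t) = mm {0,1,2,3} b w t 0 - \<E> (\<lambda>om. (lin p b 0 om)\<^sup>2) * mm {2,3} b w t 0
     - \<E> (\<lambda>om. (lin q b 0 om)\<^sup>2) * mm {0,1} b w t 0
     + \<E> (\<lambda>om. (lin p b 0 om)\<^sup>2) * \<E> (\<lambda>om. (lin q b 0 om)\<^sup>2)" for t
   proof -
    have j: "integrable M (\<lambda>om. \<Prod>i\<in>U. lin (w i) b t om)" if "U \<subseteq> {..<4}" for U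
     using card_le4(1)[OF that] by (intro rv8_prod_integrable rv8_lin) auto
    have eq: "Q t om = (\<Prod>i\<in>{0,1,2,3}. lin (w i) b t om) - \<E> (\<lambda>om. (lin p b 0 om)\<^sup>2) * (\<Prod>i\<in>{2,3}. lin (w i) b t om)
     - \<E> (\<lambda>om. (lin q b 0 om)\<^sup>2) * (\<Prod>i\<in>{0,1}. lin (w i) b t om)
     + \<E> (\<lambda>om. (lin p b 0 om)\<^sup>2) * \<E> (\<lambda>om. (lin q b 0 om)\<^sup>2)" for om
     by (simp add: Q_def qprod_def w_def power2_eq_square algebra_simps)
    show ?thesis unfolding eq[abs_def]
     using j[of "{0,1,2,3}"] j[of "{2,3}"] j[of "{0,1}"]
      mm_split(2)[of "{0,1,2,3}" "{}" b w t 0] mm_split(2)[of "{2,3}" "{}" b w t 0] mm_split(2)[of "{0,1}" "{}" b w t 0]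
     by (simp add: prob_space del: prod.insert)
   qed
   then show ?thesis unfolding e_def using e0[of "{0,1,2,3}" t 0] e0[of "{2,3}" t 0] e0[of "{0,1}" t 0] by simp
  qed
  have sq: "((\<Sum>t=1..N. Q t om) / N - e)\<^sup>2 = (\<Sum>t=1..N. \<Sum>s=1..N. (Q t om * Q s om) - e * Q t om - e * Q s om + e * e) / (real N)\<^sup>2" for om
  proof -
   have "(\<Sum>t=1..N. Q t om) / N - e = (\<Sum>t=1..N. Q t om - e) / N"
    using N by (simp add: sum_subtractf field_simps)
   then have "((\<Sum>t=1..N. Q t om) / N - e)\<^sup>2 = (\<Sum>t=1..N. \<Sum>s=1..N. (Q t om - e) * (Q s om - e)) / (real N)\<^sup>2"
    by (simp add: power_divide) (simp add: power2_eq_square sum_product)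
   then show ?thesis by (simp add: algebra_simps)
  qed
  have "\<E> (\<lambda>om. ((\<Sum>t=1..N. Q t om) / N - e)\<^sup>2) = (\<Sum>t=1..N. \<Sum>s=1..N. \<E> (\<lambda>om. Q t om * Q s om) - e * e) / (real N)\<^sup>2"
   unfolding sq using i1 i2 by (simp add: et prob_space)
  also have "\<dots> = (\<Sum>t=1..N. \<Sum>s=1..N. covk b w t s) / (real N)\<^sup>2"
   using cov by (simp add: et)
  also have "\<dots> \<le> C * (real N * real b + r * real N * sqrt (real N * real b)) / (real N)\<^sup>2"
  proof (intro divide_right_mono)
   have "\<bar>\<Sum>t=1..N. \<Sum>s=1..N. covk b w t s\<bar> \<le> C * (real N * real b + r * real N * sqrt (real N * real b))"
    by (rule C(2)[OF v r0]) (rule bd)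
   then show "(\<Sum>t=1..N. \<Sum>s=1..N. covk b w t s) \<le> C * (real N * real b + r * real N * sqrt (real N * real b))"
    by linarith
  qed simp
  also have "\<dots> = C * (b / N + r * sqrt (b / N))"
  proof -
   have s: "sqrt (real N * real b) / N = sqrt (b / N)"
   proof -
    have "sqrt (real N * real b) / N = sqrt (real N * real b) / sqrt ((real N)\<^sup>2)" by simp
    also have "\<dots> = sqrt (real N * real b / (real N)\<^sup>2)" by (simp only: real_sqrt_divide)
    also have "real N * real b / (real N)\<^sup>2 = b / N" using N by (simp add: power2_eq_square)
    finally show ?thesis .
   qed
   have "(real N * real b + r * real N * sqrt (real N * real b)) / (real N)\<^sup>2 = b / N + r * (sqrt (real N * real b) / N)"
    using N by (simp add: power2_eq_square add_divide_distrib)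
   then show ?thesis unfolding s times_divide_eq_right[symmetric] by simp
  qed
  finally show "\<E> (\<lambda>om. ((\<Sum>t=1..N. qprod p q b t om) / N - \<E> (qprod p q b 0))\<^sup>2) \<le>
    C * (b / N + r * sqrt (b / N))" unfolding Q_def e_def .
 qed
qed

end

section \<open>Trigonometric weights at the Fourier frequencies\<close>

lemma infsum_finite_sum:
 fixes f :: "'x => 'h => real"
 assumes "finite A" "\<And>x. x \<in> A ==> f x summable_on B"
 shows "(\<lambda>h. \<Sum>x\<in>A. f x h) summable_on B" "(\<Sum>\<^sub>\<infinity>h\<in>B. \<Sum>x\<in>A. f x h) = (\<Sum>x\<in>A. infsum (f x) B)"
 using assms
proof (induction A rule: finite_induct)
 case (insert x A)
 { case 1 then show ?case using insert by (auto intro!: summable_on_add) }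
 { case 2 then show ?case using insert by (auto simp: infsum_add) }
qed auto

lemma infsum_minus:
 fixes f g :: "'h => real"
 assumes "f summable_on B" "g summable_on B"
 shows "(\<lambda>h. f h - g h) summable_on B" "(\<Sum>\<^sub>\<infinity>h\<in>B. f h - g h) = infsum f B - infsum g B"
 using summable_on_add[OF assms(1), of "\<lambda>h. - g h"] infsum_add[OF assms(1), of "\<lambda>h. - g h"] assms(2)
 by (simp_all add: summable_on_uminus infsum_uminus)

lemma abs_cos_diff_le: "\<bar>cos u - cos v\<bar> \<le> \<bar>u - v\<bar>" for u v :: real
proof -
 have "\<bar>cos u - cos v\<bar> = 2 * \<bar>sin ((u + v) / 2)\<bar> * \<bar>sin ((v - u) / 2)\<bar>"
  by (simp add: cos_diff_cos abs_mult)
 also have "\<dots> \<le> 2 * 1 * \<bar>(v - u) / 2\<bar>"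
  by (intro mult_mono abs_sin_le_one abs_sin_x_le_abs_x) auto
 finally show ?thesis by (simp add: abs_minus_commute)
qed

text \<open>As for the Dirichlet kernel, multiplication by \<open>2 * sin (\<theta> / 2)\<close>
  telescopes the sum, and the two ends agree up to full turns. The assumption on \<open>q\<close>
  says that this factor is not zero.\<close>

lemma sum_cos_full_period:
 assumes b: "b \<ge> (1::nat)" and q: "\<not> int b dvd q"
 shows "(\<Sum>u=1..b. cos (2 * pi * of_int q / b * real u + c)) = 0"
proof -
 let ?t = "2 * pi * of_int q / b"
 have sn: "sin (?t / 2) \<noteq> 0"
 proof
  assume "sin (?t / 2) = 0"
  then obtain i where "?t / 2 = of_int i * pi" by (auto simp: sin_zero_iff_int2)
  then have "real_of_int q = of_int i * real b" using b by (simp add: field_simps)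
  also have "\<dots> = of_int (i * int b)" by simp
  finally have "q = i * int b" by (simp only: of_int_eq_iff)
  then show False using q by simp
 qed
 have tel: "2 * sin (\<theta> / 2) * (\<Sum>u=1..n. cos (\<theta> * real u + c)) = sin (\<theta> * (real n + 1 / 2) + c) - sin (\<theta> / 2 + c)" for n \<theta>
 proof (induction n)
  case (Suc n)
  have "sin (\<theta> * (real (Suc n) + 1 / 2) + c) - sin (\<theta> * (real n + 1 / 2) + c)
    = 2 * sin (\<theta> / 2) * cos (\<theta> * real (Suc n) + c)"
  proof -
   have "\<theta> * (real (Suc n) + 1 / 2) + c = (\<theta> * real (Suc n) + c) + \<theta> / 2"
    "\<theta> * (real n + 1 / 2) + c = (\<theta> * real (Suc n) + c) - \<theta> / 2"
    by (simp_all add: algebra_simps)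
   then show ?thesis by (simp only: sin_add sin_diff) (simp add: algebra_simps)
  qed
  moreover have "(\<Sum>u=1..Suc n. cos (\<theta> * real u + c)) = (\<Sum>u=1..n. cos (\<theta> * real u + c)) + cos (\<theta> * real (Suc n) + c)"
   by simp
  ultimately show ?case using Suc.IH by (simp only: distrib_left)
 qed simp
 have "?t * (real b + 1 / 2) + c = (?t / 2 + c) + 2 * pi * of_int q"
  using b by (simp add: field_simps)
 then have "sin (?t * (real b + 1 / 2) + c) = sin (?t / 2 + c)"
  by (simp only: sin_add[of "?t / 2 + c"] sin_int_2pin cos_int_2pin mult_1_right mult_zero_right add_0_right)
 then show ?thesis using tel[of ?t b] sn by simp
qed

text \<open>The phase \<open>- (pi / 2)\<close> turns the cosine into a sine, so one boolean covers
  both kinds of trigonometric weights.\<close>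

definition ph :: "bool => real" where "ph a = (if a then - (pi / 2) else 0)"

text \<open>Defined at all integers, because completing the lag sums evaluates the weight at
  positions \<open>u + h\<close> outside the block.\<close>

definition fwi :: "bool => int => nat => int => real" where
 "fwi a j b z = cos (ff j b * of_int z + ph a)"

definition fw :: "bool => int => nat => nat => real" where
 "fw a j b u = fwi a j b (int u)"

lemma abs_fw: "\<bar>fw a j b u\<bar> \<le> 1" by (simp add: fw_def fwi_def)

lemma sum_fw: "b \<ge> 1 ==> \<not> int b dvd j ==> (\<Sum>u=1..b. fw a j b u) = 0"
 using sum_cos_full_period[of b j "ph a"] by (simp add: fw_def fwi_def fourier_freq_def)

lemma fwi_product:
 "fwi a j b z * fwi c k b (z + h) =
  (cos (2 * pi * of_int (j + k) / b * of_int z + (ff k b * of_int h + ph a + ph c))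
   + cos (2 * pi * of_int (j - k) / b * of_int z + (ph a - ph c - ff k b * of_int h))) / 2"
proof -
 let ?A = "ff j b * of_int z + ph a" and ?B = "ff k b * of_int (z + h) + ph c"
 have "cos ?A * cos ?B = (cos (?A + ?B) + cos (?A - ?B)) / 2"
  by (simp add: cos_times_cos algebra_simps)
 also have "?A + ?B = 2 * pi * of_int (j + k) / b * of_int z + (ff k b * of_int h + ph a + ph c)"
  by (simp only: fourier_freq_def divide_inverse of_int_add) (simp only: algebra_simps)
 also have "?A - ?B = 2 * pi * of_int (j - k) / b * of_int z + (ph a - ph c - ff k b * of_int h)"
  by (simp only: fourier_freq_def divide_inverse of_int_add of_int_diff) (simp only: algebra_simps)
 finally show ?thesis by (simp only: fwi_def)
qed

text \<open>The product splits into a sum frequency and a difference frequency; each averages out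
  over the block unless its index is divisible by \<open>b\<close>.\<close>

lemma sum_fwi_product:
 assumes b: "b \<ge> 1" and d: "\<not> int b dvd j + k"
 shows "\<not> int b dvd j - k ==> (\<Sum>u=1..b. fwi a j b (int u) * fwi c k b (int u + h)) = 0"
  and "j = k ==> (\<Sum>u=1..b. fwi a j b (int u) * fwi c k b (int u + h)) =
   b / 2 * cos (ff j b * of_int h + (ph c - ph a))"
proof -
 have s: "(\<Sum>u=1..b. fwi a j b (int u) * fwi c k b (int u + h)) =
   ((\<Sum>u=1..b. cos (2 * pi * of_int (j + k) / b * real u + (ff k b * of_int h + ph a + ph c)))
   + (\<Sum>u=1..b. cos (2 * pi * of_int (j - k) / b * real u + (ph a - ph c - ff k b * of_int h)))) / 2"
  unfolding fwi_product by (simp add: sum.distrib sum_divide_distrib[symmetric])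
 have z: "(\<Sum>u=1..b. cos (2 * pi * of_int (j + k) / b * real u + (ff k b * of_int h + ph a + ph c))) = 0"
  by (rule sum_cos_full_period[OF b d])
 show "\<not> int b dvd j - k ==> (\<Sum>u=1..b. fwi a j b (int u) * fwi c k b (int u + h)) = 0"
  unfolding s z using sum_cos_full_period[OF b, of "j - k"] by simp
 show "(\<Sum>u=1..b. fwi a j b (int u) * fwi c k b (int u + h)) =
   b / 2 * cos (ff j b * of_int h + (ph c - ph a))" if "j = k"
 proof -
  have "cos (ph a - ph c - ff k b * of_int h) = cos (ff j b * of_int h + (ph c - ph a))"
   using cos_minus[of "ff j b * of_int h + (ph c - ph a)"] that by (simp add: algebra_simps)
  then show ?thesis unfolding s z using that by simp
 qed
qed

section \<open>The spectral density and the correlations of trigonometric statistics\<close>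

context spec_process
begin

abbreviation "acv \<equiv> autocov M X"
abbreviation "sd \<equiv> spectral_density M X"

definition acv0 :: real where "acv0 = (\<Sum>\<^sub>\<infinity>h. \<bar>acv h\<bar>)"
definition acv1 :: real where "acv1 = (\<Sum>\<^sub>\<infinity>h. \<bar>real_of_int h\<bar> * \<bar>acv h\<bar>)"

lemma acv_even: "acv (- h) = acv h"
 using expectation_XX[of 0 h] expectation_XX[of h 0] by (simp add: mult.commute)

lemma acv1_summable: "(\<lambda>h. \<bar>real_of_int h\<bar> * \<bar>acv h\<bar>) summable_on UNIV"
 by (rule summable_on_comparison_test[OF acov]) (auto simp: algebra_simps)

lemma acv0_nonneg: "acv0 \<ge> 0" unfolding acv0_def by (intro infsum_nonneg) simp
lemma acv1_nonneg: "acv1 \<ge> 0" unfolding acv1_def by (intro infsum_nonneg) simp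

lemma acv_weighted_summable:
 assumes "\<And>h. \<bar>g h\<bar> \<le> 1"
 shows "(\<lambda>h. acv h * g h) summable_on A"
proof -
 have "(\<lambda>h. norm (acv h * g h)) summable_on A"
 proof (rule summable_on_comparison_test)
  show "(\<lambda>h. \<bar>acv h\<bar>) summable_on A" by (rule summable_on_subset_banach[OF acov_abs]) simp
  show "norm (acv h * g h) \<le> \<bar>acv h\<bar>" for h
   using mult_left_mono[OF assms, of "\<bar>acv h\<bar>" h] by (simp add: abs_mult)
 qed auto
 then show ?thesis by (rule abs_summable_summable)
qed

lemma sd_eq: "sd l = (\<Sum>\<^sub>\<infinity>h. acv h * cos (of_int h * l)) / (2 * pi)"
proof -
 let ?f = "\<lambda>h. complex_of_real (acv h) * exp (- \<i> * of_int h * of_real l)"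
 have e: "exp (- \<i> * of_int h * of_real l) = cis (- (of_int h * l))" for h
  by (simp add: cis_conv_exp mult.assoc)
 have "(\<lambda>h. norm (?f h)) summable_on UNIV"
  using acov_abs unfolding e by (simp add: norm_mult)
 then have s: "?f summable_on UNIV" by (rule abs_summable_summable)
 have "sd l = Re (\<Sum>\<^sub>\<infinity>h. ?f h) / (2 * pi)"
 proof -
  have "Re (complex_of_real (1 / (2 * pi)) * S) = Re S / (2 * pi)" for S by simp
  then show ?thesis unfolding spectral_density_def .
 qed
 also have "Re (\<Sum>\<^sub>\<infinity>h. ?f h) = (\<Sum>\<^sub>\<infinity>h. Re (?f h))" by (rule infsum_Re[OF s, symmetric])
 also have "(\<Sum>\<^sub>\<infinity>h. Re (?f h)) = (\<Sum>\<^sub>\<infinity>h. acv h * cos (of_int h * l))"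
  unfolding e by (intro infsum_cong) (simp add: cis.sel)
 finally show ?thesis .
qed

lemma sd_even: "sd (- l) = sd l" by (simp add: sd_eq)

lemma acv_odd_sum: "(\<Sum>\<^sub>\<infinity>h. acv h * sin (of_int h * l)) = 0"
proof -
 have "(\<Sum>\<^sub>\<infinity>h. acv h * sin (of_int h * l)) = (\<Sum>\<^sub>\<infinity>h. acv (- h) * sin (of_int (- h) * l))"
  by (rule infsum_reindex_bij_betw[symmetric]) (auto intro!: bij_betwI[where g = uminus])
 also have "\<dots> = - (\<Sum>\<^sub>\<infinity>h. acv h * sin (of_int h * l))"
  by (simp add: acv_even infsum_uminus)
 finally show ?thesis by simp
qed

lemma abs_acv_sum_le:
 assumes "\<And>h. \<bar>g h\<bar> \<le> 1"
 shows "\<bar>\<Sum>\<^sub>\<infinity>h. acv h * g h\<bar> \<le> acv0"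
proof -
 have "norm (\<Sum>\<^sub>\<infinity>h. acv h * g h) \<le> (\<Sum>\<^sub>\<infinity>h. \<bar>acv h\<bar>)"
 proof (rule norm_infsum_le)
  show "((\<lambda>h. acv h * g h) has_sum (\<Sum>\<^sub>\<infinity>h. acv h * g h)) UNIV"
   using acv_weighted_summable[OF assms] by simp
  show "((\<lambda>h. \<bar>acv h\<bar>) has_sum (\<Sum>\<^sub>\<infinity>h. \<bar>acv h\<bar>)) UNIV" using acov_abs by simp
  show "norm (acv h * g h) \<le> \<bar>acv h\<bar>" for h
   using mult_left_mono[OF assms, of "\<bar>acv h\<bar>" h] by (simp add: abs_mult)
 qed
 then show ?thesis by (simp add: acv0_def)
qed

lemma sd_bound: "\<bar>sd l\<bar> \<le> acv0"
proof -
 have "\<bar>sd l\<bar> \<le> acv0 / (2 * pi)"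
  unfolding sd_eq using abs_acv_sum_le[of "\<lambda>h. cos (of_int h * l)"] by (simp add: divide_right_mono)
 also have "\<dots> \<le> acv0"
 proof -
  have "acv0 * 1 \<le> acv0 * (2 * pi)" using acv0_nonneg pi_gt3 by (intro mult_left_mono) auto
  then show ?thesis by (simp add: divide_le_eq)
 qed
 finally show ?thesis .
qed

lemma sd_lipschitz: "\<bar>sd x - sd y\<bar> \<le> acv1 * \<bar>x - y\<bar>"
proof -
 have s: "(\<lambda>h. acv h * cos (of_int h * l)) summable_on UNIV" for l
  by (intro acv_weighted_summable) simp
 have "norm (\<Sum>\<^sub>\<infinity>h. acv h * cos (of_int h * x) - acv h * cos (of_int h * y)) \<le> (\<Sum>\<^sub>\<infinity>h. \<bar>real_of_int h\<bar> * \<bar>acv h\<bar> * \<bar>x - y\<bar>)"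
 proof (rule norm_infsum_le)
  show "((\<lambda>h. acv h * cos (of_int h * x) - acv h * cos (of_int h * y)) has_sum
    (\<Sum>\<^sub>\<infinity>h. acv h * cos (of_int h * x) - acv h * cos (of_int h * y))) UNIV"
   using infsum_minus(1)[OF s s] by simp
  show "((\<lambda>h. \<bar>real_of_int h\<bar> * \<bar>acv h\<bar> * \<bar>x - y\<bar>) has_sum (\<Sum>\<^sub>\<infinity>h. \<bar>real_of_int h\<bar> * \<bar>acv h\<bar> * \<bar>x - y\<bar>)) UNIV"
   using summable_on_cmult_left[OF acv1_summable] by simp
  show "norm (acv h * cos (of_int h * x) - acv h * cos (of_int h * y)) \<le> \<bar>real_of_int h\<bar> * \<bar>acv h\<bar> * \<bar>x - y\<bar>" for h
  proof -
   have "\<bar>acv h\<bar> * \<bar>cos (of_int h * x) - cos (of_int h * y)\<bar> \<le> \<bar>acv h\<bar> * \<bar>of_int h * x - of_int h * y\<bar>"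
    by (intro mult_left_mono abs_cos_diff_le) simp
   moreover have "of_int h * x - of_int h * y = of_int h * (x - y)" by (simp add: algebra_simps)
   ultimately show ?thesis
    by (simp only: right_diff_distrib[symmetric] abs_mult real_norm_def) (simp add: mult_ac)
  qed
 qed
 also have "(\<Sum>\<^sub>\<infinity>h. acv h * cos (of_int h * x) - acv h * cos (of_int h * y)) = 2 * pi * (sd x - sd y)"
  unfolding infsum_minus(2)[OF s s] by (simp add: sd_eq diff_divide_distrib[symmetric])
 also have "(\<Sum>\<^sub>\<infinity>h. \<bar>real_of_int h\<bar> * \<bar>acv h\<bar> * \<bar>x - y\<bar>) = acv1 * \<bar>x - y\<bar>"
  unfolding acv1_def by (rule infsum_cmult_left')
 finally have "2 * pi * \<bar>sd x - sd y\<bar> \<le> acv1 * \<bar>x - y\<bar>" by (simp add: abs_mult)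
 moreover have "1 * \<bar>sd x - sd y\<bar> \<le> 2 * pi * \<bar>sd x - sd y\<bar>"
  using pi_gt3 by (intro mult_right_mono) auto
 ultimately show ?thesis unfolding mult_1 by (rule order_trans[rotated])
qed

text \<open>Replacing the lags available inside a block by all lags costs a constant, because lag \<open>h\<close>
 is missing for at most \<open>\<bar>h\<bar>\<close> positions.\<close>

lemma lag_sum_edge:
 assumes g: "\<And>u h. \<bar>g u h\<bar> \<le> 1"
 shows "\<bar>(\<Sum>u=1..b. \<Sum>v=1..b. acv (int v - int u) * g u (int v - int u))
   - (\<Sum>\<^sub>\<infinity>h. acv h * (\<Sum>u=1..b. g u h))\<bar> \<le> acv1"
proof -
 define H where "H u = {1 - int u..int b - int u}" for u :: nat
 have s: "(\<lambda>h. acv h * g u h) summable_on A" for u A by (rule acv_weighted_summable[OF g])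
 have fin: "(\<Sum>v=1..b. acv (int v - int u) * g u (int v - int u)) = (\<Sum>h\<in>H u. acv h * g u h)" for u
 proof (rule sum.reindex_bij_witness[where i = "\<lambda>h. nat (h + int u)" and j = "\<lambda>v. int v - int u"])
 qed (auto simp: H_def)
 have spl: "(\<Sum>\<^sub>\<infinity>h. acv h * g u h) = (\<Sum>h\<in>H u. acv h * g u h) + (\<Sum>\<^sub>\<infinity>h\<in>- H u. acv h * g u h)" for u
 proof -
  have "finite (H u)" by (simp add: H_def)
  then show ?thesis
   using infsum_Un_disjoint[OF s[of u "H u"] s[of u "- H u"]] by simp
 qed
 have tail: "\<bar>\<Sum>\<^sub>\<infinity>h\<in>- H u. acv h * g u h\<bar> \<le> (\<Sum>\<^sub>\<infinity>h. \<bar>acv h\<bar> * of_bool (h \<notin> H u))" for u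
 proof -
  have s1: "(\<lambda>h. \<bar>acv h\<bar>) summable_on A" for A by (rule summable_on_subset_banach[OF acov_abs]) simp
  have "norm (\<Sum>\<^sub>\<infinity>h\<in>- H u. acv h * g u h) \<le> (\<Sum>\<^sub>\<infinity>h\<in>- H u. \<bar>acv h\<bar>)"
  proof (rule norm_infsum_le)
   show "((\<lambda>h. acv h * g u h) has_sum (\<Sum>\<^sub>\<infinity>h\<in>- H u. acv h * g u h)) (- H u)" using s by simp
   show "((\<lambda>h. \<bar>acv h\<bar>) has_sum (\<Sum>\<^sub>\<infinity>h\<in>- H u. \<bar>acv h\<bar>)) (- H u)" using s1 by simp
   show "norm (acv h * g u h) \<le> \<bar>acv h\<bar>" for h
    using mult_left_mono[OF g, of "\<bar>acv h\<bar>" u h] by (simp add: abs_mult)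
  qed
  also have "(\<Sum>\<^sub>\<infinity>h\<in>- H u. \<bar>acv h\<bar>) = (\<Sum>\<^sub>\<infinity>h. \<bar>acv h\<bar> * of_bool (h \<notin> H u))"
   by (rule infsum_cong_neutral) auto
  finally show ?thesis by simp
 qed
 have sb: "(\<lambda>h. \<bar>acv h\<bar> * of_bool (h \<notin> H u)) summable_on UNIV" for u
  by (rule summable_on_comparison_test[OF acov_abs]) auto
 have "(\<Sum>\<^sub>\<infinity>h. acv h * (\<Sum>u=1..b. g u h)) = (\<Sum>u=1..b. \<Sum>\<^sub>\<infinity>h. acv h * g u h)"
  unfolding sum_distrib_left by (rule infsum_finite_sum(2)) (auto intro: s)
 then have "(\<Sum>u=1..b. \<Sum>v=1..b. acv (int v - int u) * g u (int v - int u))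
   - (\<Sum>\<^sub>\<infinity>h. acv h * (\<Sum>u=1..b. g u h)) = - (\<Sum>u=1..b. \<Sum>\<^sub>\<infinity>h\<in>- H u. acv h * g u h)"
  unfolding fin spl by (simp add: sum.distrib)
 also have "\<bar>\<dots>\<bar> \<le> (\<Sum>u=1..b. \<Sum>\<^sub>\<infinity>h. \<bar>acv h\<bar> * of_bool (h \<notin> H u))"
  unfolding abs_minus_cancel by (intro order_trans[OF sum_abs] sum_mono tail)
 also have "\<dots> = (\<Sum>\<^sub>\<infinity>h. \<Sum>u=1..b. \<bar>acv h\<bar> * of_bool (h \<notin> H u))"
  by (rule infsum_finite_sum(2)[symmetric]) (auto intro: sb)
 also have "\<dots> \<le> acv1"
  unfolding acv1_def
 proof (rule infsum_mono)
  show "(\<lambda>h. \<Sum>u=1..b. \<bar>acv h\<bar> * of_bool (h \<notin> H u)) summable_on UNIV"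
   by (rule infsum_finite_sum(1)) (auto intro: sb)
  show "(\<lambda>h. \<bar>real_of_int h\<bar> * \<bar>acv h\<bar>) summable_on UNIV" by (rule acv1_summable)
  fix h :: int
  have "(\<Sum>u=1..b. of_bool (h \<notin> H u) :: real) = real (card {u \<in> {1..b}. h \<notin> H u})"
   by (simp add: sum.inter_filter[symmetric] of_bool_def)
  also have "\<dots> \<le> \<bar>real_of_int h\<bar>"
  proof (cases "h \<ge> 0")
   case True
   have "{u \<in> {1..b}. h \<notin> H u} \<subseteq> {b + 1 - nat h..b}" using True by (auto simp: H_def)
   then have "card {u \<in> {1..b}. h \<notin> H u} \<le> card {b + 1 - nat h..b}" by (intro card_mono) auto
   also have "\<dots> \<le> nat h" by simp
   finally show ?thesis using True by linarith
  next
   case False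
   have "{u \<in> {1..b}. h \<notin> H u} \<subseteq> {1..nat (- h)}" using False by (auto simp: H_def)
   then have "card {u \<in> {1..b}. h \<notin> H u} \<le> card {1..nat (- h)}" by (intro card_mono) auto
   then show ?thesis using False by simp
  qed
  finally have c: "(\<Sum>u=1..b. of_bool (h \<notin> H u) :: real) \<le> \<bar>real_of_int h\<bar>" .
  show "(\<Sum>u=1..b. \<bar>acv h\<bar> * of_bool (h \<notin> H u)) \<le> \<bar>real_of_int h\<bar> * \<bar>acv h\<bar>"
   unfolding sum_distrib_left[symmetric] by (subst mult.commute) (rule mult_right_mono[OF c abs_ge_zero])
 qed
 finally show ?thesis .
qed

lemma expectation_lin_lin:
 "\<E> (\<lambda>om. lin p b t om * lin q b t om) = (\<Sum>u=1..b. \<Sum>v=1..b. acv (int v - int u) * (p u * q v)) / b"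
proof -
 have XX: "integrable M (\<lambda>om. X s om * X t om)" for s t
  using rv8_pow_integrable[OF rv8_X, of 2] X_meas by (intro integrable_mult_squares) auto
 have "lin p b t om * lin q b t om = (\<Sum>u=1..b. \<Sum>v=1..b. p u * q v / b * (X (int t + int u - 1) om * X (int t + int v - 1) om))" for om
  unfolding lin_alt sum_product by (intro sum.cong refl) (simp add: field_simps)
 then have "\<E> (\<lambda>om. lin p b t om * lin q b t om) = (\<Sum>u=1..b. \<Sum>v=1..b. p u * q v / b * acv ((int t + int v - 1) - (int t + int u - 1)))"
  using XX by (simp add: expectation_XX)
 then show ?thesis by (simp add: sum_divide_distrib mult_ac)
qed

definition per :: "int => nat => nat => 'a => real" where
 "per j b t om = (\<Sum>a\<in>{False,True}. (lin (fw a j b) b t om)\<^sup>2) / (2 * pi)"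

definition permean :: "int => nat => real" where
 "permean j b = \<E> (per j b 0)"

definition corr :: "bool => int => bool => int => nat => real" where
 "corr a j c k b = \<E> (\<lambda>om. lin (fw a j b) b 0 om * lin (fw c k b) b 0 om)"

text \<open>With all lags present at every position, the sum over \<open>u\<close> covers full
  periods and can be evaluated. \<open>lag_sum_edge\<close> bounds the price of completing the lags,
  and the normalisation divides it by \<open>b\<close>.\<close>

lemma corr_edge:
 assumes b: "b \<ge> 1"
 shows "\<bar>corr a j c k b - (\<Sum>\<^sub>\<infinity>h. acv h * (\<Sum>u=1..b. fwi a j b (int u) * fwi c k b (int u + h))) / b\<bar> \<le> acv1 / b"
proof -
 define g where "g u h = fwi a j b (int u) * fwi c k b (int u + h)" for u :: nat and h
 have g: "\<bar>g u h\<bar> \<le> 1" for u h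
 proof -
  have "\<bar>g u h\<bar> \<le> 1 * 1" unfolding g_def abs_mult by (intro mult_mono) (auto simp: fwi_def)
  then show ?thesis by simp
 qed
 have "corr a j c k b = (\<Sum>u=1..b. \<Sum>v=1..b. acv (int v - int u) * g u (int v - int u)) / b"
  unfolding corr_def expectation_lin_lin g_def by (simp add: fw_def)
 then have "corr a j c k b - (\<Sum>\<^sub>\<infinity>h. acv h * (\<Sum>u=1..b. g u h)) / b =
   ((\<Sum>u=1..b. \<Sum>v=1..b. acv (int v - int u) * g u (int v - int u)) - (\<Sum>\<^sub>\<infinity>h. acv h * (\<Sum>u=1..b. g u h))) / b"
  by (simp add: diff_divide_distrib)
 also have "\<bar>\<dots>\<bar> \<le> acv1 / b" using lag_sum_edge[where g = g and b = b, OF g] b by (simp add: divide_right_mono)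
 finally show ?thesis by (simp add: g_def)
qed

lemma corr_off:
 assumes "b \<ge> 1" "\<not> int b dvd j + k" "\<not> int b dvd j - k"
 shows "\<bar>corr a j c k b\<bar> \<le> acv1 / b"
proof -
 have "(\<Sum>\<^sub>\<infinity>h. acv h * (\<Sum>u=1..b. fwi a j b (int u) * fwi c k b (int u + h))) = 0"
  by (simp only: sum_fwi_product(1)[OF assms] mult_zero_right infsum_0_simp)
 then show ?thesis using corr_edge[where a = a and j = j and c = c and k = k, OF assms(1)] by simp
qed

text \<open>Among the Fourier frequencies the assumption on \<open>j\<close> excludes only
  \<open>pi\<close> and \<open>- pi\<close>, where the sine weight degenerates. Elsewhere cosine and
  sine statistics have the same limiting variance and are asymptotically uncorrelated, because the
  autocovariance is even.\<close>

lemma corr_diag: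
 assumes b: "b \<ge> 1" and j: "\<not> int b dvd 2 * j"
 shows "\<bar>corr a j c j b - (if a = c then pi * sd (ff j b) else 0)\<bar> \<le> acv1 / b"
proof -
 have "(\<Sum>\<^sub>\<infinity>h. acv h * (\<Sum>u=1..b. fwi a j b (int u) * fwi c j b (int u + h))) / b
   = (\<Sum>\<^sub>\<infinity>h. acv h * cos (ff j b * of_int h + (ph c - ph a))) / 2"
 proof -
  have d: "\<not> int b dvd j + j" using j unfolding mult_2 .
  have "acv h * (\<Sum>u=1..b. fwi a j b (int u) * fwi c j b (int u + h)) =
    (real b / 2) * (acv h * cos (ff j b * of_int h + (ph c - ph a)))" for h
   unfolding sum_fwi_product(2)[OF b d refl] by simp
  then have "(\<Sum>\<^sub>\<infinity>h. acv h * (\<Sum>u=1..b. fwi a j b (int u) * fwi c j b (int u + h))) =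
    (real b / 2) * (\<Sum>\<^sub>\<infinity>h. acv h * cos (ff j b * of_int h + (ph c - ph a)))"
   by (simp only: infsum_cmult_right')
  then show ?thesis using b by simp
 qed
 also have "\<dots> = (if a = c then pi * sd (ff j b) else 0)"
 proof (cases "a = c")
  case True
  then show ?thesis by (simp add: sd_eq mult.commute)
 next
  case False
  then have "ph c - ph a = pi / 2 \<or> ph c - ph a = - (pi / 2)" by (auto simp: ph_def)
  then show ?thesis
  proof
   assume d: "ph c - ph a = pi / 2"
   have "acv h * cos (ff j b * of_int h + pi / 2) = - (acv h * sin (of_int h * ff j b))" for h
    by (simp add: cos_add mult.commute)
   then have "(\<Sum>\<^sub>\<infinity>h. acv h * cos (ff j b * of_int h + pi / 2)) = (\<Sum>\<^sub>\<infinity>h. - (acv h * sin (of_int h * ff j b)))"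
    by (intro infsum_cong)
   then show ?thesis using False unfolding d infsum_uminus acv_odd_sum by simp
  next
   assume d: "ph c - ph a = - (pi / 2)"
   have "acv h * cos (ff j b * of_int h + - (pi / 2)) = acv h * sin (of_int h * ff j b)" for h
    by (simp add: cos_diff mult.commute)
   then have "(\<Sum>\<^sub>\<infinity>h. acv h * cos (ff j b * of_int h + - (pi / 2))) = (\<Sum>\<^sub>\<infinity>h. acv h * sin (of_int h * ff j b))"
    by (intro infsum_cong)
   then show ?thesis using False unfolding d acv_odd_sum by simp
  qed
 qed
 finally show ?thesis using corr_edge[where a = a and j = j and c = c and k = j, OF b] by simp
qed

lemma abs_corr: "b \<ge> 1 ==> \<bar>corr a j c k b\<bar> \<le> cumbound 2"
 unfolding corr_def by (rule lin2_bound[OF abs_fw abs_fw])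

lemma lin_sq_integrable: "integrable M (\<lambda>om. (lin p b t om)\<^sup>2)"
 using rv8_pow_integrable[OF rv8_lin, of 2] by simp

text \<open>Cosine and sine weights together give the cosine of lag times frequency, which is free
  of the position; so no sum over a period has to be evaluated and every frequency is
  allowed.\<close>

lemma permean_bias:
 assumes b: "b \<ge> 1"
 shows "\<bar>permean j b - sd (ff j b)\<bar> \<le> acv1 / b"
proof -
 let ?l = "ff j b"
 have g: "\<bar>cos (of_int h * ?l)\<bar> \<le> 1" for h by simp
 have pp: "fw False j b u * fw False j b v + fw True j b u * fw True j b v = cos (of_int (int v - int u) * ?l)" for u v
 proof -
  have "cos (?l * real u - pi / 2) = sin (?l * real u)" for u by (simp add: cos_diff)
  then show ?thesis
   by (simp add: fw_def fwi_def ph_def cos_diff left_diff_distrib mult.commute[of ?l])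
 qed
 define S where "S = (\<Sum>u=1..b. \<Sum>v=1..b. acv (int v - int u) * cos (of_int (int v - int u) * ?l))"
 define Z where "Z = (\<Sum>\<^sub>\<infinity>h. acv h * (\<Sum>u=1..b. cos (of_int h * ?l)))"
 have "2 * pi * permean j b = \<E> (\<lambda>om. (lin (fw False j b) b 0 om)\<^sup>2) + \<E> (\<lambda>om. (lin (fw True j b) b 0 om)\<^sup>2)"
  using lin_sq_integrable by (simp add: permean_def per_def[abs_def])
 also have "\<dots> = (\<Sum>u=1..b. \<Sum>v=1..b. acv (int v - int u) * (fw False j b u * fw False j b v + fw True j b u * fw True j b v)) / b"
  unfolding power2_eq_square expectation_lin_lin by (simp only: add_divide_distrib sum.distrib distrib_left)
 also have "\<dots> = S / b" unfolding S_def by (simp only: pp)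
 finally have S: "S = b * (2 * pi * permean j b)" using b by simp
 have Z: "Z = b * (2 * pi * sd ?l)"
 proof -
  have "acv h * (\<Sum>u=1..b. cos (of_int h * ?l)) = real b * (acv h * cos (of_int h * ?l))" for h by simp
  then have "Z = real b * (\<Sum>\<^sub>\<infinity>h. acv h * cos (of_int h * ?l))"
   unfolding Z_def by (simp only: infsum_cmult_right')
  then show ?thesis by (simp add: sd_eq)
 qed
 have "\<bar>S - Z\<bar> \<le> acv1"
  unfolding S_def Z_def by (rule lag_sum_edge) simp
 also have "S - Z = 2 * pi * (b * (permean j b - sd ?l))" unfolding S Z by (simp add: algebra_simps)
 finally have "2 * pi * (b * \<bar>permean j b - sd ?l\<bar>) \<le> acv1" by (simp add: abs_mult)
 moreover have "1 * (b * \<bar>permean j b - sd ?l\<bar>) \<le> 2 * pi * (b * \<bar>permean j b - sd ?l\<bar>)"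
  using pi_gt3 by (intro mult_right_mono) auto
 ultimately have "b * \<bar>permean j b - sd ?l\<bar> \<le> acv1" unfolding mult_1 by (rule order_trans[rotated])
 then show ?thesis using b by (simp add: pos_le_divide_eq mult.commute)
qed

abbreviation kap4 :: "(nat => real) => (nat => real) => nat => nat => real" where
 "kap4 p q b t \<equiv> kappa (mom (\<lambda>i::nat. lin (if i \<in> {0,1} then p else q) b t)) {..<4}"

lemma kap4_bound:
 assumes p: "\<And>u. \<bar>p u\<bar> \<le> 1" "\<And>u. \<bar>q u\<bar> \<le> 1" and b: "b \<ge> 1"
 shows "\<bar>kap4 p q b t\<bar> \<le> cumbound 4 / b"
proof -
 have "\<bar>kap4 p q b t\<bar> \<le> (1 / sqrt b) ^ 4 * (real b * cumbound 4)"
  using p b by (intro kappa_lin_le cumsummable4) auto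
 also have "(1 / sqrt b) ^ 4 = ((1 / sqrt b)\<^sup>2)\<^sup>2" by simp
 also have "\<dots> * (real b * cumbound 4) = cumbound 4 / b"
  using b by (simp add: power_divide) (simp add: power2_eq_square)
 finally show ?thesis .
qed

lemma fourth_moment_kap4:
 "\<E> (\<lambda>om. (lin p b t om)\<^sup>2 * (lin q b t om)\<^sup>2) =
   \<E> (\<lambda>om. (lin p b t om)\<^sup>2) * \<E> (\<lambda>om. (lin q b t om)\<^sup>2)
   + 2 * (\<E> (\<lambda>om. lin p b t om * lin q b t om))\<^sup>2 + kap4 p q b t"
proof -
 let ?m = "mom (\<lambda>i::nat. lin (if i \<in> {0,1} then p else q) b t)"
 have S: "{..<4::nat} = {0,1,2,3}" by auto
 have "?m {0,1,2,3} = kappa ?m {0,1,2,3} + ?m {0,1} * ?m {2,3} + ?m {0,2} * ?m {1,3} + ?m {0,3} * ?m {1,2}"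
  by (intro kappa4) (auto simp: mom_def lin_mean prob_space)
 moreover have "?m {0,1,2,3} = \<E> (\<lambda>om. (lin p b t om)\<^sup>2 * (lin q b t om)\<^sup>2)"
  by (simp add: mom_def power2_eq_square mult_ac)
 moreover have "?m {0,1} = \<E> (\<lambda>om. (lin p b t om)\<^sup>2)" "?m {2,3} = \<E> (\<lambda>om. (lin q b t om)\<^sup>2)"
  "?m {0,2} = \<E> (\<lambda>om. lin p b t om * lin q b t om)" "?m {1,3} = \<E> (\<lambda>om. lin p b t om * lin q b t om)"
  "?m {0,3} = \<E> (\<lambda>om. lin p b t om * lin q b t om)" "?m {1,2} = \<E> (\<lambda>om. lin p b t om * lin q b t om)"
  by (simp_all add: mom_def power2_eq_square)
 ultimately show ?thesis unfolding S by (simp add: power2_eq_square algebra_simps)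
qed

end

section \<open>Periodograms at the Fourier frequencies\<close>

lemma finite_fourier_indices [simp]: "finite (FI b)"
proof (rule finite_subset)
 show "FI b \<subseteq> {- int b..int b}" by (auto simp: fourier_indices_def)
qed simp

lemma fourier_indices_eq: "FI b = int ` {1..b div 2} \<union> (\<lambda>i. - int i) ` {1..b div 2}"
proof (intro set_eqI iffI)
 fix j assume "j \<in> FI b"
 then have j: "1 \<le> \<bar>j\<bar>" "\<bar>j\<bar> \<le> int (b div 2)" by (auto simp: fourier_indices_def)
 show "j \<in> int ` {1..b div 2} \<union> (\<lambda>i. - int i) ` {1..b div 2}"
 proof (cases "j \<ge> 0")
  case True
  then have "j = int (nat j)" "nat j \<in> {1..b div 2}" using j by auto
  then show ?thesis by blast
 next
  case False
  then have "j = - int (nat (- j))" "nat (- j) \<in> {1..b div 2}" using j by auto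
  then show ?thesis by blast
 qed
qed (auto simp: fourier_indices_def)

lemma card_fourier_indices: "card (FI b) \<le> b"
proof -
 have "card (FI b) \<le> card (int ` {1..b div 2}) + card ((\<lambda>i. - int i) ` {1..b div 2})"
  unfolding fourier_indices_eq by (rule card_Un_le)
 also have "\<dots> \<le> card {1..b div 2} + card {1..b div 2}"
  by (intro add_mono card_image_le) auto
 finally show ?thesis by simp
qed

lemma fourier_not_dvd: "j \<in> FI b ==> \<not> int b dvd j"
proof
 assume j: "j \<in> FI b" and d: "int b dvd j"
 then have "int b \<le> \<bar>j\<bar>" by (intro zdvd_imp_le[of "int b" "\<bar>j\<bar>"]) (auto simp: fourier_indices_def)
 then show False using j by (auto simp: fourier_indices_def)
qed

lemma fourier_not_dvd_pm:
 assumes "j \<in> FI b" "k \<in> FI b" "\<bar>j\<bar> \<noteq> \<bar>k\<bar>"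
 shows "\<not> int b dvd j + k" "\<not> int b dvd j - k"
proof -
 have *: "\<bar>j + k\<bar> < int b" "\<bar>j - k\<bar> < int b" "j + k \<noteq> 0" "j - k \<noteq> 0"
  using assms by (auto simp: fourier_indices_def)
 show "\<not> int b dvd j + k" "\<not> int b dvd j - k"
  using * dvd_imp_le_int[of "j + k" "int b"] dvd_imp_le_int[of "j - k" "int b"] by auto
qed

lemma fourier_ge1: "j \<in> FI b ==> b \<ge> 1"
 by (cases "b = 0") (auto simp: fourier_indices_def)

text \<open>For each \<open>j\<close> only \<open>j\<close> and \<open>- j\<close> have the same
  modulus: at most \<open>2 * b\<close> pairs get the bound \<open>A\<close>, at most
  \<open>b * b\<close> pairs the bound \<open>B\<close>.\<close>

lemma sum_abs_eq_le:
 fixes g :: "int => int => real"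
 assumes "\<And>j k. j \<in> FI b ==> k \<in> FI b ==> \<bar>j\<bar> = \<bar>k\<bar> ==> g j k \<le> A"
  and "\<And>j k. j \<in> FI b ==> k \<in> FI b ==> \<bar>j\<bar> \<noteq> \<bar>k\<bar> ==> g j k \<le> B"
  and "A \<ge> 0" "B \<ge> 0"
 shows "(\<Sum>j\<in>FI b. \<Sum>k\<in>FI b. g j k) \<le> 2 * real b * A + (real b)\<^sup>2 * B"
proof -
 let ?G = "FI b"
 have cG: "real (card ?G) \<le> real b" using card_fourier_indices by simp
 have "(\<Sum>k\<in>?G. g j k) \<le> 2 * A + real b * B" if j: "j \<in> ?G" for j
 proof -
  have "(\<Sum>k\<in>?G. g j k) \<le> (\<Sum>k\<in>?G. (if k \<in> {j, - j} then A else 0) + B)"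
  proof (rule sum_mono)
   fix k assume k: "k \<in> ?G"
   show "g j k \<le> (if k \<in> {j, - j} then A else 0) + B"
   proof (cases "\<bar>j\<bar> = \<bar>k\<bar>")
    case True
    then have "k \<in> {j, - j}" by auto
    then show ?thesis using assms(1)[OF j k True] assms(4) by simp
   next
    case False
    then have "k \<notin> {j, - j}" by auto
    then show ?thesis using assms(2)[OF j k False] by simp
   qed
  qed
  also have "\<dots> = real (card (?G \<inter> {j, - j})) * A + real (card ?G) * B"
  proof -
   have "{k. k = j \<or> k = - j} = {j, - j}" by auto
   then show ?thesis by (simp add: sum.distrib sum.If_cases)
  qed
  also have "\<dots> \<le> 2 * A + real b * B"
  proof (intro add_mono mult_right_mono assms(3,4) cG)
   have "card (?G \<inter> {j, - j}) \<le> card {j, - j}" by (intro card_mono) auto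
   also have "\<dots> \<le> 2" by (simp add: card_insert_if)
   finally show "real (card (?G \<inter> {j, - j})) \<le> 2" by simp
  qed
  finally show ?thesis .
 qed
 then have "(\<Sum>j\<in>?G. \<Sum>k\<in>?G. g j k) \<le> (\<Sum>j\<in>?G. 2 * A + real b * B)" by (intro sum_mono)
 also have "\<dots> = real (card ?G) * (2 * A + real b * B)" by simp
 also have "\<dots> \<le> real b * (2 * A + real b * B)"
  using assms(3,4) by (intro mult_right_mono cG) auto
 finally show ?thesis by (simp add: power2_eq_square algebra_simps)
qed

context spec_process
begin

lemma lin_measurable [measurable]: "lin w b t \<in> borel_measurable M"
 using rv8_lin by (simp add: rv8_def)

definition I0 :: "int => nat => nat => 'a => real" where
 "I0 j b t om = per j b t om - permean j b"

definition eV :: "int => int => nat => real" where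
 "eV j k b = \<E> (\<lambda>om. I0 j b 0 om * I0 k b 0 om)"

lemma permean_eq: "permean j b = (\<Sum>a\<in>{False,True}. \<E> (\<lambda>om. (lin (fw a j b) b 0 om)\<^sup>2)) / (2 * pi)"
 using lin_sq_integrable by (simp add: permean_def per_def[abs_def])

lemma I0_eq: "I0 j b t om = (\<Sum>a\<in>{False,True}. (lin (fw a j b) b t om)\<^sup>2 - \<E> (\<lambda>om. (lin (fw a j b) b 0 om)\<^sup>2)) / (2 * pi)"
 by (simp add: I0_def per_def permean_eq add_divide_distrib diff_divide_distrib)

lemma I0_mult: "I0 j b t om * I0 k b t om =
  (\<Sum>a\<in>{False,True}. \<Sum>c\<in>{False,True}. qprod (fw a j b) (fw c k b) b t om) / (2 * pi)\<^sup>2"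
 by (simp add: I0_eq qprod_def power2_eq_square algebra_simps add_divide_distrib)

lemma qprod_integrable: "b \<ge> 1 ==> integrable M (qprod (fw a j b) (fw c k b) b t)"
 using qprod_cov(3)[of "fw a j b" "fw c k b" b t] abs_fw by blast

lemma eV_eq: "b \<ge> 1 ==> eV j k b = (\<Sum>a\<in>{False,True}. \<Sum>c\<in>{False,True}. \<E> (qprod (fw a j b) (fw c k b) b 0)) / (2 * pi)\<^sup>2"
 unfolding eV_def I0_mult using qprod_integrable by simp

lemma qprod_mean:
 "\<E> (qprod (fw a j b) (fw c k b) b 0) = 2 * (corr a j c k b)\<^sup>2 + kap4 (fw a j b) (fw c k b) b 0"
proof -
 let ?P = "\<lambda>om. (lin (fw a j b) b 0 om)\<^sup>2" and ?R = "\<lambda>om. (lin (fw c k b) b 0 om)\<^sup>2"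
 have PR: "integrable M (\<lambda>om. ?P om * ?R om)"
 proof (rule integrable_mult_squares)
  show "?P \<in> borel_measurable M" "?R \<in> borel_measurable M" by measurable
  show "integrable M (\<lambda>om. (?P om)\<^sup>2)" "integrable M (\<lambda>om. (?R om)\<^sup>2)"
   using rv8_pow_integrable[OF rv8_lin, of 4] by (simp_all flip: power_mult)
 qed
 have "\<E> (qprod (fw a j b) (fw c k b) b 0) = \<E> (\<lambda>om. ?P om * ?R om) - \<E> ?P * \<E> ?R"
  unfolding qprod_def[abs_def] using PR lin_sq_integrable by (simp add: algebra_simps prob_space)
 then show ?thesis
  using fourth_moment_kap4[of "fw a j b" b 0 "fw c k b"] by (simp only: corr_def)
qed

lemma pi_sq_ge: "(2 * pi)\<^sup>2 \<ge> 4"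
proof -
 have "2\<^sup>2 \<le> (2 * pi)\<^sup>2" using pi_gt3 by (intro power_mono) auto
 then show ?thesis by simp
qed

lemma eV_corr:
 assumes b: "b \<ge> 1"
 shows "\<bar>eV j k b - (\<Sum>a\<in>{False,True}. \<Sum>c\<in>{False,True}. 2 * (corr a j c k b)\<^sup>2) / (2 * pi)\<^sup>2\<bar> \<le> cumbound 4 / b"
proof -
 have "\<bar>eV j k b - (\<Sum>a\<in>{False,True}. \<Sum>c\<in>{False,True}. 2 * (corr a j c k b)\<^sup>2) / (2 * pi)\<^sup>2\<bar>
   = \<bar>\<Sum>a\<in>{False,True}. \<Sum>c\<in>{False,True}. kap4 (fw a j b) (fw c k b) b 0\<bar> / (2 * pi)\<^sup>2"
  unfolding eV_eq[OF b] qprod_mean by (simp only: sum.distrib add_divide_distrib abs_divide) simp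
 also have "\<dots> \<le> (\<Sum>a\<in>{False,True}. \<Sum>c\<in>{False,True}. cumbound 4 / b) / (2 * pi)\<^sup>2"
  by (intro divide_right_mono order_trans[OF sum_abs] sum_mono order_trans[OF sum_abs] kap4_bound abs_fw b) simp
 also have "\<dots> = 4 * (cumbound 4 / b) / (2 * pi)\<^sup>2" by simp
 also have "\<dots> \<le> 4 * (cumbound 4 / b) / 4"
  using pi_sq_ge cumbound_nonneg by (intro divide_left_mono) auto
 finally show ?thesis by simp
qed

text \<open>Only squared correlations and fourth cumulants enter; both are of order at most
  \<open>1 / b\<close> when the moduli of the frequencies differ.\<close>

lemma eV_bounds:
 assumes b: "b \<ge> 1"
 shows "\<bar>eV j k b\<bar> \<le> 2 * (cumbound 2)\<^sup>2 + cumbound 4"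
  and "j \<in> FI b ==> k \<in> FI b ==> \<bar>j\<bar> \<noteq> \<bar>k\<bar> ==>
   \<bar>eV j k b\<bar> \<le> (2 * acv1\<^sup>2 + cumbound 4) / b"
proof -
 have main: "\<bar>eV j k b\<bar> \<le> 2 * r\<^sup>2 + cumbound 4 / b" if r: "\<And>a c. \<bar>corr a j c k b\<bar> \<le> r" for r
 proof -
  have "(corr a j c k b)\<^sup>2 \<le> r\<^sup>2" for a c using power_mono[OF r, of a c 2] by simp
  then have "(\<Sum>a\<in>{False,True}. \<Sum>c\<in>{False,True}. 2 * (corr a j c k b)\<^sup>2) \<le> (\<Sum>a\<in>{False,True}. \<Sum>c\<in>{False,True}. 2 * r\<^sup>2)"
   by (intro sum_mono mult_left_mono) auto
  then have "(\<Sum>a\<in>{False,True}. \<Sum>c\<in>{False,True}. 2 * (corr a j c k b)\<^sup>2) / (2 * pi)\<^sup>2 \<le> (8 * r\<^sup>2) / (2 * pi)\<^sup>2"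
   by (intro divide_right_mono) auto
  also have "\<dots> \<le> (8 * r\<^sup>2) / 4" using pi_sq_ge by (intro divide_left_mono) auto
  finally have "(\<Sum>a\<in>{False,True}. \<Sum>c\<in>{False,True}. 2 * (corr a j c k b)\<^sup>2) / (2 * pi)\<^sup>2 \<le> 2 * r\<^sup>2" by simp
  moreover have "(\<Sum>a\<in>{False,True}. \<Sum>c\<in>{False,True}. 2 * (corr a j c k b)\<^sup>2) / (2 * pi)\<^sup>2 \<ge> 0"
   by (intro divide_nonneg_nonneg sum_nonneg) auto
  ultimately show ?thesis using eV_corr[OF b, of j k] by linarith
 qed
 have "cumbound 4 / b \<le> cumbound 4 / 1" using b cumbound_nonneg[of 4] by (intro divide_left_mono) auto
 then show "\<bar>eV j k b\<bar> \<le> 2 * (cumbound 2)\<^sup>2 + cumbound 4"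
  using main[OF abs_corr[OF b]] by simp
 assume jk: "j \<in> FI b" "k \<in> FI b" "\<bar>j\<bar> \<noteq> \<bar>k\<bar>"
 have "\<bar>eV j k b\<bar> \<le> 2 * (acv1 / b)\<^sup>2 + cumbound 4 / b"
  using fourier_not_dvd_pm[OF jk] b by (intro main corr_off)
 also have "(acv1 / b)\<^sup>2 \<le> acv1\<^sup>2 / b"
  using b by (simp add: power_divide power2_eq_square[of "real b"] divide_left_mono mult_le_cancel_left1)
 finally show "\<bar>eV j k b\<bar> \<le> (2 * acv1\<^sup>2 + cumbound 4) / b"
  by (simp add: add_divide_distrib)
qed

lemma sum_eV_bound:
 obtains C :: real where "C \<ge> 0" "\<And>b. b \<ge> 1 ==> (\<Sum>j\<in>FI b. \<Sum>k\<in>FI b. \<bar>eV j k b\<bar>) \<le> C * b"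
proof (rule that[of "2 * (2 * (cumbound 2)\<^sup>2 + cumbound 4) + (2 * acv1\<^sup>2 + cumbound 4)"])
 show "0 \<le> 2 * (2 * (cumbound 2)\<^sup>2 + cumbound 4) + (2 * acv1\<^sup>2 + cumbound 4)"
  using cumbound_nonneg by simp
 fix b :: nat assume b: "b \<ge> 1"
 have "(\<Sum>j\<in>FI b. \<Sum>k\<in>FI b. \<bar>eV j k b\<bar>) \<le>
   2 * real b * (2 * (cumbound 2)\<^sup>2 + cumbound 4) + (real b)\<^sup>2 * ((2 * acv1\<^sup>2 + cumbound 4) / b)"
  using cumbound_nonneg eV_bounds[OF b] by (intro sum_abs_eq_le) auto
 also have "\<dots> = (2 * (2 * (cumbound 2)\<^sup>2 + cumbound 4) + (2 * acv1\<^sup>2 + cumbound 4)) * b"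
  using b by (simp add: power2_eq_square field_simps)
 finally show "(\<Sum>j\<in>FI b. \<Sum>k\<in>FI b. \<bar>eV j k b\<bar>) \<le>
   (2 * (2 * (cumbound 2)\<^sup>2 + cumbound 4) + (2 * acv1\<^sup>2 + cumbound 4)) * b" .
qed

definition Vhat :: "int => int => nat => nat => 'a => real" where
 "Vhat j k b N om = (\<Sum>t=1..N. I0 j b t om * I0 k b t om) / N - eV j k b"

lemma expectation_abs_le_sqrt:
 assumes "f \<in> borel_measurable M" "integrable M (\<lambda>om. (f om)\<^sup>2)"
 shows "\<E> (\<lambda>om. \<bar>f om\<bar>) \<le> sqrt (\<E> (\<lambda>om. (f om)\<^sup>2))"
proof -
 have i: "integrable M f" using square_integrable_imp_integrable[OF assms] .
 have "(\<E> (\<lambda>om. \<bar>f om\<bar>))\<^sup>2 \<le> \<E> (\<lambda>om. \<bar>f om\<bar>\<^sup>2)"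
 proof -
  have "0 \<le> variance (\<lambda>om. \<bar>f om\<bar>)" by (rule variance_positive)
  then show ?thesis using i assms by (subst (asm) variance_eq) auto
 qed
 then show ?thesis by (intro real_le_rsqrt) simp
qed

lemma qprod_product_integrable:
 "b \<ge> 1 ==> integrable M (\<lambda>om. qprod (fw a j b) (fw c k b) b t om * qprod (fw a' j b) (fw c' k b) b s om)"
proof (rule integrable_mult_squares)
 assume b: "b \<ge> 1"
 show "qprod (fw a j b) (fw c k b) b t \<in> borel_measurable M" "qprod (fw a' j b) (fw c' k b) b s \<in> borel_measurable M"
  using qprod_integrable[OF b] by auto
 show "integrable M (\<lambda>om. (qprod (fw a j b) (fw c k b) b t om)\<^sup>2)"
  "integrable M (\<lambda>om. (qprod (fw a' j b) (fw c' k b) b s om)\<^sup>2)"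
  using qprod_cov(2)[of "fw a j b" "fw c k b" b t t] qprod_cov(2)[of "fw a' j b" "fw c' k b" b s s] abs_fw b
  by (simp_all add: power2_eq_square)
qed

text \<open>At most \<open>2 * b\<close> pairs have equal modulus and merely bounded correlation;
  for the others, at most \<open>b * b\<close>, the correlation is at most \<open>acv1 / b\<close>.
  The first summand of the bound comes from the latter, the second from the former.\<close>

lemma Vhat_concentration:
 obtains C :: real where "C \<ge> 0"
  "\<And>(b::nat) (N::nat). 1 \<le> b ==> b \<le> N ==>
   integrable M (\<lambda>om. \<Sum>j\<in>FI b. \<Sum>k\<in>FI b. \<bar>Vhat j k b N om\<bar>) \<and>
   \<E> (\<lambda>om. \<Sum>j\<in>FI b. \<Sum>k\<in>FI b. \<bar>Vhat j k b N om\<bar>) / b \<le>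
    C * (b * sqrt (b / N + sqrt (b / N) / b) + sqrt (b / N + sqrt (b / N)))"
proof (rule qprod_avg_variance)
 fix C assume C: "C \<ge> 0"
  "\<And>b N p q r. 1 \<le> b ==> b \<le> N ==> (\<And>u. \<bar>p u\<bar> \<le> 1) ==> (\<And>u. \<bar>q u\<bar> \<le> 1) ==>
   (\<Sum>u=1..b. p u) = 0 ==> (\<Sum>u=1..b. q u) = 0 ==>
   \<bar>\<E> (\<lambda>om. lin p b 0 om * lin q b 0 om)\<bar> \<le> r ==>
   \<E> (\<lambda>om. ((\<Sum>t=1..N. qprod p q b t om) / N - \<E> (qprod p q b 0))\<^sup>2) \<le>
    C * (b / N + r * sqrt (b / N))"
 \<comment> \<open>\<open>R\<close> dominates both correlation bounds and is at least 1, so that it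
   may also multiply the term without \<open>r\<close>.\<close>
 define R where "R = 1 + acv1 + cumbound 2"
 have R: "R \<ge> 1" "acv1 \<le> R" "cumbound 2 \<le> R" using acv1_nonneg cumbound_nonneg by (auto simp: R_def)
 show thesis
 proof (rule that[of "2 * sqrt (C * R)"])
  show "0 \<le> 2 * sqrt (C * R)" using C R by simp
  fix b N :: nat assume b: "1 \<le> b" "b \<le> N"
  let ?G = "FI b"
  let ?x = "real b / real N"
  have x: "?x \<ge> 0" by simp
  define D where "D a j c k om = (\<Sum>t=1..N. qprod (fw a j b) (fw c k b) b t om) / N - \<E> (qprod (fw a j b) (fw c k b) b 0)"
   for a j c k om
  have Dm: "D a j c k \<in> borel_measurable M" for a j c k
   unfolding D_def[abs_def] using qprod_integrable[OF b(1)]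
   by (intro borel_measurable_diff borel_measurable_divide borel_measurable_sum) auto
  have D2: "integrable M (\<lambda>om. (D a j c k om)\<^sup>2)" for a j c k
  proof -
   have "integrable M (\<lambda>om. (\<Sum>t=1..N. qprod (fw a j b) (fw c k b) b t om)\<^sup>2)"
    unfolding power2_eq_square sum_product using qprod_product_integrable[OF b(1)]
    by (intro Bochner_Integration.integrable_sum)
   moreover have "integrable M (\<lambda>om. \<Sum>t=1..N. qprod (fw a j b) (fw c k b) b t om)"
    using qprod_integrable[OF b(1)] by (intro Bochner_Integration.integrable_sum)
   ultimately show ?thesis unfolding D_def power2_diff power_divide by auto
  qed
  have Veq: "Vhat j k b N om = (\<Sum>a\<in>{False,True}. \<Sum>c\<in>{False,True}. D a j c k om) / (2 * pi)\<^sup>2" for j k om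
  proof -
   have "(\<Sum>t=1..N. I0 j b t om * I0 k b t om) / N =
    (\<Sum>a\<in>{False,True}. \<Sum>c\<in>{False,True}. (\<Sum>t=1..N. qprod (fw a j b) (fw c k b) b t om) / N) / (2 * pi)\<^sup>2"
    unfolding I0_mult by (simp add: sum_divide_distrib[symmetric] sum.distrib add_divide_distrib mult.commute)
   then show ?thesis unfolding Vhat_def eV_eq[OF b(1)] D_def
    by (simp add: diff_divide_distrib add_divide_distrib)
  qed
  have Vint: "integrable M (\<lambda>om. \<bar>Vhat j k b N om\<bar>)" for j k
   unfolding Veq using square_integrable_imp_integrable[OF Dm D2]
   by (intro integrable_abs Bochner_Integration.integrable_divide Bochner_Integration.integrable_sum) auto
  have EV: "\<E> (\<lambda>om. \<bar>Vhat j k b N om\<bar>) \<le> sqrt (C * (?x + r * sqrt ?x))"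
   if jk: "j \<in> ?G" "k \<in> ?G" and r: "\<And>a c. \<bar>corr a j c k b\<bar> \<le> r" for j k r
  proof -
   have e: "\<E> (\<lambda>om. \<bar>D a j c k om\<bar>) \<le> sqrt (C * (?x + r * sqrt ?x))" for a c
   proof -
    have "\<E> (\<lambda>om. (D a j c k om)\<^sup>2) \<le> C * (?x + r * sqrt ?x)"
     unfolding D_def using r[of a c] jk b
     by (intro C(2) abs_fw sum_fw fourier_not_dvd) (auto simp: corr_def)
    then show ?thesis
     using expectation_abs_le_sqrt[OF Dm D2, of a j c k] real_sqrt_le_mono order_trans by blast
   qed
   have Di: "integrable M (\<lambda>om. \<bar>D a j c k om\<bar>)" for a c
    using square_integrable_imp_integrable[OF Dm D2] by (intro integrable_abs)
   have "\<E> (\<lambda>om. \<bar>Vhat j k b N om\<bar>) \<le> \<E> (\<lambda>om. (\<Sum>a\<in>{False,True}. \<Sum>c\<in>{False,True}. \<bar>D a j c k om\<bar>) / 4)"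
   proof (rule integral_mono[OF Vint])
    show "integrable M (\<lambda>om. (\<Sum>a\<in>{False,True}. \<Sum>c\<in>{False,True}. \<bar>D a j c k om\<bar>) / 4)"
     using Di by (intro Bochner_Integration.integrable_divide Bochner_Integration.integrable_sum) auto
    fix om
    have "\<bar>Vhat j k b N om\<bar> \<le> (\<Sum>a\<in>{False,True}. \<Sum>c\<in>{False,True}. \<bar>D a j c k om\<bar>) / (2 * pi)\<^sup>2"
     unfolding Veq abs_divide abs_power2
     by (intro divide_right_mono order_trans[OF sum_abs] sum_mono sum_abs) simp
    also have "\<dots> \<le> (\<Sum>a\<in>{False,True}. \<Sum>c\<in>{False,True}. \<bar>D a j c k om\<bar>) / 4"
     using pi_sq_ge by (intro divide_left_mono sum_nonneg) auto
    finally show "\<bar>Vhat j k b N om\<bar> \<le> (\<Sum>a\<in>{False,True}. \<Sum>c\<in>{False,True}. \<bar>D a j c k om\<bar>) / 4" .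
   qed
   also have "\<dots> = (\<Sum>a\<in>{False,True}. \<Sum>c\<in>{False,True}. \<E> (\<lambda>om. \<bar>D a j c k om\<bar>)) / 4"
    using Di by simp
   also have "\<dots> \<le> (\<Sum>a\<in>{False,True}. \<Sum>c\<in>{False,True}. sqrt (C * (?x + r * sqrt ?x))) / 4"
    by (intro divide_right_mono sum_mono e) simp
   finally show ?thesis by simp
  qed
  let ?A = "sqrt (C * R) * sqrt (?x + sqrt ?x)" and ?B = "sqrt (C * R) * sqrt (?x + sqrt ?x / b)"
  have mono: "sqrt (C * (?x + R * y * sqrt ?x)) \<le> sqrt (C * R) * sqrt (?x + sqrt ?x * y)" if "y \<ge> 0" for y
  proof -
   have "?x \<le> R * ?x" using mult_right_mono[OF R(1) x] by simp
   then have "C * (?x + R * y * sqrt ?x) \<le> C * (R * (?x + sqrt ?x * y))"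
    using C by (intro mult_left_mono) (auto simp: algebra_simps)
   then show ?thesis by (simp add: real_sqrt_mult[symmetric] mult.assoc)
  qed
  have cs: "sqrt (C * (?x + r * sqrt ?x)) \<le> sqrt (C * (?x + r' * sqrt ?x))" if "r \<le> r'" for r r'
   using that C x by (intro real_sqrt_le_mono mult_left_mono add_left_mono mult_right_mono) auto
  have "(\<Sum>j\<in>?G. \<Sum>k\<in>?G. \<E> (\<lambda>om. \<bar>Vhat j k b N om\<bar>)) \<le> 2 * real b * ?A + (real b)\<^sup>2 * ?B"
  proof (rule sum_abs_eq_le)
   fix j k assume jk: "j \<in> ?G" "k \<in> ?G"
   have "\<E> (\<lambda>om. \<bar>Vhat j k b N om\<bar>) \<le> sqrt (C * (?x + R * 1 * sqrt ?x))"
    using EV[OF jk order_trans[OF abs_corr[OF b(1)] R(3)]] by simp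
   also have "\<dots> \<le> ?A" using mono[of 1] by simp
   finally show "\<E> (\<lambda>om. \<bar>Vhat j k b N om\<bar>) \<le> ?A" .
   assume ne: "\<bar>j\<bar> \<noteq> \<bar>k\<bar>"
   have co: "\<bar>corr a j c k b\<bar> \<le> R * (1 / b)" for a c
   proof (rule order_trans[OF corr_off[OF b(1) fourier_not_dvd_pm[OF jk ne]]])
    show "acv1 / b \<le> R * (1 / b)" using R(2) by (simp add: divide_right_mono)
   qed
   have "\<E> (\<lambda>om. \<bar>Vhat j k b N om\<bar>) \<le> sqrt (C * (?x + R * (1 / b) * sqrt ?x))"
    by (rule EV[OF jk co])
   also have "\<dots> \<le> ?B" using mono[of "1 / b"] by simp
   finally show "\<E> (\<lambda>om. \<bar>Vhat j k b N om\<bar>) \<le> ?B" .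
  qed (use C R in auto)
  also have "\<dots> \<le> (2 * sqrt (C * R) * (b * sqrt (?x + sqrt ?x / b) + sqrt (?x + sqrt ?x))) * b"
  proof -
   have "0 \<le> (real b)\<^sup>2 * ?B" using C R by simp
   then show ?thesis by (simp add: power2_eq_square algebra_simps)
  qed
  finally have "(\<Sum>j\<in>?G. \<Sum>k\<in>?G. \<E> (\<lambda>om. \<bar>Vhat j k b N om\<bar>)) / b \<le>
    2 * sqrt (C * R) * (b * sqrt (?x + sqrt ?x / b) + sqrt (?x + sqrt ?x))"
   using b by (subst pos_divide_le_eq) auto
  then show "integrable M (\<lambda>om. \<Sum>j\<in>?G. \<Sum>k\<in>?G. \<bar>Vhat j k b N om\<bar>) \<and>
   \<E> (\<lambda>om. \<Sum>j\<in>?G. \<Sum>k\<in>?G. \<bar>Vhat j k b N om\<bar>) / b \<le>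
    2 * sqrt (C * R) * (b * sqrt (b / N + sqrt (b / N) / b) + sqrt (b / N + sqrt (b / N)))"
   using Vint by simp
 qed
qed

text \<open>\<open>schur4\<close> bounds the row sums of the covariances of centred squares, and the
  average over blocks inherits a variance of order \<open>b / N\<close>.\<close>

lemma avg_I0_square:
 obtains C :: real where "C \<ge> 0"
  "\<And>(b::nat) (N::nat) j. 1 \<le> b ==> b \<le> N ==>
   integrable M (\<lambda>om. ((\<Sum>t=1..N. I0 j b t om) / N)\<^sup>2) \<and>
   \<E> (\<lambda>om. ((\<Sum>t=1..N. I0 j b t om) / N)\<^sup>2) \<le> C * (b / N)"
proof -
 define K where "K = cumbound 4 + 2 * (cumbound 2 * (1 + 8 * mom8))"
 have K0: "K \<ge> 0" using cumbound_nonneg mom8_nonneg by (auto simp: K_def)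
 show thesis
 proof (rule that[OF K0])
  fix b N :: nat and j assume b: "1 \<le> b" "b \<le> N"
  have N: "real N > 0" using b by simp
  define e where "e a = \<E> (\<lambda>om. (lin (fw a j b) b 0 om)\<^sup>2)" for a
  define S where "S a t om = (lin (fw a j b) b t om)\<^sup>2 - e a" for a t om
  have L1: "integrable M (\<lambda>om. (lin (fw a j b) b t om)\<^sup>2)" for a t by (rule lin_sq_integrable)
  have L2: "integrable M (\<lambda>om. (lin (fw a j b) b t om)\<^sup>2 * (lin (fw c j b) b s om)\<^sup>2)" for a t c s
  proof (rule integrable_mult_squares)
   show "(\<lambda>om. (lin (fw a j b) b t om)\<^sup>2) \<in> borel_measurable M" "(\<lambda>om. (lin (fw c j b) b s om)\<^sup>2) \<in> borel_measurable M"
    by measurable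
   show "integrable M (\<lambda>om. ((lin (fw a j b) b t om)\<^sup>2)\<^sup>2)" "integrable M (\<lambda>om. ((lin (fw c j b) b s om)\<^sup>2)\<^sup>2)"
    using rv8_pow_integrable[OF rv8_lin, of 4] by (simp_all flip: power_mult)
  qed
  have m0: "\<E> (\<lambda>om. (lin (fw a j b) b t om)\<^sup>2) = e a" for a t
   unfolding e_def power2_eq_square expectation_lin_lin ..
  have SS: "integrable M (\<lambda>om. S a t om * S a s om)" for a t s
   using L1 L2 unfolding S_def by (simp add: algebra_simps)
  have cov: "(\<Sum>s=1..N. \<bar>\<E> (\<lambda>om. S a t om * S a s om)\<bar>) \<le> b * K" for a t
  proof -
   have "\<E> (\<lambda>om. S a t om * S a s om) =
    \<E> (\<lambda>om. (lin (fw a j b) b t om)\<^sup>2 * (lin (fw a j b) b s om)\<^sup>2) - e a * e a" for s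
    using L1 L2 unfolding S_def by (simp add: algebra_simps prob_space m0)
   also have "\<dots> s = \<E> (\<lambda>om. lin (fw a j b) b t om * lin (fw a j b) b t om * (lin (fw a j b) b s om * lin (fw a j b) b s om))
    - \<E> (\<lambda>om. lin (fw a j b) b t om * lin (fw a j b) b t om) * \<E> (\<lambda>om. lin (fw a j b) b s om * lin (fw a j b) b s om)" for s
    using m0[of a t] m0[of a s] by (simp add: power2_eq_square)
   finally show ?thesis
    unfolding K_def using schur4[where w = "\<lambda>_. fw a j b" and b = b and N = N and t = t, OF abs_fw b(1)] by simp
  qed
  have sq: "integrable M (\<lambda>om. (\<Sum>t=1..N. S a t om)\<^sup>2) \<and> \<E> (\<lambda>om. (\<Sum>t=1..N. S a t om)\<^sup>2) \<le> N * (K * b)" for a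
  proof
   have eq: "(\<Sum>t=1..N. S a t om)\<^sup>2 = (\<Sum>t=1..N. \<Sum>s=1..N. S a t om * S a s om)" for om
    by (simp add: power2_eq_square sum_product)
   show "integrable M (\<lambda>om. (\<Sum>t=1..N. S a t om)\<^sup>2)"
    unfolding eq using SS by (intro Bochner_Integration.integrable_sum)
   have "\<E> (\<lambda>om. (\<Sum>t=1..N. S a t om)\<^sup>2) = (\<Sum>t=1..N. \<Sum>s=1..N. \<E> (\<lambda>om. S a t om * S a s om))"
    unfolding eq using SS by simp
   also have "\<dots> \<le> (\<Sum>t=1..N. b * K)"
    by (rule sum_mono) (rule order_trans[OF sum_mono[OF abs_ge_self] cov])
   finally show "\<E> (\<lambda>om. (\<Sum>t=1..N. S a t om)\<^sup>2) \<le> N * (K * b)" by (simp add: mult_ac)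
  qed
  have avg: "(\<Sum>t=1..N. I0 j b t om) / N = ((\<Sum>t=1..N. S False t om) + (\<Sum>t=1..N. S True t om)) / (2 * pi * N)" for om
   unfolding I0_eq S_def e_def by (simp add: sum.distrib sum_divide_distrib[symmetric])
  have Sm: "(\<lambda>om. \<Sum>t=1..N. S a t om) \<in> borel_measurable M" for a
   unfolding S_def by measurable
  have prodint: "integrable M (\<lambda>om. (\<Sum>t=1..N. S False t om) * (\<Sum>t=1..N. S True t om))"
   using sq Sm by (intro integrable_mult_squares) auto
  have int: "integrable M (\<lambda>om. ((\<Sum>t=1..N. I0 j b t om) / N)\<^sup>2)"
   unfolding avg power_divide power2_sum using sq prodint by (auto simp: mult.assoc)
  have le: "((\<Sum>t=1..N. I0 j b t om) / N)\<^sup>2 \<le> (2 * (\<Sum>t=1..N. S False t om)\<^sup>2 + 2 * (\<Sum>t=1..N. S True t om)\<^sup>2) / (4 * (real N)\<^sup>2)" for om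
  proof -
   have q: "(x + y)\<^sup>2 \<le> 2 * x\<^sup>2 + 2 * y\<^sup>2" for x y :: real
    using sum_squares_bound[of x y] by (simp add: power2_sum)
   have "((\<Sum>t=1..N. I0 j b t om) / N)\<^sup>2 \<le> (2 * (\<Sum>t=1..N. S False t om)\<^sup>2 + 2 * (\<Sum>t=1..N. S True t om)\<^sup>2) / (2 * pi * N)\<^sup>2"
    unfolding avg power_divide by (intro divide_right_mono q) simp
   also have "\<dots> \<le> (2 * (\<Sum>t=1..N. S False t om)\<^sup>2 + 2 * (\<Sum>t=1..N. S True t om)\<^sup>2) / (4 * (real N)\<^sup>2)"
   proof (rule divide_left_mono)
    show "4 * (real N)\<^sup>2 \<le> (2 * pi * N)\<^sup>2" using mult_right_mono[OF pi_sq_ge, of "(real N)\<^sup>2"] by (simp add: power_mult_distrib)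
   qed (use N in auto)
   finally show ?thesis .
  qed
  have "\<E> (\<lambda>om. ((\<Sum>t=1..N. I0 j b t om) / N)\<^sup>2) \<le>
   \<E> (\<lambda>om. (2 * (\<Sum>t=1..N. S False t om)\<^sup>2 + 2 * (\<Sum>t=1..N. S True t om)\<^sup>2) / (4 * (real N)\<^sup>2))"
   using int sq le by (intro integral_mono) auto
  also have "\<dots> = (2 * \<E> (\<lambda>om. (\<Sum>t=1..N. S False t om)\<^sup>2) + 2 * \<E> (\<lambda>om. (\<Sum>t=1..N. S True t om)\<^sup>2)) / (4 * (real N)\<^sup>2)"
   using sq by simp
  also have "\<dots> \<le> (2 * (N * (K * b)) + 2 * (N * (K * b))) / (4 * (real N)\<^sup>2)"
   using sq by (intro divide_right_mono add_mono mult_left_mono) auto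
  also have "\<dots> = K * (b / N)" using N by (simp add: power2_eq_square)
  finally show "integrable M (\<lambda>om. ((\<Sum>t=1..N. I0 j b t om) / N)\<^sup>2) \<and>
   \<E> (\<lambda>om. ((\<Sum>t=1..N. I0 j b t om) / N)\<^sup>2) \<le> K * (b / N)" using int by simp
 qed
qed

lemma per_pow4:
 assumes b: "b \<ge> 1"
 shows "integrable M (\<lambda>om. per j b t om ^ 4)" "\<E> (\<lambda>om. per j b t om ^ 4) \<le> mom8"
proof -
 have l8: "integrable M (\<lambda>om. lin (fw a j b) b t om ^ 8)" for a using rv8_lin by (simp add: rv8_def)
 have le: "per j b t om ^ 4 \<le> (lin (fw False j b) b t om ^ 8 + lin (fw True j b) b t om ^ 8) / 2" for om
 proof -
  have q: "(x + y)\<^sup>2 \<le> 2 * (x\<^sup>2 + y\<^sup>2)" for x y :: real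
   using sum_squares_bound[of x y] by (simp add: power2_sum)
  have p4: "(x + y) ^ 4 \<le> 8 * (x ^ 4 + y ^ 4)" for x y :: real
  proof -
   have "(x + y) ^ 4 = ((x + y)\<^sup>2)\<^sup>2" by simp
   also have "\<dots> \<le> (2 * (x\<^sup>2 + y\<^sup>2))\<^sup>2" by (intro power_mono q) auto
   also have "\<dots> = 4 * (x\<^sup>2 + y\<^sup>2)\<^sup>2" by (simp only: power_mult_distrib) simp
   also have "\<dots> \<le> 4 * (2 * ((x\<^sup>2)\<^sup>2 + (y\<^sup>2)\<^sup>2))" by (intro mult_left_mono q) auto
   also have "\<dots> = 8 * (x ^ 4 + y ^ 4)" by simp
   finally show ?thesis .
  qed
  have "per j b t om ^ 4 = ((lin (fw False j b) b t om)\<^sup>2 + (lin (fw True j b) b t om)\<^sup>2) ^ 4 / (2 * pi) ^ 4"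
   by (simp add: per_def power_divide)
  also have "\<dots> \<le> (8 * (((lin (fw False j b) b t om)\<^sup>2) ^ 4 + ((lin (fw True j b) b t om)\<^sup>2) ^ 4)) / (2 * pi) ^ 4"
   by (intro divide_right_mono p4) auto
  also have "\<dots> \<le> (8 * (((lin (fw False j b) b t om)\<^sup>2) ^ 4 + ((lin (fw True j b) b t om)\<^sup>2) ^ 4)) / 16"
  proof (rule divide_left_mono)
   have "2 ^ 4 \<le> (2 * pi) ^ 4" using pi_gt3 by (intro power_mono) auto
   then show "16 \<le> (2 * pi) ^ 4" by simp
  qed auto
  finally show ?thesis by (simp add: power_mult[symmetric])
 qed
 have pm: "per j b t \<in> borel_measurable M"
  unfolding per_def[abs_def] by measurable
 show int: "integrable M (\<lambda>om. per j b t om ^ 4)"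
 proof (rule Bochner_Integration.integrable_bound)
  show "integrable M (\<lambda>om. (lin (fw False j b) b t om ^ 8 + lin (fw True j b) b t om ^ 8) / 2)" using l8 by simp
  show "AE om in M. norm (per j b t om ^ 4) \<le> norm ((lin (fw False j b) b t om ^ 8 + lin (fw True j b) b t om ^ 8) / 2)"
   using le by (intro AE_I2) (simp add: abs_of_nonneg)
 qed (use pm in simp)
 have "\<E> (\<lambda>om. per j b t om ^ 4) \<le> \<E> (\<lambda>om. (lin (fw False j b) b t om ^ 8 + lin (fw True j b) b t om ^ 8) / 2)"
  using int l8 le by (intro integral_mono) auto
 also have "\<dots> = (\<E> (\<lambda>om. lin (fw False j b) b t om ^ 8) + \<E> (\<lambda>om. lin (fw True j b) b t om ^ 8)) / 2"
  using l8 by simp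
 also have "\<dots> \<le> (mom8 + mom8) / 2"
  by (intro divide_right_mono add_mono lin8_bound abs_fw b) simp
 finally show "\<E> (\<lambda>om. per j b t om ^ 4) \<le> mom8" by simp
qed

end

section \<open>Riemann sums of functions of bounded variation\<close>

lemma bv_interlaced:
 assumes "bounded_variation_on a c g"
 obtains B :: real where "B \<ge> 0"
  "\<And>n x y. (\<And>i. i < n ==> x i \<le> y i) ==> (\<And>i. Suc i < n ==> y i \<le> x (Suc i)) ==>
   (\<And>i. i < n ==> a \<le> x i \<and> y i \<le> c) ==> (\<Sum>i<n. \<bar>g (y i) - g (x i)\<bar>) \<le> B"
proof -
 obtain B where B: "\<And>p m. mono_on {..m} p ==> p ` {..m} \<subseteq> {a..c} ==>
   (\<Sum>i<m. \<bar>g (p (Suc i)) - g (p i)\<bar>) \<le> B" for p :: "nat => real"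
  using assms unfolding bounded_variation_on_def by blast
 show thesis
 proof (rule that[of "\<bar>B\<bar>"])
  fix n and x y :: "nat => real"
  assume xy: "\<And>i. i < n ==> x i \<le> y i" "\<And>i. Suc i < n ==> y i \<le> x (Suc i)"
   and ac: "\<And>i. i < n ==> a \<le> x i \<and> y i \<le> c"
  show "(\<Sum>i<n. \<bar>g (y i) - g (x i)\<bar>) \<le> \<bar>B\<bar>"
  proof (cases "n = 0")
   case False
   \<comment> \<open>The two families interlace, so merging them gives one monotone grid; the
     increments from \<open>x i\<close> to \<open>y i\<close> are its steps with even index.\<close>
   define p where "p i = (if even i then x (i div 2) else y (i div 2))" for i
   let ?m = "2 * n - 1"
   have step: "p i \<le> p (Suc i)" if "i < ?m" for i
   proof (cases "even i")
    case True
    then show ?thesis using xy(1)[of "i div 2"] that by (simp add: p_def)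
   next
    case odd: False
    then obtain k where k: "i = 2 * k + 1" by (auto elim: oddE)
    then show ?thesis using xy(2)[of k] that by (simp add: p_def)
   qed
   have mono: "mono_on {..?m} p"
   proof (rule mono_onI)
    fix r s assume rs: "r \<in> {..?m}" "s \<in> {..?m}" "r \<le> s"
    from rs(3) rs(2) show "p r \<le> p s"
    proof (induction s rule: dec_induct)
     case (step k)
     have "p k \<le> p (Suc k)" using step.prems by (intro \<open>\<And>i. i < ?m ==> p i \<le> p (Suc i)\<close>) auto
     then show ?case using step by auto
    qed simp
   qed
   have "p i \<in> {a..c}" if "i \<le> ?m" for i
   proof -
    have "i div 2 < n" using that False by linarith
    then show ?thesis using ac[of "i div 2"] xy(1)[of "i div 2"] by (auto simp: p_def)
   qed
   then have "(\<Sum>i<?m. \<bar>g (p (Suc i)) - g (p i)\<bar>) \<le> B" by (intro B mono) auto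
   moreover have "(\<Sum>i<n. \<bar>g (y i) - g (x i)\<bar>) = (\<Sum>i\<in>(\<lambda>i. 2 * i) ` {..<n}. \<bar>g (p (Suc i)) - g (p i)\<bar>)"
    by (subst sum.reindex) (auto simp: inj_on_def p_def)
   moreover have "\<dots> \<le> (\<Sum>i<?m. \<bar>g (p (Suc i)) - g (p i)\<bar>)"
    by (intro sum_mono2) auto
   ultimately show ?thesis by linarith
  qed simp
 qed simp
qed

text \<open>This class is closed under products and contains the integrands of the limiting variance.\<close>

definition bvdom :: "(real => real) => (real => real) => bool" where
 "bvdom \<psi> g \<longleftrightarrow> set_borel_measurable lborel {-pi..pi} g \<and>
   (\<exists>B. \<forall>x\<in>{-pi..pi}. \<bar>g x\<bar> \<le> B) \<and>
   (\<exists>K\<ge>0. \<forall>x\<in>{-pi..pi}. \<forall>y\<in>{-pi..pi}.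
    \<bar>g x - g y\<bar> \<le> K * (\<bar>\<psi> x - \<psi> y\<bar> + \<bar>\<psi> (- x) - \<psi> (- y)\<bar> + \<bar>x - y\<bar>))"

lemma bv_bounded:
 assumes "bounded_variation_on a c g" "a \<le> c"
 shows "\<exists>B. \<forall>x\<in>{a..c}. \<bar>g x\<bar> \<le> B"
proof (rule bv_interlaced[OF assms(1)])
 fix B assume B: "\<And>n x y. (\<And>i. i < n ==> x i \<le> y i) ==> (\<And>i. Suc i < n ==> y i \<le> x (Suc i)) ==>
   (\<And>i. i < n ==> a \<le> x i \<and> y i \<le> c) ==> (\<Sum>i<n. \<bar>g (y i) - g (x i)\<bar>) \<le> B"
 have "\<bar>g x\<bar> \<le> \<bar>g a\<bar> + B" if "x \<in> {a..c}" for x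
  using B[of 1 "\<lambda>_. a" "\<lambda>_. x"] that by auto
 then show ?thesis by blast
qed

lemma set_measurable_times:
 fixes g h :: "real => real"
 assumes "set_borel_measurable lborel A g" "set_borel_measurable lborel A h"
 shows "set_borel_measurable lborel A (\<lambda>x. g x * h x)"
proof -
 have "(\<lambda>x. indicator A x *\<^sub>R (g x * h x)) = (\<lambda>x. (indicator A x *\<^sub>R g x) * (indicator A x *\<^sub>R h x))"
  by (auto simp: indicator_def)
 then show ?thesis using assms unfolding set_borel_measurable_def by simp
qed

lemma set_measurable_reflect:
 fixes g :: "real => real"
 assumes "set_borel_measurable lborel {-pi..pi} g"
 shows "set_borel_measurable lborel {-pi..pi} (\<lambda>x. g (- x))"
proof -
 have "(\<lambda>x. indicator {-pi..pi} (- x) *\<^sub>R g (- x)) \<in> borel_measurable lborel"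
  using measurable_compose[OF _ assms[unfolded set_borel_measurable_def], of uminus lborel] by simp
 moreover have "indicator {-pi..pi} (- x) = (indicator {-pi..pi} x :: real)" for x :: real
  by (auto simp: indicator_def)
 ultimately show ?thesis unfolding set_borel_measurable_def by simp
qed

lemma bvdom_self:
 assumes "set_borel_measurable lborel {-pi..pi} \<psi>" "bounded_variation_on (-pi) pi \<psi>"
 shows "bvdom \<psi> \<psi>"
 unfolding bvdom_def using assms bv_bounded[OF assms(2)] by (auto intro!: exI[of _ 1])

lemma bvdom_reflect:
 assumes "bvdom \<psi> g"
 shows "bvdom \<psi> (\<lambda>x. g (- x))"
proof -
 obtain B K where B: "\<And>x. x \<in> {-pi..pi} ==> \<bar>g x\<bar> \<le> B" and K: "K \<ge> 0"
  "\<And>x y. x \<in> {-pi..pi} ==> y \<in> {-pi..pi} ==> \<bar>g x - g y\<bar> \<le> K * (\<bar>\<psi> x - \<psi> y\<bar> + \<bar>\<psi> (- x) - \<psi> (- y)\<bar> + \<bar>x - y\<bar>)"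
  using assms unfolding bvdom_def by blast
 have "\<bar>g (- x) - g (- y)\<bar> \<le> K * (\<bar>\<psi> x - \<psi> y\<bar> + \<bar>\<psi> (- x) - \<psi> (- y)\<bar> + \<bar>x - y\<bar>)"
  if "x \<in> {-pi..pi}" "y \<in> {-pi..pi}" for x y
  using K(2)[of "- x" "- y"] that by (simp add: abs_minus_commute[of y x] add_ac)
 moreover have "\<bar>g (- x)\<bar> \<le> B" if "x \<in> {-pi..pi}" for x using B[of "- x"] that by auto
 ultimately show ?thesis
  using assms set_measurable_reflect K(1) unfolding bvdom_def by blast
qed

lemma bvdom_lipschitz:
 assumes "L \<ge> 0" "\<And>x y. \<bar>g x - g y\<bar> \<le> L * \<bar>x - y\<bar>"
 shows "bvdom \<psi> g"
proof -
 have c: "continuous_on A g" for A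
 proof (rule uniformly_continuous_imp_continuous, rule lipschitz_on_uniformly_continuous[where L = L])
  show "L-lipschitz_on A g" using assms by (intro lipschitz_onI) (auto simp: dist_real_def)
 qed
 have "g \<in> borel_measurable borel" using c by (rule borel_measurable_continuous_onI)
 then have "set_borel_measurable lborel {-pi..pi} g" unfolding set_borel_measurable_def by simp
 moreover have "\<bar>g x\<bar> \<le> \<bar>g 0\<bar> + L * pi" if "x \<in> {-pi..pi}" for x
 proof -
  have "\<bar>g x - g 0\<bar> \<le> L * \<bar>x - 0\<bar>" by (rule assms(2))
  also have "\<dots> \<le> L * pi" using that assms(1) by (intro mult_left_mono) auto
  finally show ?thesis by linarith
 qed
 moreover have "\<bar>g x - g y\<bar> \<le> L * (\<bar>\<psi> x - \<psi> y\<bar> + \<bar>\<psi> (- x) - \<psi> (- y)\<bar> + \<bar>x - y\<bar>)" for x y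
  by (rule order_trans[OF assms(2)]) (use assms(1) in \<open>auto intro!: mult_left_mono\<close>)
 ultimately show ?thesis using assms(1) unfolding bvdom_def by blast
qed

lemma bvdom_add:
 assumes "bvdom \<psi> g" "bvdom \<psi> h"
 shows "bvdom \<psi> (\<lambda>x. g x + h x)"
proof -
 obtain B K where B: "\<And>x. x \<in> {-pi..pi} ==> \<bar>g x\<bar> \<le> B" and K: "K \<ge> 0"
  "\<And>x y. x \<in> {-pi..pi} ==> y \<in> {-pi..pi} ==> \<bar>g x - g y\<bar> \<le> K * (\<bar>\<psi> x - \<psi> y\<bar> + \<bar>\<psi> (- x) - \<psi> (- y)\<bar> + \<bar>x - y\<bar>)"
  using assms(1) unfolding bvdom_def by blast
 obtain B' K' where B': "\<And>x. x \<in> {-pi..pi} ==> \<bar>h x\<bar> \<le> B'" and K': "K' \<ge> 0"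
  "\<And>x y. x \<in> {-pi..pi} ==> y \<in> {-pi..pi} ==> \<bar>h x - h y\<bar> \<le> K' * (\<bar>\<psi> x - \<psi> y\<bar> + \<bar>\<psi> (- x) - \<psi> (- y)\<bar> + \<bar>x - y\<bar>)"
  using assms(2) unfolding bvdom_def by blast
 have "set_borel_measurable lborel {-pi..pi} (\<lambda>x. g x + h x)"
 proof -
  have "set_borel_measurable lborel {-pi..pi} g" "set_borel_measurable lborel {-pi..pi} h"
   using assms unfolding bvdom_def by blast+
  then show ?thesis unfolding set_borel_measurable_def by (simp add: distrib_left)
 qed
 moreover have "\<bar>g x + h x\<bar> \<le> B + B'" if "x \<in> {-pi..pi}" for x
  using B[OF that] B'[OF that] by linarith
 moreover have "\<bar>(g x + h x) - (g y + h y)\<bar> \<le> (K + K') * (\<bar>\<psi> x - \<psi> y\<bar> + \<bar>\<psi> (- x) - \<psi> (- y)\<bar> + \<bar>x - y\<bar>)"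
  if "x \<in> {-pi..pi}" "y \<in> {-pi..pi}" for x y
  using K(2)[OF that] K'(2)[OF that] unfolding distrib_right[of K K'] by linarith
 moreover have "K + K' \<ge> 0" using K K' by simp
 ultimately show ?thesis unfolding bvdom_def by blast
qed

lemma bvdom_mult:
 assumes "bvdom \<psi> g" "bvdom \<psi> h"
 shows "bvdom \<psi> (\<lambda>x. g x * h x)"
proof -
 obtain B K where B: "\<And>x. x \<in> {-pi..pi} ==> \<bar>g x\<bar> \<le> B" and K: "K \<ge> 0"
  "\<And>x y. x \<in> {-pi..pi} ==> y \<in> {-pi..pi} ==> \<bar>g x - g y\<bar> \<le> K * (\<bar>\<psi> x - \<psi> y\<bar> + \<bar>\<psi> (- x) - \<psi> (- y)\<bar> + \<bar>x - y\<bar>)"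
  using assms(1) unfolding bvdom_def by blast
 obtain B' K' where B': "\<And>x. x \<in> {-pi..pi} ==> \<bar>h x\<bar> \<le> B'" and K': "K' \<ge> 0"
  "\<And>x y. x \<in> {-pi..pi} ==> y \<in> {-pi..pi} ==> \<bar>h x - h y\<bar> \<le> K' * (\<bar>\<psi> x - \<psi> y\<bar> + \<bar>\<psi> (- x) - \<psi> (- y)\<bar> + \<bar>x - y\<bar>)"
  using assms(2) unfolding bvdom_def by blast
 have pos: "B \<ge> 0" "B' \<ge> 0" using B[of 0] B'[of 0] by auto
 have "\<bar>g x * h x\<bar> \<le> B * B'" if "x \<in> {-pi..pi}" for x
  unfolding abs_mult using B[OF that] B'[OF that] pos by (intro mult_mono) auto
 moreover have "\<bar>g x * h x - g y * h y\<bar> \<le> (B * K' + B' * K) * (\<bar>\<psi> x - \<psi> y\<bar> + \<bar>\<psi> (- x) - \<psi> (- y)\<bar> + \<bar>x - y\<bar>)"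
  if xy: "x \<in> {-pi..pi}" "y \<in> {-pi..pi}" for x y
 proof -
  have "g x * h x - g y * h y = g x * (h x - h y) + h y * (g x - g y)" by (simp add: algebra_simps)
  then have "\<bar>g x * h x - g y * h y\<bar> \<le> \<bar>g x\<bar> * \<bar>h x - h y\<bar> + \<bar>h y\<bar> * \<bar>g x - g y\<bar>"
   by (metis abs_triangle_ineq abs_mult)
  also have "\<dots> \<le> B * (K' * (\<bar>\<psi> x - \<psi> y\<bar> + \<bar>\<psi> (- x) - \<psi> (- y)\<bar> + \<bar>x - y\<bar>))
    + B' * (K * (\<bar>\<psi> x - \<psi> y\<bar> + \<bar>\<psi> (- x) - \<psi> (- y)\<bar> + \<bar>x - y\<bar>))"
   using B[OF xy(1)] B'[OF xy(2)] K(2)[OF xy] K'(2)[OF xy] pos by (intro add_mono mult_mono) auto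
  finally show ?thesis by (simp add: distrib_right mult.assoc)
 qed
 moreover have "B * K' + B' * K \<ge> 0" using K K' pos by simp
 moreover have "set_borel_measurable lborel {-pi..pi} (\<lambda>x. g x * h x)"
  using assms unfolding bvdom_def by (intro set_measurable_times) auto
 ultimately show ?thesis unfolding bvdom_def by blast
qed

lemma bvdom_set_integrable:
 assumes "bvdom \<psi> g" "S \<subseteq> {-pi..pi}" "S \<in> sets borel"
 shows "set_integrable lborel S g"
proof -
 obtain B where B: "\<And>x. x \<in> {-pi..pi} ==> \<bar>g x\<bar> \<le> B" using assms unfolding bvdom_def by blast
 have "set_integrable lborel {-pi..pi} g"
  unfolding set_integrable_def
 proof (rule integrableI_bounded_set[where A = "{-pi..pi}" and B = B])
  show "(\<lambda>x. indicator {-pi..pi} x *\<^sub>R g x) \<in> borel_measurable lborel"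
   using assms(1) unfolding bvdom_def set_borel_measurable_def by blast
  show "emeasure lborel {-pi..pi} < \<infinity>" by (simp add: emeasure_lborel_Icc_eq)
 qed (use B in auto)
 then show ?thesis by (rule set_integrable_subset) (use assms in auto)
qed

lemma bvdom_integrable_on:
 assumes "bvdom \<psi> g" "-pi \<le> a" "c \<le> pi"
 shows "g integrable_on {a..c}"
proof -
 have "set_integrable lborel {a..c} g" using assms by (intro bvdom_set_integrable[OF assms(1)]) auto
 then show ?thesis by (rule set_borel_integral_eq_integral(1))
qed

text \<open>Reflection reverses the order of the points and exchanges left and right ends, so the
  reflected sum is an interlaced sum read backwards.\<close>

lemma bv_interlaced_reflect:
 assumes "bounded_variation_on (- c) c g"
 obtains B :: real where "B \<ge> 0"
  "\<And>n x y. (\<And>i. i < n ==> x i \<le> y i) ==> (\<And>i. Suc i < n ==> y i \<le> x (Suc i)) ==>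
   (\<And>i. i < n ==> - c \<le> x i \<and> y i \<le> c) ==>
   (\<Sum>i<n. \<bar>g (y i) - g (x i)\<bar>) \<le> B \<and> (\<Sum>i<n. \<bar>g (- y i) - g (- x i)\<bar>) \<le> B"
proof (rule bv_interlaced[OF assms])
 fix B assume B: "B \<ge> 0" "\<And>n x y. (\<And>i. i < n ==> x i \<le> y i) ==> (\<And>i. Suc i < n ==> y i \<le> x (Suc i)) ==>
   (\<And>i. i < n ==> - c \<le> x i \<and> y i \<le> c) ==> (\<Sum>i<n. \<bar>g (y i) - g (x i)\<bar>) \<le> B"
 show thesis
 proof (rule that[OF B(1)], intro conjI)
  fix n and x y :: "nat => real"
  assume xy: "\<And>i. i < n ==> x i \<le> y i" "\<And>i. Suc i < n ==> y i \<le> x (Suc i)"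
   "\<And>i. i < n ==> - c \<le> x i \<and> y i \<le> c"
  show "(\<Sum>i<n. \<bar>g (y i) - g (x i)\<bar>) \<le> B" by (rule B(2)[where x = x and y = y]) (use xy in auto)
  have "(\<Sum>i<n. \<bar>g (- y i) - g (- x i)\<bar>) = (\<Sum>i<n. \<bar>g (- y (n - Suc i)) - g (- x (n - Suc i))\<bar>)"
   by (rule sum.nat_diff_reindex[symmetric])
  also have "\<dots> = (\<Sum>i<n. \<bar>g (- x (n - Suc i)) - g (- y (n - Suc i))\<bar>)"
   by (simp add: abs_minus_commute)
  also have "\<dots> \<le> B"
  proof (rule B(2))
   fix i assume i: "Suc i < n"
   then have "Suc (n - Suc (Suc i)) = n - Suc i" by simp
   then show "- x (n - Suc i) \<le> - y (n - Suc (Suc i))" using xy(2)[of "n - Suc (Suc i)"] i by simp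
  next
   fix i assume "i < n"
   then show "- y (n - Suc i) \<le> - x (n - Suc i)" "- c \<le> - y (n - Suc i) \<and> - x (n - Suc i) \<le> c"
    using xy(1)[of "n - Suc i"] xy(3)[of "n - Suc i"] by auto
  qed
  finally show "(\<Sum>i<n. \<bar>g (- y i) - g (- x i)\<bar>) \<le> B" .
 qed
qed

text \<open>\<open>g\<close> need not be continuous, hence the slack \<open>e\<close> in place of an
  exact mean value. If every \<open>y\<close> violated the bound, the oscillation
  \<open>g y - g a\<close> would everywhere stay below its own average by a fixed amount.\<close>

lemma integral_point_bound:
 fixes g :: "real => real"
 assumes g: "g integrable_on {a..c}" and ac: "a < c" and e: "e > 0"
 shows "\<exists>y\<in>{a..c}. \<bar>integral {a..c} g - (c - a) * g a\<bar> \<le> (c - a) * (\<bar>g y - g a\<bar> + e)"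
proof (rule ccontr)
 define D where "D = \<bar>integral {a..c} g - (c - a) * g a\<bar> / (c - a)"
 have D: "\<bar>integral {a..c} g - (c - a) * g a\<bar> = D * (c - a)" using ac by (simp add: D_def)
 assume "\<not> ?thesis"
 then have lt: "\<bar>g y - g a\<bar> + e < D" if "y \<in> {a..c}" for y
  using that ac unfolding D by (auto simp: not_le mult.commute)
 have "((\<lambda>y. g y - g a) has_integral (integral {a..c} g - (c - a) * g a)) (cbox a c)"
  using has_integral_diff[OF integrable_integral[OF g] has_integral_const_real[of "g a" a c]] ac
  by simp
 then have "norm (integral {a..c} g - (c - a) * g a) \<le> (D - e) * measure lborel (cbox a c)"
 proof (rule has_integral_bound[rotated])
  show "0 \<le> D - e" using lt[of a] ac by simp
  show "norm (g y - g a) \<le> D - e" if "y \<in> cbox a c" for y using lt[of y] that by simp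
 qed
 then have "D * (c - a) \<le> (D - e) * (c - a)" using ac D by simp
 then show False using ac e by simp
qed

lemma riemann_bvdom:
 assumes bv: "bounded_variation_on (-pi) pi \<psi>" and g: "bvdom \<psi> g"
 obtains C :: real where "\<And>b. b \<ge> 1 ==>
  \<bar>2 * pi / b * (\<Sum>j\<in>FI b. g (ff j b)) - (LBINT l:{-pi..pi}. g l)\<bar> \<le> C / b"
proof (rule bv_interlaced_reflect[OF bv])
 fix V assume V: "V \<ge> 0" "\<And>n x y. (\<And>i. i < n ==> x i \<le> y i) ==> (\<And>i. Suc i < n ==> y i \<le> x (Suc i)) ==>
   (\<And>i. i < n ==> - pi \<le> x i \<and> y i \<le> pi) ==>
   (\<Sum>i<n. \<bar>\<psi> (y i) - \<psi> (x i)\<bar>) \<le> V \<and> (\<Sum>i<n. \<bar>\<psi> (- y i) - \<psi> (- x i)\<bar>) \<le> V"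
 obtain B K where B: "\<And>x. x \<in> {-pi..pi} ==> \<bar>g x\<bar> \<le> B" and K: "K \<ge> 0"
  "\<And>x y. x \<in> {-pi..pi} ==> y \<in> {-pi..pi} ==> \<bar>g x - g y\<bar> \<le> K * (\<bar>\<psi> x - \<psi> y\<bar> + \<bar>\<psi> (- x) - \<psi> (- y)\<bar> + \<bar>x - y\<bar>)"
  using g unfolding bvdom_def by blast
 have B0: "B \<ge> 0" using B[of 0] by auto
 show thesis
 proof (rule that[of "2 * pi * (K * (V + V + 2 * pi) + 2 * pi + 4 * B)"])
  fix b :: nat assume b: "b \<ge> 1"
  define n where "n = b div 2"
  define h where "h = 2 * pi / b"
  \<comment> \<open>The grid runs from \<open>- (n * h)\<close> to \<open>n * h\<close> with
    \<open>n = b div 2\<close>, which leaves at most \<open>h / 2\<close> of the interval uncovered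
    at each end.\<close>
  define x where "x i = (real i - real n) * h" for i :: nat
  have h: "h > 0" using b by (simp add: h_def)
  have "2 * real n \<le> b" "real b \<le> 2 * real n + 1" unfolding n_def by linarith+
  then have "2 * real n * h \<le> b * h" "b * h \<le> (2 * real n + 1) * h" using h by (auto intro!: mult_right_mono)
  moreover have "b * h = 2 * pi" using b by (simp add: h_def)
  ultimately have nh: "n * h \<le> pi" "pi \<le> n * h + h / 2" by (auto simp: algebra_simps)
  have xs: "x (Suc i) = x i + h" for i by (simp add: x_def algebra_simps)
  have x0: "x 0 = - (n * h)" and x2n: "x (2 * n) = n * h" by (auto simp: x_def)
  have xm: "x i \<le> x k" if "i \<le> k" for i k using that h by (simp add: x_def)
  have xin: "x i \<in> {-pi..pi}" if "i \<le> 2 * n" for i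
   using xm[of 0 i] xm[OF that] nh by (auto simp: x0 x2n)
  have int: "g integrable_on {a..c}" if "-pi \<le> a" "c \<le> pi" for a c
   by (rule bvdom_integrable_on[OF g that])
  have "\<exists>y\<in>{x i..x (Suc i)}. \<bar>integral {x i..x (Suc i)} g - h * g (x i)\<bar> \<le> h * (\<bar>g y - g (x i)\<bar> + h)"
   if "i < 2 * n" for i
   using integral_point_bound[of g "x i" "x (Suc i)" h] int[of "x i" "x (Suc i)"] xin[of i] xin[of "Suc i"] that h
   by (simp add: xs)
  then obtain y where y: "\<And>i. i < 2 * n ==> y i \<in> {x i..x (Suc i)}"
   "\<And>i. i < 2 * n ==> \<bar>integral {x i..x (Suc i)} g - h * g (x i)\<bar> \<le> h * (\<bar>g (y i) - g (x i)\<bar> + h)"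
   by metis
  have yin: "y i \<in> {-pi..pi}" if "i < 2 * n" for i
   using y(1)[OF that] xin[of i] xin[of "Suc i"] that by auto
  \<comment> \<open>Each cell contributes a pair between consecutive grid points, so the total
    variation bounds the oscillations of all cells at once and leaves the factor \<open>h\<close> as
    the rate.\<close>
  have VV: "(\<Sum>i<2*n. \<bar>\<psi> (y i) - \<psi> (x i)\<bar>) \<le> V \<and> (\<Sum>i<2*n. \<bar>\<psi> (- y i) - \<psi> (- x i)\<bar>) \<le> V"
   by (rule V(2)) (use y(1) xin yin in \<open>auto simp: less_imp_le\<close>)
  have comb: "integral {x 0..x m} g = (\<Sum>i<m. integral {x i..x (Suc i)} g)" if "m \<le> 2 * n" for m
   using that
  proof (induction m)
   case (Suc m)
   have "integral {x 0..x m} g + integral {x m..x (Suc m)} g = integral {x 0..x (Suc m)} g"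
    using Suc.prems xm[of 0 m] xm[of m "Suc m"] xin[of 0] xin[of "Suc m"]
    by (intro Henstock_Kurzweil_Integration.integral_combine int) auto
   then show ?case using Suc by simp
  qed simp
  have "\<bar>integral {x 0..x (2 * n)} g - (\<Sum>i<2*n. h * g (x i))\<bar> \<le> (\<Sum>i<2*n. h * (\<bar>g (y i) - g (x i)\<bar> + h))"
   unfolding comb[OF order_refl] sum_subtractf[symmetric]
   by (intro order_trans[OF sum_abs] sum_mono y(2)) auto
  also have "\<dots> \<le> (\<Sum>i<2*n. h * (K * (\<bar>\<psi> (y i) - \<psi> (x i)\<bar> + \<bar>\<psi> (- y i) - \<psi> (- x i)\<bar> + h) + h))"
  proof (intro sum_mono mult_left_mono add_right_mono)
   fix i assume "i \<in> {..<2 * n}"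
   then have i: "i < 2 * n" by simp
   have "\<bar>y i - x i\<bar> \<le> h" using y(1)[OF i] by (auto simp: xs)
   then have "K * (\<bar>\<psi> (y i) - \<psi> (x i)\<bar> + \<bar>\<psi> (- y i) - \<psi> (- x i)\<bar> + \<bar>y i - x i\<bar>) \<le>
     K * (\<bar>\<psi> (y i) - \<psi> (x i)\<bar> + \<bar>\<psi> (- y i) - \<psi> (- x i)\<bar> + h)" using K(1) by (intro mult_left_mono) auto
   then show "\<bar>g (y i) - g (x i)\<bar> \<le> K * (\<bar>\<psi> (y i) - \<psi> (x i)\<bar> + \<bar>\<psi> (- y i) - \<psi> (- x i)\<bar> + h)"
    using K(2)[OF yin[OF i] xin[of i]] i by linarith
  qed (use h in auto)
  also have "\<dots> = h * (K * ((\<Sum>i<2*n. \<bar>\<psi> (y i) - \<psi> (x i)\<bar>) + (\<Sum>i<2*n. \<bar>\<psi> (- y i) - \<psi> (- x i)\<bar>) + 2 * real n * h) + 2 * real n * h)"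
   by (simp add: sum.distrib sum_distrib_left[symmetric])
  also have "\<dots> \<le> h * (K * (V + V + 2 * pi) + 2 * pi)"
   using VV nh K(1) h by (intro mult_left_mono add_mono) auto
  finally have main: "\<bar>integral {x 0..x (2 * n)} g - (\<Sum>i<2*n. h * g (x i))\<bar> \<le> h * (K * (V + V + 2 * pi) + 2 * pi)" .
  have small: "\<bar>integral {a..c} g\<bar> \<le> B * h" if "-pi \<le> a" "a \<le> c" "c \<le> pi" "c - a \<le> h" for a c
  proof -
   have "norm (integral {a..c} g) \<le> B * measure lborel (cbox a c)"
    using integrable_integral[OF int[OF that(1,3)]] B that B0 by (intro has_integral_bound) auto
   also have "\<dots> \<le> B * h" using that B0 by (simp add: mult_left_mono)
   finally show ?thesis by simp
  qed
  have "integral {-pi..pi} g = integral {-pi..x 0} g + integral {x 0..x (2 * n)} g + integral {x (2 * n)..pi} g"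
  proof -
   have "integral {-pi..x 0} g + integral {x 0..pi} g = integral {-pi..pi} g"
    using xin[of 0] by (intro Henstock_Kurzweil_Integration.integral_combine int) auto
   moreover have "integral {x 0..x (2 * n)} g + integral {x (2 * n)..pi} g = integral {x 0..pi} g"
    using xin[of 0] xin[of "2 * n"] xm[of 0 "2 * n"] by (intro Henstock_Kurzweil_Integration.integral_combine int) auto
   ultimately show ?thesis by simp
  qed
  moreover have "\<bar>integral {-pi..x 0} g\<bar> \<le> B * h" "\<bar>integral {x (2 * n)..pi} g\<bar> \<le> B * h"
   using nh h xin[of 0] xin[of "2 * n"] by (auto intro!: small simp: x0 x2n)
  ultimately have ends: "\<bar>integral {-pi..pi} g - integral {x 0..x (2 * n)} g\<bar> \<le> 2 * B * h" by linarith
  have "(\<Sum>j\<in>FI b. g (ff j b)) = (\<Sum>i=1..n. g (real i * h)) + (\<Sum>i=1..n. g (- (real i * h)))"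
  proof -
   have "(\<Sum>j\<in>FI b. g (ff j b)) = (\<Sum>j\<in>int ` {1..n}. g (ff j b)) + (\<Sum>j\<in>(\<lambda>i. - int i) ` {1..n}. g (ff j b))"
    unfolding fourier_indices_eq n_def by (rule sum.union_disjoint) auto
   then show ?thesis by (simp add: sum.reindex inj_on_def fourier_freq_def h_def mult_ac)
  qed
  also have "(\<Sum>i=1..n. g (- (real i * h))) = (\<Sum>i<n. g (x i))"
   by (rule sum.reindex_bij_witness[of _ "\<lambda>i. n - i" "\<lambda>i. n - i"]) (auto simp: x_def algebra_simps of_nat_diff)
  \<comment> \<open>The Fourier indices omit 0 and include \<open>n\<close>, whereas the left
    endpoints include 0 and omit \<open>n\<close>: hence the correction by two values of
    \<open>g\<close>.\<close>
  also have "(\<Sum>i=1..n. g (real i * h)) = (\<Sum>i<n. g (real i * h)) - g 0 + g (n * h)"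
  proof -
   have "(\<Sum>i<Suc n. g (real i * h)) = g 0 + (\<Sum>i=1..n. g (real i * h))"
    by (simp add: lessThan_Suc_atMost atMost_atLeast0 sum.atLeast_Suc_atMost)
   then show ?thesis by simp
  qed
  also have "(\<Sum>i<n. g (real i * h)) = (\<Sum>i=n..<2*n. g (x i))"
   by (rule sum.reindex_bij_witness[of _ "\<lambda>i. i - n" "\<lambda>i. i + n"]) (auto simp: x_def)
  finally have "(\<Sum>j\<in>FI b. g (ff j b)) = (\<Sum>i<2*n. g (x i)) - g 0 + g (n * h)"
   using sum.atLeastLessThan_concat[of 0 n "2 * n" "\<lambda>i. g (x i)"] by (simp add: lessThan_atLeast0)
  then have "h * (\<Sum>j\<in>FI b. g (ff j b)) - (\<Sum>i<2*n. h * g (x i)) = h * (g (n * h) - g 0)"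
   unfolding sum_distrib_left[symmetric] by (simp only: right_diff_distrib[symmetric] distrib_left) (simp add: algebra_simps)
  also have "\<bar>\<dots>\<bar> \<le> h * (2 * B)"
   unfolding abs_mult using B[of "n * h"] B[of 0] xin[of "2 * n"] h by (intro mult_mono) (auto simp: x2n)
  finally have G: "\<bar>h * (\<Sum>j\<in>FI b. g (ff j b)) - (\<Sum>i<2*n. h * g (x i))\<bar> \<le> h * (2 * B)" .
  have L: "(LBINT l:{-pi..pi}. g l) = integral {-pi..pi} g"
   by (rule set_borel_integral_eq_integral(2)[OF bvdom_set_integrable[OF g]]) auto
  have "\<bar>h * (\<Sum>j\<in>FI b. g (ff j b)) - integral {-pi..pi} g\<bar> \<le> h * (K * (V + V + 2 * pi) + 2 * pi + 4 * B)"
   using main ends G by (simp add: algebra_simps)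
  then show "\<bar>2 * pi / b * (\<Sum>j\<in>FI b. g (ff j b)) - (LBINT l:{-pi..pi}. g l)\<bar> \<le>
    2 * pi * (K * (V + V + 2 * pi) + 2 * pi + 4 * B) / b"
   unfolding L h_def by simp
 qed
qed

lemma riemann_tendsto:
 assumes "bounded_variation_on (-pi) pi \<psi>" "bvdom \<psi> g"
 shows "(\<lambda>b. 2 * pi / real b * (\<Sum>j\<in>FI b. g (ff j b))) \<longlonglongrightarrow> (LBINT l:{-pi..pi}. g l)"
proof (rule riemann_bvdom[OF assms])
 fix C assume C: "\<And>b. b \<ge> 1 ==>
  \<bar>2 * pi / real b * (\<Sum>j\<in>FI b. g (ff j b)) - (LBINT l:{-pi..pi}. g l)\<bar> \<le> C / real b"
 have "(\<lambda>b. 2 * pi / real b * (\<Sum>j\<in>FI b. g (ff j b)) - (LBINT l:{-pi..pi}. g l)) \<longlonglongrightarrow> 0"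
 proof (rule Lim_null_comparison)
  show "\<forall>\<^sub>F b in sequentially. norm (2 * pi / real b * (\<Sum>j\<in>FI b. g (ff j b)) - (LBINT l:{-pi..pi}. g l)) \<le> C / real b"
   using eventually_ge_at_top[of 1] by eventually_elim (use C in auto)
  show "(\<lambda>b. C / real b) \<longlonglongrightarrow> 0" by (rule lim_const_over_n)
 qed
 then show ?thesis by (simp add: LIM_zero_iff)
qed

section \<open>Exchanging an integral and an unordered sum\<close>

text \<open>Majorised by the summable \<open>G\<close>, the finite partial sums converge uniformly
  on the interval along the net of finite sets; \<open>g\<close> is bounded there, so the integrals
  converge as well.\<close>

lemma integral_infsum_exchange:
 fixes a :: "'h => real => complex" and \<psi> :: "real => real"
 assumes g: "bvdom \<psi> g" and G: "G summable_on UNIV"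
  and a: "\<And>h l. l \<in> {-pi..pi} ==> norm (a h l) \<le> G h"
  and c: "\<And>h. continuous_on {-pi..pi} (a h)"
 shows "((\<lambda>h. LBINT l:{-pi..pi}. complex_of_real (g l) * a h l) has_sum
  (LBINT l:{-pi..pi}. complex_of_real (g l) * (\<Sum>\<^sub>\<infinity>h. a h l))) UNIV"
proof -
 let ?I = "{-pi..pi}"
 let ?S = "\<lambda>l. \<Sum>\<^sub>\<infinity>h. a h l"
 obtain B where B: "\<And>x. x \<in> ?I ==> \<bar>g x\<bar> \<le> B" using g unfolding bvdom_def by blast
 have B0: "B \<ge> 0" using B[of 0] by auto
 have ul: "uniform_limit ?I (\<lambda>F l. \<Sum>h\<in>F. a h l) ?S (finite_subsets_at_top UNIV)"
  by (rule Weierstrass_m_test_general[OF _ G]) (use a in auto)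
 have cS: "continuous_on ?I ?S"
 proof (rule uniform_limit_theorem[OF _ ul])
  show "\<forall>\<^sub>F F in finite_subsets_at_top UNIV. continuous_on ?I (\<lambda>l. \<Sum>h\<in>F. a h l)"
   by (intro always_eventually allI continuous_on_sum c)
 qed simp
 have meas: "(\<lambda>l. indicator ?I l *\<^sub>R (complex_of_real (g l) * u l)) \<in> borel_measurable lborel"
  if "continuous_on ?I u" for u :: "real => complex"
 proof -
  have 1: "(\<lambda>l. indicator ?I l *\<^sub>R u l) \<in> borel_measurable lborel"
   using borel_measurable_continuous_on_indicator[OF _ that] by simp
  have 2: "(\<lambda>l. indicator ?I l *\<^sub>R g l) \<in> borel_measurable lborel"
   using g unfolding bvdom_def set_borel_measurable_def by blast
  have "(\<lambda>l. indicator ?I l *\<^sub>R (complex_of_real (g l) * u l)) =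
    (\<lambda>l. complex_of_real (indicator ?I l *\<^sub>R g l) * (indicator ?I l *\<^sub>R u l))"
   by (auto simp: indicator_def)
  moreover have "(\<lambda>l. complex_of_real (indicator ?I l *\<^sub>R g l)) \<in> borel_measurable lborel"
   using measurable_compose[OF 2, of complex_of_real borel] by simp
  ultimately show ?thesis using 1 by (simp only: borel_measurable_times)
 qed
 have int: "integrable lborel (\<lambda>l. indicator ?I l *\<^sub>R (complex_of_real (g l) * u l))"
  if u: "continuous_on ?I u" for u :: "real => complex"
 proof -
  obtain D where D: "\<And>l. l \<in> ?I ==> norm (u l) \<le> D"
   using compact_imp_bounded[OF compact_continuous_image[OF u compact_Icc]] unfolding bounded_iff by blast
  show ?thesis
  proof (rule integrableI_bounded_set[where A = ?I and B = "B * D"])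
   show "emeasure lborel ?I < \<infinity>" by (simp add: emeasure_lborel_Icc_eq)
   show "AE l in lborel. l \<in> ?I \<longrightarrow> norm (indicator ?I l *\<^sub>R (complex_of_real (g l) * u l)) \<le> B * D"
   proof (intro AE_I2 impI)
    fix l assume l: "l \<in> ?I"
    then have "norm (indicator ?I l *\<^sub>R (complex_of_real (g l) * u l)) = \<bar>g l\<bar> * norm (u l)"
     by (simp add: norm_mult)
    also have "\<dots> \<le> B * D" using B[OF l] D[OF l] B0 by (intro mult_mono) auto
    finally show "norm (indicator ?I l *\<^sub>R (complex_of_real (g l) * u l)) \<le> B * D" .
   qed
  qed (use meas[OF u] in auto)
 qed
 show ?thesis
  unfolding has_sum_def
 proof (rule tendstoI)
  fix e :: real assume e: "e > 0"
  define e' where "e' = e / (2 * pi * B + 1)"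
  have pB: "2 * pi * B + 1 > 0" using B0 by (intro add_nonneg_pos) auto
  have e': "e' > 0" using e pB by (simp add: e'_def)
  show "\<forall>\<^sub>F F in finite_subsets_at_top UNIV. dist (\<Sum>h\<in>F. LBINT l:?I. complex_of_real (g l) * a h l)
    (LBINT l:?I. complex_of_real (g l) * ?S l) < e"
   using uniform_limitD[OF ul e']
  proof eventually_elim
   case (elim F)
   have "(\<Sum>h\<in>F. LBINT l:?I. complex_of_real (g l) * a h l) =
     (LBINT l:?I. complex_of_real (g l) * (\<Sum>h\<in>F. a h l))"
    unfolding set_lebesgue_integral_def using int[OF c]
    by (subst Bochner_Integration.integral_sum[symmetric]) (auto simp: sum_distrib_left scaleR_sum_right)
   then have "dist (\<Sum>h\<in>F. LBINT l:?I. complex_of_real (g l) * a h l) (LBINT l:?I. complex_of_real (g l) * ?S l) =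
     norm (\<integral>l. indicator ?I l *\<^sub>R (complex_of_real (g l) * ((\<Sum>h\<in>F. a h l) - ?S l)) \<partial>lborel)"
    using Bochner_Integration.integral_diff[OF int[OF continuous_on_sum[of F ?I a, OF c]] int[OF cS]]
    unfolding set_lebesgue_integral_def dist_norm by (simp add: right_diff_distrib scaleR_diff_right)
   also have "\<dots> \<le> (\<integral>l. indicator ?I l *\<^sub>R (B * e') \<partial>lborel)"
   proof (rule order_trans[OF integral_norm_bound Bochner_Integration.integral_mono[OF integrable_norm]])
    show "integrable lborel (\<lambda>l. indicator ?I l *\<^sub>R (complex_of_real (g l) * ((\<Sum>h\<in>F. a h l) - ?S l)))"
     using c cS by (intro int continuous_on_diff continuous_on_sum)
    show "integrable lborel (\<lambda>l. indicator ?I l *\<^sub>R (B * e'))"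
     by (simp add: emeasure_lborel_Icc_eq)
    fix l
    show "norm (indicator ?I l *\<^sub>R (complex_of_real (g l) * ((\<Sum>h\<in>F. a h l) - ?S l))) \<le> indicator ?I l *\<^sub>R (B * e')"
    proof (cases "l \<in> ?I")
     case True
     have "\<bar>g l\<bar> * norm ((\<Sum>h\<in>F. a h l) - ?S l) \<le> B * e'"
      using B[OF True] elim True B0 e' by (intro mult_mono) (auto simp: dist_norm less_imp_le)
     then show ?thesis using True by (simp add: norm_mult)
    qed simp
   qed
   also have "\<dots> = 2 * pi * B * e'" by simp
   also have "\<dots> < (2 * pi * B + 1) * e'" using e' by (simp add: distrib_right)
   also have "\<dots> = e" using pB by (simp add: e'_def)
   finally show ?case .
  qed
 qed
qed

section \<open>The limiting variance\<close>

text \<open>Dominated convergence for the counting measure, with majorant a multiple of the modulus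
  of \<open>c\<close>.\<close>

lemma infsum_dominated:
 fixes c :: "'h => real"
 assumes c: "(\<lambda>h. \<bar>c h\<bar>) summable_on UNIV" and K: "\<And>b h. \<bar>a b h\<bar> \<le> K"
  and lim: "\<And>h. (\<lambda>b. a b h) \<longlonglongrightarrow> \<alpha> h"
 shows "(\<lambda>b. \<Sum>\<^sub>\<infinity>h. c h * a b h) \<longlonglongrightarrow> (\<Sum>\<^sub>\<infinity>h. c h * \<alpha> h)"
proof -
 have eq: "(\<Sum>\<^sub>\<infinity>h. c h * d h) = (\<integral>h. c h * d h \<partial>count_space UNIV)" if d: "\<And>h. \<bar>d h\<bar> \<le> K" for d
 proof -
  have "(\<lambda>h. norm (c h * d h)) summable_on UNIV"
  proof (rule summable_on_comparison_test[OF summable_on_cmult_right[OF c, of K]])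
   show "norm (c h * d h) \<le> K * \<bar>c h\<bar>" for h
    using mult_left_mono[OF d[of h], of "\<bar>c h\<bar>"] by (simp add: abs_mult mult.commute)
  qed auto
  then have "Infinite_Set_Sum.abs_summable_on (\<lambda>h. c h * d h) UNIV"
   unfolding abs_summable_equivalent[symmetric] .
  then show ?thesis by (simp add: infsetsum_infsum infsetsum_def[symmetric])
 qed
 have \<alpha>: "\<bar>\<alpha> h\<bar> \<le> K" for h
  by (rule LIMSEQ_le_const2[OF tendsto_rabs[OF lim]]) (use K in auto)
 have ci: "integrable (count_space UNIV) (\<lambda>h. K * \<bar>c h\<bar>)"
  using c abs_summable_equivalent[of c UNIV] by (simp add: abs_summable_on_def)
 have "(\<lambda>b. \<integral>h. c h * a b h \<partial>count_space UNIV) \<longlonglongrightarrow> (\<integral>h. c h * \<alpha> h \<partial>count_space UNIV)"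
 proof (rule integral_dominated_convergence[OF _ _ ci])
  show "AE h in count_space UNIV. (\<lambda>b. c h * a b h) \<longlonglongrightarrow> c h * \<alpha> h"
   by (intro AE_I2 tendsto_mult_left lim)
  show "AE h in count_space UNIV. norm (c h * a b h) \<le> K * \<bar>c h\<bar>" for b
  proof (rule AE_I2)
   show "norm (c h * a b h) \<le> K * \<bar>c h\<bar>" for h
    using mult_left_mono[OF K[of b h], of "\<bar>c h\<bar>"] by (simp add: abs_mult mult.commute)
  qed
 qed simp_all
 then show ?thesis by (simp only: eq[OF K] eq[OF \<alpha>])
qed

lemma bvdom_cos: "bvdom \<psi> (\<lambda>l. cos (l * of_int k + c))"
proof (rule bvdom_lipschitz[of "\<bar>of_int k\<bar>"])
 show "\<bar>cos (x * of_int k + c) - cos (y * of_int k + c)\<bar> \<le> \<bar>of_int k\<bar> * \<bar>x - y\<bar>" for x y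
  using abs_cos_diff_le[of "x * of_int k + c" "y * of_int k + c"]
  by (simp add: left_diff_distrib[symmetric] abs_mult mult.commute)
qed simp

lemma bv_sup_bound:
 assumes "bounded_variation_on (-pi) pi \<psi>"
 obtains B where "B \<ge> 0" "\<And>x. x \<in> {-pi..pi} ==> \<bar>\<psi> x\<bar> \<le> B"
proof -
 obtain B where "\<And>x. x \<in> {-pi..pi} ==> \<bar>\<psi> x\<bar> \<le> B"
  using bv_bounded[OF assms] by (metis atLeastAtMost_iff minus_le_iff order_trans pi_ge_zero neg_le_0_iff_le)
 then show ?thesis using that[of B] order_trans[OF abs_ge_zero, of "\<psi> 0" B] by simp
qed

lemma fourier_freq_in: "j \<in> FI b ==> ff j b \<in> {-pi..pi}"
proof -
 assume j: "j \<in> FI b"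
 then have b: "b \<ge> 1" by (rule fourier_ge1)
 have "2 * \<bar>j\<bar> \<le> int b" using j by (auto simp: fourier_indices_def)
 then have "2 * \<bar>real_of_int j\<bar> \<le> real b" by linarith
 then have "2 * pi * \<bar>real_of_int j\<bar> \<le> pi * real b" using mult_left_mono[of "2 * \<bar>real_of_int j\<bar>" "real b" pi] by simp
 then have "\<bar>ff j b\<bar> \<le> pi" using b by (simp add: fourier_freq_def abs_mult pos_divide_le_eq)
 then show ?thesis by auto
qed

text \<open>Divisibility forces \<open>j\<close> to be \<open>b div 2\<close> up to sign, and then
  \<open>k\<close> as well, which leaves at most four pairs.\<close>

lemma fourier_half_pairs:
 "(\<Sum>j\<in>FI b. \<Sum>k\<in>FI b. of_bool (\<bar>j\<bar> = \<bar>k\<bar> \<and> int b dvd 2 * j)) \<le> (4::real)"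
proof -
 let ?G = "FI b" and ?H = "{int (b div 2), - int (b div 2)}"
 have half: "j \<in> ?H" if "j \<in> ?G" "int b dvd 2 * j" for j
 proof -
  have "int b \<le> \<bar>2 * j\<bar>" using that by (intro zdvd_imp_le[of "int b" "\<bar>2 * j\<bar>"]) (auto simp: fourier_indices_def)
  then have "\<bar>j\<bar> = int (b div 2)" using that(1) by (auto simp: fourier_indices_def)
  then show ?thesis by auto
 qed
 have "(\<Sum>j\<in>?G. \<Sum>k\<in>?G. of_bool (\<bar>j\<bar> = \<bar>k\<bar> \<and> int b dvd 2 * j)) =
   (\<Sum>(j,k)\<in>?G \<times> ?G. of_bool (\<bar>j\<bar> = \<bar>k\<bar> \<and> int b dvd 2 * j) :: real)"
  by (rule sum.cartesian_product)
 also have "\<dots> = (\<Sum>(j,k)\<in>?G \<times> ?G \<inter> {z. \<bar>fst z\<bar> = \<bar>snd z\<bar> \<and> int b dvd 2 * fst z}. 1)"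
  by (rule sum.mono_neutral_cong_right) auto
 also have "\<dots> = real (card (?G \<times> ?G \<inter> {z. \<bar>fst z\<bar> = \<bar>snd z\<bar> \<and> int b dvd 2 * fst z}))"
  by (simp add: case_prod_unfold)
 also have "card (?G \<times> ?G \<inter> {z. \<bar>fst z\<bar> = \<bar>snd z\<bar> \<and> int b dvd 2 * fst z}) \<le> card (?H \<times> ?H)"
 proof (rule card_mono)
  show "?G \<times> ?G \<inter> {z. \<bar>fst z\<bar> = \<bar>snd z\<bar> \<and> int b dvd 2 * fst z} \<subseteq> ?H \<times> ?H"
  proof
   fix z assume z: "z \<in> ?G \<times> ?G \<inter> {z. \<bar>fst z\<bar> = \<bar>snd z\<bar> \<and> int b dvd 2 * fst z}"
   then have "fst z \<in> ?H" by (intro half) auto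
   moreover have "\<bar>fst z\<bar> = \<bar>snd z\<bar>" using z by auto
   ultimately show "z \<in> ?H \<times> ?H" by (cases z) auto
  qed
 qed simp
 also have "card (?H \<times> ?H) \<le> 4" by (simp add: card_cartesian_product card_insert_if)
 finally show ?thesis by simp
qed

lemma sum_PiE4:
 "(\<Sum>u\<in>PiE {..<4::nat} (\<lambda>_. A). G (u 0) (u 1) (u 2) (u 3)) =
  (\<Sum>(u0,u1,u2,u3)\<in>A \<times> A \<times> A \<times> A. G u0 u1 u2 u3)"
 by (rule sum.reindex_bij_witness[of _ "\<lambda>(a,b,c,d). \<lambda>i\<in>{..<4}. [a,b,c,d] ! i" "\<lambda>u. (u 0, u 1, u 2, u 3)"])
  (auto simp: PiE_def Pi_def extensional_def restrict_def fun_eq_iff less_Suc_eq numeral_eq_Suc)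

context spec_process
begin

abbreviation corr2 :: "int => int => nat => real" where
 "corr2 j k b \<equiv> \<Sum>a\<in>{False,True}. \<Sum>c\<in>{False,True}. (corr a j c k b)\<^sup>2"

text \<open>Replacing \<open>k\<close> by \<open>- k\<close> only changes the sign of the sine
  weight, which the squares do not see.\<close>

lemma corr2_reflect: "corr2 j (- k) b = corr2 j k b"
proof -
 have fw: "fw c (- k) b = (\<lambda>u. (if c then -1 else 1) * fw c k b u)" for c
  by (rule ext) (simp add: fw_def fwi_def ph_def fourier_freq_def cos_diff)
 have "lin (fw c (- k) b) b 0 om = (if c then -1 else 1) * lin (fw c k b) b 0 om" for c om
  unfolding fw lin_def by (simp add: sum_negf)
 then have "corr a j c (- k) b = (if c then -1 else 1) * corr a j c k b" for a c
  unfolding corr_def by simp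
 then show ?thesis by simp
qed

lemma corr2_diag:
 assumes b: "b \<ge> 1" and j: "\<not> int b dvd 2 * j"
 shows "\<bar>corr2 j j b - 2 * (pi * sd (ff j b))\<^sup>2\<bar> \<le> 4 * acv1 * (acv1 + 8 * acv0) / b"
proof -
 let ?s = "pi * sd (ff j b)"
 have s: "\<bar>?s\<bar> \<le> 4 * acv0"
  using mult_mono[of pi 4 "\<bar>sd (ff j b)\<bar>" acv0] sd_bound pi_less_4 by (simp add: abs_mult)
 have main: "\<bar>(corr a j c j b)\<^sup>2 - (if a = c then ?s\<^sup>2 else 0)\<bar> \<le> acv1 * (acv1 + 8 * acv0) / b" for a c
 proof -
  define x y where "x = corr a j c j b" and "y = (if a = c then ?s else 0)"
  have xy: "\<bar>x - y\<bar> \<le> acv1 / b" using corr_diag[OF b j, of a c] by (simp add: x_def y_def)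
  have ab: "acv1 / b \<le> acv1" using b acv1_nonneg by (simp add: divide_le_eq mult_le_cancel_left1)
  have y: "\<bar>y\<bar> \<le> 4 * acv0" using s acv0_nonneg by (simp add: y_def)
  have "\<bar>x + y\<bar> \<le> acv1 + 8 * acv0" using xy ab y by linarith
  then have "\<bar>x - y\<bar> * \<bar>x + y\<bar> \<le> acv1 / b * (acv1 + 8 * acv0)"
   using xy acv1_nonneg by (intro mult_mono) auto
  moreover have "x\<^sup>2 - y\<^sup>2 = (x - y) * (x + y)" by (simp add: power2_eq_square algebra_simps)
  moreover have "y\<^sup>2 = (if a = c then ?s\<^sup>2 else 0)" by (simp add: y_def)
  ultimately show ?thesis by (simp add: x_def abs_mult)
 qed
 have "corr2 j j b - 2 * ?s\<^sup>2 = (\<Sum>a\<in>{False,True}. \<Sum>c\<in>{False,True}. (corr a j c j b)\<^sup>2 - (if a = c then ?s\<^sup>2 else 0))"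
  by simp
 also have "\<bar>\<dots>\<bar> \<le> (\<Sum>a\<in>{False,True}. \<Sum>c\<in>{False,True}. acv1 * (acv1 + 8 * acv0) / b)"
  by (intro order_trans[OF sum_abs] sum_mono main)
 also have "\<dots> = 4 * acv1 * (acv1 + 8 * acv0) / b" by simp
 finally show ?thesis .
qed

text \<open>For \<open>k = j\<close> and \<open>k = - j\<close> the squared correlations add up to
  about \<open>2 * (pi * sd)^2\<close>, which produces a Riemann sum of the integrand of
  \<open>tau1_sq\<close>. The error \<open>R\<close> is of order \<open>1 / b\<close> on these
  pairs, \<open>1 / b^2\<close> on the others and bounded on at most four exceptional pairs; its
  double sum stays bounded, and the factor \<open>2 / b\<close> removes it.\<close>

lemma second_order_limit:
 assumes m: "set_borel_measurable lborel {-pi..pi} \<psi>" and bv: "bounded_variation_on (-pi) pi \<psi>"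
 shows "(\<lambda>b. 2 / real b * (\<Sum>j\<in>FI b. \<Sum>k\<in>FI b.
   \<psi> (ff j b) * \<psi> (ff k b) * corr2 j k b)) \<longlonglongrightarrow> tau1_sq M X \<psi>"
proof -
 obtain B where B0: "B \<ge> 0" and B: "\<And>x. x \<in> {-pi..pi} ==> \<bar>\<psi> x\<bar> \<le> B"
  using bv_sup_bound[OF bv] by auto
 define h where "h l = \<psi> l * (\<psi> l + \<psi> (- l)) * (sd l)\<^sup>2" for l
 have dom: "bvdom \<psi> h"
 proof -
  have "bvdom \<psi> sd" using acv1_nonneg sd_lipschitz by (rule bvdom_lipschitz)
  then show ?thesis unfolding h_def[abs_def] power2_eq_square
   by (intro bvdom_mult bvdom_add bvdom_self[OF m bv] bvdom_reflect[OF bvdom_self[OF m bv]])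
 qed
 define K where "K = B\<^sup>2 * (4 * acv1 * (acv1 + 8 * acv0) + 4 * acv1\<^sup>2 + 4 * (cumbound 2)\<^sup>2 + 32 * acv0\<^sup>2)"
 have K0: "K \<ge> 0" using acv1_nonneg acv0_nonneg by (simp add: K_def)
 have bound: "\<bar>2 / real b * (\<Sum>j\<in>FI b. \<Sum>k\<in>FI b.
   \<psi> (ff j b) * \<psi> (ff k b) * corr2 j k b)
   - 2 * pi * (2 * pi / real b * (\<Sum>j\<in>FI b. h (ff j b)))\<bar> \<le> 14 * K / b" if b: "b \<ge> 1" for b
 proof -
  let ?G = "FI b"
  let ?p = "\<lambda>j. \<psi> (ff j b)" and ?s = "\<lambda>j. 2 * (pi * sd (ff j b))\<^sup>2"
  define R where "R j k = ?p j * ?p k * (corr2 j k b - (if \<bar>j\<bar> = \<bar>k\<bar> then ?s j else 0))" for j k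
  have pp: "\<bar>?p j * ?p k\<bar> \<le> B\<^sup>2" if "j \<in> ?G" "k \<in> ?G" for j k
   unfolding abs_mult power2_eq_square using B[OF fourier_freq_in] that B0 by (intro mult_mono) auto
  have Rle: "\<bar>R j k\<bar> \<le> B\<^sup>2 * D" if "j \<in> ?G" "k \<in> ?G" "\<bar>corr2 j k b - (if \<bar>j\<bar> = \<bar>k\<bar> then ?s j else 0)\<bar> \<le> D" for j k D
   unfolding R_def abs_mult[of "?p j * ?p k"] using pp[OF that(1,2)] that(3) by (intro mult_mono) auto
  \<comment> \<open>Subtracting \<open>K\<close> on the exceptional pairs makes one bound valid for
    all pairs of equal modulus; \<open>fourier_half_pairs\<close> adds it back at the cost
    \<open>4 * K\<close>.\<close>
  have diag: "\<bar>R j k\<bar> - K * of_bool (\<bar>j\<bar> = \<bar>k\<bar> \<and> int b dvd 2 * j) \<le> K / b" if jk: "j \<in> ?G" "k \<in> ?G" "\<bar>j\<bar> = \<bar>k\<bar>" for j k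
  proof -
   have c: "corr2 j k b = corr2 j j b" using jk(3) corr2_reflect[of j j b] by (auto simp: abs_eq_iff)
   show ?thesis
   proof (cases "int b dvd 2 * j")
    case False
    have "\<bar>R j k\<bar> \<le> B\<^sup>2 * (4 * acv1 * (acv1 + 8 * acv0) / b)"
     by (rule Rle[OF jk(1,2)]) (use c corr2_diag[OF b False] jk(3) in simp)
    also have "\<dots> \<le> K / b" unfolding K_def times_divide_eq_right
     by (intro divide_right_mono mult_left_mono) (auto simp: acv0_nonneg)
    finally show ?thesis using False by simp
   next
    case True
    have "(corr a j c j b)\<^sup>2 \<le> (cumbound 2)\<^sup>2" for a c using power_mono[OF abs_corr[OF b], of a j c j 2] by simp
    then have "corr2 j j b \<le> (\<Sum>a\<in>{False,True}. \<Sum>c\<in>{False,True}. (cumbound 2)\<^sup>2)" by (intro sum_mono)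
    moreover have "(\<Sum>a\<in>{False,True}. \<Sum>c\<in>{False,True}. (cumbound 2)\<^sup>2) = 4 * (cumbound 2)\<^sup>2" by simp
    moreover have "corr2 j j b \<ge> 0" by (intro sum_nonneg) auto
    moreover have "?s j \<le> 32 * acv0\<^sup>2"
    proof -
     have "\<bar>pi * sd (ff j b)\<bar> \<le> 4 * acv0"
      using mult_mono[of pi 4 "\<bar>sd (ff j b)\<bar>" acv0] sd_bound pi_less_4 by (simp add: abs_mult)
     from power_mono[OF this, of 2] show ?thesis by (simp add: power_mult_distrib)
    qed
    moreover have "?s j \<ge> 0" by simp
    ultimately have "\<bar>corr2 j j b - ?s j\<bar> \<le> 4 * (cumbound 2)\<^sup>2 + 32 * acv0\<^sup>2"
     unfolding abs_le_iff by linarith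
    then have "\<bar>R j k\<bar> \<le> B\<^sup>2 * (4 * (cumbound 2)\<^sup>2 + 32 * acv0\<^sup>2)"
     by (intro Rle[OF jk(1,2)]) (simp only: c jk(3) if_True simp_thms)
    also have "\<dots> \<le> K" unfolding K_def
     by (intro mult_left_mono) (auto simp: acv0_nonneg acv1_nonneg)
    finally have "\<bar>R j k\<bar> \<le> K" .
    moreover have "K / b \<ge> 0" using K0 by simp
    ultimately have "\<bar>R j k\<bar> - K \<le> K / b" by linarith
    then show ?thesis using True jk(3) by simp
   qed
  qed
  have off: "\<bar>R j k\<bar> - K * of_bool (\<bar>j\<bar> = \<bar>k\<bar> \<and> int b dvd 2 * j) \<le> K / b\<^sup>2" if jk: "j \<in> ?G" "k \<in> ?G" "\<bar>j\<bar> \<noteq> \<bar>k\<bar>" for j k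
  proof -
   have "(corr a j c k b)\<^sup>2 \<le> (acv1 / b)\<^sup>2" for a c
    using power_mono[OF corr_off[OF b fourier_not_dvd_pm[OF jk]], of a c 2] by simp
   then have "corr2 j k b \<le> (\<Sum>a\<in>{False,True}. \<Sum>c\<in>{False,True}. (acv1 / b)\<^sup>2)" by (intro sum_mono)
   moreover have "corr2 j k b \<ge> 0" by (intro sum_nonneg) auto
   ultimately have "\<bar>corr2 j k b\<bar> \<le> 4 * (acv1 / b)\<^sup>2" by simp
   then have "\<bar>R j k\<bar> \<le> B\<^sup>2 * (4 * (acv1 / b)\<^sup>2)"
    by (intro Rle[OF jk(1,2)]) (simp only: jk(3) if_False diff_0_right)
   also have "\<dots> = B\<^sup>2 * (4 * acv1\<^sup>2) / b\<^sup>2" by (simp add: power_divide)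
   also have "\<dots> \<le> K / b\<^sup>2" unfolding K_def
    by (intro divide_right_mono mult_left_mono) (auto simp: acv0_nonneg acv1_nonneg)
   finally show ?thesis using jk(3) by simp
  qed
  have "(\<Sum>j\<in>?G. \<Sum>k\<in>?G. \<bar>R j k\<bar> - K * of_bool (\<bar>j\<bar> = \<bar>k\<bar> \<and> int b dvd 2 * j)) \<le> 2 * real b * (K / b) + (real b)\<^sup>2 * (K / b\<^sup>2)"
   using diag off K0 by (intro sum_abs_eq_le) auto
  moreover have "2 * real b * (K / b) + (real b)\<^sup>2 * (K / b\<^sup>2) = 3 * K" using b by simp
  ultimately have "(\<Sum>j\<in>?G. \<Sum>k\<in>?G. \<bar>R j k\<bar>) \<le> 3 * K + K * (\<Sum>j\<in>?G. \<Sum>k\<in>?G. of_bool (\<bar>j\<bar> = \<bar>k\<bar> \<and> int b dvd 2 * j))"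
   unfolding sum_subtractf sum_distrib_left[symmetric] by linarith
  also have "\<dots> \<le> 3 * K + K * 4" using K0 by (intro add_left_mono mult_left_mono fourier_half_pairs)
  finally have R: "(\<Sum>j\<in>?G. \<Sum>k\<in>?G. \<bar>R j k\<bar>) \<le> 7 * K" by simp
  have "(\<Sum>k\<in>?G. ?p j * ?p k * (if \<bar>j\<bar> = \<bar>k\<bar> then ?s j else 0)) = 2 * pi\<^sup>2 * h (ff j b)" if j: "j \<in> ?G" for j
  proof -
   have j': "j \<noteq> - j" "- j \<in> ?G" using j by (auto simp: fourier_indices_def)
   have "(\<Sum>k\<in>?G. ?p j * ?p k * (if \<bar>j\<bar> = \<bar>k\<bar> then ?s j else 0)) = (\<Sum>k\<in>{j, - j}. ?p j * ?p k * ?s j)"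
    by (rule sum.mono_neutral_cong_right) (use j j' in \<open>auto simp: abs_eq_iff\<close>)
   also have "\<dots> = ?p j * ?p j * ?s j + ?p j * ?p (- j) * ?s j" using j'(1) by simp
   also have "\<dots> = 2 * pi\<^sup>2 * h (ff j b)"
    by (simp add: h_def fourier_freq_def power_mult_distrib algebra_simps)
   finally show ?thesis .
  qed
  then have main: "(\<Sum>j\<in>?G. \<Sum>k\<in>?G. ?p j * ?p k * (if \<bar>j\<bar> = \<bar>k\<bar> then ?s j else 0)) = 2 * pi\<^sup>2 * (\<Sum>j\<in>?G. h (ff j b))"
   by (simp add: sum_distrib_left)
  have "(\<Sum>j\<in>?G. \<Sum>k\<in>?G. R j k) = (\<Sum>j\<in>?G. \<Sum>k\<in>?G. ?p j * ?p k * corr2 j k b) - 2 * pi\<^sup>2 * (\<Sum>j\<in>?G. h (ff j b))"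
   unfolding R_def right_diff_distrib sum_subtractf main ..
  moreover have "\<bar>\<Sum>j\<in>?G. \<Sum>k\<in>?G. R j k\<bar> \<le> 7 * K"
   using R by (intro order_trans[OF sum_abs] order_trans[OF sum_mono[OF sum_abs]])
  ultimately have "\<bar>2 / real b * ((\<Sum>j\<in>?G. \<Sum>k\<in>?G. ?p j * ?p k * corr2 j k b) - 2 * pi\<^sup>2 * (\<Sum>j\<in>?G. h (ff j b)))\<bar> \<le> 2 / real b * (7 * K)"
   unfolding abs_mult by (intro mult_mono) auto
  then show ?thesis by (simp add: right_diff_distrib power2_eq_square mult_ac)
 qed
 have "(\<lambda>b. 2 / real b * (\<Sum>j\<in>FI b. \<Sum>k\<in>FI b.
   \<psi> (ff j b) * \<psi> (ff k b) * corr2 j k b)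
   - 2 * pi * (2 * pi / real b * (\<Sum>j\<in>FI b. h (ff j b)))) \<longlonglongrightarrow> 0"
  by (rule Lim_null_comparison[OF _ lim_const_over_n[of "14 * K"]])
   (use bound in \<open>auto intro!: eventually_mono[OF eventually_ge_at_top[of 1]]\<close>)
 from tendsto_add[OF this tendsto_mult_left[OF riemann_tendsto[OF bv dom], of "2 * pi"]]
 show ?thesis by (simp add: tau1_sq_def h_def)
qed

definition c4 :: "int \<times> int \<times> int => real" where
 "c4 = (\<lambda>(h1,h2,h3). cum M [X 0, X h1, X h2, X h3])"

lemma c4_summable: "(\<lambda>h. \<bar>c4 h\<bar>) summable_on UNIV"
 using cum4 by (simp add: c4_def case_prod_unfold)

lemma kap4_eq:
 "kap4 p q b 0 = (\<Sum>(u0,u1,u2,u3)\<in>{1..b} \<times> {1..b} \<times> {1..b} \<times> {1..b}.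
   p u0 * p u1 * q u2 * q u3 * c4 (int u1 - int u0, int u2 - int u0, int u3 - int u0)) / (real b)\<^sup>2"
proof -
 let ?w = "\<lambda>i::nat. if i \<in> {0,1} then p else q"
 have "kap4 p q b 0 = (\<Sum>u\<in>PiE {..<4::nat} (\<lambda>_. {1..b}). (\<Prod>i<4. ?w i (u i) / sqrt b) * cumX (\<lambda>i. int 0 + int (u i) - 1) {..<4})"
  unfolding cumX_def using rv8_X by (intro kappa_multilinear) (auto simp: lin_alt)
 also have "\<dots> = (\<Sum>u\<in>PiE {..<4::nat} (\<lambda>_. {1..b}). p (u 0) * p (u 1) * q (u 2) * q (u 3) *
   c4 (int (u 1) - int (u 0), int (u 2) - int (u 0), int (u 3) - int (u 0)) / (real b)\<^sup>2)"
 proof (rule sum.cong[OF refl])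
  fix u
  have "cumX (\<lambda>i. int 0 + int (u i) - 1) {..<4} = c4 (int (u 1) - int (u 0), int (u 2) - int (u 0), int (u 3) - int (u 0))"
   by (simp add: cumX_list c4_def upt_rec numeral_2_eq_2 numeral_3_eq_3)
  moreover have "{..<4::nat} = {0,1,2,3}" by auto
  ultimately show "(\<Prod>i<4. ?w i (u i) / sqrt b) * cumX (\<lambda>i. int 0 + int (u i) - 1) {..<4} =
    p (u 0) * p (u 1) * q (u 2) * q (u 3) * c4 (int (u 1) - int (u 0), int (u 2) - int (u 0), int (u 3) - int (u 0)) / (real b)\<^sup>2"
   by (simp add: power2_eq_square mult_ac)
 qed
 finally show ?thesis
  unfolding sum_PiE4[where A = "{1..b}" and G = "\<lambda>u0 u1 u2 u3. p u0 * p u1 * q u2 * q u3 * c4 (int u1 - int u0, int u2 - int u0, int u3 - int u0) / (real b)\<^sup>2"]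
  by (simp add: sum_divide_distrib case_prod_unfold)
qed

lemma fw_pair: "fw False j b u * fw False j b v + fw True j b u * fw True j b v = cos (ff j b * of_int (int v - int u))"
proof -
 have "cos (ff j b * of_int (int v - int u)) = cos (ff j b * real v - ff j b * real u)"
  by (simp add: right_diff_distrib)
 then show ?thesis by (simp add: fw_def fwi_def ph_def cos_diff)
qed

lemma kap4_sum:
 "(\<Sum>a\<in>{False,True}. \<Sum>c\<in>{False,True}. kap4 (fw a j b) (fw c k b) b 0) =
  (\<Sum>(u0,u1,u2,u3)\<in>{1..b} \<times> {1..b} \<times> {1..b} \<times> {1..b}.
   cos (ff j b * of_int (int u1 - int u0)) * cos (ff k b * of_int (int u3 - int u2)) *
   c4 (int u1 - int u0, int u2 - int u0, int u3 - int u0)) / (real b)\<^sup>2"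
proof -
 have alg: "x1 * x2 * y1 * y2 * c + x1 * x2 * z1 * z2 * c + (w1 * w2 * y1 * y2 * c + w1 * w2 * z1 * z2 * c)
   = (x1 * x2 + w1 * w2) * (y1 * y2 + z1 * z2) * c" for x1 x2 y1 y2 z1 z2 w1 w2 c :: real
  by (simp add: algebra_simps)
 have two: "(\<Sum>a\<in>{False,True}. \<Sum>c\<in>{False,True}. f a c) = (f False False + f False True) + (f True False + f True True)"
  for f :: "bool => bool => real" by simp
 show ?thesis
  unfolding two kap4_eq fw_pair[symmetric] add_divide_distrib[symmetric] sum.distrib[symmetric] case_prod_unfold alg ..
qed

text \<open>Up to the factor \<open>2 * pi / b\<close>, a Riemann sum for the cosine coefficient
  \<open>ccoef\<close>.\<close>

definition Psi :: "(real => real) => nat => int => real" where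
 "Psi \<psi> b h = (\<Sum>j\<in>FI b. \<psi> (ff j b) * cos (ff j b * of_int h))"

definition ccoef :: "(real => real) => int => real" where
 "ccoef \<psi> h = (LBINT l:{-pi..pi}. \<psi> l * cos (l * of_int h))"

definition lags :: "nat => nat => (int \<times> int \<times> int) set" where
 "lags b u = {(h1,h2,h3). {int u + h1, int u + h2, int u + h3} \<subseteq> {1..int b}}"

lemma sum_lags:
 fixes F :: "int \<times> int \<times> int => real"
 shows "(\<lambda>h. F h * of_bool (h \<in> lags b u)) summable_on UNIV"
  "(\<Sum>(u1,u2,u3)\<in>{1..b} \<times> {1..b} \<times> {1..b}. F (int u1 - int u, int u2 - int u, int u3 - int u)) =
   (\<Sum>\<^sub>\<infinity>h. F h * of_bool (h \<in> lags b u))"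
proof -
 let ?f = "\<lambda>(u1,u2,u3). (int u1 - int u, int u2 - int u, int u3 - int u)"
 let ?g = "\<lambda>(h1,h2,h3). (nat (int u + h1), nat (int u + h2), nat (int u + h3))"
 have fin: "finite (lags b u)"
 proof (rule finite_subset)
  show "lags b u \<subseteq> ?f ` ({1..b} \<times> {1..b} \<times> {1..b})"
  proof
   fix h assume h: "h \<in> lags b u"
   then have "h = ?f (?g h)" "?g h \<in> {1..b} \<times> {1..b} \<times> {1..b}" by (auto simp: lags_def)
   then show "h \<in> ?f ` ({1..b} \<times> {1..b} \<times> {1..b})" by (rule image_eqI)
  qed
 qed simp
 have "(\<lambda>h. F h * of_bool (h \<in> lags b u)) summable_on UNIV \<longleftrightarrow> F summable_on lags b u"
  by (rule summable_on_cong_neutral) auto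
 then show "(\<lambda>h. F h * of_bool (h \<in> lags b u)) summable_on UNIV" using fin by simp
 have "(\<Sum>(u1,u2,u3)\<in>{1..b} \<times> {1..b} \<times> {1..b}. F (int u1 - int u, int u2 - int u, int u3 - int u)) = sum F (lags b u)"
  by (rule sum.reindex_bij_witness[of _ ?g ?f]) (auto simp: lags_def)
 also have "\<dots> = (\<Sum>\<^sub>\<infinity>h. F h * of_bool (h \<in> lags b u))"
  unfolding infsum_finite[OF fin, symmetric] by (rule infsum_cong_neutral) auto
 finally show "(\<Sum>(u1,u2,u3)\<in>{1..b} \<times> {1..b} \<times> {1..b}. F (int u1 - int u, int u2 - int u, int u3 - int u)) =
   (\<Sum>\<^sub>\<infinity>h. F h * of_bool (h \<in> lags b u))" .
qed

text \<open>Summing over the frequencies first gives two factors \<open>Psi\<close>, one for the lag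
  inside the pair of weights at \<open>j\<close>, one for the lag inside the pair at
  \<open>k\<close>. The positions then merely count how often a lag triple fits into the
  block.\<close>

lemma fourth_order_sum:
 "1 / real b * (\<Sum>j\<in>FI b. \<Sum>k\<in>FI b. \<psi> (ff j b) * \<psi> (ff k b) *
   (\<Sum>a\<in>{False,True}. \<Sum>c\<in>{False,True}. kap4 (fw a j b) (fw c k b) b 0)) =
  (\<Sum>\<^sub>\<infinity>h. c4 h * (Psi \<psi> b (fst h) / b * (Psi \<psi> b (fst (snd h) - snd (snd h)) / b) * ((\<Sum>u=1..b. of_bool (h \<in> lags b u)) / b)))"
proof -
 let ?G = "FI b" and ?Q = "{1..b} \<times> {1..b} \<times> {1..b} \<times> {1..b}"
 let ?p = "\<lambda>j. \<psi> (ff j b)"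
 define F where "F h = c4 h * (Psi \<psi> b (fst h) * Psi \<psi> b (fst (snd h) - snd (snd h)))" for h
 have Peven: "Psi \<psi> b (- h) = Psi \<psi> b h" for h by (simp add: Psi_def)
 define T where "T j k u = (case u of (u0,u1,u2,u3) => cos (ff j b * of_int (int u1 - int u0)) * cos (ff k b * of_int (int u3 - int u2)) *
   c4 (int u1 - int u0, int u2 - int u0, int u3 - int u0))" for j k and u :: "nat \<times> nat \<times> nat \<times> nat"
 have "(\<Sum>j\<in>?G. \<Sum>k\<in>?G. ?p j * ?p k * (\<Sum>a\<in>{False,True}. \<Sum>c\<in>{False,True}. kap4 (fw a j b) (fw c k b) b 0)) =
   (\<Sum>j\<in>?G. \<Sum>k\<in>?G. \<Sum>u\<in>?Q. ?p j * ?p k * T j k u) / (real b)\<^sup>2"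
  unfolding kap4_sum T_def by (simp add: sum_divide_distrib sum_distrib_left)
 also have "(\<Sum>j\<in>?G. \<Sum>k\<in>?G. \<Sum>u\<in>?Q. ?p j * ?p k * T j k u) = (\<Sum>u\<in>?Q. \<Sum>j\<in>?G. \<Sum>k\<in>?G. ?p j * ?p k * T j k u)"
  by (simp only: sum.swap[where B = ?Q])
 also have "\<dots> = (\<Sum>(u0,u1,u2,u3)\<in>?Q. F (int u1 - int u0, int u2 - int u0, int u3 - int u0))"
 proof (rule sum.cong[OF refl])
  fix u assume "u \<in> ?Q"
  obtain u0 u1 u2 u3 where u: "u = (u0,u1,u2,u3)" by (cases u) auto
  have "(\<Sum>j\<in>?G. \<Sum>k\<in>?G. ?p j * ?p k * T j k u) =
    Psi \<psi> b (int u1 - int u0) * Psi \<psi> b (int u3 - int u2) * c4 (int u1 - int u0, int u2 - int u0, int u3 - int u0)"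
   unfolding Psi_def sum_product u T_def prod.case by (simp add: sum_distrib_right sum_distrib_left mult_ac)
  also have "Psi \<psi> b (int u3 - int u2) = Psi \<psi> b (int u2 - int u3)" using Peven[of "int u2 - int u3"] by simp
  finally show "(\<Sum>j\<in>?G. \<Sum>k\<in>?G. ?p j * ?p k * T j k u) =
   (case u of (u0,u1,u2,u3) => F (int u1 - int u0, int u2 - int u0, int u3 - int u0))"
   by (simp add: u F_def mult_ac)
 qed
 also have "\<dots> = (\<Sum>u0=1..b. \<Sum>(u1,u2,u3)\<in>{1..b} \<times> {1..b} \<times> {1..b}. F (int u1 - int u0, int u2 - int u0, int u3 - int u0))"
  by (rule sum.cartesian_product[symmetric])
 also have "\<dots> = (\<Sum>u0=1..b. \<Sum>\<^sub>\<infinity>h. F h * of_bool (h \<in> lags b u0))" by (simp only: sum_lags)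
 also have "\<dots> = (\<Sum>\<^sub>\<infinity>h. \<Sum>u0=1..b. F h * of_bool (h \<in> lags b u0))"
  by (rule infsum_finite_sum(2)[symmetric]) (auto intro: sum_lags)
 finally have "1 / real b * (\<Sum>j\<in>?G. \<Sum>k\<in>?G. ?p j * ?p k * (\<Sum>a\<in>{False,True}. \<Sum>c\<in>{False,True}. kap4 (fw a j b) (fw c k b) b 0)) =
   1 / real b ^ 3 * (\<Sum>\<^sub>\<infinity>h. \<Sum>u0=1..b. F h * of_bool (h \<in> lags b u0))"
  by (simp only: power3_eq_cube power2_eq_square) simp
 then show ?thesis
  unfolding infsum_cmult_right'[symmetric]
  by (simp only: F_def sum_distrib_left[symmetric] power3_eq_cube) (simp add: mult_ac)
qed

lemma lags_density: "(\<lambda>b. (\<Sum>u=1..b. of_bool (h \<in> lags b u)) / real b) \<longlonglongrightarrow> 1"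
proof -
 obtain h1 h2 h3 where h: "h = (h1,h2,h3)" by (cases h)
 define s where "s = nat (\<bar>h1\<bar> + \<bar>h2\<bar> + \<bar>h3\<bar>)"
 have up: "(\<Sum>u=1..b. of_bool (h \<in> lags b u)) \<le> real b" for b
  using sum_mono[of "{1..b}" "\<lambda>u. of_bool (h \<in> lags b u)" "\<lambda>_. 1::real"] by simp
 \<comment> \<open>A position can fail only within distance \<open>s\<close> of an end of the
   block.\<close>
 have low: "real b - 2 * real s \<le> (\<Sum>u=1..b. of_bool (h \<in> lags b u))" for b
 proof -
  have "real b - 2 * real s \<le> real (card {s+1..b-s})" by simp
  also have "\<dots> = (\<Sum>u\<in>{s+1..b-s}. 1)" by simp
  also have "\<dots> = (\<Sum>u\<in>{s+1..b-s}. of_bool (h \<in> lags b u))"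
   by (rule sum.cong) (auto simp: h lags_def s_def)
  also have "\<dots> \<le> (\<Sum>u=1..b. of_bool (h \<in> lags b u))" by (rule sum_mono2) auto
  finally show ?thesis .
 qed
 show ?thesis
 proof (rule tendsto_sandwich[where f = "\<lambda>b. 1 - 2 * real s / real b" and h = "\<lambda>_. 1"])
  show "\<forall>\<^sub>F b in sequentially. 1 - 2 * real s / real b \<le> (\<Sum>u=1..b. of_bool (h \<in> lags b u)) / real b"
   using eventually_gt_at_top[of 0]
  proof eventually_elim
   case (elim b)
   have "(real b - 2 * real s) / real b \<le> (\<Sum>u=1..b. of_bool (h \<in> lags b u)) / real b"
    by (intro divide_right_mono low) simp
   then show ?case using elim by (simp add: diff_divide_distrib)
  qed
  show "\<forall>\<^sub>F b in sequentially. (\<Sum>u=1..b. of_bool (h \<in> lags b u)) / real b \<le> 1"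
   using eventually_gt_at_top[of 0] by eventually_elim (use up in \<open>simp add: divide_le_eq\<close>)
  have "(\<lambda>b. 1 - 2 * real s / real b) \<longlonglongrightarrow> 1 - 0" by (intro tendsto_diff tendsto_const lim_const_over_n)
  then show "(\<lambda>b. 1 - 2 * real s / real b) \<longlonglongrightarrow> 1" by simp
 qed simp
qed

text \<open>Dominated convergence over the lag triples: every factor is bounded uniformly in
  \<open>b\<close> and converges for fixed lags.\<close>

lemma fourth_order_limit:
 assumes m: "set_borel_measurable lborel {-pi..pi} \<psi>" and bv: "bounded_variation_on (-pi) pi \<psi>"
 shows "(\<lambda>b. 1 / real b * (\<Sum>j\<in>FI b. \<Sum>k\<in>FI b. \<psi> (ff j b) * \<psi> (ff k b) *
   (\<Sum>a\<in>{False,True}. \<Sum>c\<in>{False,True}. kap4 (fw a j b) (fw c k b) b 0))) \<longlonglongrightarrow>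
  (\<Sum>\<^sub>\<infinity>h. c4 h * (ccoef \<psi> (fst h) * ccoef \<psi> (fst (snd h) - snd (snd h)))) / (2 * pi)\<^sup>2"
proof -
 obtain B where B0: "B \<ge> 0" and B: "\<And>x. x \<in> {-pi..pi} ==> \<bar>\<psi> x\<bar> \<le> B"
  using bv_sup_bound[OF bv] by auto
 have Psi: "\<bar>Psi \<psi> b h / b\<bar> \<le> B" for b h
 proof -
  have "\<bar>Psi \<psi> b h\<bar> \<le> (\<Sum>j\<in>FI b. B)"
   unfolding Psi_def
  proof (rule order_trans[OF sum_abs sum_mono])
   fix j assume j: "j \<in> FI b"
   show "\<bar>\<psi> (ff j b) * cos (ff j b * of_int h)\<bar> \<le> B"
    using mult_mono[OF B[OF fourier_freq_in[OF j]] abs_cos_le_one B0] by (simp add: abs_mult)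
  qed
  also have "\<dots> \<le> real b * B" using card_fourier_indices[of b] B0 by (simp add: mult_right_mono)
  finally show ?thesis using B0 by (cases "b = 0") (auto simp: divide_le_eq mult.commute)
 qed
 have cnt: "\<bar>(\<Sum>u=1..b. of_bool (h \<in> lags b u)) / real b\<bar> \<le> 1" for b h
  using sum_mono[of "{1..b}" "\<lambda>u. of_bool (h \<in> lags b u)" "\<lambda>_. 1::real"]
  by (cases "b = 0") (auto simp: divide_le_eq sum_nonneg)
 have lim: "(\<lambda>b. Psi \<psi> b h / real b) \<longlonglongrightarrow> ccoef \<psi> h / (2 * pi)" for h
 proof -
  have "bvdom \<psi> (\<lambda>l. cos (l * of_int h))" using bvdom_cos[of \<psi> h 0] by simp
  then have "bvdom \<psi> (\<lambda>l. \<psi> l * cos (l * of_int h))" by (intro bvdom_mult bvdom_self[OF m bv])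
  from tendsto_divide[OF riemann_tendsto[OF bv this] tendsto_const[of "2 * pi"]]
  show ?thesis by (simp add: Psi_def ccoef_def)
 qed
 have "(\<lambda>b. \<Sum>\<^sub>\<infinity>h. c4 h * (Psi \<psi> b (fst h) / b * (Psi \<psi> b (fst (snd h) - snd (snd h)) / b) * ((\<Sum>u=1..b. of_bool (h \<in> lags b u)) / b)))
   \<longlonglongrightarrow> (\<Sum>\<^sub>\<infinity>h. c4 h * (ccoef \<psi> (fst h) / (2 * pi) * (ccoef \<psi> (fst (snd h) - snd (snd h)) / (2 * pi)) * 1))"
 proof (rule infsum_dominated[OF c4_summable, where K = "B * B * 1"])
  show "\<bar>Psi \<psi> b (fst h) / b * (Psi \<psi> b (fst (snd h) - snd (snd h)) / b) * ((\<Sum>u=1..b. of_bool (h \<in> lags b u)) / b)\<bar> \<le> B * B * 1" for b h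
   unfolding abs_mult[of "_ * _"] abs_mult[of "Psi _ _ _ / _"] using Psi cnt B0 by (intro mult_mono) auto
 qed (intro tendsto_mult lim lags_density)
 also have "(\<Sum>\<^sub>\<infinity>h. c4 h * (ccoef \<psi> (fst h) / (2 * pi) * (ccoef \<psi> (fst (snd h) - snd (snd h)) / (2 * pi)) * 1)) =
   (\<Sum>\<^sub>\<infinity>h. c4 h * (ccoef \<psi> (fst h) * ccoef \<psi> (fst (snd h) - snd (snd h))) * (1 / (2 * pi)\<^sup>2))"
  by (simp add: power2_eq_square)
 finally show ?thesis unfolding fourth_order_sum infsum_cmult_left' by simp
qed

text \<open>Exchanging the last two lags is the transposition of positions 2 and 3, to which
  \<open>kappa_reindex\<close> applies.\<close>

lemma c4_swap: "c4 (fst h, snd (snd h), fst (snd h)) = c4 h"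
proof -
 obtain h1 h2 h3 where h: "h = (h1,h2,h3)" by (cases h)
 have S4: "{..<4::nat} = {0,1,2,3}" by auto
 let ?f = "\<lambda>i::nat. if i = 2 then 3 else if i = 3 then 2 else i"
 have im: "?f ` {..<4} = {..<4}" unfolding S4 by auto
 have inj: "inj_on ?f {..<4}" by (auto simp: inj_on_def)
 have "c4 h = kappa (mom (\<lambda>i. X ([0,h1,h2,h3] ! i))) {..<4}"
  using cum_eq_cumX[of "[0,h1,h2,h3]"] by (simp add: h c4_def cumX_def numeral_eq_Suc)
 also have "\<dots> = kappa (\<lambda>B. mom (\<lambda>i. X ([0,h1,h2,h3] ! i)) (?f ` B)) {..<4}"
  using kappa_reindex[OF inj, of "mom (\<lambda>i. X ([0,h1,h2,h3] ! i))"] unfolding im .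
 also have "\<dots> = kappa (mom (\<lambda>i. X ([0,h1,h3,h2] ! i))) {..<4}"
 proof (rule kappa_cong)
  fix T :: "nat set" assume T: "T \<subseteq> {..<4}"
  have "mom (\<lambda>i. X ([0,h1,h2,h3] ! i)) (?f ` T) = mom (\<lambda>i. X ([0,h1,h2,h3] ! ?f i)) T"
   unfolding mom_def by (subst prod.reindex[OF inj_on_subset[OF inj T]]) (simp add: o_def)
  also have "\<dots> = mom (\<lambda>i. X ([0,h1,h3,h2] ! i)) T"
  proof (rule mom_cong)
   fix i assume "i \<in> T"
   then have "i \<in> {0,1,2,3}" using T unfolding S4 by blast
   then show "X ([0,h1,h2,h3] ! ?f i) = X ([0,h1,h3,h2] ! i)" by auto
  qed
  finally show "mom (\<lambda>i. X ([0,h1,h2,h3] ! i)) (?f ` T) = mom (\<lambda>i. X ([0,h1,h3,h2] ! i)) T" .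
 qed
 also have "\<dots> = c4 (h1,h3,h2)"
  using cum_eq_cumX[of "[0,h1,h3,h2]"] by (simp add: h c4_def cumX_def numeral_eq_Suc)
 finally show ?thesis by (simp add: h)
qed

text \<open>A Fourier series is integrated against \<open>\<psi>\<close> twice; term by term this
  gives products of complex coefficients \<open>E\<close>. Their real part contains a product of
  sine parts, which changes sign under the exchange of the last two lags while \<open>c4\<close>
  does not. So it sums to zero and only cosine coefficients survive.\<close>

lemma tau2_eq:
 assumes m: "set_borel_measurable lborel {-pi..pi} \<psi>" and bv: "bounded_variation_on (-pi) pi \<psi>"
 shows "tau2 M X \<psi> = (\<Sum>\<^sub>\<infinity>h. c4 h * (ccoef \<psi> (fst h) * ccoef \<psi> (fst (snd h) - snd (snd h)))) / (2 * pi)\<^sup>2"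
proof -
 note dom = bvdom_self[OF m bv]
 define E where "E k = (LBINT l:{-pi..pi}. complex_of_real (\<psi> l) * exp (- \<i> * (of_int k * of_real l)))" for k :: int
 obtain B where B0: "B \<ge> 0" and B: "\<And>x. x \<in> {-pi..pi} ==> \<bar>\<psi> x\<bar> \<le> B"
  using bv_sup_bound[OF bv] by auto
 have e: "exp (- \<i> * (of_int k * of_real l)) = cis (- (l * of_int k))" for k :: int and l
  by (simp add: cis_conv_exp mult_ac)
 have trig: "bvdom \<psi> (\<lambda>l. \<psi> l * cos (l * of_int k + c))" for k :: int and c
  by (intro bvdom_mult dom bvdom_cos)
 \<comment> \<open>The phase \<open>pi / 2\<close> makes this minus the sine coefficient, so that
   both parts share the facts proved for a general phase \<open>c\<close>.\<close>
 define S where "S k = (LBINT l:{-pi..pi}. \<psi> l * cos (l * of_int k + pi / 2))" for k :: int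
 have ci: "set_integrable lborel {-pi..pi} (\<lambda>l. \<psi> l * cos (l * of_int k + c))" for k c
  by (rule bvdom_set_integrable[OF trig]) auto
 have E_eq: "E k = Complex (ccoef \<psi> k) (S k)" for k
 proof -
  have "E k = (LBINT l:{-pi..pi}. complex_of_real (\<psi> l * cos (l * of_int k + 0)) + \<i> * complex_of_real (\<psi> l * cos (l * of_int k + pi / 2)))"
   unfolding E_def e by (intro set_lebesgue_integral_cong) (auto simp: complex_eq_iff cos_add)
  also have "\<dots> = complex_of_real (ccoef \<psi> k) + \<i> * complex_of_real (S k)"
   using ci[of k 0] ci[of k "pi / 2"]
   by (subst set_integral_add) (simp_all add: set_integral_complex_of_real ccoef_def S_def set_integrable_def
    complex_of_real_integrable_eq[of lborel "\<lambda>l. indicator _ l * _ l"] scaleR_conv_of_real mult.left_commute[of "of_real _" \<i>]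
    flip: of_real_mult)
  finally show ?thesis by (simp add: complex_eq_iff)
 qed
 have cb: "\<bar>LBINT l:{-pi..pi}. \<psi> l * cos (l * of_int k + c)\<bar> \<le> 2 * pi * B" for k c
 proof -
  have "norm (LBINT l:{-pi..pi}. \<psi> l * cos (l * of_int k + c)) \<le> (LBINT l:{-pi..pi}. norm (\<psi> l * cos (l * of_int k + c)))"
   by (rule set_integral_norm_bound[OF ci])
  also have "\<dots> \<le> (LBINT l:{-pi..pi}. B)"
  proof (rule set_integral_mono)
   show "set_integrable lborel {-pi..pi} (\<lambda>l. norm (\<psi> l * cos (l * of_int k + c)))"
    by (rule set_integrable_norm[OF ci])
   show "set_integrable lborel {-pi..pi} (\<lambda>_. B)" by (simp add: set_integrable_def emeasure_lborel_Icc_eq)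
   show "norm (\<psi> l * cos (l * of_int k + c)) \<le> B" if "l \<in> {-pi..pi}" for l
    using mult_mono[OF B[OF that] abs_cos_le_one B0] by (simp add: abs_mult)
  qed
  also have "\<dots> = 2 * pi * B" by (simp add: set_lebesgue_integral_def)
  finally show ?thesis by simp
 qed
 have Eb: "norm (E k) \<le> 4 * pi * B" for k
  using cmod_le[of "E k"] cb[of k 0] cb[of k "pi / 2"] unfolding E_eq by (simp add: ccoef_def S_def)
 define u where "u h = complex_of_real (c4 h)" for h
 define x where "x k l = exp (- \<i> * (of_int k * complex_of_real l))" for k :: int and l
 have x1: "norm (x k l) = 1" for k l unfolding x_def e by simp
 have xc: "continuous_on A (x k)" for k A unfolding x_def by (intro continuous_intros)
 have f4: "fourth_order_density M X l1 l2 (- l2) =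
   1 / (2 * pi) ^ 3 * (\<Sum>\<^sub>\<infinity>h. u h * x (fst h) l1 * x (fst (snd h) - snd (snd h)) l2)" for l1 l2
  unfolding fourth_order_density_def
  by (intro arg_cong2[where f = times] infsum_cong)
   (auto simp: u_def c4_def x_def exp_add[symmetric] algebra_simps)
 have inner: "(LBINT l2:{-pi..pi}. complex_of_real (\<psi> l1) * complex_of_real (\<psi> l2) * fourth_order_density M X l1 l2 (- l2)) =
   1 / (2 * pi) ^ 3 * (complex_of_real (\<psi> l1) * (\<Sum>\<^sub>\<infinity>h. u h * E (fst (snd h) - snd (snd h)) * x (fst h) l1))" for l1
 proof -
  have "((\<lambda>h. LBINT l2:{-pi..pi}. complex_of_real (\<psi> l2) * (u h * x (fst h) l1 * x (fst (snd h) - snd (snd h)) l2)) has_sum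
   (LBINT l2:{-pi..pi}. complex_of_real (\<psi> l2) * (\<Sum>\<^sub>\<infinity>h. u h * x (fst h) l1 * x (fst (snd h) - snd (snd h)) l2))) UNIV"
   by (rule integral_infsum_exchange[OF dom c4_summable])
    (auto simp: norm_mult x1 u_def intro!: continuous_intros xc)
  moreover have "(LBINT l2:{-pi..pi}. complex_of_real (\<psi> l2) * (u h * x (fst h) l1 * x k l2)) = u h * E k * x (fst h) l1" for h k
  proof -
   have "(LBINT l2:{-pi..pi}. complex_of_real (\<psi> l2) * (u h * x (fst h) l1 * x k l2)) =
    (LBINT l2:{-pi..pi}. (u h * x (fst h) l1) * (complex_of_real (\<psi> l2) * x k l2))" by (simp add: mult_ac)
   also have "\<dots> = u h * x (fst h) l1 * E k" unfolding set_integral_mult_right by (simp add: E_def x_def)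
   finally show ?thesis by (simp add: mult_ac)
  qed
  ultimately have s: "(LBINT l2:{-pi..pi}. complex_of_real (\<psi> l2) * (\<Sum>\<^sub>\<infinity>h. u h * x (fst h) l1 * x (fst (snd h) - snd (snd h)) l2)) =
    (\<Sum>\<^sub>\<infinity>h. u h * E (fst (snd h) - snd (snd h)) * x (fst h) l1)"
   by (simp add: infsumI[symmetric])
  have "(LBINT l2:{-pi..pi}. complex_of_real (\<psi> l1) * complex_of_real (\<psi> l2) * fourth_order_density M X l1 l2 (- l2)) =
   (LBINT l2:{-pi..pi}. (1 / (2 * pi) ^ 3 * complex_of_real (\<psi> l1)) * (complex_of_real (\<psi> l2) * (\<Sum>\<^sub>\<infinity>h. u h * x (fst h) l1 * x (fst (snd h) - snd (snd h)) l2)))"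
   unfolding f4 by (simp add: mult_ac)
  then show ?thesis unfolding set_integral_mult_right s by simp
 qed
 have outer: "(LBINT l1:{-pi..pi}. complex_of_real (\<psi> l1) * (\<Sum>\<^sub>\<infinity>h. u h * E (fst (snd h) - snd (snd h)) * x (fst h) l1)) =
   (\<Sum>\<^sub>\<infinity>h. u h * (E (fst h) * E (fst (snd h) - snd (snd h))))"
  and sm: "(\<lambda>h. u h * (E (fst h) * E (fst (snd h) - snd (snd h)))) summable_on UNIV"
 proof -
  have "((\<lambda>h. LBINT l1:{-pi..pi}. complex_of_real (\<psi> l1) * (u h * E (fst (snd h) - snd (snd h)) * x (fst h) l1)) has_sum
   (LBINT l1:{-pi..pi}. complex_of_real (\<psi> l1) * (\<Sum>\<^sub>\<infinity>h. u h * E (fst (snd h) - snd (snd h)) * x (fst h) l1))) UNIV"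
  proof (rule integral_infsum_exchange[OF dom summable_on_cmult_left[OF c4_summable, of "4 * pi * B"]])
   show "norm (u h * E (fst (snd h) - snd (snd h)) * x (fst h) l) \<le> \<bar>c4 h\<bar> * (4 * pi * B)" for h l
    unfolding norm_mult x1 by (simp add: u_def mult_left_mono Eb)
  qed (intro continuous_intros xc)
  moreover have "(LBINT l1:{-pi..pi}. complex_of_real (\<psi> l1) * (u h * E (fst (snd h) - snd (snd h)) * x (fst h) l1)) =
   u h * (E (fst h) * E (fst (snd h) - snd (snd h)))" for h
  proof -
   have "(LBINT l1:{-pi..pi}. complex_of_real (\<psi> l1) * (u h * E (fst (snd h) - snd (snd h)) * x (fst h) l1)) =
    (LBINT l1:{-pi..pi}. (u h * E (fst (snd h) - snd (snd h))) * (complex_of_real (\<psi> l1) * x (fst h) l1))" by (simp add: mult_ac)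
   also have "\<dots> = u h * E (fst (snd h) - snd (snd h)) * E (fst h)" unfolding set_integral_mult_right by (simp add: E_def x_def)
   finally show ?thesis by (simp add: mult_ac)
  qed
  ultimately have hs: "((\<lambda>h. u h * (E (fst h) * E (fst (snd h) - snd (snd h)))) has_sum
   (LBINT l1:{-pi..pi}. complex_of_real (\<psi> l1) * (\<Sum>\<^sub>\<infinity>h. u h * E (fst (snd h) - snd (snd h)) * x (fst h) l1))) UNIV" by simp
  show "(LBINT l1:{-pi..pi}. complex_of_real (\<psi> l1) * (\<Sum>\<^sub>\<infinity>h. u h * E (fst (snd h) - snd (snd h)) * x (fst h) l1)) =
   (\<Sum>\<^sub>\<infinity>h. u h * (E (fst h) * E (fst (snd h) - snd (snd h))))" using infsumI[OF hs] by simp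
  show "(\<lambda>h. u h * (E (fst h) * E (fst (snd h) - snd (snd h)))) summable_on UNIV" using hs by (rule has_sum_imp_summable)
 qed
 let ?C = "\<lambda>h. ccoef \<psi> (fst h) * ccoef \<psi> (fst (snd h) - snd (snd h))" and ?S = "\<lambda>h. S (fst h) * S (fst (snd h) - snd (snd h))"
 have bs: "(\<lambda>h. c4 h * (f (fst h) * f (fst (snd h) - snd (snd h)))) summable_on UNIV"
  if f: "\<And>k. \<bar>f k\<bar> \<le> 2 * pi * B" for f :: "int => real"
 proof (rule abs_summable_summable, rule summable_on_comparison_test[OF summable_on_cmult_left[OF c4_summable, of "(2 * pi * B) * (2 * pi * B)"]])
  show "norm (c4 h * (f (fst h) * f (fst (snd h) - snd (snd h)))) \<le> \<bar>c4 h\<bar> * ((2 * pi * B) * (2 * pi * B))" for h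
   using f B0 by (simp only: real_norm_def abs_mult) (intro mult_left_mono mult_mono, auto)
 qed simp_all
 have sS: "(\<lambda>h. c4 h * ?S h) summable_on UNIV" and sC: "(\<lambda>h. c4 h * ?C h) summable_on UNIV"
  using cb[of _ "pi / 2"] cb[of _ 0] by (intro bs; simp add: S_def ccoef_def)+
 have "(\<Sum>\<^sub>\<infinity>h. c4 h * ?S h) = 0"
 proof -
  let ?r = "\<lambda>h :: int \<times> int \<times> int. (fst h, snd (snd h), fst (snd h))"
  have Sodd: "S (- k) = - S k" for k
  proof -
   have "S (- k) = (LBINT l:{-pi..pi}. (- 1) * (\<psi> l * cos (l * of_int k + pi / 2)))"
    unfolding S_def by (simp add: cos_add cos_diff)
   then show ?thesis unfolding set_integral_mult_right S_def by simp
  qed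
  have Sr: "?S (?r h) = - ?S h" for h using Sodd[of "fst (snd h) - snd (snd h)"] by simp
  have "(\<Sum>\<^sub>\<infinity>h. c4 h * ?S h) = (\<Sum>\<^sub>\<infinity>h. c4 (?r h) * ?S (?r h))"
   by (rule infsum_reindex_bij_betw[symmetric, of ?r UNIV UNIV "\<lambda>h. c4 h * ?S h"])
    (rule bij_betwI[where g = ?r], auto)
  also have "\<dots> = - (\<Sum>\<^sub>\<infinity>h. c4 h * ?S h)" by (simp only: c4_swap Sr mult_minus_right infsum_uminus)
  finally show ?thesis by simp
 qed
 moreover have "Re (\<Sum>\<^sub>\<infinity>h. u h * (E (fst h) * E (fst (snd h) - snd (snd h)))) = (\<Sum>\<^sub>\<infinity>h. c4 h * ?C h - c4 h * ?S h)"
  unfolding infsum_Re[OF sm, symmetric] by (simp add: u_def E_eq right_diff_distrib)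
 ultimately have "Re (\<Sum>\<^sub>\<infinity>h. u h * (E (fst h) * E (fst (snd h) - snd (snd h)))) = (\<Sum>\<^sub>\<infinity>h. c4 h * ?C h)"
  using infsum_minus(2)[OF sC sS] by simp
 moreover have "tau2 M X \<psi> = 2 * pi * (1 / (2 * pi) ^ 3 * Re (\<Sum>\<^sub>\<infinity>h. u h * (E (fst h) * E (fst (snd h) - snd (snd h)))))"
  unfolding tau2_def inner set_integral_mult_right outer unfolding scaleR_conv_of_real[symmetric] scaleR_complex.sel ..
 ultimately show ?thesis by (simp add: power3_eq_cube power2_eq_square)
qed

lemma eV_limit:
 assumes "set_borel_measurable lborel {-pi..pi} \<psi>" "bounded_variation_on (-pi) pi \<psi>"
 shows "(\<lambda>b. 4 * pi\<^sup>2 / real b * (\<Sum>j\<in>FI b. \<Sum>k\<in>FI b.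
   \<psi> (ff j b) * \<psi> (ff k b) * eV j k b)) \<longlonglongrightarrow> tau_sq M X \<psi>"
proof -
 have "\<forall>\<^sub>F b in sequentially. 2 / real b * (\<Sum>j\<in>FI b. \<Sum>k\<in>FI b.
    \<psi> (ff j b) * \<psi> (ff k b) * corr2 j k b) +
   1 / real b * (\<Sum>j\<in>FI b. \<Sum>k\<in>FI b. \<psi> (ff j b) * \<psi> (ff k b) *
    (\<Sum>a\<in>{False,True}. \<Sum>c\<in>{False,True}. kap4 (fw a j b) (fw c k b) b 0)) =
   4 * pi\<^sup>2 / real b * (\<Sum>j\<in>FI b. \<Sum>k\<in>FI b.
    \<psi> (ff j b) * \<psi> (ff k b) * eV j k b)"
  using eventually_ge_at_top[of 1]
 proof eventually_elim
  case (elim b)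
  have "4 * pi\<^sup>2 * eV j k b = (\<Sum>a\<in>{False,True}. \<Sum>c\<in>{False,True}. \<E> (qprod (fw a j b) (fw c k b) b 0))" for j k
   unfolding eV_eq[OF elim] by (simp only: power_mult_distrib) simp
  then have "4 * pi\<^sup>2 * eV j k b = 2 * corr2 j k b + (\<Sum>a\<in>{False,True}. \<Sum>c\<in>{False,True}. kap4 (fw a j b) (fw c k b) b 0)" for j k
   unfolding qprod_mean by simp
  then have "4 * pi\<^sup>2 * (\<psi> (ff j b) * \<psi> (ff k b) * eV j k b) =
    2 * (\<psi> (ff j b) * \<psi> (ff k b) * corr2 j k b) + \<psi> (ff j b) * \<psi> (ff k b) *
    (\<Sum>a\<in>{False,True}. \<Sum>c\<in>{False,True}. kap4 (fw a j b) (fw c k b) b 0)" for j k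
   by (simp only: mult.left_commute[of "4 * pi\<^sup>2"] mult.left_commute[of 2] distrib_left)
  then have "4 * pi\<^sup>2 * (\<Sum>j\<in>FI b. \<Sum>k\<in>FI b. \<psi> (ff j b) * \<psi> (ff k b) * eV j k b) =
    2 * (\<Sum>j\<in>FI b. \<Sum>k\<in>FI b. \<psi> (ff j b) * \<psi> (ff k b) * corr2 j k b) +
    (\<Sum>j\<in>FI b. \<Sum>k\<in>FI b. \<psi> (ff j b) * \<psi> (ff k b) *
    (\<Sum>a\<in>{False,True}. \<Sum>c\<in>{False,True}. kap4 (fw a j b) (fw c k b) b 0))"
   unfolding sum_distrib_left[of "4 * pi\<^sup>2"] sum_distrib_left[of 2] sum.distrib[symmetric] by (intro sum.cong refl)
  then show ?case by (simp only: times_divide_eq_left add_divide_distrib mult_1)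
 qed
 then show ?thesis
  using tendsto_add[OF second_order_limit[OF assms] fourth_order_limit[OF assms]]
  unfolding tau_sq_def tau2_eq[OF assms] by (rule Lim_transform_eventually[rotated])
qed

end

section \<open>Sets of vanishing outer probability\<close>

text \<open>The events may involve suprema of unknown measurability, hence the outer measure, for
  which monotonicity and subadditivity survive.\<close>

definition vanishing :: "'a measure => (nat => 'a set) => bool" where
 "vanishing M A \<longleftrightarrow> (\<lambda>m. outer_measure_of M (A m)) \<longlonglongrightarrow> 0"

lemma oP1_vanishing: "oP1 M Y \<longleftrightarrow> (\<forall>\<epsilon>>0. vanishing M (\<lambda>m. {om \<in> space M. ereal \<epsilon> < \<bar>Y m om\<bar>}))"
 by (simp add: oP1_def vanishing_def)

lemma vanishing_subset:
 assumes "vanishing M B" "\<forall>\<^sub>F m in sequentially. A m \<subseteq> B m"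
 shows "vanishing M A"
 unfolding vanishing_def
proof (rule tendsto_sandwich[OF _ _ tendsto_const assms(1)[unfolded vanishing_def]])
 show "\<forall>\<^sub>F m in sequentially. outer_measure_of M (A m) \<le> outer_measure_of M (B m)"
  using assms(2) by eventually_elim (rule outer_measure_of_mono)
qed simp

lemma vanishing_Un:
 assumes "vanishing M A" "vanishing M B" "\<And>m. A m \<subseteq> space M" "\<And>m. B m \<subseteq> space M"
 shows "vanishing M (\<lambda>m. A m \<union> B m)"
 unfolding vanishing_def
proof (rule tendsto_sandwich[OF _ _ tendsto_const])
 show "(\<lambda>m. outer_measure_of M (A m) + outer_measure_of M (B m)) \<longlonglongrightarrow> 0"
  using tendsto_add[OF assms(1,2)[unfolded vanishing_def]] by simp
 show "\<forall>\<^sub>F m in sequentially. outer_measure_of M (A m \<union> B m) \<le> outer_measure_of M (A m) + outer_measure_of M (B m)"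
 proof (intro always_eventually allI)
  fix m
  \<comment> \<open>Subadditivity is inherited from measurable covers that attain the outer
    measures.\<close>
  obtain E F where E: "E \<in> sets M" "A m \<subseteq> E" "outer_measure_of M (A m) = emeasure M E"
   and F: "F \<in> sets M" "B m \<subseteq> F" "outer_measure_of M (B m) = emeasure M F"
   using outer_measure_of_attain[OF assms(3), of m] outer_measure_of_attain[OF assms(4), of m] by auto
  have "outer_measure_of M (A m \<union> B m) \<le> outer_measure_of M (E \<union> F)"
   using E F by (intro outer_measure_of_mono) auto
  also have "\<dots> \<le> emeasure M E + emeasure M F" using E F by (simp add: emeasure_subadditive)
  finally show "outer_measure_of M (A m \<union> B m) \<le> outer_measure_of M (A m) + outer_measure_of M (B m)"
   by (simp add: E F)
 qed
qed simp

lemma (in prob_space) vanishing_Markov: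
 fixes f :: "nat => 'a => real"
 assumes "\<And>m. integrable M (f m)" "\<And>m om. f m om \<ge> 0" "\<forall>\<^sub>F m in sequentially. \<E> (f m) \<le> r m"
  "r \<longlonglongrightarrow> 0" "\<delta> > 0"
 shows "vanishing M (\<lambda>m. {om \<in> space M. f m om > \<delta>})"
 unfolding vanishing_def
proof (rule tendsto_sandwich[OF _ _ tendsto_const])
 show "(\<lambda>m. ennreal (r m / \<delta>)) \<longlonglongrightarrow> 0"
  using tendsto_ennrealI[OF tendsto_divide_zero[OF assms(4)]] by simp
 show "\<forall>\<^sub>F m in sequentially. outer_measure_of M {om \<in> space M. f m om > \<delta>} \<le> ennreal (r m / \<delta>)"
  using assms(3)
 proof eventually_elim
  case (elim m)
  have [measurable]: "f m \<in> borel_measurable M" using assms(1) by auto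
  have "prob {om \<in> space M. f m om > \<delta>} \<le> prob {om \<in> space M. f m om \<ge> \<delta>}"
   by (intro finite_measure_mono) auto
  also have "\<dots> \<le> \<E> (f m) / \<delta>"
   by (rule integral_Markov_inequality_measure[OF assms(1), of "{}"]) (use assms(2,5) in auto)
  also have "\<dots> \<le> r m / \<delta>" using elim assms(5) by (simp add: divide_right_mono)
  finally show ?case by (simp add: emeasure_eq_measure ennreal_leI)
 qed
qed simp

section \<open>The normal distribution function\<close>

abbreviation Phi :: "real => real" where "Phi \<equiv> cdf std_normal_distribution"

interpretation normal: real_distribution std_normal_distribution by (rule real_dist_normal_dist)

lemma Phi_lipschitz: "x \<le> y ==> Phi y - Phi x \<le> y - x"
proof (cases "x = y")
 case False
 assume "x \<le> y"
 with False have xy: "x < y" by simp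
 have "1 / sqrt (2 * pi) \<le> 1" using pi_gt3 by simp
 then have d1: "std_normal_density z \<le> 1" for z
  using mult_mono[of "1 / sqrt (2 * pi)" 1 "exp (- z\<^sup>2 / 2)" 1] by (simp add: std_normal_density_def)
 have "emeasure std_normal_distribution {x<..y} = (\<integral>\<^sup>+z. ennreal (std_normal_density z) * indicator {x<..y} z \<partial>lborel)"
  by (rule emeasure_density) auto
 also have "\<dots> \<le> (\<integral>\<^sup>+z. indicator {x<..y} z \<partial>lborel)"
  by (intro nn_integral_mono) (auto simp: indicator_def d1 ennreal_le_1)
 also have "\<dots> = ennreal (y - x)" using xy by simp
 finally have "measure std_normal_distribution {x<..y} \<le> y - x"
  using xy by (simp add: normal.emeasure_eq_measure)
 then show ?thesis using normal.cdf_diff_eq[OF xy] by simp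
qed simp

lemma Phi_cont: "isCont Phi x"
proof -
 have "\<bar>Phi u - Phi v\<bar> \<le> 1 * \<bar>u - v\<bar>" for u v
  using Phi_lipschitz[of u v] Phi_lipschitz[of v u] normal.cdf_nondecreasing[of u v] normal.cdf_nondecreasing[of v u]
  by (cases "u \<le> v") auto
 then have "1-lipschitz_on UNIV Phi" by (intro lipschitz_onI) (auto simp: dist_real_def)
 then have "continuous_on UNIV Phi" by (rule uniformly_continuous_imp_continuous[OF lipschitz_on_uniformly_continuous])
 then show ?thesis by (simp add: continuous_on_eq_continuous_at)
qed

lemma cdf_centred_normal:
 assumes v: "v > 0"
 shows "cdf (centred_normal v) x = Phi (x / sqrt v)"
proof -
 interpret C: prob_space "centred_normal v"
  unfolding centred_normal_def using v by (simp add: prob_space_normal_density)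
 have "distributed (centred_normal v) lborel (\<lambda>x. x) (normal_density 0 (sqrt v))"
  using v by (simp add: distributed_def centred_normal_def distr_id2)
 then have "distributed (centred_normal v) lborel (\<lambda>x. (x - 0) / sqrt v) std_normal_density"
  using C.normal_standard_normal_convert[of "sqrt v"] v by simp
 then have d: "distr (centred_normal v) lborel (\<lambda>x. x / sqrt v) = std_normal_distribution"
  by (simp add: distributed_def)
 have "sets (centred_normal v) = sets borel" using v by (simp add: centred_normal_def)
 then have "Phi (x / sqrt v) = measure (centred_normal v) ((\<lambda>x. x / sqrt v) -` {..x / sqrt v} \<inter> space (centred_normal v))"
  unfolding cdf_def d[symmetric] by (subst measure_distr) (auto cong: measurable_cong_sets)
 also have "(\<lambda>x. x / sqrt v) -` {..x / sqrt v} \<inter> space (centred_normal v) = {..x}"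
  using v by (auto simp: centred_normal_def divide_le_cancel)
 finally show ?thesis by (simp add: cdf_def)
qed

text \<open>Polya's theorem: the normal distribution function is continuous, so convergence is uniform.\<close>

lemma weak_conv_normal_uniform:
 assumes \<mu>: "\<And>m. real_distribution (\<mu> m)" and lim: "\<And>x. (\<lambda>m. cdf (\<mu> m) x) \<longlonglongrightarrow> Phi x" and e: "e > 0"
 shows "\<forall>\<^sub>F m in sequentially. \<forall>x. \<bar>cdf (\<mu> m) x - Phi x\<bar> \<le> e"
proof -
 obtain a where a: "Phi a < e / 2"
  using order_tendstoD(2)[OF normal.cdf_lim_at_bot, of "e / 2"] e eventually_at_bot_linorder by (metis half_gt_zero order_refl)
 obtain b where b: "Phi b > 1 - e / 2"
  using order_tendstoD(1)[OF normal.cdf_lim_at_top_prob, of "1 - e / 2"] e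
  by (metis diff_less_eq eventually_at_top_linorder less_add_same_cancel1 half_gt_zero order_refl)
 \<comment> \<open>Spacing \<open>e / 2\<close> suffices, since \<open>Phi\<close> has Lipschitz
   constant 1 and so moves by at most \<open>e / 2\<close> per cell.\<close>
 define g where "g i = a + real i * (e / 2)" for i
 obtain K where K: "b \<le> g K"
 proof -
  obtain K :: nat where "(b - a) / (e / 2) < real K" using reals_Archimedean2 by blast
  then have "b \<le> g K" using e by (simp add: g_def divide_less_eq)
  then show ?thesis by (rule that)
 qed
 have "\<forall>\<^sub>F m in sequentially. \<forall>i\<in>{..K}. \<bar>cdf (\<mu> m) (g i) - Phi (g i)\<bar> < e / 2"
  using tendstoD[OF lim, of "e / 2"] e by (intro eventually_ball_finite) (auto simp: dist_real_def)
 then show ?thesis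
 proof eventually_elim
  case (elim m)
  interpret R: real_distribution "\<mu> m" by (rule \<mu>)
  show ?case
  proof
   fix x
   consider "x \<le> g 0" | "g K \<le> x" | "g 0 \<le> x" "x \<le> g K" by linarith
   then show "\<bar>cdf (\<mu> m) x - Phi x\<bar> \<le> e"
   proof cases
    case 1
    then show ?thesis using elim[rule_format, of 0, unfolded abs_less_iff] a R.cdf_nondecreasing[OF 1] normal.cdf_nondecreasing[OF 1]
     R.cdf_nonneg[of x] normal.cdf_nonneg[of x] unfolding abs_le_iff by (simp add: g_def)
   next
    case 2
    have "Phi b \<le> Phi (g K)" by (rule normal.cdf_nondecreasing[OF K])
    then show ?thesis using elim[rule_format, of K, unfolded abs_less_iff] b R.cdf_nondecreasing[OF 2] normal.cdf_nondecreasing[OF 2]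
     R.cdf_bounded_prob[of x] normal.cdf_bounded_prob[of x] unfolding abs_le_iff by simp
   next
    case 3
    define i where "i = nat \<lfloor>(x - a) / (e / 2)\<rfloor>"
    have q: "(x - a) / (e / 2) \<ge> 0" using 3(1) e by (simp add: g_def)
    have ri: "real i \<le> (x - a) / (e / 2)" "(x - a) / (e / 2) < real i + 1"
     unfolding i_def using q by (simp_all add: of_nat_nat)
    have i: "g i \<le> x" "x \<le> g (Suc i)" using ri e by (simp_all add: g_def field_simps)
    show ?thesis
    proof (cases "i < K")
     case True
     then have iK: "i \<in> {..K}" "Suc i \<in> {..K}" by auto
     have "Phi (g (Suc i)) - Phi (g i) \<le> e / 2"
      using Phi_lipschitz[of "g i" "g (Suc i)"] e by (simp add: g_def algebra_simps)
     then show ?thesis using elim[rule_format, OF iK(1), unfolded abs_less_iff] elim[rule_format, OF iK(2), unfolded abs_less_iff]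
      R.cdf_nondecreasing[OF i(1)] R.cdf_nondecreasing[OF i(2)]
      normal.cdf_nondecreasing[OF i(1)] normal.cdf_nondecreasing[OF i(2)] unfolding abs_le_iff by simp
    next
     case False
     then have "g K \<le> g i" using e by (simp add: g_def)
     then have "x = g K" using i(1) 3(2) by simp
     then show ?thesis using elim[rule_format, of K] e by simp
    qed
   qed
  qed
 qed
qed

section \<open>Independent uniform draws\<close>

definition draws :: "nat => nat => (nat => nat) pmf" where
 "draws k N = Pi_pmf {1..k} 0 (\<lambda>_. pmf_of_set {1..N})"

definition drawsum :: "(nat => real) => nat => (nat => nat) => real" where
 "drawsum y k i = (\<Sum>l=1..k. y (i l)) / sqrt k"

definition avg :: "(nat => real) => nat => real" where
 "avg y N = (\<Sum>t=1..N. y t) / N"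

context
 fixes k N :: nat and y :: "nat => real"
 assumes N: "N \<ge> 1"
begin

abbreviation "ED \<equiv> measure_pmf.expectation (draws k N)"

lemma draw_expectation:
 assumes "l \<in> {1..k}"
 shows "ED (\<lambda>i. h (i l)) = avg h N"
proof -
 have "ED (\<lambda>i. h (i l)) = measure_pmf.expectation (map_pmf (\<lambda>i. i l) (draws k N)) h"
  by simp
 also have "map_pmf (\<lambda>i. i l) (draws k N) = pmf_of_set {1..N}"
  using assms unfolding draws_def by (subst Pi_pmf_component) auto
 finally show ?thesis using N by (simp add: integral_pmf_of_set avg_def)
qed

lemma draws_integrable: "integrable (measure_pmf (draws k N)) (f :: _ => real)"
proof (rule integrable_measure_pmf_finite)
 have "set_pmf (draws k N) \<subseteq> PiE_dflt {1..k} 0 (\<lambda>_. {1..N})"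
  using set_Pi_pmf_subset'[of "{1..k}" 0 "\<lambda>_. pmf_of_set {1..N}"] N by (simp add: draws_def o_def)
 then show "finite (set_pmf (draws k N))" by (rule finite_subset) (intro finite_PiE_dflt, auto)
qed

lemma draws_indep: "prob_space.indep_vars (measure_pmf (draws k N)) (\<lambda>_. borel) (\<lambda>l i. h (i l) :: real) {1..k}"
 using prob_space.indep_vars_compose2[OF measure_pmf.prob_space_axioms indep_vars_Pi_pmf[of "{1..k}" 0 "\<lambda>_. pmf_of_set {1..N}"],
  of "\<lambda>_. h" "\<lambda>_. borel"] by (simp add: draws_def)

lemma drawsum_mean:
 assumes "avg y N = 0"
 shows "ED (drawsum y k) = 0"
 unfolding drawsum_def[abs_def] using draws_integrable draw_expectation[of _ y] assms by simp

lemma drawsum_second_moment: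
 assumes "avg y N = 0" "k \<ge> 1"
 shows "ED (\<lambda>i. (drawsum y k i)\<^sup>2) = avg (\<lambda>t. (y t)\<^sup>2) N"
proof -
 have "ED (\<lambda>i. (\<Sum>l\<in>A. y (i l))\<^sup>2) = real (card A) * avg (\<lambda>t. (y t)\<^sup>2) N" if "A \<subseteq> {1..k}" for A
  using finite_subset[OF that finite_atLeastAtMost] that
 proof (induction A rule: finite_induct)
  case (insert a A)
  then have a: "a \<in> {1..k}" and A: "A \<subseteq> {1..k}" by auto
  have "prob_space.indep_var (measure_pmf (draws k N)) borel (\<lambda>i. y (i a)) borel (\<lambda>i. \<Sum>l\<in>A. y (i l))"
   using prob_space.indep_vars_sum[OF measure_pmf.prob_space_axioms insert(1,2) prob_space.indep_vars_subset[OF measure_pmf.prob_space_axioms draws_indep[of y] insert(4)]] .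
  from prob_space.indep_var_lebesgue_integral[OF measure_pmf.prob_space_axioms this]
  have "ED (\<lambda>i. y (i a) * (\<Sum>l\<in>A. y (i l))) = 0"
   using draws_integrable draw_expectation[OF a, of y] assms by simp
  moreover have "ED (\<lambda>i. (\<Sum>l\<in>insert a A. y (i l))\<^sup>2) = ED (\<lambda>i. (y (i a))\<^sup>2)
    + 2 * ED (\<lambda>i. y (i a) * (\<Sum>l\<in>A. y (i l))) + ED (\<lambda>i. (\<Sum>l\<in>A. y (i l))\<^sup>2)"
   using insert(1,2) draws_integrable by (simp add: power2_sum mult.assoc)
  ultimately show ?case
   using insert(3)[OF A] insert(1,2) draw_expectation[OF a, of "\<lambda>t. (y t)\<^sup>2"] by (simp add: algebra_simps)
 qed simp
 from this[of "{1..k}"] show ?thesis using assms(2) by (simp add: drawsum_def power_divide)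
qed

text \<open>A quantitative Lindeberg estimate. Both \<open>\<psi>\<close> and
  \<open>1 - s^2 / (2 * k)\<close> lie in the unit disc, the latter because
  \<open>s^2 \<le> 4 * k\<close>, so their \<open>k\<close>-th powers differ by at most
  \<open>k\<close> times their difference. The parameter \<open>\<eta>\<close> is free and is chosen
  when the limit is taken.\<close>

lemma drawsum_char:
 assumes "avg y N = 0" "k \<ge> 1" "(s::real)\<^sup>2 \<le> 4 * real k" "\<eta> > 0"
 shows "cmod (char (distr (measure_pmf (draws k N)) borel (drawsum y k)) s - complex_of_real ((1 + (- (s\<^sup>2) / 2) / real k) ^ k)) \<le>
  s\<^sup>2 / 2 * \<bar>avg (\<lambda>t. (y t)\<^sup>2) N - 1\<bar> + s\<^sup>2 / 6 * (\<eta> * avg (\<lambda>t. (y t)\<^sup>2) N + s\<^sup>2 / (4 * \<eta>) * (avg (\<lambda>t. y t ^ 4) N / k))"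
proof -
 let ?a2 = "avg (\<lambda>t. (y t)\<^sup>2) N" and ?a4 = "avg (\<lambda>t. y t ^ 4) N"
 let ?u = "s / sqrt k"
 define \<psi> where "\<psi> = char (distr (measure_pmf (draws k N)) borel (\<lambda>i. y (i 1))) ?u"
 have k1: "1 \<in> {1..k}" using assms(2) by simp
 have ch: "char (distr (measure_pmf (draws k N)) borel (\<lambda>i. y (i l))) ?u = \<psi>" if l: "l \<in> {1..k}" for l
 proof -
  have re: "char (distr (measure_pmf (draws k N)) borel (\<lambda>i. y (i l))) ?u =
    measure_pmf.expectation (map_pmf (\<lambda>i. i l) (draws k N)) (\<lambda>t. iexp (?u * y t))" for l
   by (simp add: char_def integral_distr)
  have "map_pmf (\<lambda>i. i l) (draws k N) = map_pmf (\<lambda>i. i 1) (draws k N)"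
   using l k1 unfolding draws_def by (simp add: Pi_pmf_component)
  then show ?thesis unfolding \<psi>_def re by simp
 qed
 have "char (distr (measure_pmf (draws k N)) borel (drawsum y k)) s =
   char (distr (measure_pmf (draws k N)) borel (\<lambda>i. \<Sum>l\<in>{1..k}. y (i l))) ?u"
  by (simp add: char_def integral_distr drawsum_def mult.commute)
 also have "\<dots> = (\<Prod>l\<in>{1..k}. char (distr (measure_pmf (draws k N)) borel (\<lambda>i. y (i l))) ?u)"
  by (rule prob_space.char_distr_sum[OF measure_pmf.prob_space_axioms draws_indep])
 also have "\<dots> = \<psi> ^ k" by (simp add: ch)
 finally have char: "char (distr (measure_pmf (draws k N)) borel (drawsum y k)) s = \<psi> ^ k" .
 have v: "measure_pmf.variance (draws k N) (\<lambda>i. y (i 1)) = ?a2"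
  using draw_expectation[OF k1, of y] draw_expectation[OF k1, of "\<lambda>t. (y t)\<^sup>2"] assms(1) by simp
 have "cmod (\<psi> - (1 - ?u\<^sup>2 * ?a2 / 2)) \<le> (?u\<^sup>2 / 6) * ED (\<lambda>i. min (6 * (y (i 1))\<^sup>2) (\<bar>?u\<bar> * \<bar>y (i 1)\<bar> ^ 3))"
  unfolding \<psi>_def
  by (rule prob_space.char_approx3'[OF measure_pmf.prob_space_axioms _ draws_integrable draws_integrable _ v refl]) (use draw_expectation[OF k1, of y] assms(1) in simp_all)
 also have "ED (\<lambda>i. min (6 * (y (i 1))\<^sup>2) (\<bar>?u\<bar> * \<bar>y (i 1)\<bar> ^ 3)) \<le>
   ED (\<lambda>i. \<eta> * (y (i 1))\<^sup>2 + ?u\<^sup>2 / (4 * \<eta>) * (y (i 1)) ^ 4)"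
 proof (rule integral_mono[OF draws_integrable draws_integrable])
  fix i
  define z where "z = \<bar>y (i 1)\<bar>"
  define w where "w = \<bar>?u\<bar> * z"
  \<comment> \<open>Arithmetic-geometric mean: the cubic term \<open>w * z^2\<close> is bounded by
    \<open>\<eta> * z^2\<close> plus a fourth-order term, so the third absolute moment
    disappears.\<close>
  have "0 \<le> (2 * \<eta> - w)\<^sup>2" by simp
  then have "w \<le> \<eta> + w\<^sup>2 / (4 * \<eta>)"
   using assms(4) by (simp add: power2_diff field_simps power2_eq_square)
  then have "\<bar>?u\<bar> * z \<le> \<eta> + ?u\<^sup>2 / (4 * \<eta>) * z\<^sup>2" by (simp add: w_def power_mult_distrib power_divide)
  then have "(\<bar>?u\<bar> * z) * z\<^sup>2 \<le> (\<eta> + ?u\<^sup>2 / (4 * \<eta>) * z\<^sup>2) * z\<^sup>2" by (rule mult_right_mono) simp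
  also have "\<dots> = \<eta> * z\<^sup>2 + ?u\<^sup>2 / (4 * \<eta>) * z ^ 4" by (simp add: algebra_simps eval_nat_numeral)
  finally show "min (6 * (y (i 1))\<^sup>2) (\<bar>?u\<bar> * \<bar>y (i 1)\<bar> ^ 3) \<le> \<eta> * (y (i 1))\<^sup>2 + ?u\<^sup>2 / (4 * \<eta>) * (y (i 1)) ^ 4"
   by (simp add: z_def power3_eq_cube power2_eq_square mult.assoc power_abs[symmetric])
 qed
 also have "\<dots> = \<eta> * ?a2 + ?u\<^sup>2 / (4 * \<eta>) * ?a4"
  using draw_expectation[OF k1, of "\<lambda>t. (y t)\<^sup>2"] draw_expectation[OF k1, of "\<lambda>t. y t ^ 4"] draws_integrable by simp
 finally have "cmod (\<psi> - (1 - ?u\<^sup>2 * ?a2 / 2)) \<le> (?u\<^sup>2 / 6) * (\<eta> * ?a2 + ?u\<^sup>2 / (4 * \<eta>) * ?a4)"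
  by (simp add: mult_left_mono)
 moreover have u2: "?u\<^sup>2 = s\<^sup>2 / k" by (simp add: power_divide)
 ultimately have c: "cmod (\<psi> - (1 - s\<^sup>2 / k * ?a2 / 2)) \<le> (s\<^sup>2 / k / 6) * (\<eta> * ?a2 + s\<^sup>2 / k / (4 * \<eta>) * ?a4)" by simp
 have w: "cmod (complex_of_real (1 + (- (s\<^sup>2) / 2) / real k)) \<le> 1"
  using assms(2,3) unfolding norm_of_real by (simp add: abs_le_iff field_simps)
 have "complex_of_real (1 - s\<^sup>2 / k * ?a2 / 2) - complex_of_real (1 + (- (s\<^sup>2) / 2) / real k) = complex_of_real (s\<^sup>2 / 2 / k * (1 - ?a2))"
  unfolding of_real_diff[symmetric] by (intro arg_cong[where f = of_real]) (simp add: right_diff_distrib diff_divide_distrib)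
 then have d: "cmod (complex_of_real (1 - s\<^sup>2 / k * ?a2 / 2) - complex_of_real (1 + (- (s\<^sup>2) / 2) / real k)) = s\<^sup>2 / 2 / k * \<bar>?a2 - 1\<bar>"
  by (simp add: norm_mult norm_divide norm_power abs_minus_commute flip: of_real_diff)
 have "cmod \<psi> \<le> 1" unfolding \<psi>_def
  by (rule real_distribution.cmod_char_le_1) (rule prob_space.real_distribution_distr[OF measure_pmf.prob_space_axioms], simp)
 then have "cmod (\<psi> ^ k - complex_of_real (1 + (- (s\<^sup>2) / 2) / real k) ^ k) \<le> k * cmod (\<psi> - complex_of_real (1 + (- (s\<^sup>2) / 2) / real k))"
  by (rule norm_power_diff[OF _ w])
 also have "\<dots> \<le> k * (s\<^sup>2 / 2 / k * \<bar>?a2 - 1\<bar> + (s\<^sup>2 / k / 6) * (\<eta> * ?a2 + s\<^sup>2 / k / (4 * \<eta>) * ?a4))"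
  using norm_triangle_ineq[of "\<psi> - (1 - s\<^sup>2 / k * ?a2 / 2)" "complex_of_real (1 - s\<^sup>2 / k * ?a2 / 2) - complex_of_real (1 + (- (s\<^sup>2) / 2) / real k)"]
   c d by (intro mult_left_mono) (auto simp: algebra_simps)
 also have "\<dots> = s\<^sup>2 / 2 * \<bar>?a2 - 1\<bar> + s\<^sup>2 / 6 * (\<eta> * ?a2 + s\<^sup>2 / (4 * \<eta>) * (?a4 / k))"
  using assms(2) by (simp add: distrib_left)
 finally show ?thesis unfolding char by simp
qed

end

text \<open>The population \<open>y\<close> depends on the data, so the limit theorem must be
  uniform over all finite populations. If no \<open>\<delta>\<close> worked, counterexamples for
  \<open>\<delta> = 1 / (m + 1)\<close> would form a triangular array for which Levy's continuity
  theorem and Polya's theorem give the opposite.\<close>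

lemma drawsum_clt:
 assumes e: "e > 0"
 obtains \<delta> :: real where "\<delta> > 0" "\<And>N k y x. N \<ge> 1 ==> k \<ge> 1 ==> avg y N = 0 ==>
   \<bar>avg (\<lambda>t. (y t)\<^sup>2) N - 1\<bar> \<le> \<delta> ==> avg (\<lambda>t. y t ^ 4) N \<le> \<delta> * real k ==> 1 / real k \<le> \<delta> ==>
   \<bar>measure_pmf.prob (draws k N) {i. drawsum y k i \<le> x} - Phi x\<bar> \<le> e"
proof (rule ccontr)
 assume no: "\<not> thesis"
 let ?good = "\<lambda>\<delta> N k y. N \<ge> 1 \<and> k \<ge> 1 \<and> avg y N = 0 \<and> \<bar>avg (\<lambda>t. (y t)\<^sup>2) N - 1\<bar> \<le> \<delta> \<and> avg (\<lambda>t. y t ^ 4) N \<le> \<delta> * real k \<and> 1 / real k \<le> \<delta>"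
 have "\<exists>N k y x. ?good (inverse (real (Suc m))) N k y \<and> \<not> \<bar>measure_pmf.prob (draws k N) {i. drawsum y k i \<le> x} - Phi x\<bar> \<le> e" for m
  using no that[of "inverse (real (Suc m))"] by fastforce
 then obtain N k y x where g: "\<And>m. ?good (inverse (real (Suc m))) (N m) (k m) (y m)"
  and bad: "\<And>m. \<not> \<bar>measure_pmf.prob (draws (k m) (N m)) {i. drawsum (y m) (k m) i \<le> x m} - Phi (x m)\<bar> \<le> e"
  by metis
 define d where "d m = inverse (real (Suc m))" for m
 have d: "d \<longlonglongrightarrow> 0" "\<And>m. d m > 0" unfolding d_def using LIMSEQ_inverse_real_of_nat by auto
 have kge: "k m \<ge> Suc m" for m
 proof -
  have "real (k m) > 0" "inverse (real (k m)) \<le> inverse (real (Suc m))" using g[of m] by (auto simp: inverse_eq_divide)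
  then have "real (Suc m) \<le> real (k m)" by (simp only: inverse_le_iff_le of_nat_0_less_iff zero_less_Suc)
  then show ?thesis by simp
 qed
 have kinf: "filterlim k at_top sequentially"
  by (rule filterlim_at_top_mono[OF filterlim_Suc]) (use kge in auto)
 define \<mu> where "\<mu> m = distr (measure_pmf (draws (k m) (N m))) borel (drawsum (y m) (k m))" for m
 have rd: "real_distribution (\<mu> m)" for m
  unfolding \<mu>_def by (rule prob_space.real_distribution_distr[OF measure_pmf.prob_space_axioms]) simp
 have cdf: "cdf (\<mu> m) z = measure_pmf.prob (draws (k m) (N m)) {i. drawsum (y m) (k m) i \<le> z}" for m z
  unfolding cdf_def \<mu>_def by (subst measure_distr) (auto intro!: arg_cong2[where f = measure])
 have "(\<lambda>m. char (\<mu> m) s) \<longlonglongrightarrow> char std_normal_distribution s" for s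
 proof -
  have exp: "(\<lambda>m. complex_of_real ((1 + (- (s\<^sup>2) / 2) / real (k m)) ^ k m)) \<longlonglongrightarrow> complex_of_real (exp (- (s\<^sup>2) / 2))"
   by (intro tendsto_of_real filterlim_compose[OF tendsto_exp_limit_sequentially kinf])
  have "(\<lambda>m. char (\<mu> m) s - complex_of_real ((1 + (- (s\<^sup>2) / 2) / real (k m)) ^ k m)) \<longlonglongrightarrow> 0"
  proof (rule Lim_null_comparison)
   have sd: "(\<lambda>m. sqrt (d m)) \<longlonglongrightarrow> 0" using tendsto_real_sqrt[OF d(1)] by simp
   have "(\<lambda>m. s\<^sup>2 / 2 * d m + s\<^sup>2 / 6 * (sqrt (d m) * (1 + d m) + s\<^sup>2 / 4 * sqrt (d m))) \<longlonglongrightarrow>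
    s\<^sup>2 / 2 * 0 + s\<^sup>2 / 6 * (0 * (1 + 0) + s\<^sup>2 / 4 * 0)" by (intro tendsto_intros sd d(1))
   then show "(\<lambda>m. s\<^sup>2 / 2 * d m + s\<^sup>2 / 6 * (sqrt (d m) * (1 + d m) + s\<^sup>2 / 4 * sqrt (d m))) \<longlonglongrightarrow> 0" by simp
   obtain m0 :: nat where "s\<^sup>2 \<le> real m0" using real_arch_simple by blast
   then have "s\<^sup>2 \<le> 4 * real (k m)" if "m \<ge> m0" for m using kge[of m] that by linarith
   then have "\<forall>\<^sub>F m in sequentially. s\<^sup>2 \<le> 4 * real (k m)" unfolding eventually_sequentially by blast
   then show "\<forall>\<^sub>F m in sequentially. norm (char (\<mu> m) s - complex_of_real ((1 + (- (s\<^sup>2) / 2) / real (k m)) ^ k m))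
     \<le> s\<^sup>2 / 2 * d m + s\<^sup>2 / 6 * (sqrt (d m) * (1 + d m) + s\<^sup>2 / 4 * sqrt (d m))"
   proof eventually_elim
    case (elim m)
    let ?a2 = "avg (\<lambda>t. (y m t)\<^sup>2) (N m)" and ?a4 = "avg (\<lambda>t. y m t ^ 4) (N m)" and ?r = "sqrt (d m)"
    have gm: "N m \<ge> 1" "k m \<ge> 1" "avg (y m) (N m) = 0" "\<bar>?a2 - 1\<bar> \<le> d m" "?a4 \<le> d m * real (k m)"
     using g[of m] by (auto simp: d_def)
    \<comment> \<open>The choice \<open>\<eta> = sqrt (d m)\<close> makes the second and the fourth
      moment term both of order \<open>sqrt (d m)\<close>.\<close>
    have r: "?r > 0" "d m / ?r = ?r" using d(2)[of m] by (simp_all add: real_div_sqrt)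
    have a4: "?a4 / k m \<le> d m" using gm by (simp add: divide_le_eq)
    have "s\<^sup>2 / (4 * ?r) * (?a4 / k m) \<le> s\<^sup>2 / (4 * ?r) * d m" using a4 r(1) by (intro mult_left_mono) auto
    also have "\<dots> = s\<^sup>2 / 4 * (d m / ?r)" by simp
    also have "\<dots> = s\<^sup>2 / 4 * ?r" by (simp only: r(2))
    finally have 1: "s\<^sup>2 / (4 * ?r) * (?a4 / k m) \<le> s\<^sup>2 / 4 * ?r" .
    have 2: "?r * ?a2 \<le> ?r * (1 + d m)" using gm(4) r(1) by (intro mult_left_mono) auto
    show ?case unfolding \<mu>_def
     by (rule order_trans[OF drawsum_char[OF gm(1,3,2) elim r(1)]])
      (intro add_mono mult_left_mono 1 2 gm(4), auto)
   qed
  qed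
  from tendsto_add[OF this exp] show ?thesis by (simp add: char_std_normal_distribution)
 qed
 then have "weak_conv_m \<mu> std_normal_distribution"
  by (intro levy_continuity rd real_dist_normal_dist)
 then have "(\<lambda>m. cdf (\<mu> m) z) \<longlonglongrightarrow> Phi z" for z
  using Phi_cont unfolding weak_conv_m_def weak_conv_def by blast
 from weak_conv_normal_uniform[OF rd this e]
 obtain m where "\<bar>cdf (\<mu> m) (x m) - Phi (x m)\<bar> \<le> e" unfolding eventually_sequentially by blast
 then show False using bad[of m] by (simp add: cdf)
qed

lemma drawsum_clt_scaled:
 assumes e: "e > 0" and v: "v > 0"
 obtains \<delta> :: real where "\<delta> > 0" "\<And>N k y x. N \<ge> 1 ==> k \<ge> 1 ==> avg y N = 0 ==>
   \<bar>avg (\<lambda>t. (y t)\<^sup>2) N - v\<bar> \<le> \<delta> ==> avg (\<lambda>t. y t ^ 4) N \<le> \<delta> * real k ==> 1 / real k \<le> \<delta> ==>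
   \<bar>measure_pmf.prob (draws k N) {i. drawsum y k i \<le> x} - Phi (x / sqrt v)\<bar> \<le> e"
proof (rule drawsum_clt[OF e])
 fix \<delta> :: real assume \<delta>: "\<delta> > 0" "\<And>N k y x. N \<ge> 1 ==> k \<ge> 1 ==> avg y N = 0 ==>
   \<bar>avg (\<lambda>t. (y t)\<^sup>2) N - 1\<bar> \<le> \<delta> ==> avg (\<lambda>t. y t ^ 4) N \<le> \<delta> * real k ==> 1 / real k \<le> \<delta> ==>
   \<bar>measure_pmf.prob (draws k N) {i. drawsum y k i \<le> x} - Phi x\<bar> \<le> e"
 define \<delta>' where "\<delta>' = Min {\<delta>, \<delta> * v, \<delta> * v\<^sup>2}"
 have \<delta>': "\<delta>' > 0" "\<delta>' \<le> \<delta>" "\<delta>' \<le> \<delta> * v" "\<delta>' \<le> \<delta> * v\<^sup>2" using \<delta>(1) v by (auto simp: \<delta>'_def)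
 show thesis
 proof (rule that[OF \<delta>'(1)])
  fix N k :: nat and y :: "nat => real" and x
  assume a: "N \<ge> 1" "k \<ge> 1" "avg y N = 0" "\<bar>avg (\<lambda>t. (y t)\<^sup>2) N - v\<bar> \<le> \<delta>'" "avg (\<lambda>t. y t ^ 4) N \<le> \<delta>' * real k" "1 / real k \<le> \<delta>'"
  let ?z = "\<lambda>t. y t / sqrt v"
  have z: "avg ?z N = avg y N / sqrt v" "avg (\<lambda>t. (?z t)\<^sup>2) N = avg (\<lambda>t. (y t)\<^sup>2) N / v"
   "avg (\<lambda>t. ?z t ^ 4) N = avg (\<lambda>t. y t ^ 4) N / v\<^sup>2"
  proof -
   have "sqrt v ^ 4 = v\<^sup>2" using v by (simp add: power4_eq_xxxx power2_eq_square)
   then show "avg ?z N = avg y N / sqrt v" "avg (\<lambda>t. (?z t)\<^sup>2) N = avg (\<lambda>t. (y t)\<^sup>2) N / v"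
    "avg (\<lambda>t. ?z t ^ 4) N = avg (\<lambda>t. y t ^ 4) N / v\<^sup>2"
    using v by (simp_all add: avg_def power_divide sum_divide_distrib[symmetric])
  qed
  have "\<bar>measure_pmf.prob (draws k N) {i. drawsum ?z k i \<le> x / sqrt v} - Phi (x / sqrt v)\<bar> \<le> e"
  proof (rule \<delta>(2)[OF a(1,2)])
   have "avg (\<lambda>t. (?z t)\<^sup>2) N - 1 = (avg (\<lambda>t. (y t)\<^sup>2) N - v) / v" using v by (simp add: z diff_divide_distrib)
   then show "\<bar>avg (\<lambda>t. (?z t)\<^sup>2) N - 1\<bar> \<le> \<delta>" using a(4) \<delta>'(3) v by (simp add: divide_le_eq)
   have "\<delta>' * real k \<le> \<delta> * v\<^sup>2 * real k" using \<delta>'(4) by (intro mult_right_mono) auto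
   then show "avg (\<lambda>t. ?z t ^ 4) N \<le> \<delta> * real k" unfolding z using a(5) v by (simp add: divide_le_eq mult_ac)
  qed (use z(1) a \<delta>' in auto)
  moreover have "drawsum ?z k i \<le> x / sqrt v \<longleftrightarrow> drawsum y k i \<le> x" for i
  proof -
   have "drawsum ?z k i = drawsum y k i / sqrt v" by (simp add: drawsum_def sum_divide_distrib[symmetric] mult.commute)
   then show ?thesis using v by (simp add: divide_le_cancel)
  qed
  ultimately show "\<bar>measure_pmf.prob (draws k N) {i. drawsum y k i \<le> x} - Phi (x / sqrt v)\<bar> \<le> e" by simp
 qed
qed

text \<open>Since \<open>U\<close> and \<open>Z\<close> differ by more than \<open>\<eta>\<close>
  only with probability \<open>e'\<close>, the events are comparable after shifting \<open>x\<close>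
  by \<open>\<eta>\<close>, and the Lipschitz bound for \<open>Phi\<close> absorbs the
  shift.\<close>

lemma prob_perturbation:
 fixes P :: "'i pmf" and U Z :: "'i => real"
 assumes Z: "\<And>x. \<bar>measure_pmf.prob P {i. Z i \<le> x} - Phi (x / s)\<bar> \<le> e" and s: "s > 0" and \<eta>: "\<eta> \<ge> 0"
  and p: "measure_pmf.prob P {i. \<bar>U i - Z i\<bar> > \<eta>} \<le> e'"
 shows "\<bar>measure_pmf.prob P {i. U i \<le> x} - Phi (x / s)\<bar> \<le> e + e' + \<eta> / s"
proof -
 let ?p = "measure_pmf.prob P"
 have le: "?p A \<le> ?p B + e'" if "A \<subseteq> B \<union> {i. \<bar>U i - Z i\<bar> > \<eta>}" for A B
 proof -
  have "?p A \<le> ?p (B \<union> {i. \<bar>U i - Z i\<bar> > \<eta>})" using that by (intro measure_pmf.finite_measure_mono) auto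
  also have "\<dots> \<le> ?p B + ?p {i. \<bar>U i - Z i\<bar> > \<eta>}" by (intro measure_Un_le) auto
  finally show ?thesis using p by simp
 qed
 have lip: "Phi ((x + \<eta>) / s) - Phi (x / s) \<le> \<eta> / s" "Phi (x / s) - Phi ((x - \<eta>) / s) \<le> \<eta> / s"
  using Phi_lipschitz[of "x / s" "(x + \<eta>) / s"] Phi_lipschitz[of "(x - \<eta>) / s" "x / s"] s \<eta>
  by (simp_all add: divide_right_mono diff_divide_distrib add_divide_distrib)
 have "?p {i. U i \<le> x} \<le> ?p {i. Z i \<le> x + \<eta>} + e'" by (rule le) auto
 moreover have "?p {i. Z i \<le> x - \<eta>} \<le> ?p {i. U i \<le> x} + e'" by (rule le) auto
 ultimately show ?thesis using lip Z[of "x + \<eta>"] Z[of "x - \<eta>"] unfolding abs_le_iff by linarith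
qed

section \<open>Bootstrap statistics as normalised sums of draws\<close>

lemma periodogram_eq:
 "periodogram y b l = ((\<Sum>t=1..b. y t * cos (l * of_nat t))\<^sup>2 + (\<Sum>t=1..b. y t * sin (l * of_nat t))\<^sup>2) / (2 * pi * b)"
proof -
 have e: "exp (- \<i> * of_real l * of_nat t) = cis (- (l * real t))" for t :: nat by (simp add: cis_conv_exp mult_ac)
 show ?thesis unfolding periodogram_def e cmod_power2 by (simp add: sum_negf)
qed

text \<open>The integrated periodogram is a finite quadratic form in the data, from which its
  measurability in the outcome follows.\<close>

lemma spec_mean_periodogram:
 assumes g: "bvdom \<psi> g"
 shows "spec_mean g (periodogram y n) =
  (\<Sum>s=1..n. \<Sum>t=1..n. y s * y t * (LBINT l:{-pi..pi}. g l * cos (l * of_int (int s - int t)))) / (2 * pi * n)"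
proof -
 let ?c = "\<lambda>s t l. g l * cos (l * of_int (int s - int t))"
 have i: "integrable lborel (\<lambda>l. indicator {-pi..pi} l *\<^sub>R ?c s t l)" for s t
  using bvdom_set_integrable[OF bvdom_mult[OF g bvdom_cos[of \<psi> "int s - int t" 0]]]
  by (simp add: set_integrable_def)
 have "g l * periodogram y n l = (\<Sum>s=1..n. \<Sum>t=1..n. y s * y t / (2 * pi * n) * ?c s t l)" for l
 proof -
  have "periodogram y n l = (\<Sum>s=1..n. \<Sum>t=1..n. y s * y t * cos (l * real s - l * real t)) / (2 * pi * n)"
   unfolding periodogram_eq power2_eq_square sum_product sum.distrib[symmetric] by (simp add: cos_diff algebra_simps)
  then show ?thesis by (simp add: sum_distrib_left sum_divide_distrib right_diff_distrib mult_ac)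
 qed
 then have "spec_mean g (periodogram y n) = (\<integral>l. (\<Sum>s=1..n. \<Sum>t=1..n. y s * y t / (2 * pi * n) * (indicator {-pi..pi} l *\<^sub>R ?c s t l)) \<partial>lborel)"
  unfolding spec_mean_def set_lebesgue_integral_def
  by (intro Bochner_Integration.integral_cong refl) (simp add: sum_distrib_left mult_ac)
 also have "\<dots> = (\<Sum>s=1..n. \<Sum>t=1..n. y s * y t / (2 * pi * n) * (LBINT l:{-pi..pi}. ?c s t l))"
  using i by (simp add: set_lebesgue_integral_def)
 finally show ?thesis by (simp add: sum_divide_distrib)
qed

text \<open>The contribution of block \<open>t\<close> to the bootstrap statistic, centred so that
  the average over all blocks is zero. The weight \<open>\<theta>\<close> is kept free because the
  ratio statistic leads to a weight that depends on the data.\<close>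

definition block_term :: "(real => real) => (nat => real) => (real => real) => nat => nat => nat => real" where
 "block_term \<theta> x g n b t = 2 * pi / sqrt b * (\<Sum>j\<in>FI b. \<theta> (ff j b) *
   (g (ff j b) / avg_periodogram x n b (ff j b)) *
   (sub_periodogram x b t (ff j b) - avg_periodogram x n b (ff j b)))"

lemma L_boot_drawsum:
 assumes b: "b \<ge> 1" and k: "k \<ge> 1" and n: "n = b * k"
  and nz: "\<And>j. j \<in> FI b ==> avg_periodogram x n b (ff j b) \<noteq> 0"
 shows "L_boot \<theta> x g n b k i = drawsum (block_term \<theta> x g n b) k i"
proof -
 let ?G = "FI b"
 let ?f = "\<lambda>j. avg_periodogram x n b (ff j b)" and ?I = "\<lambda>l j. sub_periodogram x b (i l) (ff j b)"
 let ?t = "\<lambda>j. \<theta> (ff j b)" and ?g = "\<lambda>j. g (ff j b)"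
 have "?t j * (boot_periodogram x g n b k i j - ?g j) = (\<Sum>l=1..k. ?t j * (?g j / ?f j) * (?I l j - ?f j)) / k" if "j \<in> ?G" for j
 proof -
  have "boot_periodogram x g n b k i j - ?g j = ((\<Sum>l=1..k. ?g j * (?I l j / ?f j)) - (\<Sum>l=1..k. ?g j)) / k"
   using k by (simp add: boot_periodogram_def rescaled_sub_periodogram_def diff_divide_distrib)
  also have "\<dots> = (\<Sum>l=1..k. ?g j / ?f j * (?I l j - ?f j)) / k"
   unfolding sum_subtractf[symmetric] using nz[OF that] by (simp add: right_diff_distrib)
  finally show ?thesis by (simp add: sum_distrib_left mult.assoc)
 qed
 then have "L_boot \<theta> x g n b k i = sqrt n * (2 * pi / b) * (\<Sum>j\<in>?G. (\<Sum>l=1..k. ?t j * (?g j / ?f j) * (?I l j - ?f j)) / k)"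
  unfolding L_boot_def by simp
 also have "\<dots> = sqrt n * (2 * pi / b) / k * (\<Sum>l=1..k. \<Sum>j\<in>?G. ?t j * (?g j / ?f j) * (?I l j - ?f j))"
  unfolding sum_divide_distrib[symmetric] by (subst sum.swap) simp
 \<comment> \<open>With \<open>n = b * k\<close> the normalisation splits into a factor for the
   block and \<open>1 / sqrt k\<close> for the draws.\<close>
 also have "sqrt n * (2 * pi / b) / k = 2 * pi / sqrt b / sqrt k"
 proof -
  have "sqrt b * sqrt k * (2 * pi / (sqrt b * sqrt b)) / (sqrt k * sqrt k) = 2 * pi / sqrt b / sqrt k"
   using b k by (simp del: real_sqrt_mult_self)
  then show ?thesis by (simp add: n real_sqrt_mult)
 qed
 finally show ?thesis unfolding drawsum_def block_term_def sum_distrib_left[symmetric] by simp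
qed

lemma avg_block_term: "num_blocks n b = N ==> N \<ge> 1 ==> avg (block_term \<theta> x g n b) N = 0"
proof -
 assume N: "num_blocks n b = N" "N \<ge> 1"
 let ?f = "\<lambda>j. avg_periodogram x n b (ff j b)" and ?I = "\<lambda>t j. sub_periodogram x b t (ff j b)"
 have z: "(\<Sum>t=1..N. ?I t j - ?f j) = 0" for j
  using N by (simp add: sum_subtractf avg_periodogram_def)
 have "(\<Sum>t=1..N. block_term \<theta> x g n b t) = 2 * pi / sqrt b * (\<Sum>j\<in>FI b. \<theta> (ff j b) * (g (ff j b) / ?f j) * (\<Sum>t=1..N. ?I t j - ?f j))"
  unfolding block_term_def sum_distrib_left by (rule sum.swap)
 then show ?thesis unfolding z by (simp add: avg_def)
qed

text \<open>The difference of the two ratios is \<open>(P * D - A * q) / (D * q)\<close>, and its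
  numerator is a linear statistic with weight \<open>\<phi> * D - A\<close>, because the terms in
  \<open>g\<close> alone cancel.\<close>

lemma LR_boot_eq:
 fixes \<phi> x g n b k i
 defines "A \<equiv> 2 * pi / b * (\<Sum>j\<in>FI b. \<phi> (ff j b) * g (ff j b))"
  and "D \<equiv> 2 * pi / b * (\<Sum>j\<in>FI b. g (ff j b))"
 assumes n: "n \<ge> 1" and b: "b \<ge> 1" and D: "D \<noteq> 0" and Q: "D + L_boot (\<lambda>_. 1) x g n b k i / sqrt n \<noteq> 0"
 shows "LR_boot \<phi> x g n b k i =
  L_boot (\<lambda>l. \<phi> l * D - A) x g n b k i / (D * (D + L_boot (\<lambda>_. 1) x g n b k i / sqrt n))"
proof -
 let ?G = "FI b" and ?S = "2 * pi / real b"
 let ?I = "boot_periodogram x g n b k i" and ?g = "\<lambda>j. g (ff j b)" and ?p = "\<lambda>j. \<phi> (ff j b)"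
 define P q where "P = ?S * (\<Sum>j\<in>?G. ?p j * ?I j)" and "q = ?S * (\<Sum>j\<in>?G. ?I j)"
 have S: "?S \<noteq> 0" "sqrt n \<noteq> 0" using b n by auto
 have q: "q = D + L_boot (\<lambda>_. 1) x g n b k i / sqrt n"
 proof -
  have "L_boot (\<lambda>_. 1) x g n b k i = sqrt n * (q - D)"
   by (simp add: L_boot_def q_def D_def sum_subtractf right_diff_distrib mult.assoc)
  then show ?thesis using S(2) by simp
 qed
 have "LR_boot \<phi> x g n b k i = sqrt n * (P / q - A / D)"
  unfolding LR_boot_def P_def q_def A_def D_def using S by simp
 also have "\<dots> = sqrt n * (P * D - A * q) / (D * q)" using D Q unfolding q[symmetric] by (simp add: field_simps)
 also have "sqrt n * (P * D - A * q) = L_boot (\<lambda>l. \<phi> l * D - A) x g n b k i"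
 proof -
  have "(\<Sum>j\<in>?G. (?p j * D - A) * (?I j - ?g j)) =
    D * (\<Sum>j\<in>?G. ?p j * ?I j) - A * (\<Sum>j\<in>?G. ?I j) - (D * (\<Sum>j\<in>?G. ?p j * ?g j) - A * (\<Sum>j\<in>?G. ?g j))"
   unfolding sum_distrib_left sum_subtractf[symmetric] by (intro sum.cong refl) (simp add: algebra_simps)
  then have "?S * (\<Sum>j\<in>?G. (?p j * D - A) * (?I j - ?g j)) =
    ?S * (D * (\<Sum>j\<in>?G. ?p j * ?I j) - A * (\<Sum>j\<in>?G. ?I j) - (D * (\<Sum>j\<in>?G. ?p j * ?g j) - A * (\<Sum>j\<in>?G. ?g j)))"
   by (rule arg_cong)
  also have "\<dots> = D * P - A * q - (D * A - A * D)"
   unfolding P_def q_def right_diff_distrib mult.left_commute[of ?S] A_def[symmetric] D_def[symmetric] ..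
  finally have "?S * (\<Sum>j\<in>?G. (?p j * D - A) * (?I j - ?g j)) = P * D - A * q" by (simp add: mult_ac)
  then show ?thesis by (simp only: L_boot_def mult.assoc[of "sqrt n"])
 qed
 finally show ?thesis by (simp add: q)
qed

lemma pow4_sum_le: "(\<Sum>a\<in>A. z a) ^ 4 \<le> real (card A) ^ 3 * (\<Sum>a\<in>A. (z a :: real) ^ 4)"
proof -
 have "(\<Sum>a\<in>A. z a) ^ 4 = ((\<Sum>a\<in>A. z a)\<^sup>2)\<^sup>2" by simp
 also have "\<dots> \<le> ((\<Sum>a\<in>A. (z a)\<^sup>2) * card A)\<^sup>2"
  using sum_squared_le_sum_of_squares[where f = z and I = A] by (intro power_mono) auto
 also have "\<dots> = (\<Sum>a\<in>A. (z a)\<^sup>2)\<^sup>2 * (card A)\<^sup>2" by (simp add: power_mult_distrib)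
 also have "\<dots> \<le> ((\<Sum>a\<in>A. ((z a)\<^sup>2)\<^sup>2) * card A) * (card A)\<^sup>2"
  using sum_squared_le_sum_of_squares[where f = "\<lambda>a. (z a)\<^sup>2" and I = A] by (intro mult_right_mono) auto
 finally show ?thesis by (simp add: power2_eq_square[of "real (card A)"] power3_eq_cube mult_ac)
qed

lemma avg_centred_pow4: "N \<ge> 1 ==> avg (\<lambda>t. (z t - avg z N) ^ 4) N \<le> 16 * avg (\<lambda>t. z t ^ 4) N"
proof -
 assume N: "N \<ge> 1"
 have p: "(a - c) ^ 4 \<le> 8 * (a ^ 4 + c ^ 4)" for a c :: real
 proof -
  have "(\<Sum>i\<in>{..<2::nat}. if i = 0 then a else - c) ^ 4 \<le> real (card {..<2::nat}) ^ 3 * (\<Sum>i\<in>{..<2::nat}. (if i = 0 then a else - c) ^ 4)"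
   by (rule pow4_sum_le)
  moreover have "(- c) ^ 4 = c ^ 4" by simp
  ultimately show ?thesis by (simp add: numeral_2_eq_2)
 qed
 have "(avg z N) ^ 4 \<le> (real N ^ 3 * (\<Sum>t=1..N. z t ^ 4)) / real N ^ 4"
  unfolding avg_def power_divide using pow4_sum_le[of z "{1..N}"] by (intro divide_right_mono) auto
 also have "\<dots> = avg (\<lambda>t. z t ^ 4) N" using N by (simp add: avg_def eval_nat_numeral)
 finally have m: "(avg z N) ^ 4 \<le> avg (\<lambda>t. z t ^ 4) N" .
 have lin: "avg (\<lambda>t. 8 * (z t ^ 4 + c)) N = 8 * avg (\<lambda>t. z t ^ 4) N + 8 * c" for c
  using N by (simp add: avg_def sum.distrib sum_distrib_left[symmetric] add_divide_distrib)
 have "avg (\<lambda>t. (z t - avg z N) ^ 4) N \<le> avg (\<lambda>t. 8 * (z t ^ 4 + (avg z N) ^ 4)) N"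
  unfolding avg_def[of _ N] by (intro divide_right_mono sum_mono p[of _ "avg z N", unfolded avg_def]) simp
 also have "\<dots> = 8 * avg (\<lambda>t. z t ^ 4) N + 8 * (avg z N) ^ 4"
  by (rule lin)
 finally show ?thesis using m by simp
qed

text \<open>Meant for the expected covariance \<open>V\<close>, its fluctuation \<open>W\<close> and
  the error \<open>e\<close> of the estimated means, with estimated weights \<open>a\<close> and
  limiting weights \<open>p\<close>.\<close>

lemma quadratic_form_perturbation:
 fixes a p e :: "'j => real" and V W :: "'j => 'j => real"
 assumes aa: "\<And>j k. j \<in> J ==> k \<in> J ==> \<bar>a j * a k\<bar> \<le> \<beta>"
  and ad: "\<And>j k. j \<in> J ==> k \<in> J ==> \<bar>a j * a k - p j * p k\<bar> \<le> \<alpha>" and \<beta>: "\<beta> \<ge> 0"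
 shows "\<bar>(\<Sum>j\<in>J. \<Sum>k\<in>J. a j * a k * (V j k + W j k - e j * e k)) - (\<Sum>j\<in>J. \<Sum>k\<in>J. p j * p k * V j k)\<bar> \<le>
  \<alpha> * (\<Sum>j\<in>J. \<Sum>k\<in>J. \<bar>V j k\<bar>) + \<beta> * ((\<Sum>j\<in>J. \<Sum>k\<in>J. \<bar>W j k\<bar>) + card J * (\<Sum>j\<in>J. (e j)\<^sup>2))"
proof -
 let ?Z = "\<Sum>j\<in>J. \<Sum>k\<in>J. \<alpha> * \<bar>V j k\<bar> + \<beta> * (\<bar>W j k\<bar> + \<bar>e j\<bar> * \<bar>e k\<bar>)"
 have eq: "(\<Sum>j\<in>J. \<Sum>k\<in>J. a j * a k * (V j k + W j k - e j * e k)) - (\<Sum>j\<in>J. \<Sum>k\<in>J. p j * p k * V j k) =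
   (\<Sum>j\<in>J. \<Sum>k\<in>J. (a j * a k - p j * p k) * V j k + a j * a k * (W j k - e j * e k))"
  unfolding sum_subtractf[symmetric] by (intro sum.cong refl) (simp add: algebra_simps)
 have le: "\<bar>\<Sum>j\<in>J. \<Sum>k\<in>J. (a j * a k - p j * p k) * V j k + a j * a k * (W j k - e j * e k)\<bar> \<le> ?Z"
 proof (intro order_trans[OF sum_abs] sum_mono)
  fix j k assume jk: "j \<in> J" "k \<in> J"
  have "\<bar>W j k - e j * e k\<bar> \<le> \<bar>W j k\<bar> + \<bar>e j\<bar> * \<bar>e k\<bar>"
   unfolding abs_mult[symmetric] by (rule abs_triangle_ineq4)
  then have 2: "\<bar>a j * a k * (W j k - e j * e k)\<bar> \<le> \<beta> * (\<bar>W j k\<bar> + \<bar>e j\<bar> * \<bar>e k\<bar>)"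
   unfolding abs_mult[of "a j * a k"] using aa[OF jk] \<beta> by (intro mult_mono) auto
  have 1: "\<bar>(a j * a k - p j * p k) * V j k\<bar> \<le> \<alpha> * \<bar>V j k\<bar>"
   unfolding abs_mult[of _ "V _ _"] by (rule mult_right_mono[OF ad[OF jk] abs_ge_zero])
  show "\<bar>(a j * a k - p j * p k) * V j k + a j * a k * (W j k - e j * e k)\<bar> \<le> \<alpha> * \<bar>V j k\<bar> + \<beta> * (\<bar>W j k\<bar> + \<bar>e j\<bar> * \<bar>e k\<bar>)"
   by (rule order_trans[OF abs_triangle_ineq add_mono[OF 1 2]])
 qed
 have "(\<Sum>j\<in>J. \<bar>e j\<bar>) * (\<Sum>j\<in>J. \<bar>e j\<bar>) \<le> card J * (\<Sum>j\<in>J. (e j)\<^sup>2)"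
  using sum_squared_le_sum_of_squares[where f = "\<lambda>j. \<bar>e j\<bar>" and I = J]
  by (simp add: power2_eq_square[of "sum _ _"] mult.commute)
 from mult_left_mono[OF add_left_mono[OF this] \<beta>]
 have "?Z \<le> \<alpha> * (\<Sum>j\<in>J. \<Sum>k\<in>J. \<bar>V j k\<bar>) + \<beta> * ((\<Sum>j\<in>J. \<Sum>k\<in>J. \<bar>W j k\<bar>) + card J * (\<Sum>j\<in>J. (e j)\<^sup>2))"
  by (simp add: sum.distrib sum_distrib_left[symmetric] sum_distrib_right[symmetric])
 with le show ?thesis unfolding eq by (rule order_trans)
qed

section \<open>Data for which the bootstrap behaves well\<close>

locale block_bootstrap = spec_process M X for M :: "'a measure" and X +
 fixes n B K :: "nat => nat" and g :: "nat => 'a => real => real"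
 assumes sd_Inf: "(INF l\<in>{0..pi}. spectral_density M X l) > 0"
  and n_eq: "\<And>m. n m = B m * K m"
  and B_top: "filterlim B at_top sequentially" and K_top: "filterlim K at_top sequentially"
  and B3: "(\<lambda>m. real (B m) ^ 3 / real (n m)) \<longlonglongrightarrow> 0"
  and g_conv: "oP1 M (\<lambda>m om. SUP l\<in>{-pi..pi}. ereal \<bar>g m om l - spectral_density M X l\<bar>)"
begin

abbreviation G :: "nat => int set" where "G m \<equiv> FI (B m)"
abbreviation fr :: "nat => int => real" where "fr m j \<equiv> ff j (B m)"
abbreviation N :: "nat => nat" where "N m \<equiv> num_blocks (n m) (B m)"
abbreviation ft :: "nat => 'a => int => real" where
 "ft m om j \<equiv> avg_periodogram (sample X (n m) om) (n m) (B m) (fr m j)"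
abbreviation er :: "nat => 'a => int => real" where "er m om j \<equiv> (\<Sum>t=1..N m. I0 j (B m) t om) / N m"
abbreviation yb :: "(real => real) => nat => 'a => nat => real" where
 "yb \<theta> m om \<equiv> block_term \<theta> (sample X (n m) om) (g m om) (n m) (B m)"

lemma sd_lower: "\<exists>c>0. \<forall>l\<in>{-pi..pi}. c \<le> sd l"
proof (intro exI conjI ballI, rule sd_Inf)
 fix l assume l: "l \<in> {-pi..pi}"
 have "(INF l\<in>{0..pi}. sd l) \<le> sd \<bar>l\<bar>"
 proof (rule cINF_lower)
  show "bdd_below (sd ` {0..pi})" using sd_bound by (intro bdd_belowI2[of _ "- acv0"]) (simp add: abs_le_iff minus_le_iff)
 qed (use l in auto)
 then show "(INF l\<in>{0..pi}. sd l) \<le> sd l" by (simp add: abs_if sd_even split: if_splits)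
qed

lemma regular: "\<forall>\<^sub>F m in sequentially. B m \<ge> 1 \<and> K m \<ge> 1 \<and> B m \<le> N m \<and> B m \<le> n m \<and> real (n m) \<le> 2 * real (N m)"
 using B_top[unfolded filterlim_at_top, rule_format, of 1] K_top[unfolded filterlim_at_top, rule_format, of 2]
proof eventually_elim
 case (elim m)
 have "B m * 2 \<le> n m" unfolding n_eq using elim by (intro mult_left_mono) auto
 then show ?case using elim by (auto simp: num_blocks_def)
qed

lemma regular_ratio: "\<forall>\<^sub>F m in sequentially. real (B m) ^ 3 / N m \<le> 2 * (real (B m) ^ 3 / n m)"
 using regular
proof eventually_elim
 case (elim m)
 then have nN: "real (n m) > 0" "real (N m) > 0" "real (n m) \<le> 2 * real (N m)" by (auto simp: num_blocks_def)
 have "real (B m) ^ 3 * real (n m) \<le> real (B m) ^ 3 * (2 * real (N m))" using nN(3) by (intro mult_left_mono) auto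
 then show ?case using nN by (simp add: field_simps)
qed

lemma sub_periodogram_per:
 assumes b: "b \<ge> 1" "b \<le> r" and t: "t \<in> {1..num_blocks r b}"
 shows "sub_periodogram (sample X r om) b t (ff j b) = per j b t om"
proof -
 have s: "sample X r om (t + u - 1) = X (int t + int u - 1) om" if "u \<in> {1..b}" for u
 proof -
  have "t + u - 1 \<in> {1..r}" "t + u \<ge> 1" using that t b by (auto simp: num_blocks_def)
  then show ?thesis by (simp add: sample_def of_nat_diff)
 qed
 have "lin (fw a j b) b t om = (1 / sqrt b) * (\<Sum>u=1..b. sample X r om (t + u - 1) * fw a j b u)" for a
  unfolding lin_def using s by (simp add: mult.commute)
 then show ?thesis
  using b by (simp add: sub_periodogram_def periodogram_eq per_def fw_def fwi_def ph_def cos_diff power_mult_distrib power_divide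
   add_divide_distrib mult_ac)
qed

lemma ft_eq:
 assumes "B m \<ge> 1" "B m \<le> n m"
 shows "ft m om j = avg (\<lambda>t. per j (B m) t om) (N m)" "ft m om j - permean j (B m) = er m om j"
proof -
 show f: "ft m om j = avg (\<lambda>t. per j (B m) t om) (N m)"
  unfolding avg_periodogram_def avg_def using sub_periodogram_per[OF assms] by simp
 have "N m \<ge> 1" by (simp add: num_blocks_def)
 then show "ft m om j - permean j (B m) = er m om j"
  unfolding f avg_def I0_def by (simp add: sum_subtractf diff_divide_distrib)
qed

text \<open>All that is asked of the data. The rescaling is defined and the plug-in estimate agrees
  with both the averaged periodogram and the spectral density; the averaged periodograms are
  accurate in sum of squares; so are the block covariances in mean modulus; and a fourth-order
  Lyapunov condition holds for the draws.\<close>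

definition good :: "real => nat => 'a => bool" where
 "good \<delta> m om \<longleftrightarrow>
   (\<forall>j\<in>G m. ft m om j > 0 \<and> \<bar>g m om (fr m j) / ft m om j - 1\<bar> \<le> \<delta> \<and> \<bar>g m om (fr m j) - sd (fr m j)\<bar> \<le> \<delta>) \<and>
   (\<Sum>j\<in>G m. (er m om j)\<^sup>2) \<le> \<delta> \<and>
   (\<Sum>j\<in>G m. \<Sum>k\<in>G m. \<bar>Vhat j k (B m) (N m) om\<bar>) / B m \<le> \<delta> \<and>
   real (B m) / K m * (\<Sum>j\<in>G m. avg (\<lambda>t. per j (B m) t om ^ 4) (N m)) \<le> \<delta>"

lemma good_mono: "good \<delta> m om ==> \<delta> \<le> \<delta>' ==> good \<delta>' m om"
 unfolding good_def by (meson order_trans)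

text \<open>The moment bound is available only where the block lengths are regular, which is so
  eventually. Elsewhere the function is replaced by 0, without effect on the limit.\<close>

lemma vanishing_regular:
 fixes f :: "nat => 'a => real"
 assumes f: "\<And>m. B m \<ge> 1 ==> B m \<le> N m ==> integrable M (f m) \<and> \<E> (f m) \<le> r m"
  and pos: "\<And>m om. f m om \<ge> 0" and r: "r \<longlonglongrightarrow> 0" and d: "\<delta> > 0"
 shows "vanishing M (\<lambda>m. {om \<in> space M. f m om > \<delta>})"
proof -
 define h where "h m om = (if B m \<ge> 1 \<and> B m \<le> N m then f m om else 0)" for m om
 have "vanishing M (\<lambda>m. {om \<in> space M. h m om > \<delta>})"
 proof (rule vanishing_Markov[OF _ _ _ r d])
  show "integrable M (h m)" "h m om \<ge> 0" for m om using f[of m] pos by (cases "B m \<ge> 1 \<and> B m \<le> N m"; auto simp: h_def[abs_def])+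
  show "\<forall>\<^sub>F m in sequentially. \<E> (h m) \<le> r m"
   using regular by eventually_elim (use f in \<open>simp add: h_def[abs_def]\<close>)
 qed
 then show ?thesis
  by (rule vanishing_subset) (use regular in \<open>eventually_elim, auto simp: h_def\<close>)
qed

lemma er_vanishing: "\<delta> > 0 ==> vanishing M (\<lambda>m. {om \<in> space M. (\<Sum>j\<in>G m. (er m om j)\<^sup>2) > \<delta>})"
proof (rule avg_I0_square)
 fix C assume d: "\<delta> > 0" and C: "C \<ge> 0" "\<And>(b::nat) (N::nat) j. 1 \<le> b ==> b \<le> N ==>
   integrable M (\<lambda>om. ((\<Sum>t=1..N. I0 j b t om) / N)\<^sup>2) \<and> \<E> (\<lambda>om. ((\<Sum>t=1..N. I0 j b t om) / N)\<^sup>2) \<le> C * (b / N)"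
 show ?thesis
 proof (rule vanishing_regular[OF _ _ _ d])
  show "integrable M (\<lambda>om. \<Sum>j\<in>G m. (er m om j)\<^sup>2) \<and> \<E> (\<lambda>om. \<Sum>j\<in>G m. (er m om j)\<^sup>2) \<le> C * (real (B m) ^ 3 / N m)"
   if b: "B m \<ge> 1" "B m \<le> N m" for m
  proof -
   have "\<E> (\<lambda>om. \<Sum>j\<in>G m. (er m om j)\<^sup>2) = (\<Sum>j\<in>G m. \<E> (\<lambda>om. (er m om j)\<^sup>2))"
    using C(2)[OF b] by (intro Bochner_Integration.integral_sum) auto
   also have "\<dots> \<le> (\<Sum>j\<in>G m. C * (B m / N m))" using C(2)[OF b] by (intro sum_mono) auto
   also have "\<dots> \<le> real (B m) * (C * (B m / N m))"
    using card_fourier_indices[of "B m"] C(1) by (simp add: mult_right_mono divide_right_mono)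
   also have "\<dots> = C * (real (B m) ^ 2 / N m)" by (simp add: power2_eq_square)
   also have "\<dots> \<le> C * (real (B m) ^ 3 / N m)"
    using b C(1) by (intro mult_left_mono divide_right_mono power_increasing) auto
   finally show ?thesis using C(2)[OF b] by auto
  qed
  have "(\<lambda>m. real (B m) ^ 3 / N m) \<longlonglongrightarrow> 0"
   by (rule Lim_null_comparison[OF _ tendsto_mult_right_zero[OF B3, of 2]]) (use regular_ratio in eventually_elim, simp)
  then show "(\<lambda>m. C * (real (B m) ^ 3 / N m)) \<longlonglongrightarrow> 0" by (rule tendsto_mult_right_zero)
 qed (auto intro: sum_nonneg)
qed

text \<open>In terms of \<open>x m = b^3 / N\<close> both parts of the concentration bound are at
  most \<open>sqrt (x m + sqrt (x m))\<close>. The factor \<open>b\<close> in front of the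
  off-diagonal root produces the cube.\<close>

lemma Vhat_vanishing: "\<delta> > 0 ==> vanishing M (\<lambda>m. {om \<in> space M. (\<Sum>j\<in>G m. \<Sum>k\<in>G m. \<bar>Vhat j k (B m) (N m) om\<bar>) / B m > \<delta>})"
proof (rule Vhat_concentration)
 fix C assume d: "\<delta> > 0" and C: "C \<ge> 0" "\<And>(b::nat) (N::nat). 1 \<le> b ==> b \<le> N ==>
   integrable M (\<lambda>om. \<Sum>j\<in>FI b. \<Sum>k\<in>FI b. \<bar>Vhat j k b N om\<bar>) \<and>
   \<E> (\<lambda>om. \<Sum>j\<in>FI b. \<Sum>k\<in>FI b. \<bar>Vhat j k b N om\<bar>) / b \<le>
    C * (b * sqrt (b / N + sqrt (b / N) / b) + sqrt (b / N + sqrt (b / N)))"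
 define x where "x m = real (B m) ^ 3 / N m" for m
 have x: "x \<longlonglongrightarrow> 0" unfolding x_def
  by (rule Lim_null_comparison[OF _ tendsto_mult_right_zero[OF B3, of 2]]) (use regular_ratio in eventually_elim, simp)
 show ?thesis
 proof (rule vanishing_regular[OF _ _ _ d])
  show "integrable M (\<lambda>om. (\<Sum>j\<in>G m. \<Sum>k\<in>G m. \<bar>Vhat j k (B m) (N m) om\<bar>) / B m) \<and>
    \<E> (\<lambda>om. (\<Sum>j\<in>G m. \<Sum>k\<in>G m. \<bar>Vhat j k (B m) (N m) om\<bar>) / B m) \<le> C * (2 * sqrt (x m + sqrt (x m)))"
   if b: "B m \<ge> 1" "B m \<le> N m" for m
  proof -
   let ?b = "real (B m)"
   have le: "?b / N m \<le> x m" unfolding x_def using b power_increasing[of 1 3 ?b] by (intro divide_right_mono) auto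
   have x0: "x m \<ge> 0" by (simp add: x_def)
   have bs: "?b * sqrt (?b / N m) = sqrt (x m)"
   proof -
    have "?b * sqrt (?b / N m) = sqrt (?b\<^sup>2) * sqrt (?b / N m)" by simp
    also have "\<dots> = sqrt (x m)" unfolding real_sqrt_mult[symmetric] x_def by (simp add: power2_eq_square power3_eq_cube)
    finally show ?thesis .
   qed
   have "?b * sqrt (?b / N m + sqrt (?b / N m) / ?b) = sqrt (?b\<^sup>2 * (?b / N m + sqrt (?b / N m) / ?b))"
    by (simp add: real_sqrt_mult)
   also have "?b\<^sup>2 * (?b / N m + sqrt (?b / N m) / ?b) = x m + ?b * sqrt (?b / N m)"
    using b by (simp add: x_def distrib_left power2_eq_square power3_eq_cube)
   finally have 1: "?b * sqrt (?b / N m + sqrt (?b / N m) / ?b) = sqrt (x m + sqrt (x m))" unfolding bs .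
   have "sqrt (?b / N m + sqrt (?b / N m)) \<le> sqrt (x m + sqrt (x m))" using le by (intro real_sqrt_le_mono add_mono) auto
   then have "C * (?b * sqrt (?b / N m + sqrt (?b / N m) / ?b) + sqrt (?b / N m + sqrt (?b / N m))) \<le> C * (2 * sqrt (x m + sqrt (x m)))"
    unfolding 1 using C(1) by (intro mult_left_mono) auto
   then show ?thesis using C(2)[OF b] by auto
  qed
  have "(\<lambda>m. C * (2 * sqrt (x m + sqrt (x m)))) \<longlonglongrightarrow> C * (2 * sqrt (0 + sqrt 0))"
   by (intro tendsto_intros x tendsto_real_sqrt)
  then show "(\<lambda>m. C * (2 * sqrt (x m + sqrt (x m)))) \<longlonglongrightarrow> 0" by simp
 qed (auto intro!: divide_nonneg_nonneg sum_nonneg)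
qed

text \<open>At most \<open>b\<close> terms of bounded expectation with the weight
  \<open>b / k\<close> give order \<open>b^2 / k\<close>, which is \<open>b^3 / n\<close>.\<close>

lemma per4_vanishing: "\<delta> > 0 ==> vanishing M (\<lambda>m. {om \<in> space M. real (B m) / K m * (\<Sum>j\<in>G m. avg (\<lambda>t. per j (B m) t om ^ 4) (N m)) > \<delta>})"
proof (rule vanishing_regular)
 show "integrable M (\<lambda>om. real (B m) / K m * (\<Sum>j\<in>G m. avg (\<lambda>t. per j (B m) t om ^ 4) (N m))) \<and>
   \<E> (\<lambda>om. real (B m) / K m * (\<Sum>j\<in>G m. avg (\<lambda>t. per j (B m) t om ^ 4) (N m))) \<le> mom8 * (real (B m) ^ 3 / n m)"
  if b: "B m \<ge> 1" "B m \<le> N m" for m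
 proof -
  have a: "integrable M (\<lambda>om. avg (\<lambda>t. per j (B m) t om ^ 4) (N m)) \<and> \<E> (\<lambda>om. avg (\<lambda>t. per j (B m) t om ^ 4) (N m)) \<le> mom8" for j
  proof -
   have "\<E> (\<lambda>om. avg (\<lambda>t. per j (B m) t om ^ 4) (N m)) = (\<Sum>t=1..N m. \<E> (\<lambda>om. per j (B m) t om ^ 4)) / N m"
    unfolding avg_def using per_pow4(1)[OF b(1)] by simp
   also have "\<dots> \<le> (\<Sum>t=1..N m. mom8) / N m" by (intro divide_right_mono sum_mono per_pow4(2) b) simp
   also have "\<dots> \<le> mom8" using mom8_nonneg b by simp
   finally show ?thesis unfolding avg_def using per_pow4(1)[OF b(1)] by auto
  qed
  then have "\<E> (\<lambda>om. \<Sum>j\<in>G m. avg (\<lambda>t. per j (B m) t om ^ 4) (N m)) = (\<Sum>j\<in>G m. \<E> (\<lambda>om. avg (\<lambda>t. per j (B m) t om ^ 4) (N m)))"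
   by (intro Bochner_Integration.integral_sum) auto
  also have "\<dots> \<le> (\<Sum>j\<in>G m. mom8)" using a by (intro sum_mono) auto
  also have "\<dots> \<le> real (B m) * mom8" using card_fourier_indices[of "B m"] mom8_nonneg by (simp add: mult_right_mono)
  finally have "real (B m) / K m * \<E> (\<lambda>om. \<Sum>j\<in>G m. avg (\<lambda>t. per j (B m) t om ^ 4) (N m)) \<le> real (B m) / K m * (real (B m) * mom8)"
   by (intro mult_left_mono) auto
  also have "\<dots> = mom8 * (real (B m) ^ 3 / n m)" using b by (simp add: n_eq power3_eq_cube)
  finally show ?thesis using a by auto
 qed
 show "(\<lambda>m. mom8 * (real (B m) ^ 3 / n m)) \<longlonglongrightarrow> 0" by (rule tendsto_mult_right_zero[OF B3])
qed (unfold avg_def, intro mult_nonneg_nonneg divide_nonneg_nonneg sum_nonneg, auto)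

lemma not_good_vanishing:
 assumes d: "\<delta> > 0"
 shows "vanishing M (\<lambda>m. {om \<in> space M. \<not> good \<delta> m om})"
proof -
 obtain c where c: "c > 0" "\<And>l. l \<in> {-pi..pi} ==> c \<le> sd l" using sd_lower by blast
 \<comment> \<open>The averaged periodogram has error at most \<open>2 * d'\<close>, so
   \<open>c / 4\<close> keeps it above \<open>c / 2\<close>; \<open>c / 6 * \<delta>\<close> turns
   the deviation \<open>3 * d'\<close> from the estimate into a relative error
   \<open>\<delta>\<close>; and 1 yields \<open>d'^2 \<le> \<delta>\<close>.\<close>
 define d' where "d' = Min {\<delta>, 1, c / 4, c / 6 * \<delta>}"
 have d': "d' > 0" "d' \<le> \<delta>" "d' \<le> 1" "d' \<le> c / 4" "d' \<le> c / 6 * \<delta>" using c d by (auto simp: d'_def)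
 define A where "A = (\<lambda>m. {om \<in> space M. ereal d' < \<bar>SUP l\<in>{-pi..pi}. ereal \<bar>g m om l - sd l\<bar>\<bar>} \<union>
   ({om \<in> space M. (\<Sum>j\<in>G m. (er m om j)\<^sup>2) > d'\<^sup>2} \<union>
   ({om \<in> space M. (\<Sum>j\<in>G m. \<Sum>k\<in>G m. \<bar>Vhat j k (B m) (N m) om\<bar>) / B m > \<delta>} \<union>
   {om \<in> space M. real (B m) / K m * (\<Sum>j\<in>G m. avg (\<lambda>t. per j (B m) t om ^ 4) (N m)) > \<delta>})))"
 have "vanishing M A" unfolding A_def
  using g_conv d' d unfolding oP1_vanishing
  by (intro vanishing_Un er_vanishing Vhat_vanishing per4_vanishing) auto
 moreover have "\<forall>\<^sub>F m in sequentially. {om \<in> space M. \<not> good \<delta> m om} \<subseteq> A m"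
 proof -
  have "(\<lambda>m. acv1 / real (B m)) \<longlonglongrightarrow> 0" by (rule filterlim_compose[OF lim_const_over_n B_top])
  then have "\<forall>\<^sub>F m in sequentially. acv1 / real (B m) < d'" using d'(1) by (rule order_tendstoD)
  with regular show ?thesis
  proof eventually_elim
   case (elim m)
   have "good \<delta> m om" if om: "om \<in> space M" "om \<notin> A m" for om
   proof -
    have eabs: "S \<le> \<bar>S\<bar>" for S :: ereal by (cases S) auto
    have gs: "\<bar>g m om l - sd l\<bar> \<le> d'" if l: "l \<in> {-pi..pi}" for l
    proof -
     have "ereal \<bar>g m om l - sd l\<bar> \<le> (SUP l\<in>{-pi..pi}. ereal \<bar>g m om l - sd l\<bar>)" by (rule SUP_upper[OF l])
     also have "\<dots> \<le> \<bar>SUP l\<in>{-pi..pi}. ereal \<bar>g m om l - sd l\<bar>\<bar>" by (rule eabs)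
     also have "\<dots> \<le> ereal d'" using om by (auto simp: A_def not_less)
     finally show ?thesis by simp
    qed
    have e2: "(\<Sum>j\<in>G m. (er m om j)\<^sup>2) \<le> d'\<^sup>2" using om by (auto simp: A_def not_less)
    have j: "ft m om j > 0 \<and> \<bar>g m om (fr m j) / ft m om j - 1\<bar> \<le> \<delta> \<and> \<bar>g m om (fr m j) - sd (fr m j)\<bar> \<le> \<delta>" if j: "j \<in> G m" for j
    proof -
     have "(er m om j)\<^sup>2 \<le> d'\<^sup>2" using member_le_sum[OF j, of "\<lambda>j. (er m om j)\<^sup>2"] e2 by auto
     then have "\<bar>er m om j\<bar> \<le> d'" using d'(1) by (simp add: abs_le_square_iff[symmetric])
     then have f: "\<bar>ft m om j - sd (fr m j)\<bar> \<le> 2 * d'"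
      using ft_eq(2)[of m om j] permean_bias[of "B m" j] elim by linarith
     have gj: "\<bar>g m om (fr m j) - sd (fr m j)\<bar> \<le> d'" by (rule gs[OF fourier_freq_in[OF j]])
     have fc: "ft m om j \<ge> c / 2" using f c(2)[OF fourier_freq_in[OF j]] d'(4) by linarith
     have "\<bar>g m om (fr m j) - ft m om j\<bar> \<le> 3 * d'" using f gj by linarith
     also have "\<dots> \<le> \<delta> * (c / 2)" using d'(5) by (simp add: mult.commute)
     also have "\<dots> \<le> \<delta> * ft m om j" using fc d by (intro mult_left_mono) auto
     finally have gf: "\<bar>g m om (fr m j) - ft m om j\<bar> \<le> \<delta> * ft m om j" .
     have pos: "ft m om j > 0" using fc c(1) by linarith
     have "g m om (fr m j) / ft m om j - 1 = (g m om (fr m j) - ft m om j) / ft m om j" using pos by (simp add: diff_divide_distrib)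
     then show ?thesis using gf gj d'(2) pos by (simp add: divide_le_eq)
    qed
    have "d'\<^sup>2 \<le> \<delta>" using d' by (simp add: power2_eq_square mult_left_le_one_le order_trans[of _ d'])
    then show ?thesis unfolding good_def using j e2 om by (auto simp: A_def not_less)
   qed
   then show ?case by blast
  qed
 qed
 ultimately show ?thesis by (rule vanishing_subset)
qed

text \<open>Closeness is asked only at the Fourier frequencies, where the statistic evaluates the
  weight, and it admits weights computed from the data.\<close>

definition near :: "real => (real => real) => nat => (real => real) => bool" where
 "near \<delta> \<psi> m \<theta> \<longleftrightarrow> (\<forall>j\<in>G m. \<bar>\<theta> (fr m j) - \<psi> (fr m j)\<bar> \<le> \<delta>)"

text \<open>The averaged square is a quadratic form in the weights whose matrix is the empirical
  covariance of the periodograms; under \<open>good\<close> it is close to the form evaluated by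
  \<open>eV_limit\<close>. The fourth moment only has to be small against \<open>k\<close>.\<close>

lemma block_moments:
 assumes m: "set_borel_measurable lborel {-pi..pi} \<psi>" and bv: "bounded_variation_on (-pi) pi \<psi>" and e: "e > 0"
 obtains \<delta> where "\<delta> > 0" "\<forall>\<^sub>F m in sequentially. \<forall>om \<theta>. good \<delta> m om \<longrightarrow> near \<delta> \<psi> m \<theta> \<longrightarrow>
   \<bar>avg (\<lambda>t. (yb \<theta> m om t)\<^sup>2) (N m) - tau_sq M X \<psi>\<bar> \<le> e \<and> avg (\<lambda>t. yb \<theta> m om t ^ 4) (N m) \<le> e * real (K m)"
proof (rule sum_eV_bound)
 fix C :: real assume C: "C \<ge> 0" "\<And>b. b \<ge> 1 ==> (\<Sum>j\<in>FI b. \<Sum>k\<in>FI b. \<bar>eV j k b\<bar>) \<le> C * b"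
 obtain P where P0: "P \<ge> 0" and P: "\<And>x. x \<in> {-pi..pi} ==> \<bar>\<psi> x\<bar> \<le> P" using bv_sup_bound[OF bv] by auto
 \<comment> \<open>\<open>A\<close> bounds the perturbed weights, as
   \<open>P + (P + 2) * \<delta> \<le> A\<close>; \<open>H1\<close> and \<open>H2\<close> are the
   factors of \<open>\<delta>\<close> that appear in the second and fourth moment bounds.\<close>
 define A where "A = 2 * P + 2"
 define H1 where "H1 = 4 * pi\<^sup>2 * ((A + P) * (P + 2) * C + 2 * A\<^sup>2)"
 define H2 where "H2 = (2 * pi) ^ 4 * A ^ 4 * 16"
 have pos: "A \<ge> 0" "H1 \<ge> 0" "H2 \<ge> 0" using P0 C(1) by (auto simp: A_def H1_def H2_def)
 define \<delta> where "\<delta> = Min {1, e / 2 / (H1 + 1), e / (H2 + 1)}"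
 have \<delta>: "\<delta> > 0" "\<delta> \<le> 1" "\<delta> \<le> e / 2 / (H1 + 1)" "\<delta> \<le> e / (H2 + 1)" using e pos by (auto simp: \<delta>_def)
 have "h * \<delta> \<le> c" if "\<delta> \<le> c / (h + 1)" "h \<ge> 0" for h c
  using that \<delta>(1) by (simp add: pos_le_divide_eq distrib_left mult.commute)
 from this[OF \<delta>(3) pos(2)] this[OF \<delta>(4) pos(3)] have H: "H1 * \<delta> \<le> e / 2" "H2 * \<delta> \<le> e" .
 define S2 where "S2 b = 4 * pi\<^sup>2 / real b * (\<Sum>j\<in>FI b. \<Sum>k\<in>FI b.
   \<psi> (ff j b) * \<psi> (ff k b) * eV j k b)" for b
 have "(\<lambda>m. S2 (B m)) \<longlonglongrightarrow> tau_sq M X \<psi>"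
  unfolding S2_def by (rule filterlim_compose[OF eV_limit[OF m bv] B_top])
 then have "\<forall>\<^sub>F m in sequentially. dist (S2 (B m)) (tau_sq M X \<psi>) < e / 2" using e by (intro tendstoD) auto
 with regular have "\<forall>\<^sub>F m in sequentially. \<forall>om \<theta>. good \<delta> m om \<longrightarrow> near \<delta> \<psi> m \<theta> \<longrightarrow>
   \<bar>avg (\<lambda>t. (yb \<theta> m om t)\<^sup>2) (N m) - tau_sq M X \<psi>\<bar> \<le> e \<and> avg (\<lambda>t. yb \<theta> m om t ^ 4) (N m) \<le> e * real (K m)"
 proof eventually_elim
  case (elim m)
  let ?b = "real (B m)"
  have b: "B m \<ge> 1" "B m \<le> n m" "B m \<le> N m" "K m \<ge> 1" and S2: "\<bar>S2 (B m) - tau_sq M X \<psi>\<bar> < e / 2"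
   using elim by (auto simp: dist_real_def)
  have N: "N m \<ge> 1" using b by linarith
  show ?case
  proof (intro allI impI)
   fix om \<theta> assume good: "good \<delta> m om" and near: "near \<delta> \<psi> m \<theta>"
   define a where "a j = \<theta> (fr m j) * (g m om (fr m j) / ft m om j)" for j
   define z where "z j t = per j (B m) t om - ft m om j" for j t
   let ?p = "\<lambda>j. \<psi> (fr m j)"
   have p: "\<bar>?p j\<bar> \<le> P" if "j \<in> G m" for j using P[OF fourier_freq_in[OF that]] .
   have ap: "\<bar>a j - ?p j\<bar> \<le> (P + 2) * \<delta>" if j: "j \<in> G m" for j
   proof -
    let ?q = "g m om (fr m j) / ft m om j - 1"
    have t: "\<bar>\<theta> (fr m j) - ?p j\<bar> \<le> \<delta>" "\<bar>?q\<bar> \<le> \<delta>" using near good j by (auto simp: near_def good_def)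
    have "a j - ?p j = \<theta> (fr m j) * ?q + (\<theta> (fr m j) - ?p j)" by (simp add: a_def algebra_simps)
    also have "\<bar>\<dots>\<bar> \<le> \<bar>\<theta> (fr m j)\<bar> * \<bar>?q\<bar> + \<delta>" using t(1) by (simp add: abs_mult[symmetric] order_trans[OF abs_triangle_ineq])
    also have "\<bar>\<theta> (fr m j)\<bar> * \<bar>?q\<bar> \<le> (P + 1) * \<delta>" using t p[OF j] \<delta>(2) by (intro mult_mono) auto
    finally show ?thesis by (simp add: algebra_simps)
   qed
   have aA: "\<bar>a j\<bar> \<le> A" if j: "j \<in> G m" for j
   proof -
    have "(P + 2) * \<delta> \<le> P + 2" using mult_left_mono[OF \<delta>(2), of "P + 2"] P0 by simp
    then show ?thesis using ap[OF j] p[OF j] abs_triangle_ineq2[of "a j" "?p j"] unfolding A_def by simp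
   qed
   have aa: "\<bar>a j * a k\<bar> \<le> A\<^sup>2" and ad: "\<bar>a j * a k - ?p j * ?p k\<bar> \<le> (A + P) * ((P + 2) * \<delta>)"
    if jk: "j \<in> G m" "k \<in> G m" for j k
   proof -
    show "\<bar>a j * a k\<bar> \<le> A\<^sup>2" unfolding abs_mult power2_eq_square using aA jk pos by (intro mult_mono) auto
    have "a j * a k - ?p j * ?p k = a j * (a k - ?p k) + (a j - ?p j) * ?p k" by (simp add: algebra_simps)
    also have "\<bar>\<dots>\<bar> \<le> \<bar>a j\<bar> * \<bar>a k - ?p k\<bar> + \<bar>a j - ?p j\<bar> * \<bar>?p k\<bar>"
     unfolding abs_mult[symmetric] by (rule abs_triangle_ineq)
    also have "\<dots> \<le> A * ((P + 2) * \<delta>) + ((P + 2) * \<delta>) * P"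
     using aA ap p jk pos P0 \<delta> by (intro add_mono mult_mono) auto
    finally show "\<bar>a j * a k - ?p j * ?p k\<bar> \<le> (A + P) * ((P + 2) * \<delta>)" by (simp add: algebra_simps)
   qed
   have y: "yb \<theta> m om t = 2 * pi / sqrt ?b * (\<Sum>j\<in>G m. a j * z j t)" if "t \<in> {1..N m}" for t
    unfolding block_term_def a_def z_def using sub_periodogram_per[OF b(1,2) that] by simp
   have y2: "(yb \<theta> m om t)\<^sup>2 = (2 * pi / sqrt ?b)\<^sup>2 * (\<Sum>j\<in>G m. \<Sum>k\<in>G m. a j * a k * (z j t * z k t))" if "t \<in> {1..N m}" for t
    unfolding y[OF that] power_mult_distrib power2_eq_square[of "sum _ _"] sum_product by (simp add: mult_ac)
   \<comment> \<open>Centring at the empirical instead of the true mean costs the product of the two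
     mean errors; the rest is the expected covariance plus its fluctuation.\<close>
   have W: "(\<Sum>t=1..N m. z j t * z k t) / N m = eV j k (B m) + Vhat j k (B m) (N m) om - er m om j * er m om k" for j k
   proof -
    have zI: "z j t = I0 j (B m) t om - er m om j" for j t
     using ft_eq(2)[OF b(1,2), of om j] unfolding z_def I0_def by linarith
    define x where "x i = (\<Sum>t=1..N m. I0 i (B m) t om)" for i
    have "(\<Sum>t=1..N m. z j t * z k t) = (\<Sum>t=1..N m. I0 j (B m) t om * I0 k (B m) t om) - x j * (x k / N m) - x j / N m * x k + N m * (x j / N m * (x k / N m))"
     unfolding zI x_def[symmetric] by (simp add: algebra_simps sum.distrib sum_subtractf sum_distrib_left[symmetric] sum_distrib_right[symmetric] del: times_divide_eq_left times_divide_eq_right) (simp add: x_def mult_ac)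
    then show ?thesis using N unfolding Vhat_def x_def[symmetric] by (simp add: diff_divide_distrib add_divide_distrib)
   qed
   have "avg (\<lambda>t. (yb \<theta> m om t)\<^sup>2) (N m) = (\<Sum>t=1..N m. (2 * pi / sqrt ?b)\<^sup>2 * (\<Sum>j\<in>G m. \<Sum>k\<in>G m. a j * a k * (z j t * z k t))) / N m"
    unfolding avg_def using y2 by (intro arg_cong2[where f = divide] sum.cong refl)
   also have "\<dots> = (2 * pi / sqrt ?b)\<^sup>2 * (\<Sum>j\<in>G m. \<Sum>k\<in>G m. a j * a k * ((\<Sum>t=1..N m. z j t * z k t) / N m))"
   proof -
    have "(\<Sum>t=1..N m. \<Sum>j\<in>G m. \<Sum>k\<in>G m. a j * a k * (z j t * z k t)) = (\<Sum>j\<in>G m. \<Sum>t=1..N m. \<Sum>k\<in>G m. a j * a k * (z j t * z k t))"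
     by (rule sum.swap)
    also have "\<dots> = (\<Sum>j\<in>G m. \<Sum>k\<in>G m. \<Sum>t=1..N m. a j * a k * (z j t * z k t))" by (intro sum.cong refl sum.swap)
    finally show ?thesis by (simp only: sum_distrib_left[symmetric] sum_divide_distrib[symmetric] times_divide_eq_right)
   qed
   also have "\<dots> = 4 * pi\<^sup>2 / ?b * (\<Sum>j\<in>G m. \<Sum>k\<in>G m. a j * a k * (eV j k (B m) + Vhat j k (B m) (N m) om - er m om j * er m om k))"
    unfolding W by (simp add: power_divide power_mult_distrib)
   finally have av: "avg (\<lambda>t. (yb \<theta> m om t)\<^sup>2) (N m) = 4 * pi\<^sup>2 / ?b * (\<Sum>j\<in>G m. \<Sum>k\<in>G m. a j * a k * (eV j k (B m) + Vhat j k (B m) (N m) om - er m om j * er m om k))" .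
   have "\<bar>avg (\<lambda>t. (yb \<theta> m om t)\<^sup>2) (N m) - S2 (B m)\<bar> \<le> 4 * pi\<^sup>2 / ?b * ((A + P) * ((P + 2) * \<delta>) * (\<Sum>j\<in>G m. \<Sum>k\<in>G m. \<bar>eV j k (B m)\<bar>) +
     A\<^sup>2 * ((\<Sum>j\<in>G m. \<Sum>k\<in>G m. \<bar>Vhat j k (B m) (N m) om\<bar>) + card (G m) * (\<Sum>j\<in>G m. (er m om j)\<^sup>2)))"
    unfolding av S2_def right_diff_distrib[symmetric] abs_mult[of "4 * pi\<^sup>2 / ?b"]
    by (intro mult_mono quadratic_form_perturbation aa ad) auto
   also have "\<dots> \<le> 4 * pi\<^sup>2 / ?b * ((A + P) * ((P + 2) * \<delta>) * (C * ?b) + A\<^sup>2 * (\<delta> * ?b + ?b * \<delta>))"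
   proof (intro mult_left_mono add_mono mult_mono)
    show "(\<Sum>j\<in>G m. \<Sum>k\<in>G m. \<bar>eV j k (B m)\<bar>) \<le> C * ?b" by (rule C(2)[OF b(1)])
    show "(\<Sum>j\<in>G m. \<Sum>k\<in>G m. \<bar>Vhat j k (B m) (N m) om\<bar>) \<le> \<delta> * ?b" "(\<Sum>j\<in>G m. (er m om j)\<^sup>2) \<le> \<delta>"
     using good b(1) by (simp_all add: good_def divide_le_eq)
    show "real (card (G m)) \<le> ?b" using card_fourier_indices[of "B m"] by simp
   qed (use pos P0 \<delta> in \<open>simp_all add: sum_nonneg\<close>)
   also have "\<dots> = 4 * pi\<^sup>2 * ((A + P) * (P + 2) * C + 2 * A\<^sup>2) * \<delta>" using b(1) by (simp add: field_simps)
   also have "\<dots> = H1 * \<delta>" by (simp only: H1_def)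
   finally have second: "\<bar>avg (\<lambda>t. (yb \<theta> m om t)\<^sup>2) (N m) - tau_sq M X \<psi>\<bar> \<le> e" using H(1) S2 by linarith
   have "avg (\<lambda>t. yb \<theta> m om t ^ 4) (N m) \<le> avg (\<lambda>t. (2 * pi) ^ 4 * A ^ 4 * (?b * (\<Sum>j\<in>G m. z j t ^ 4))) (N m)"
    unfolding avg_def
   proof (intro divide_right_mono sum_mono)
    fix t assume t: "t \<in> {1..N m}"
    have "yb \<theta> m om t ^ 4 = (2 * pi) ^ 4 / ?b\<^sup>2 * (\<Sum>j\<in>G m. a j * z j t) ^ 4"
    proof -
     have "sqrt ?b ^ 4 = ?b\<^sup>2" by (simp add: power4_eq_xxxx power2_eq_square)
     then show ?thesis unfolding y[OF t] by (simp add: power_mult_distrib power_divide)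
    qed
    \<comment> \<open>Convexity over at most \<open>b\<close> frequencies costs \<open>b^3\<close>,
      against \<open>b^2\<close> from the normalisation; the remaining factor \<open>b\<close> is
      matched by the weight \<open>b / k\<close> in \<open>good\<close>.\<close>
    also have "\<dots> \<le> (2 * pi) ^ 4 / ?b\<^sup>2 * (?b ^ 3 * (\<Sum>j\<in>G m. A ^ 4 * z j t ^ 4))"
    proof (intro mult_left_mono order_trans[OF pow4_sum_le] mult_mono sum_mono power_mono)
     fix j assume j: "j \<in> G m"
     have "\<bar>a j\<bar> ^ 4 \<le> A ^ 4" using aA[OF j] by (intro power_mono) auto
     then show "(a j * z j t) ^ 4 \<le> A ^ 4 * z j t ^ 4" unfolding power_mult_distrib by (intro mult_right_mono) auto
    qed (use card_fourier_indices[of "B m"] in \<open>auto intro!: sum_nonneg\<close>)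
    also have "\<dots> = (2 * pi) ^ 4 * A ^ 4 * (?b * (\<Sum>j\<in>G m. z j t ^ 4))"
     using b(1) by (simp add: sum_distrib_left[symmetric] power2_eq_square power3_eq_cube)
    finally show "yb \<theta> m om t ^ 4 \<le> (2 * pi) ^ 4 * A ^ 4 * (?b * (\<Sum>j\<in>G m. z j t ^ 4))" .
   qed simp
   also have "\<dots> = (2 * pi) ^ 4 * A ^ 4 * (?b * (\<Sum>j\<in>G m. avg (\<lambda>t. z j t ^ 4) (N m)))"
    unfolding avg_def sum_distrib_left[symmetric] sum_divide_distrib[symmetric] by (subst sum.swap) simp
   also have "\<dots> \<le> (2 * pi) ^ 4 * A ^ 4 * (?b * (\<Sum>j\<in>G m. 16 * avg (\<lambda>t. per j (B m) t om ^ 4) (N m)))"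
    unfolding z_def ft_eq(1)[OF b(1,2)] by (intro mult_left_mono sum_mono avg_centred_pow4[OF N]) auto
   also have "\<dots> = H2 * K m * (?b / K m * (\<Sum>j\<in>G m. avg (\<lambda>t. per j (B m) t om ^ 4) (N m)))"
    using b(4) by (simp add: H2_def sum_distrib_left[symmetric])
   also have "\<dots> \<le> H2 * K m * \<delta>" using good pos by (intro mult_left_mono) (auto simp: good_def)
   also have "\<dots> \<le> e * K m" using mult_right_mono[OF H(2), of "real (K m)"] by (simp add: mult_ac)
   finally show "\<bar>avg (\<lambda>t. (yb \<theta> m om t)\<^sup>2) (N m) - tau_sq M X \<psi>\<bar> \<le> e \<and> avg (\<lambda>t. yb \<theta> m om t ^ 4) (N m) \<le> e * real (K m)"
    using second by simp
  qed
 qed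
 with \<delta>(1) show thesis by (rule that)
qed

end

section \<open>Consistency of the bootstrap\<close>

lemma bounded_variation_affine:
 assumes "bounded_variation_on a c g"
 shows "bounded_variation_on a c (\<lambda>x. g x * s - r)"
proof -
 obtain B where B: "\<And>p m. mono_on {..m} p \<and> p ` {..m} \<subseteq> {a..c} ==> (\<Sum>i<m. \<bar>g (p (Suc i)) - g (p i)\<bar>) \<le> B" for p :: "nat => real"
  using assms unfolding bounded_variation_on_def by blast
 have "(\<Sum>i<m. \<bar>(g (p (Suc i)) * s - r) - (g (p i) * s - r)\<bar>) \<le> B * \<bar>s\<bar>" if "mono_on {..m} p \<and> p ` {..m} \<subseteq> {a..c}" for p :: "nat => real" and m
  using mult_right_mono[OF B[OF that], of "\<bar>s\<bar>"] by (simp add: sum_distrib_right abs_mult[symmetric] left_diff_distrib)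
 then show ?thesis unfolding bounded_variation_on_def by blast
qed

lemma set_measurable_affine:
 fixes g :: "real => real"
 assumes "set_borel_measurable lborel {-pi..pi} g"
 shows "set_borel_measurable lborel {-pi..pi} (\<lambda>x. g x * s - r)"
proof -
 have "(\<lambda>x. indicator {-pi..pi} x *\<^sub>R (g x * s - r)) = (\<lambda>x. (indicator {-pi..pi} x *\<^sub>R g x) * s - indicator {-pi..pi} x * r)"
  by (auto simp: indicator_def)
 then show ?thesis using assms unfolding set_borel_measurable_def by simp
qed

text \<open>\<open>\<eta> \<le> m1 / 4\<close> keeps \<open>D\<close> and \<open>Q\<close> above
  \<open>m1 / 2\<close>. The numerator is at most \<open>5 * m1 * \<eta>\<close>, and the constant
  20 makes this \<open>\<kappa>\<close> times the lower bound \<open>m1^2 / 4\<close> of the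
  product.\<close>

lemma product_ratio:
 fixes D Q m1 \<eta> \<kappa> :: real
 assumes m1: "m1 > 0" and D: "\<bar>D - m1\<bar> \<le> \<eta>" and Q: "\<bar>Q - m1\<bar> \<le> 2 * \<eta>"
  and \<eta>: "\<eta> \<le> m1 / 4" "\<eta> \<le> \<kappa> * m1 / 20" and \<kappa>: "\<kappa> > 0"
 shows "D * Q > 0 \<and> \<bar>(m1\<^sup>2 - D * Q) / (D * Q)\<bar> \<le> \<kappa>"
proof -
 have Dh: "D \<ge> m1 / 2" "D \<le> 2 * m1" and Qh: "Q \<ge> m1 / 2" using D Q \<eta>(1) m1 by linarith+
 have DQ: "m1 / 2 * (m1 / 2) \<le> D * Q" by (rule mult_mono[OF Dh(1) Qh]) (use Dh m1 in auto)
 have DQ0: "D * Q > 0" using Dh Qh m1 by simp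
 have "m1\<^sup>2 - D * Q = m1 * (m1 - D) + D * (m1 - Q)" by (simp add: power2_eq_square algebra_simps)
 also have "\<bar>m1 * (m1 - D) + D * (m1 - Q)\<bar> \<le> m1 * \<eta> + 2 * m1 * (2 * \<eta>)"
  by (rule order_trans[OF abs_triangle_ineq], unfold abs_mult) (use D Q Dh m1 in \<open>intro add_mono mult_mono; auto\<close>)
 finally have "\<bar>m1\<^sup>2 - D * Q\<bar> \<le> 5 * m1 * \<eta>" by (simp add: mult.commute)
 also have "\<dots> \<le> 5 * m1 * (\<kappa> * m1 / 20)" using m1 by (intro mult_left_mono \<eta>(2)) simp
 also have "\<dots> = \<kappa> * (m1 / 2 * (m1 / 2))" by simp
 also have "\<dots> \<le> \<kappa> * (D * Q)" using DQ \<kappa> by (intro mult_left_mono) auto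
 finally show ?thesis using DQ0 by (simp add: divide_le_eq)
qed

text \<open>While the numerator is at most \<open>R\<close> and the denominator fluctuates by at
  most \<open>\<eta>\<close>, replacing the random \<open>D * Q\<close> by \<open>m1^2\<close>
  changes the statistic only by a relative error \<open>\<kappa>\<close>.\<close>

lemma LR_boot_close:
 fixes \<phi> x g n b k i
 defines "A \<equiv> 2 * pi / b * (\<Sum>j\<in>FI b. \<phi> (ff j b) * g (ff j b))"
  and "D \<equiv> 2 * pi / b * (\<Sum>j\<in>FI b. g (ff j b))"
 assumes nb: "n \<ge> 1" "b \<ge> 1" and m1: "m1 > 0" and D: "\<bar>D - m1\<bar> \<le> \<eta>"
  and \<eta>: "\<eta> \<le> m1 / 4" "\<eta> \<le> \<kappa> * m1 / 20" and \<kappa>: "\<kappa> > 0"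
  and Z: "\<bar>L_boot (\<lambda>l. \<phi> l * D - A) x g n b k i\<bar> \<le> R" and L: "\<bar>L_boot (\<lambda>_. 1) x g n b k i\<bar> \<le> sqrt n * \<eta>"
 shows "\<bar>m1\<^sup>2 * LR_boot \<phi> x g n b k i - L_boot (\<lambda>l. \<phi> l * D - A) x g n b k i\<bar> \<le> R * \<kappa>"
proof -
 define Q where "Q = D + L_boot (\<lambda>_. 1) x g n b k i / sqrt n"
 have "\<bar>L_boot (\<lambda>_. 1) x g n b k i / sqrt n\<bar> \<le> \<eta>"
  using L nb(1) by (simp add: pos_divide_le_eq mult.commute[of \<eta>])
 then have "\<bar>Q - m1\<bar> \<le> 2 * \<eta>" using D unfolding Q_def by linarith
 then have DQ: "D * Q > 0" and r: "\<bar>(m1\<^sup>2 - D * Q) / (D * Q)\<bar> \<le> \<kappa>"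
  using product_ratio[OF m1 D _ \<eta> \<kappa>] by auto
 have nz: "D \<noteq> 0" "D + L_boot (\<lambda>_. 1) x g n b k i / sqrt n \<noteq> 0" using DQ by (auto simp: Q_def)
 have LR: "LR_boot \<phi> x g n b k i = L_boot (\<lambda>l. \<phi> l * D - A) x g n b k i / (D * Q)"
  unfolding Q_def A_def D_def by (rule LR_boot_eq[OF nb nz[unfolded D_def]])
 have "m1\<^sup>2 * (z / q) - z = z * ((m1\<^sup>2 - q) / q)" if "q > 0" for z q :: real
  using that by (simp add: field_simps)
 then have "\<bar>m1\<^sup>2 * LR_boot \<phi> x g n b k i - L_boot (\<lambda>l. \<phi> l * D - A) x g n b k i\<bar> =
   \<bar>L_boot (\<lambda>l. \<phi> l * D - A) x g n b k i\<bar> * \<bar>(m1\<^sup>2 - D * Q) / (D * Q)\<bar>"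
  unfolding LR abs_mult[symmetric] using DQ by metis
 also have "\<dots> \<le> R * \<kappa>" by (rule mult_mono[OF Z r]) (use Z in auto)
 finally show ?thesis .
qed

context spec_process
begin

lemma spec_mean_measurable:
 assumes "bvdom \<psi> f"
 shows "(\<lambda>om. spec_mean f (periodogram (sample X r om) r)) \<in> borel_measurable M"
proof -
 have "(\<lambda>om. sample X r om s) \<in> borel_measurable M" for s
  by (cases "s \<in> {1..r}") (simp_all add: sample_def)
 then show ?thesis unfolding spec_mean_periodogram[OF assms] by measurable
qed

end

section \<open>The conditional law of the bootstrap statistics\<close>

context block_bootstrap
begin

abbreviation Lb :: "(real => real) => nat => 'a => (nat => nat) => real" where
 "Lb \<theta> m om \<equiv> L_boot \<theta> (sample X (n m) om) (g m om) (n m) (B m) (K m)"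
abbreviation Pb :: "nat => (nat => nat) pmf" where "Pb m \<equiv> draws (K m) (N m)"
abbreviation "EP m \<equiv> measure_pmf.expectation (Pb m)"
abbreviation "PP m \<equiv> measure_pmf.prob (Pb m)"

lemma N_ge1: "N m \<ge> 1" by (simp add: num_blocks_def)

lemma Lb_eq: "good \<delta> m om ==> B m \<ge> 1 ==> K m \<ge> 1 ==> Lb \<theta> m om = drawsum (yb \<theta> m om) (K m)"
 by (intro ext L_boot_drawsum n_eq) (auto simp: good_def)

lemma yb_mean: "avg (yb \<theta> m om) (N m) = 0"
 by (rule avg_block_term[OF refl N_ge1])

lemma boot_variance:
 assumes "set_borel_measurable lborel {-pi..pi} \<psi>" "bounded_variation_on (-pi) pi \<psi>" "e > 0"
 obtains \<delta> where "\<delta> > 0" "\<forall>\<^sub>F m in sequentially. \<forall>om \<theta>. good \<delta> m om \<longrightarrow> near \<delta> \<psi> m \<theta> \<longrightarrow>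
   EP m (Lb \<theta> m om) = 0 \<and> \<bar>EP m (\<lambda>i. (Lb \<theta> m om i)\<^sup>2) - tau_sq M X \<psi>\<bar> \<le> e"
proof (rule block_moments[OF assms])
 fix \<delta> assume \<delta>: "\<delta> > 0" and ev: "\<forall>\<^sub>F m in sequentially. \<forall>om \<theta>. good \<delta> m om \<longrightarrow> near \<delta> \<psi> m \<theta> \<longrightarrow>
   \<bar>avg (\<lambda>t. (yb \<theta> m om t)\<^sup>2) (N m) - tau_sq M X \<psi>\<bar> \<le> e \<and> avg (\<lambda>t. yb \<theta> m om t ^ 4) (N m) \<le> e * real (K m)"
 show thesis
 proof (rule that[OF \<delta>])
  show "\<forall>\<^sub>F m in sequentially. \<forall>om \<theta>. good \<delta> m om \<longrightarrow> near \<delta> \<psi> m \<theta> \<longrightarrow>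
   EP m (Lb \<theta> m om) = 0 \<and> \<bar>EP m (\<lambda>i. (Lb \<theta> m om i)\<^sup>2) - tau_sq M X \<psi>\<bar> \<le> e"
   using ev regular
  proof eventually_elim
   case (elim m)
   then show ?case
    using drawsum_mean[OF N_ge1 yb_mean] drawsum_second_moment[OF N_ge1 yb_mean] by (auto simp: Lb_eq)
  qed
 qed
qed

lemma boot_clt:
 assumes "set_borel_measurable lborel {-pi..pi} \<psi>" "bounded_variation_on (-pi) pi \<psi>" "e > 0" "tau_sq M X \<psi> > 0"
 obtains \<delta> where "\<delta> > 0" "\<forall>\<^sub>F m in sequentially. \<forall>om \<theta>. good \<delta> m om \<longrightarrow> near \<delta> \<psi> m \<theta> \<longrightarrow>
   (\<forall>x. \<bar>PP m {i. Lb \<theta> m om i \<le> x} - Phi (x / sqrt (tau_sq M X \<psi>))\<bar> \<le> e)"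
proof (rule drawsum_clt_scaled[OF assms(3,4)])
 fix d assume d: "d > 0" "\<And>N k y x. N \<ge> 1 ==> k \<ge> 1 ==> avg y N = 0 ==>
   \<bar>avg (\<lambda>t. (y t)\<^sup>2) N - tau_sq M X \<psi>\<bar> \<le> d ==> avg (\<lambda>t. y t ^ 4) N \<le> d * real k ==> 1 / real k \<le> d ==>
   \<bar>measure_pmf.prob (draws k N) {i. drawsum y k i \<le> x} - Phi (x / sqrt (tau_sq M X \<psi>))\<bar> \<le> e"
 have "(\<lambda>m. 1 / real (K m)) \<longlonglongrightarrow> 0" by (rule filterlim_compose[OF lim_const_over_n K_top])
 then have k: "\<forall>\<^sub>F m in sequentially. 1 / real (K m) < d" using d(1) by (rule order_tendstoD)
 show thesis
 proof (rule block_moments[OF assms(1,2) d(1)])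
  fix \<delta> assume \<delta>: "\<delta> > 0" and ev: "\<forall>\<^sub>F m in sequentially. \<forall>om \<theta>. good \<delta> m om \<longrightarrow> near \<delta> \<psi> m \<theta> \<longrightarrow>
    \<bar>avg (\<lambda>t. (yb \<theta> m om t)\<^sup>2) (N m) - tau_sq M X \<psi>\<bar> \<le> d \<and> avg (\<lambda>t. yb \<theta> m om t ^ 4) (N m) \<le> d * real (K m)"
  show thesis
  proof (rule that[OF \<delta>])
   show "\<forall>\<^sub>F m in sequentially. \<forall>om \<theta>. good \<delta> m om \<longrightarrow> near \<delta> \<psi> m \<theta> \<longrightarrow>
     (\<forall>x. \<bar>PP m {i. Lb \<theta> m om i \<le> x} - Phi (x / sqrt (tau_sq M X \<psi>))\<bar> \<le> e)"
    using ev regular k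
   proof eventually_elim
    case (elim m)
    show ?case
    proof (intro allI impI)
     fix om \<theta> x assume gn: "good \<delta> m om" "near \<delta> \<psi> m \<theta>"
     have L: "Lb \<theta> m om = drawsum (yb \<theta> m om) (K m)" using elim by (intro Lb_eq[OF gn(1)]) auto
     show "\<bar>PP m {i. Lb \<theta> m om i \<le> x} - Phi (x / sqrt (tau_sq M X \<psi>))\<bar> \<le> e"
      unfolding L using elim gn by (intro d(2) N_ge1 yb_mean) auto
    qed
   qed
  qed
 qed
qed

text \<open>Both distribution functions are compared with the same normal one: the true one by
  Polya's theorem, the bootstrap one under \<open>good\<close>. The set where the supremum is large
  thus lies in the complement of \<open>good\<close>, whether or not it is measurable.\<close>

lemma uniform_conclusion:
 assumes T: "\<And>m. T m \<in> borel_measurable M" and v: "v > 0"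
  and wc: "weak_conv_m (\<lambda>m. distr M borel (T m)) (centred_normal v)"
  and Z: "\<And>e. e > 0 ==> \<exists>\<delta>>0. \<forall>\<^sub>F m in sequentially. \<forall>om. good \<delta> m om \<longrightarrow>
   (\<forall>x. \<bar>PP m {i. Z m om i \<le> x} - Phi (x / sqrt v)\<bar> \<le> e)"
 shows "oP1 M (\<lambda>m om. SUP x :: real. ereal \<bar>PP m {i. Z m om i \<le> x} - measure M {om' \<in> space M. T m om' \<le> x}\<bar>)"
 unfolding oP1_vanishing
proof (intro allI impI)
 fix \<epsilon> :: real assume \<epsilon>: "\<epsilon> > 0"
 have cdfT: "cdf (distr M borel (T m)) x = measure M {om' \<in> space M. T m om' \<le> x}" for m x
  unfolding cdf_def using T by (subst measure_distr) (auto intro!: arg_cong2[where f = measure])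
 define \<mu> where "\<mu> m = distr M borel (\<lambda>om. T m om / sqrt v)" for m
 have cdf\<mu>: "cdf (\<mu> m) x = measure M {om' \<in> space M. T m om' \<le> x * sqrt v}" for m x
  unfolding cdf_def \<mu>_def using T v by (subst measure_distr) (auto intro!: arg_cong2[where f = measure] simp: divide_le_eq)
 have "\<forall>\<^sub>F m in sequentially. \<forall>x. \<bar>cdf (\<mu> m) x - Phi x\<bar> \<le> \<epsilon> / 2"
 proof (rule weak_conv_normal_uniform)
  show "real_distribution (\<mu> m)" for m unfolding \<mu>_def using T by (intro real_distribution_distr) simp
  have "isCont (cdf (centred_normal v)) x" for x
   unfolding cdf_centred_normal[OF v, abs_def] using v by (intro continuous_intros isCont_o2[OF _ Phi_cont]) auto
  then have "(\<lambda>m. cdf (distr M borel (T m)) x) \<longlonglongrightarrow> cdf (centred_normal v) x" for x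
   using wc unfolding weak_conv_m_def weak_conv_def by blast
  from this[of "x * sqrt v" for x] show "(\<lambda>m. cdf (\<mu> m) x) \<longlonglongrightarrow> Phi x" for x
   using v by (simp add: cdf_centred_normal[OF v] cdfT cdf\<mu>)
 qed (use \<epsilon> in simp)
 then have polya: "\<forall>\<^sub>F m in sequentially. \<forall>x. \<bar>measure M {om' \<in> space M. T m om' \<le> x} - Phi (x / sqrt v)\<bar> \<le> \<epsilon> / 2"
 proof eventually_elim
  case (elim m)
  show ?case using elim[rule_format, of "x / sqrt v" for x] v by (simp add: cdf\<mu>)
 qed
 obtain \<delta> where \<delta>: "\<delta> > 0" "\<forall>\<^sub>F m in sequentially. \<forall>om. good \<delta> m om \<longrightarrow>
   (\<forall>x. \<bar>PP m {i. Z m om i \<le> x} - Phi (x / sqrt v)\<bar> \<le> \<epsilon> / 2)"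
  using Z[of "\<epsilon> / 2"] \<epsilon> by auto
 show "vanishing M (\<lambda>m. {om \<in> space M. ereal \<epsilon> < \<bar>SUP x :: real. ereal \<bar>PP m {i. Z m om i \<le> x} - measure M {om' \<in> space M. T m om' \<le> x}\<bar>\<bar>})"
 proof (rule vanishing_subset[OF not_good_vanishing[OF \<delta>(1)]])
  show "\<forall>\<^sub>F m in sequentially. {om \<in> space M. ereal \<epsilon> < \<bar>SUP x :: real. ereal \<bar>PP m {i. Z m om i \<le> x} - measure M {om' \<in> space M. T m om' \<le> x}\<bar>\<bar>}
    \<subseteq> {om \<in> space M. \<not> good \<delta> m om}"
   using polya \<delta>(2)
  proof eventually_elim
   case (elim m)
   have "\<bar>SUP x :: real. ereal \<bar>PP m {i. Z m om i \<le> x} - measure M {om' \<in> space M. T m om' \<le> x}\<bar>\<bar> \<le> ereal \<epsilon>"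
    if good: "good \<delta> m om" for om
   proof -
    let ?h = "\<lambda>x. \<bar>PP m {i. Z m om i \<le> x} - measure M {om' \<in> space M. T m om' \<le> x}\<bar>"
    have "?h x \<le> \<epsilon>" for x
     using elim(1)[rule_format, of x] elim(2)[rule_format, OF good, of x] by linarith
    then have "(SUP x. ereal (?h x)) \<le> ereal \<epsilon>" by (intro SUP_least) simp
    moreover have "0 \<le> (SUP x. ereal (?h x))" by (rule SUP_upper2[of 0]) auto
    ultimately show ?thesis by (simp add: abs_ereal_ge0)
   qed
   then show ?case by (auto simp: not_less[symmetric])
  qed
 qed
qed

lemma draws_Chebyshev:
 assumes "a > 0"
 shows "PP m {i. \<bar>f i\<bar> > a} \<le> EP m (\<lambda>i. (f i)\<^sup>2) / a\<^sup>2"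
proof -
 have "PP m {i. \<bar>f i\<bar> > a} \<le> PP m {i \<in> space (measure_pmf (Pb m)). \<bar>f i\<bar> \<ge> a}"
  by (intro measure_pmf.finite_measure_mono) auto
 also have "\<dots> \<le> EP m (\<lambda>i. (f i)\<^sup>2) / a\<^sup>2"
  using assms by (intro measure_pmf.second_moment_method draws_integrable N_ge1) auto
 finally show ?thesis .
qed

lemma sd_mean_pos: "(LBINT l:{-pi..pi}. sd l) > 0"
proof -
 obtain c where c: "c > 0" "\<And>l. l \<in> {-pi..pi} ==> c \<le> sd l" using sd_lower by blast
 have "bvdom (\<lambda>_. 0) sd" using acv1_nonneg sd_lipschitz by (rule bvdom_lipschitz)
 then have "set_integrable lborel {-pi..pi} sd" by (rule bvdom_set_integrable) auto
 then have "(LBINT l:{-pi..pi}. c) \<le> (LBINT l:{-pi..pi}. sd l)"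
  using c(2) by (intro set_integral_mono) (auto simp: set_integrable_def emeasure_lborel_Icc_eq)
 moreover have "(LBINT l:{-pi..pi}. c) = 2 * pi * c" by (simp add: set_lebesgue_integral_def)
 moreover have "2 * pi * c > 0" using c(1) by simp
 ultimately show ?thesis by linarith
qed

text \<open>Under \<open>good\<close> the estimate may be replaced by the spectral density at the
  cost \<open>2 * pi * P * \<delta>\<close>; the rest is a convergent Riemann sum.\<close>

lemma plugin_means:
 assumes m: "set_borel_measurable lborel {-pi..pi} \<phi>" and bv: "bounded_variation_on (-pi) pi \<phi>" and e: "e > 0"
 obtains \<delta> where "\<delta> > 0" "\<forall>\<^sub>F m in sequentially. \<forall>om. good \<delta> m om \<longrightarrow>
   \<bar>2 * pi / B m * (\<Sum>j\<in>G m. \<phi> (fr m j) * g m om (fr m j)) - (LBINT l:{-pi..pi}. \<phi> l * sd l)\<bar> \<le> e"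
proof -
 obtain P where P0: "P \<ge> 0" and P: "\<And>x. x \<in> {-pi..pi} ==> \<bar>\<phi> x\<bar> \<le> P" using bv_sup_bound[OF bv] by auto
 define \<delta> where "\<delta> = e / 2 / (2 * pi * P + 1)"
 have pP: "2 * pi * P + 1 > 0" using P0 by (intro add_nonneg_pos) auto
 have \<delta>: "\<delta> > 0" "2 * pi * P * \<delta> \<le> e / 2"
  using e pP by (auto simp: \<delta>_def divide_le_eq intro!: mult_left_mono)
 let ?s = "\<lambda>m. 2 * pi / real (B m) * (\<Sum>j\<in>G m. \<phi> (fr m j) * sd (fr m j))"
 have "bvdom \<phi> (\<lambda>l. \<phi> l * sd l)"
  using acv1_nonneg sd_lipschitz by (intro bvdom_mult bvdom_self m bv bvdom_lipschitz[of acv1])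
 from filterlim_compose[OF riemann_tendsto[OF bv this] B_top]
 have "?s \<longlonglongrightarrow> (LBINT l:{-pi..pi}. \<phi> l * sd l)" .
 then have "\<forall>\<^sub>F m in sequentially. dist (?s m) (LBINT l:{-pi..pi}. \<phi> l * sd l) < e / 2" using e by (intro tendstoD) auto
 with regular have "\<forall>\<^sub>F m in sequentially. \<forall>om. good \<delta> m om \<longrightarrow>
   \<bar>2 * pi / B m * (\<Sum>j\<in>G m. \<phi> (fr m j) * g m om (fr m j)) - (LBINT l:{-pi..pi}. \<phi> l * sd l)\<bar> \<le> e"
 proof eventually_elim
  case (elim m)
  show ?case
  proof (intro allI impI)
   fix om assume good: "good \<delta> m om"
   have "\<bar>(\<Sum>j\<in>G m. \<phi> (fr m j) * g m om (fr m j)) - (\<Sum>j\<in>G m. \<phi> (fr m j) * sd (fr m j))\<bar> \<le> (\<Sum>j\<in>G m. P * \<delta>)"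
    unfolding sum_subtractf[symmetric] right_diff_distrib[symmetric]
   proof (intro order_trans[OF sum_abs] sum_mono)
    fix j assume j: "j \<in> G m"
    show "\<bar>\<phi> (fr m j) * (g m om (fr m j) - sd (fr m j))\<bar> \<le> P * \<delta>"
     unfolding abs_mult using P[OF fourier_freq_in[OF j]] good j P0 by (intro mult_mono) (auto simp: good_def)
   qed
   also have "\<dots> \<le> real (B m) * (P * \<delta>)"
    using card_fourier_indices[of "B m"] P0 \<delta>(1) by (simp add: mult_right_mono)
   finally have "2 * pi / B m * \<bar>(\<Sum>j\<in>G m. \<phi> (fr m j) * g m om (fr m j)) - (\<Sum>j\<in>G m. \<phi> (fr m j) * sd (fr m j))\<bar> \<le> 2 * pi / B m * (real (B m) * (P * \<delta>))"
    by (rule mult_left_mono) simp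
   also have "\<dots> \<le> e / 2" using elim \<delta>(2) by simp
   finally have "\<bar>2 * pi / B m * ((\<Sum>j\<in>G m. \<phi> (fr m j) * g m om (fr m j)) - (\<Sum>j\<in>G m. \<phi> (fr m j) * sd (fr m j)))\<bar> \<le> e / 2"
    by (simp only: abs_mult) simp
   then show "\<bar>2 * pi / B m * (\<Sum>j\<in>G m. \<phi> (fr m j) * g m om (fr m j)) - (LBINT l:{-pi..pi}. \<phi> l * sd l)\<bar> \<le> e"
    using elim unfolding dist_real_def right_diff_distrib by linarith
  qed
 qed
 with \<delta>(1) show thesis by (rule that)
qed

text \<open>The linear statistic is taken with the data-dependent weight
  \<open>\<phi> * D - A\<close>, which is near \<open>w\<close>, and \<open>m1^2\<close> times the
  ratio statistic is close to it. The error \<open>e\<close> is shared in quarters by the normal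
  approximation, a numerator exceeding \<open>R\<close>, a denominator fluctuating by more than
  \<open>\<eta>\<close>, and the shift inside \<open>Phi\<close>.\<close>

lemma ratio_clt:
 assumes m: "set_borel_measurable lborel {-pi..pi} \<phi>" and bv: "bounded_variation_on (-pi) pi \<phi>"
  and e: "e > 0" and vR: "tauR_sq M X \<phi> > 0"
 shows "\<exists>\<delta>>0. \<forall>\<^sub>F m in sequentially. \<forall>om. good \<delta> m om \<longrightarrow>
  (\<forall>x. \<bar>PP m {i. LR_boot \<phi> (sample X (n m) om) (g m om) (n m) (B m) (K m) i \<le> x} - Phi (x / sqrt (tauR_sq M X \<phi>))\<bar> \<le> e)"
proof -
 obtain P where P0: "P \<ge> 0" and P: "\<And>x. x \<in> {-pi..pi} ==> \<bar>\<phi> x\<bar> \<le> P" using bv_sup_bound[OF bv] by auto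
 define m1 where "m1 = (LBINT l:{-pi..pi}. sd l)"
 define a1 where "a1 = (LBINT l:{-pi..pi}. \<phi> l * sd l)"
 define w where "w = (\<lambda>l. \<phi> l * m1 - a1)"
 define v where "v = tau_sq M X w"
 have m1: "m1 > 0" using sd_mean_pos by (simp add: m1_def)
 have w: "ratio_weight M X \<phi> = w" by (simp add: ratio_weight_def w_def m1_def a1_def fun_eq_iff)
 have tR: "tauR_sq M X \<phi> = v / m1 ^ 4"
  unfolding tauR_sq_def w v_def tau_sq_def by (simp add: spec_mean_def m1_def add_divide_distrib)
 have v: "v > 0" using vR m1 by (simp add: tR zero_less_divide_iff)
 have wm: "set_borel_measurable lborel {-pi..pi} w" "bounded_variation_on (-pi) pi w"
  unfolding w_def by (rule set_measurable_affine[OF m], rule bounded_variation_affine[OF bv])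
 have om: "set_borel_measurable lborel {-pi..pi} (\<lambda>_. 1 :: real)" "bounded_variation_on (-pi) pi (\<lambda>_. 1)"
  by (simp_all add: set_borel_measurable_def bounded_variation_on_def) auto
 \<comment> \<open>By Chebyshev's inequality a numerator with second moment at most
   \<open>v + 1\<close> exceeds \<open>R\<close> with probability at most
   \<open>e / 4\<close>.\<close>
 define R where "R = sqrt (4 * (v + 1) / e)"
 have "u / (sqrt (4 * u / e))\<^sup>2 = e / 4" if "u > 0" for u using that e by simp
 from this[of "v + 1"] have R: "R > 0" "(v + 1) / R\<^sup>2 = e / 4" using v e by (simp_all add: R_def)
 \<comment> \<open>With this choice a deviation of size \<open>R * \<kappa>\<close> moves
   \<open>Phi (x / sqrt v)\<close> by at most \<open>e / 4\<close>.\<close>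
 define \<kappa> where "\<kappa> = e / 4 * sqrt v / R"
 have \<kappa>: "\<kappa> > 0" "R * \<kappa> / sqrt v = e / 4" using v e R by (auto simp: \<kappa>_def)
 show ?thesis
 proof (rule boot_clt[OF wm, of "e / 4"])
  show "e / 4 > 0" "tau_sq M X w > 0" using e v by (auto simp: v_def)
  fix \<delta>1 assume \<delta>1: "\<delta>1 > 0" "\<forall>\<^sub>F m in sequentially. \<forall>om \<theta>. good \<delta>1 m om \<longrightarrow> near \<delta>1 w m \<theta> \<longrightarrow>
    (\<forall>x. \<bar>PP m {i. Lb \<theta> m om i \<le> x} - Phi (x / sqrt (tau_sq M X w))\<bar> \<le> e / 4)"
  show ?thesis
  proof (rule boot_variance[OF wm zero_less_one], rule boot_variance[OF om zero_less_one])
   fix \<delta>2 \<delta>3 assume \<delta>2: "\<delta>2 > 0" "\<forall>\<^sub>F m in sequentially. \<forall>om \<theta>. good \<delta>2 m om \<longrightarrow> near \<delta>2 w m \<theta> \<longrightarrow>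
     EP m (Lb \<theta> m om) = 0 \<and> \<bar>EP m (\<lambda>i. (Lb \<theta> m om i)\<^sup>2) - tau_sq M X w\<bar> \<le> 1"
    and \<delta>3: "\<delta>3 > 0" "\<forall>\<^sub>F m in sequentially. \<forall>om \<theta>. good \<delta>3 m om \<longrightarrow> near \<delta>3 (\<lambda>_. 1) m \<theta> \<longrightarrow>
     EP m (Lb \<theta> m om) = 0 \<and> \<bar>EP m (\<lambda>i. (Lb \<theta> m om i)\<^sup>2) - tau_sq M X (\<lambda>_. 1)\<bar> \<le> 1"
   \<comment> \<open>The bounds with \<open>P + 1\<close> bring the plug-in weight near
     \<open>w\<close>; the other two are what \<open>LR_boot_close\<close> asks for.\<close>
   define \<eta> where "\<eta> = Min {m1 / 4, \<delta>1 / (P + 1), \<delta>2 / (P + 1), \<kappa> * m1 / 20}"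
   have "\<eta> > 0" using m1 \<delta>1(1) \<delta>2(1) P0 \<kappa>(1) by (simp add: \<eta>_def)
   moreover have "\<eta> \<le> m1 / 4" "\<eta> \<le> \<delta>1 / (P + 1)" "\<eta> \<le> \<delta>2 / (P + 1)" "\<eta> \<le> \<kappa> * m1 / 20"
    unfolding \<eta>_def by (rule Min_le; simp)+
   ultimately have \<eta>: "\<eta> > 0" "\<eta> \<le> m1 / 4" "\<eta> \<le> \<delta>1 / (P + 1)" "\<eta> \<le> \<delta>2 / (P + 1)" "\<eta> \<le> \<kappa> * m1 / 20" .
   have \<eta>P: "(P + 1) * \<eta> \<le> \<delta>1" "(P + 1) * \<eta> \<le> \<delta>2" using \<eta>(3,4) P0 by (simp_all add: pos_le_divide_eq mult.commute)
   \<comment> \<open>A bound for the second moment of the statistic with weight 1. Chebyshev's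
     inequality at the level \<open>sqrt n * \<eta>\<close> then gives
     \<open>t1 / (\<eta>^2 * n)\<close>, which tends to zero.\<close>
   define t1 where "t1 = tau_sq M X (\<lambda>_. 1) + 1"
   have "(\<lambda>m. t1 / \<eta>\<^sup>2 / real (n m)) \<longlonglongrightarrow> 0"
   proof (rule filterlim_compose[OF lim_const_over_n])
    show "filterlim n at_top sequentially"
     by (rule filterlim_at_top_mono[OF B_top]) (use regular in eventually_elim, simp)
   qed
   then have n_large: "\<forall>\<^sub>F m in sequentially. t1 / \<eta>\<^sup>2 / real (n m) < e / 4" using e by (intro order_tendstoD) auto
   show ?thesis
   proof (rule plugin_means[OF m bv \<eta>(1)], rule plugin_means[OF om \<eta>(1)])
    fix \<delta>4 \<delta>5 assume \<delta>4: "\<delta>4 > 0" "\<forall>\<^sub>F m in sequentially. \<forall>om. good \<delta>4 m om \<longrightarrow>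
     \<bar>2 * pi / B m * (\<Sum>j\<in>G m. \<phi> (fr m j) * g m om (fr m j)) - (LBINT l:{-pi..pi}. \<phi> l * sd l)\<bar> \<le> \<eta>"
     and \<delta>5: "\<delta>5 > 0" "\<forall>\<^sub>F m in sequentially. \<forall>om. good \<delta>5 m om \<longrightarrow>
     \<bar>2 * pi / B m * (\<Sum>j\<in>G m. 1 * g m om (fr m j)) - (LBINT l:{-pi..pi}. 1 * sd l)\<bar> \<le> \<eta>"
    define \<delta> where "\<delta> = Min {\<delta>1, \<delta>2, \<delta>3, \<delta>4, \<delta>5}"
    have \<delta>: "\<delta> > 0" "\<delta> \<le> \<delta>1" "\<delta> \<le> \<delta>2" "\<delta> \<le> \<delta>3" "\<delta> \<le> \<delta>4" "\<delta> \<le> \<delta>5"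
     using \<delta>1(1) \<delta>2(1) \<delta>3(1) \<delta>4(1) \<delta>5(1) by (auto simp: \<delta>_def)
    have "\<forall>\<^sub>F m in sequentially. \<forall>om. good \<delta> m om \<longrightarrow>
     (\<forall>x. \<bar>PP m {i. LR_boot \<phi> (sample X (n m) om) (g m om) (n m) (B m) (K m) i \<le> x} - Phi (x / sqrt (tauR_sq M X \<phi>))\<bar> \<le> e)"
     using \<delta>1(2) \<delta>2(2) \<delta>3(2) \<delta>4(2) \<delta>5(2) n_large regular
    proof eventually_elim
     case (elim m)
     show ?case
     proof (intro allI impI)
      fix om x assume good: "good \<delta> m om"
      note goods = good_mono[OF good \<delta>(2)] good_mono[OF good \<delta>(3)] good_mono[OF good \<delta>(4)] good_mono[OF good \<delta>(5)] good_mono[OF good \<delta>(6)]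
      define A where "A = 2 * pi / B m * (\<Sum>j\<in>G m. \<phi> (fr m j) * g m om (fr m j))"
      define D where "D = 2 * pi / B m * (\<Sum>j\<in>G m. g m om (fr m j))"
      let ?\<theta> = "\<lambda>l. \<phi> l * D - A"
      let ?LR = "LR_boot \<phi> (sample X (n m) om) (g m om) (n m) (B m) (K m)"
      have n1: "n m \<ge> 1" "B m \<ge> 1" using elim by auto
      have AD: "\<bar>A - a1\<bar> \<le> \<eta>" "\<bar>D - m1\<bar> \<le> \<eta>"
       using elim(4)[rule_format, OF goods(4)] elim(5)[rule_format, OF goods(5)] by (simp_all add: A_def D_def a1_def m1_def)
      have close: "\<bar>?\<theta> (fr m j) - w (fr m j)\<bar> \<le> (P + 1) * \<eta>" if j: "j \<in> G m" for j
      proof -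
       have "\<bar>\<phi> (fr m j)\<bar> * \<bar>D - m1\<bar> \<le> P * \<eta>" using P[OF fourier_freq_in[OF j]] AD(2) P0 by (intro mult_mono) auto
       moreover have "?\<theta> (fr m j) - w (fr m j) = \<phi> (fr m j) * (D - m1) - (A - a1)" by (simp add: w_def algebra_simps)
       ultimately show ?thesis using AD(1) abs_triangle_ineq4[of "\<phi> (fr m j) * (D - m1)" "A - a1"]
        by (simp add: abs_mult distrib_right)
      qed
      have nr: "near \<delta>1 w m ?\<theta>" "near \<delta>2 w m ?\<theta>" "near \<delta>3 (\<lambda>_. 1) m (\<lambda>_. 1)"
       unfolding near_def by (intro ballI order_trans[OF close] \<eta>P; simp add: \<delta>3(1) less_imp_le)+
      let ?Z = "Lb ?\<theta> m om" and ?L1 = "Lb (\<lambda>_. 1) m om" and ?U = "\<lambda>i. m1\<^sup>2 * ?LR i"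
      have bad1: "PP m {i. \<bar>?Z i\<bar> > R} \<le> e / 4"
      proof -
       have "EP m (\<lambda>i. (?Z i)\<^sup>2) \<le> v + 1"
        using elim(2)[rule_format, OF goods(2) nr(2)] by (simp add: v_def abs_le_iff)
       then have "EP m (\<lambda>i. (?Z i)\<^sup>2) / R\<^sup>2 \<le> e / 4"
        unfolding R(2)[symmetric] by (rule divide_right_mono) simp
       then show ?thesis by (rule order_trans[OF draws_Chebyshev[OF R(1)]])
      qed
      have bad2: "PP m {i. \<bar>?L1 i\<bar> > sqrt (n m) * \<eta>} \<le> e / 4"
      proof -
       have sp: "sqrt (n m) * \<eta> > 0" using n1 \<eta>(1) by simp
       have "EP m (\<lambda>i. (?L1 i)\<^sup>2) / (sqrt (n m) * \<eta>)\<^sup>2 \<le> t1 / (sqrt (n m) * \<eta>)\<^sup>2"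
        using elim(3)[rule_format, OF goods(3) nr(3)] by (intro divide_right_mono) (simp_all add: t1_def abs_le_iff)
       also have "\<dots> = t1 / \<eta>\<^sup>2 / n m" by (simp add: power_mult_distrib mult.commute)
       also have "\<dots> \<le> e / 4" using elim(6) by simp
       finally show ?thesis by (rule order_trans[OF draws_Chebyshev[OF sp]])
      qed
      have dev: "\<bar>?U i - ?Z i\<bar> \<le> R * \<kappa>" if i: "\<bar>?Z i\<bar> \<le> R" "\<bar>?L1 i\<bar> \<le> sqrt (n m) * \<eta>" for i
       using LR_boot_close[OF n1 m1 AD(2)[unfolded D_def] \<eta>(2,5) \<kappa>(1) i[unfolded A_def D_def]] unfolding A_def D_def .
      have "PP m {i. \<bar>?U i - ?Z i\<bar> > R * \<kappa>} \<le>
        PP m ({i. \<bar>?Z i\<bar> > R} \<union> {i. \<bar>?L1 i\<bar> > sqrt (n m) * \<eta>})"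
       using dev by (intro measure_pmf.finite_measure_mono) (auto simp: not_le[symmetric])
      also have "\<dots> \<le> e / 4 + e / 4" using bad1 bad2 by (intro order_trans[OF measure_Un_le add_mono]) auto
      finally have bad: "PP m {i. \<bar>?U i - ?Z i\<bar> > R * \<kappa>} \<le> e / 4 + e / 4" .
      have "\<bar>PP m {i. ?U i \<le> m1\<^sup>2 * x} - Phi (m1\<^sup>2 * x / sqrt v)\<bar> \<le> e / 4 + (e / 4 + e / 4) + R * \<kappa> / sqrt v"
       by (rule prob_perturbation[OF _ _ _ bad])
        (use elim(1)[rule_format, OF goods(1) nr(1)] v R \<kappa> in \<open>auto simp: v_def\<close>)
      moreover have "m1\<^sup>2 * x / sqrt v = x / sqrt (v / m1 ^ 4)"
      proof -
       have "sqrt (m1 ^ 4) = m1\<^sup>2" by (rule real_sqrt_unique) (use m1 in \<open>simp_all flip: power_mult\<close>)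
       then show ?thesis by (simp add: real_sqrt_divide mult.commute)
      qed
      moreover have "{i. ?U i \<le> m1\<^sup>2 * x} = {i. ?LR i \<le> x}" using m1 by auto
      ultimately show "\<bar>PP m {i. ?LR i \<le> x} - Phi (x / sqrt (tauR_sq M X \<phi>))\<bar> \<le> e"
       using \<kappa>(2) by (simp add: tR)
     qed
    qed
    with \<delta>(1) show ?thesis by (intro exI[of _ \<delta>] conjI)
   qed
  qed
 qed
qed

end

text \<open>A positive limiting variance makes the limit law continuous, so that Polya's theorem
  applies in the second and third parts. The limit law of the ratio statistic enters the third part
  as a premise.\<close>

theorem theorem4p4:
  fixes M :: "'a measure"
    and X :: "int \<Rightarrow> 'a \<Rightarrow> real"
    and \<phi> :: "real \<Rightarrow> real"
    and \<nu> b k :: "nat \<Rightarrow> nat"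
    and fhat :: "nat \<Rightarrow> (nat \<Rightarrow> real) \<Rightarrow> real \<Rightarrow> real"
  assumes "prob_space M"
    \<comment> \<open>(A1)\<close>
    and "\<And>t. X t \<in> borel_measurable M"
    and "strictly_stationary M X"
    and "\<And>t. integrable M (\<lambda>\<omega>. X t \<omega> ^ 8)"
    and "\<And>t. (\<integral>\<omega>. X t \<omega> \<partial>M) = 0"
    and "(\<lambda>h. (1 + \<bar>real_of_int h\<bar>) * \<bar>autocov M X h\<bar>) summable_on UNIV"
    and "(INF l\<in>{0..pi}. spectral_density M X l) > 0"
    and "(\<lambda>(h1, h2, h3).
            (1 + \<bar>real_of_int h1\<bar> + \<bar>real_of_int h2\<bar> + \<bar>real_of_int h3\<bar>) *
            \<bar>cum M [X 0, X h1, X h2, X h3]\<bar>) summable_on UNIV"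
    and "(\<lambda>hs. \<bar>cum M (map X (0 # hs))\<bar>) summable_on {hs. length hs = 7}"
    \<comment> \<open>(A2)\<close>
    and "set_borel_measurable lborel {-pi..pi} \<phi>"
    and "set_integrable lborel {-pi..pi} (\<lambda>l. (\<phi> l)\<^sup>2)"
    and "bounded_variation_on (-pi) pi \<phi>"
    \<comment> \<open>(B1): \<open>n\<close> runs through the sample sizes \<open>\<nu> 0 < \<nu> 1 < \<dots>\<close>, which satisfy \<open>n = b k\<close>\<close>
    and "strict_mono \<nu>"
    and "\<And>m. \<nu> m = b (\<nu> m) * k (\<nu> m)"
    and "filterlim (\<lambda>m. b (\<nu> m)) at_top sequentially"
    and "filterlim (\<lambda>m. k (\<nu> m)) at_top sequentially"
    \<comment> \<open>(B2)\<close>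
    and "(\<lambda>m. real (b (\<nu> m)) ^ 3 / real (\<nu> m)) \<longlonglongrightarrow> 0"
    and "(\<lambda>m. ln (real (num_blocks (\<nu> m) (b (\<nu> m)))) / real (b (\<nu> m))) \<longlonglongrightarrow> 0"
    \<comment> \<open>(C)\<close>
    and "\<And>n l. l \<in> {-pi..pi} \<Longrightarrow>
           (\<lambda>x. fhat n x l) \<in> borel_measurable (Pi\<^sub>M {1..n} (\<lambda>_. borel))"
    and "oP1 M (\<lambda>m \<omega>. SUP l\<in>{-pi..pi}.
           ereal \<bar>fhat (\<nu> m) (sample X (\<nu> m) \<omega>) l - spectral_density M X l\<bar>)"
    \<comment> \<open>central limit theorem for \<open>L\<^sub>n\<close>\<close>
    and "weak_conv_m (\<lambda>m. distr M borel (L_stat M X \<phi> (\<nu> m))) (centred_normal (tau_sq M X \<phi>))"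
  shows
    "conv_in_prob M
       (\<lambda>m \<omega>. measure_pmf.variance (boot_index_law (\<nu> m) (b (\<nu> m)) (k (\<nu> m)))
          (L_boot \<phi> (sample X (\<nu> m) \<omega>) (fhat (\<nu> m) (sample X (\<nu> m) \<omega>))
             (\<nu> m) (b (\<nu> m)) (k (\<nu> m))))
       (tau_sq M X \<phi>)
     \<and>
     (tau_sq M X \<phi> > 0 \<longrightarrow>
      oP1 M (\<lambda>m \<omega>. SUP x :: real. ereal
        \<bar>measure_pmf.prob (boot_index_law (\<nu> m) (b (\<nu> m)) (k (\<nu> m)))
            {i. L_boot \<phi> (sample X (\<nu> m) \<omega>) (fhat (\<nu> m) (sample X (\<nu> m) \<omega>))
                  (\<nu> m) (b (\<nu> m)) (k (\<nu> m)) i \<le> x}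
         - measure M {\<omega>' \<in> space M. L_stat M X \<phi> (\<nu> m) \<omega>' \<le> x}\<bar>))
     \<and>
     (tauR_sq M X \<phi> > 0 \<longrightarrow>
      weak_conv_m (\<lambda>m. distr M borel (LR_stat M X \<phi> (\<nu> m))) (centred_normal (tauR_sq M X \<phi>)) \<longrightarrow>
      oP1 M (\<lambda>m \<omega>. SUP x :: real. ereal
        \<bar>measure_pmf.prob (boot_index_law (\<nu> m) (b (\<nu> m)) (k (\<nu> m)))
            {i. LR_boot \<phi> (sample X (\<nu> m) \<omega>) (fhat (\<nu> m) (sample X (\<nu> m) \<omega>))
                  (\<nu> m) (b (\<nu> m)) (k (\<nu> m)) i \<le> x}
         - measure M {\<omega>' \<in> space M. LR_stat M X \<phi> (\<nu> m) \<omega>' \<le> x}\<bar>))"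
proof -
 have s1: "(\<lambda>h::int \<times> int \<times> int. \<bar>cum M [X 0, X (fst h), X (fst (snd h)), X (snd (snd h))]\<bar>) summable_on UNIV"
 proof (rule summable_on_comparison_test)
  show "(\<lambda>(h1, h2, h3). (1 + \<bar>real_of_int h1\<bar> + \<bar>real_of_int h2\<bar> + \<bar>real_of_int h3\<bar>) * \<bar>cum M [X 0, X h1, X h2, X h3]\<bar>) summable_on UNIV"
   by (rule assms(8))
  fix h :: "int \<times> int \<times> int"
  have "1 * \<bar>cum M [X 0, X (fst h), X (fst (snd h)), X (snd (snd h))]\<bar> \<le>
   (1 + \<bar>real_of_int (fst h)\<bar> + \<bar>real_of_int (fst (snd h))\<bar> + \<bar>real_of_int (snd (snd h))\<bar>) * \<bar>cum M [X 0, X (fst h), X (fst (snd h)), X (snd (snd h))]\<bar>"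
   by (rule mult_right_mono) auto
  then show "\<bar>cum M [X 0, X (fst h), X (fst (snd h)), X (snd (snd h))]\<bar> \<le>
   (case h of (h1, h2, h3) => (1 + \<bar>real_of_int h1\<bar> + \<bar>real_of_int h2\<bar> + \<bar>real_of_int h3\<bar>) * \<bar>cum M [X 0, X h1, X h2, X h3]\<bar>)"
   by (simp add: case_prod_unfold)
 qed auto
 interpret prob_space M by (rule assms(1))
 interpret B: block_bootstrap M X \<nu> "\<lambda>m. b (\<nu> m)" "\<lambda>m. k (\<nu> m)" "\<lambda>m om. fhat (\<nu> m) (sample X (\<nu> m) om)"
  by unfold_locales (use assms s1 in \<open>auto simp: case_prod_unfold\<close>)
 note m = assms(10) and bv = assms(12)
 \<comment> \<open>For the linear statistic the weight is \<open>\<phi>\<close> itself, so nearness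
   is trivial.\<close>
 have near: "B.near \<delta> \<phi> m \<phi>" if "\<delta> > 0" for \<delta> m using that by (simp add: B.near_def)
 have law: "boot_index_law (\<nu> m) (b (\<nu> m)) (k (\<nu> m)) = draws (k (\<nu> m)) (B.N m)" for m
  by (simp add: boot_index_law_def draws_def)
 note dom = bvdom_self[OF m bv] and one = bvdom_lipschitz[of 0 "\<lambda>_. 1" \<phi>, simplified]
 have T: "L_stat M X \<phi> r \<in> borel_measurable M" "LR_stat M X \<phi> r \<in> borel_measurable M" for r
  unfolding L_stat_def[abs_def] LR_stat_def[abs_def] spec_ratio_def
  using B.spec_mean_measurable[OF dom] B.spec_mean_measurable[OF one] by measurable
 show ?thesis
  unfolding law
 proof (intro conjI impI)
  show "conv_in_prob M (\<lambda>m om. measure_pmf.variance (draws (k (\<nu> m)) (B.N m)) (B.Lb \<phi> m om)) (tau_sq M X \<phi>)"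
   unfolding conv_in_prob_def oP1_vanishing
  proof (intro allI impI, rule B.boot_variance[OF m bv])
   fix \<epsilon> \<delta> :: real
   assume \<epsilon>: "\<epsilon> > 0" and \<delta>: "\<delta> > 0" "\<forall>\<^sub>F m in sequentially. \<forall>om \<theta>. B.good \<delta> m om \<longrightarrow> B.near \<delta> \<phi> m \<theta> \<longrightarrow>
    measure_pmf.expectation (B.Pb m) (B.Lb \<theta> m om) = 0 \<and>
    \<bar>measure_pmf.expectation (B.Pb m) (\<lambda>i. (B.Lb \<theta> m om i)\<^sup>2) - tau_sq M X \<phi>\<bar> \<le> \<epsilon>"
   show "vanishing M (\<lambda>m. {om \<in> space M. ereal \<epsilon> < \<bar>ereal (measure_pmf.variance (B.Pb m) (B.Lb \<phi> m om) - tau_sq M X \<phi>)\<bar>})"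
   proof (rule vanishing_subset[OF B.not_good_vanishing[OF \<delta>(1)]])
    show "\<forall>\<^sub>F m in sequentially. {om \<in> space M. ereal \<epsilon> < \<bar>ereal (measure_pmf.variance (B.Pb m) (B.Lb \<phi> m om) - tau_sq M X \<phi>)\<bar>} \<subseteq> {om \<in> space M. \<not> B.good \<delta> m om}"
     using \<delta>(2)
    proof eventually_elim
     case (elim m)
     then show ?case using near[OF \<delta>(1)] by force
    qed
   qed
  qed
  assume v: "tau_sq M X \<phi> > 0"
  show "oP1 M (\<lambda>m om. SUP x :: real. ereal \<bar>measure_pmf.prob (draws (k (\<nu> m)) (B.N m)) {i. B.Lb \<phi> m om i \<le> x} - measure M {om' \<in> space M. L_stat M X \<phi> (\<nu> m) om' \<le> x}\<bar>)"
  proof (rule B.uniform_conclusion[OF T(1) v assms(21)])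
   fix e :: real assume e: "e > 0"
   show "\<exists>\<delta>>0. \<forall>\<^sub>F m in sequentially. \<forall>om. B.good \<delta> m om \<longrightarrow>
    (\<forall>x. \<bar>measure_pmf.prob (B.Pb m) {i. B.Lb \<phi> m om i \<le> x} - Phi (x / sqrt (tau_sq M X \<phi>))\<bar> \<le> e)"
   proof (rule B.boot_clt[OF m bv e v])
    fix \<delta> assume \<delta>: "\<delta> > 0" "\<forall>\<^sub>F m in sequentially. \<forall>om \<theta>. B.good \<delta> m om \<longrightarrow> B.near \<delta> \<phi> m \<theta> \<longrightarrow>
     (\<forall>x. \<bar>measure_pmf.prob (B.Pb m) {i. B.Lb \<theta> m om i \<le> x} - Phi (x / sqrt (tau_sq M X \<phi>))\<bar> \<le> e)"
    show ?thesis
    proof (intro exI conjI)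
     show "\<forall>\<^sub>F m in sequentially. \<forall>om. B.good \<delta> m om \<longrightarrow>
      (\<forall>x. \<bar>measure_pmf.prob (B.Pb m) {i. B.Lb \<phi> m om i \<le> x} - Phi (x / sqrt (tau_sq M X \<phi>))\<bar> \<le> e)"
      using \<delta>(2) by eventually_elim (use near[OF \<delta>(1)] in simp)
    qed (rule \<delta>(1))
   qed
  qed
 next
  assume v: "tauR_sq M X \<phi> > 0"
   and wc: "weak_conv_m (\<lambda>m. distr M borel (LR_stat M X \<phi> (\<nu> m))) (centred_normal (tauR_sq M X \<phi>))"
  show "oP1 M (\<lambda>m om. SUP x :: real. ereal \<bar>measure_pmf.prob (draws (k (\<nu> m)) (B.N m))
    {i. LR_boot \<phi> (sample X (\<nu> m) om) (fhat (\<nu> m) (sample X (\<nu> m) om)) (\<nu> m) (b (\<nu> m)) (k (\<nu> m)) i \<le> x} -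
    measure M {om' \<in> space M. LR_stat M X \<phi> (\<nu> m) om' \<le> x}\<bar>)"
   by (rule B.uniform_conclusion[OF T(2) v wc B.ratio_clt[OF m bv _ v]])
 qed
qed

end
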